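(* 1) For every $w_h\in X_h^p$ the projected velocity $v_h=\mathcal{P}_h^{\mathrm{RT}}w_h$ satisfies the local mass conservation property: for every element $E\in\mathcal{E}_h$, with $n_E$ the unit normal on $\partial E$ outward to $E$, $$\sum_{e\in\Gamma_h^{\mathrm{int}}\cap\partial E}(\{v_h\}\cdot n_E,1)_{0,e}+\sum_{e\in\Gamma_h^{N}\cap\partial E}(v_h\cdot n_E,1)_{0,e}+\sum_{e\in\Gamma_h^D\cap\partial E}(g\cdot n_E,1)_{0,e}=0.$$ Moreover, this property can also be achieved with reconstruction in the Raviart–Thomas space $\mathrm{RT}_h^k$ of degree $k\le p-1$, i.e. it holds for $v_h=\mathcal{P}_h^{\mathrm{RT},k}w_h$ with any $0\le k\le p-1$. 2) $\mathcal{P}_h^{\mathrm{RT}}$ is a projection: $(\mathcal{P}_h^{\mathrm{RT}})^2=\mathcal{P}_h^{\mathrm{RT}}$ on $X_h^p$. Indeed, when $\mathcal{P}_h^{\mathrm{RT}}$ is applied to $\mathcal{P}_h^{\mathrm{RT}}w_h$, the right-hand side $b(\mathcal{P}_h^{\mathrm{RT}}w_h,q)-r(q)$ in step (i) vanishes for all $q\in M_h^{p-1}$, so the second application produces a zero correction.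
   Context: **Domain and mesh.** $\Omega\subset\mathbb{R}^d$ ($d=2,3$) is open and bounded, with boundary $\partial\Omega=\Gamma_D\cup\Gamma_N$, $\Gamma_N=\partial\Omega\setminus\Gamma_D$. Either $\Gamma_D=\partial\Omega$ (Dirichlet case, $\Gamma_N=\emptyset$) or $\Gamma_D\ne\partial\Omega,\emptyset$ (mixed case). Velocity data $g$ are given on $\Gamma_D$ (at a fixed time); in the Dirichlet case $\int_{\partial\Omega}g\cdot n\,ds=0$ is required, $n$ being the outer unit normal. $\mathcal{E}_h$ is an affine cuboid mesh of $\Omega$: every element is $E=\mu_E(\hat E)$, with $\hat E$ the reference cube and $\mu_E(\hat x)=B_E\hat x+b_E$ an affine transformation (so elements are parallelepipeds). $\Gamma_h^{\mathrm{int}},\Gamma_h^D,\Gamma_h^N$ are the sets of interior faces, of faces on $\Gamma_D$, and of faces on $\Gamma_N$. Each interior face $e$ shared by $E_e^1,E_e^2$ has a fixed unit normal $n_e$ pointing from $E_e^1$ to $E_e^2$; for boundary faces $n_e=n$. On $e\in\Gamma_h^{\mathrm{int}}$: $[\phi]=\phi|_{E_e^1}-\phi|_{E_e^2}$ and $\{\phi\}=\tfrac12\phi|_{E_e^1}+\tfrac12\phi|_{E_e^2}$ (same for vector-valued $\phi$). On boundary faces functions are evaluated by their trace from the interior. $(\cdot,\cdot)_{0,\omega}$ is the $L^2(\omega)$ inner product (scalar or vector). Derivatives of discontinuous functions are taken elementwise. **Spaces.** Let $p\ge1$. $Q_h^p=\{v\in L^2(\Omega): v|_E=q\circ\mu_E^{-1},\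 q\in\mathbb{Q}_{p,d},\ E\in\mathcal{E}_h\}$, where $\mathbb{Q}_{p,d}$ is the set of polynomials in $d$ variables of degree at most $p$ in each variable. $X_h^p=(Q_h^p)^d$. In the mixed case $M_h^{p-1}=Q_h^{p-1}$; in the Dirichlet case $M_h^{p-1}=\{q\in Q_h^{p-1}:\int_\Omega q\,dx=0\}$. **Forms.** $$b(v,q)=-\sum_{E\in\mathcal{E}_h}(\nabla\cdot v,q)_{0,E}+\sum_{e\in\Gamma_h^{\mathrm{int}}}([v]\cdot n_e,\{q\})_{0,e}+\sum_{e\in\Gamma_h^D}(v\cdot n,q)_{0,e},\qquad r(q)=\sum_{e\in\Gamma_h^D}(g\cdot n,q)_{0,e}.$$ $\alpha(\psi,q)=b(\nabla\psi,q)+j_0(\psi,q)$, where $\nabla\psi$ is the elementwise gradient and $$j_0(\psi,q)=-\sum_{e\in\Gamma_h^{\mathrm{int}}}(\{\nabla q\}\cdot n_e,[\psi])_{0,e}+\sum_{e\in\Gamma_h^{\mathrm{int}}}\frac{\sigma}{h_e}([q],[\psi])_{0,e}-\sum_{e\in\Gamma_h^N}(\nabla q\cdot n_e,\psi)_{0,e}+\sum_{e\in\Gamma_h^N}\frac{\sigma}{h_e}(q,\psi)_{0,e}.$$ Here $h_e>0$ is a face length scale (the minimum of the volumes of the elements adjacent to $e$ divided by $|e|$) and $\sigma>0$ is a penalty parameter chosen such that $\alpha$ is coercive on $M_h^{p-1}$. **Raviart–Thomas spaces.** With the Piola transformation $T_E(\hat v)=\frac{1}{|\det B_E|}B_E\hat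 v$ (composed with $\mu_E^{-1}$), let $\mathrm{RT}_E^k$ be the set of $v=T_E(\hat v)$ whose component $\hat v_i$ is a polynomial of degree at most $k+\delta_{ij}$ in $\hat x_j$ ($j=1,\dots,d$), and, for $k>0$, let $\Psi_E^k$ be the set of $v=T_E(\hat v)$ with $\hat v_i$ of degree at most $k-\delta_{ij}$ in $\hat x_j$. $\mathrm{RT}_h^k=\{v\in H(\mathrm{div};\Omega): v|_E\in\mathrm{RT}_E^k\ \forall E\in\mathcal{E}_h\}$. $Q_e^k$ is the space of polynomials on the face $e$ of degree at most $k$ in each of the $d-1$ (affine) face coordinates. **Reconstruction.** For $\psi_h\in M_h^{p-1}$ and $0\le k\le p-1$, $\gamma_h=G_h^k\psi_h\in\mathrm{RT}_h^{k}$ is defined by: for all faces $e$ and all $q\in Q_e^k$, - $(\gamma_h\cdot n_e,q)_{0,e}=(-\{\nabla\psi_h\}\cdot n_e+\frac{\sigma}{h_e}[\psi_h],q)_{0,e}$ if $e\in\Gamma_h^{\mathrm{int}}$, - $(\gamma_h\cdot n_e,q)_{0,e}=(-\nabla\psi_h\cdot n_e+\frac{\sigma}{h_e}\psi_h,q)_{0,e}$ if $e\in\Gamma_h^N$, - $(\gamma_h\cdot n_e,q)_{0,e}=0$ if $e\in\Gamma_h^D$, and, if $k>0$, for all $E\in\mathcal{E}_h$ and $r\in\Psi_E^k$, $$(\gamma_h,r)_{0,E}=-(\nabla\psi_h,r)_{0,E}+\tfrac12\sum_{e\in\partial E\cap\Gamma_h^{\mathrm{int}}}(r\cdot n_e,[\psi_h])_{0,e}+\sum_{e\in\partial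 E\cap\Gamma_h^N}(r\cdot n_e,\psi_h)_{0,e}.$$ **RT projection.** For $w_h\in X_h^p$: (i) let $\psi_h\in M_h^{p-1}$ solve $\alpha(\psi_h,q)=b(w_h,q)-r(q)$ for all $q\in M_h^{p-1}$; (ii) compute $G_h^k\psi_h\in\mathrm{RT}_h^{k}$; (iii) $\mathcal{P}_h^{\mathrm{RT},k}w_h:=v_h\in X_h^p$, where $(v_h,\varphi)_{0,\Omega}=(w_h,\varphi)_{0,\Omega}+(G_h^k\psi_h,\varphi)_{0,\Omega}$ for all $\varphi\in X_h^p$. The RT projection is $\mathcal{P}_h^{\mathrm{RT}}:=\mathcal{P}_h^{\mathrm{RT},p-1}$.
   Formalization: Part 2 (projection property, vanishing right-hand side, zero correction) is stated only for p = 1 or when all elements are rectangular (columns of B_E orthogonal); for p ≥ 2 it fails on non-rectangular parallelepipeds, e.g. a single parallelogram with g = 0, p = 2. *)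

theory Defs
  imports "HOL-Analysis.Analysis"
begin

section \<open>Meshes of parallelepipeds\<close>

text \<open>
  The bundled data are: the domain, the Dirichlet part of its boundary, the set of (closed) elements,
  the matrix and the translation of the affine map from the reference cube onto each element, and
  for every interior face the two adjacent elements in a fixed order, which orients the face.
\<close>

record ('n::finite) dgmesh =
  dom :: "(real^'n) set"
  GammaD :: "(real^'n) set"
  elems :: "(real^'n) set set"
  Bmat :: "(real^'n) set \<Rightarrow> real^'n^'n"
  bvec :: "(real^'n) set \<Rightarrow> real^'n"
  elem1 :: "(real^'n) set \<Rightarrow> (real^'n) set"
  elem2 :: "(real^'n) set \<Rightarrow> (real^'n) set"

definition GammaN :: "('n::finite) dgmesh \<Rightarrow> (real^'n) set" where
  "GammaN m = frontier (dom m) - GammaD m"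

definition dirichlet_case :: "('n::finite) dgmesh \<Rightarrow> bool" where
  "dirichlet_case m \<longleftrightarrow> GammaD m = frontier (dom m)"

definition ref_cube :: "(real^'n::finite) set" where
  "ref_cube = {x. \<forall>i. 0 \<le> x $ i \<and> x $ i \<le> 1}"

definition elem_map :: "('n::finite) dgmesh \<Rightarrow> (real^'n) set \<Rightarrow> real^'n \<Rightarrow> real^'n" where
  "elem_map m E x = Bmat m E *v x + bvec m E"

definition faces :: "('n::finite) dgmesh \<Rightarrow> (real^'n) set set" where
  "faces m = {e. \<exists>E\<in>elems m. e facet_of E}"

definition adjacent :: "('n::finite) dgmesh \<Rightarrow> (real^'n) set \<Rightarrow> (real^'n) set set" where
  "adjacent m e = {E \<in> elems m. e facet_of E}"

text \<open>
  Faces are closed sets, so a face lying in the domain or on one part of the boundary may still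
  touch the other parts along its relative boundary.
\<close>

definition int_faces :: "('n::finite) dgmesh \<Rightarrow> (real^'n) set set" where
  "int_faces m = {e \<in> faces m. rel_interior e \<subseteq> dom m}"

definition D_faces :: "('n::finite) dgmesh \<Rightarrow> (real^'n) set set" where
  "D_faces m = {e \<in> faces m. rel_interior e \<subseteq> GammaD m}"

definition N_faces :: "('n::finite) dgmesh \<Rightarrow> (real^'n) set set" where
  "N_faces m = {e \<in> faces m. rel_interior e \<subseteq> GammaN m}"

text \<open>
  The last three conditions say that the mesh has no hanging nodes, resolves the splitting of the
  boundary, and that the domain lies on one side only of each boundary face.
\<close>

definition affine_mesh :: "('n::finite) dgmesh \<Rightarrow> bool" where
  "affine_mesh m \<longleftrightarrow>
     open (dom m) \<and> bounded (dom m) \<and>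
     GammaD m \<subseteq> frontier (dom m) \<and> (GammaD m = frontier (dom m) \<or> GammaD m \<noteq> {}) \<and>
     finite (elems m) \<and>
     (\<forall>E\<in>elems m. invertible (Bmat m E) \<and> E = elem_map m E ` ref_cube \<and> interior E \<subseteq> dom m) \<and>
     \<Union>(elems m) = closure (dom m) \<and>
     (\<forall>E\<in>elems m. \<forall>E'\<in>elems m. E \<noteq> E' \<longrightarrow> interior E \<inter> interior E' = {}) \<and>
     faces m = int_faces m \<union> D_faces m \<union> N_faces m \<and>
     (\<forall>e\<in>int_faces m. elem1 m e \<noteq> elem2 m e \<and> adjacent m e = {elem1 m e, elem2 m e}) \<and>
     (\<forall>e\<in>D_faces m \<union> N_faces m. \<exists>!E. E \<in> adjacent m e)"

text \<open>
  The elements are genuine (possibly rotated) cuboids. This matters for the interior degrees of freedom of the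
  reconstruction below: their test spaces \<open>Psi_elem\<close> are defined by the contravariant Piola map, so they
  contain the gradients of all mapped polynomials of degree \<open>k > 0\<close> only if the columns of the
  element matrix are orthogonal.
\<close>

definition rectangular_mesh :: "('n::finite) dgmesh \<Rightarrow> bool" where
  "rectangular_mesh m \<longleftrightarrow>
     (\<forall>E\<in>elems m. \<forall>i j. i \<noteq> j \<longrightarrow> column i (Bmat m E) \<bullet> column j (Bmat m E) = 0)"

definition bdry_elem :: "('n::finite) dgmesh \<Rightarrow> (real^'n) set \<Rightarrow> (real^'n) set" where
  "bdry_elem m e = (THE E. E \<in> adjacent m e)"

text \<open>Unit normal of the convex body \<open>E\<close> on its facet \<open>e\<close>, pointing out of \<open>E\<close>.\<close>

definition outer_normal :: "(real^'n::finite) set \<Rightarrow> (real^'n) set \<Rightarrow> real^'n" where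
  "outer_normal E e = (THE n. norm n = 1 \<and> (\<forall>y\<in>e. \<forall>x\<in>E. n \<bullet> (x - y) \<le> 0))"

definition normal :: "('n::finite) dgmesh \<Rightarrow> (real^'n) set \<Rightarrow> real^'n" where
  "normal m e = (if e \<in> int_faces m then outer_normal (elem1 m e) e
                 else outer_normal (bdry_elem m e) e)"

section \<open>Surface integrals\<close>

text \<open>
  Surface measure on a flat face \<open>e\<close>: the \<open>d\<close>-dimensional Lebesgue measure of the right
  prism of height one having \<open>e\<close> as its mid-section, pushed forward to the hyperplane of \<open>e\<close> by the
  orthogonal projection.
\<close>

definition face_proj :: "(real^'n::finite) set \<Rightarrow> real^'n \<Rightarrow> real^'n" where
  "face_proj e = closest_point (affine hull e)"

definition surf :: "(real^'n::finite) set \<Rightarrow> (real^'n) measure" where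
  "surf e = distr (restrict_space lborel {x. face_proj e x \<in> e \<and> dist x (face_proj e x) \<le> 1/2})
                  borel (face_proj e)"

definition face_int :: "(real^'n::finite) set \<Rightarrow> (real^'n \<Rightarrow> real) \<Rightarrow> real" where
  "face_int e f = (LINT x:e|surf e. f x)"

definition face_size :: "('n::finite) dgmesh \<Rightarrow> (real^'n) set \<Rightarrow> real" where
  "face_size m e = Min (measure lborel ` adjacent m e) / measure (surf e) e"

section \<open>Broken functions\<close>

text \<open>
  A piecewise polynomial function in \<open>L\<^sup>2\<close> of the domain is determined by its restrictions to the
  elements, each of which is the restriction of a unique polynomial on the whole space. It is
  represented by the family of these polynomials, indexed by the elements and equal to zero at all
  other indices. The trace from an element to one of its faces and the derivatives up
  to the boundary of the element are then values and derivatives of that polynomial.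
\<close>

type_synonym ('n, 'a) broken = "(real^'n) set \<Rightarrow> real^'n \<Rightarrow> 'a"

definition jump :: "('n::finite) dgmesh \<Rightarrow> ('n, 'a::real_vector) broken \<Rightarrow>
    (real^'n) set \<Rightarrow> real^'n \<Rightarrow> 'a" where
  "jump m v e x = v (elem1 m e) x - v (elem2 m e) x"

definition avg :: "('n::finite) dgmesh \<Rightarrow> ('n, 'a::real_vector) broken \<Rightarrow>
    (real^'n) set \<Rightarrow> real^'n \<Rightarrow> 'a" where
  "avg m v e x = (1/2) *\<^sub>R v (elem1 m e) x + (1/2) *\<^sub>R v (elem2 m e) x"

definition btrace :: "('n::finite) dgmesh \<Rightarrow> ('n, 'a) broken \<Rightarrow> (real^'n) set \<Rightarrow> real^'n \<Rightarrow> 'a" where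
  "btrace m v e = v (bdry_elem m e)"

definition partial :: "'n::finite \<Rightarrow> (real^'n \<Rightarrow> real) \<Rightarrow> real^'n \<Rightarrow> real" where
  "partial i f x = frechet_derivative f (at x) (axis i 1)"

definition grad :: "(real^'n::finite \<Rightarrow> real) \<Rightarrow> real^'n \<Rightarrow> real^'n" where
  "grad f x = (\<chi> i. partial i f x)"

definition divergence :: "(real^'n::finite \<Rightarrow> real^'n) \<Rightarrow> real^'n \<Rightarrow> real" where
  "divergence v x = (\<Sum>i\<in>UNIV. partial i (\<lambda>y. v y $ i) x)"

definition bgrad :: "('n::finite, real) broken \<Rightarrow> ('n, real^'n) broken" where
  "bgrad q E = grad (q E)"

text \<open>Polynomials of degree at most \<open>D i\<close> in the variable \<open>i\<close>.\<close>

definition polys :: "('n::finite \<Rightarrow> nat) \<Rightarrow> (real^'n \<Rightarrow> real) set" where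
  "polys D = {f. \<exists>c. \<forall>x. f x = (\<Sum>a\<in>{a. \<forall>i. a i \<le> D i}. c a * (\<Prod>i\<in>UNIV. x $ i ^ a i))}"

definition Qh :: "('n::finite) dgmesh \<Rightarrow> nat \<Rightarrow> ('n, real) broken set" where
  "Qh m p = {v. (\<forall>E\<in>elems m. \<exists>q\<in>polys (\<lambda>_. p). v E = q \<circ> inv (elem_map m E)) \<and>
                (\<forall>E. E \<notin> elems m \<longrightarrow> v E = (\<lambda>_. 0))}"

definition Xh :: "('n::finite) dgmesh \<Rightarrow> nat \<Rightarrow> ('n, real^'n) broken set" where
  "Xh m p = {v. \<forall>i. (\<lambda>E x. v E x $ i) \<in> Qh m p}"

definition Mh :: "('n::finite) dgmesh \<Rightarrow> nat \<Rightarrow> ('n, real) broken set" where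
  "Mh m l = {q \<in> Qh m l. dirichlet_case m \<longrightarrow> (\<Sum>E\<in>elems m. LINT x:E|lborel. q E x) = 0}"

text \<open>
  The inner product of \<open>L\<^sup>2\<close> over the whole domain, which the elements cover up to a null set.
\<close>

definition l2 :: "('n::finite) dgmesh \<Rightarrow> ('n, 'a::real_inner) broken \<Rightarrow> ('n, 'a) broken \<Rightarrow> real" where
  "l2 m u v = (\<Sum>E\<in>elems m. LINT x:E|lborel. u E x \<bullet> v E x)"

section \<open>Bilinear forms\<close>

definition bform :: "('n::finite) dgmesh \<Rightarrow> ('n, real^'n) broken \<Rightarrow> ('n, real) broken \<Rightarrow> real" where
  "bform m v q =
     - (\<Sum>E\<in>elems m. LINT x:E|lborel. divergence (v E) x * q E x)
     + (\<Sum>e\<in>int_faces m. face_int e (\<lambda>x. (jump m v e x \<bullet> normal m e) * avg m q e x))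
     + (\<Sum>e\<in>D_faces m. face_int e (\<lambda>x. (btrace m v e x \<bullet> normal m e) * btrace m q e x))"

definition rform :: "('n::finite) dgmesh \<Rightarrow> (real^'n \<Rightarrow> real^'n) \<Rightarrow> ('n, real) broken \<Rightarrow> real" where
  "rform m g q = (\<Sum>e\<in>D_faces m. face_int e (\<lambda>x. (g x \<bullet> normal m e) * btrace m q e x))"

definition j0form :: "('n::finite) dgmesh \<Rightarrow> real \<Rightarrow> ('n, real) broken \<Rightarrow> ('n, real) broken \<Rightarrow> real" where
  "j0form m \<sigma> \<psi> q =
     - (\<Sum>e\<in>int_faces m. face_int e (\<lambda>x. (avg m (bgrad q) e x \<bullet> normal m e) * jump m \<psi> e x))
     + (\<Sum>e\<in>int_faces m. \<sigma> / face_size m e * face_int e (\<lambda>x. jump m q e x * jump m \<psi> e x))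
     - (\<Sum>e\<in>N_faces m. face_int e (\<lambda>x. (btrace m (bgrad q) e x \<bullet> normal m e) * btrace m \<psi> e x))
     + (\<Sum>e\<in>N_faces m. \<sigma> / face_size m e * face_int e (\<lambda>x. btrace m q e x * btrace m \<psi> e x))"

definition alpha :: "('n::finite) dgmesh \<Rightarrow> real \<Rightarrow> ('n, real) broken \<Rightarrow> ('n, real) broken \<Rightarrow> real" where
  "alpha m \<sigma> \<psi> q = bform m (bgrad \<psi>) q + j0form m \<sigma> \<psi> q"

text \<open>
  The mesh is fixed and the space is finite-dimensional, so the choice of the norm is immaterial.
\<close>

definition coercive_on :: "('n::finite) dgmesh \<Rightarrow> real \<Rightarrow> ('n, real) broken set \<Rightarrow> bool" where
  "coercive_on m \<sigma> M \<longleftrightarrow> (\<exists>c>0. \<forall>q\<in>M. c * l2 m q q \<le> alpha m \<sigma> q q)"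

text \<open>
  In the compatibility condition the boundary of the domain is the union of the Dirichlet faces.
\<close>

definition dirichlet_data :: "('n::finite) dgmesh \<Rightarrow> (real^'n \<Rightarrow> real^'n) \<Rightarrow> bool" where
  "dirichlet_data m g \<longleftrightarrow>
     (\<forall>e\<in>D_faces m. set_borel_measurable (surf e) e g \<and>
                    set_integrable (surf e) e (\<lambda>x. (norm (g x))\<^sup>2)) \<and>
     (dirichlet_case m \<longrightarrow> (\<Sum>e\<in>D_faces m. face_int e (\<lambda>x. g x \<bullet> normal m e)) = 0)"

section \<open>Raviart--Thomas spaces\<close>

primrec continuously_diff :: "nat \<Rightarrow> (real^'n::finite \<Rightarrow> real) \<Rightarrow> bool" where
  "continuously_diff 0 f = continuous_on UNIV f"
| "continuously_diff (Suc k) f =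
     ((\<forall>x. f differentiable (at x)) \<and> (\<forall>i. continuously_diff k (partial i f)))"

definition test_function :: "(real^'n::finite) set \<Rightarrow> (real^'n \<Rightarrow> real) \<Rightarrow> bool" where
  "test_function S \<phi> \<longleftrightarrow>
     (\<forall>k. continuously_diff k \<phi>) \<and> (\<exists>K. compact K \<and> K \<subseteq> S \<and> (\<forall>x. x \<notin> K \<longrightarrow> \<phi> x = 0))"

definition L2 :: "(real^'n::finite) set \<Rightarrow> (real^'n \<Rightarrow> 'a::{second_countable_topology,real_normed_vector}) set"
  where "L2 S = {f. set_borel_measurable lborel S f \<and> set_integrable lborel S (\<lambda>x. (norm (f x))\<^sup>2)}"

definition Hdiv :: "(real^'n::finite) set \<Rightarrow> (real^'n \<Rightarrow> real^'n) set" where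
  "Hdiv S = {v \<in> L2 S. \<exists>w\<in>L2 S. \<forall>\<phi>. test_function S \<phi> \<longrightarrow>
     (LINT x:S|lborel. v x \<bullet> grad \<phi> x) = - (LINT x:S|lborel. w x * \<phi> x)}"

text \<open>The function on the domain, defined off the mesh skeleton, that a broken function represents.\<close>

definition glue :: "('n::finite) dgmesh \<Rightarrow> ('n, 'a::zero) broken \<Rightarrow> real^'n \<Rightarrow> 'a" where
  "glue m v x = (if \<exists>E\<in>elems m. x \<in> interior E
                 then v (THE E. E \<in> elems m \<and> x \<in> interior E) x else 0)"

definition piola :: "('n::finite) dgmesh \<Rightarrow> (real^'n) set \<Rightarrow> (real^'n \<Rightarrow> real^'n) \<Rightarrow> real^'n \<Rightarrow> real^'n" where
  "piola m E v x = (1 / \<bar>det (Bmat m E)\<bar>) *\<^sub>R (Bmat m E *v v (inv (elem_map m E) x))"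

definition RT_elem :: "('n::finite) dgmesh \<Rightarrow> nat \<Rightarrow> (real^'n) set \<Rightarrow> (real^'n \<Rightarrow> real^'n) set" where
  "RT_elem m k E = piola m E ` {v. \<forall>i. (\<lambda>x. v x $ i) \<in> polys (\<lambda>j. k + (if i = j then 1 else 0))}"

definition Psi_elem :: "('n::finite) dgmesh \<Rightarrow> nat \<Rightarrow> (real^'n) set \<Rightarrow> (real^'n \<Rightarrow> real^'n) set" where
  "Psi_elem m k E = piola m E ` {v. \<forall>i. (\<lambda>x. v x $ i) \<in> polys (\<lambda>j. k - (if i = j then 1 else 0))}"

definition RTh :: "('n::finite) dgmesh \<Rightarrow> nat \<Rightarrow> ('n, real^'n) broken set" where
  "RTh m k = {v. (\<forall>E\<in>elems m. v E \<in> RT_elem m k E) \<and> (\<forall>E. E \<notin> elems m \<longrightarrow> v E = (\<lambda>_. 0)) \<and>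
                 glue m v \<in> Hdiv (dom m)}"

text \<open>
  On a face one of the \<open>d\<close> reference coordinates of an adjacent element is constant and the others
  are affine coordinates of the face. The functions below are thus, as far as their values on the
  face are concerned, the polynomials of degree at most \<open>k\<close> in each face coordinate.
\<close>

definition Qface :: "('n::finite) dgmesh \<Rightarrow> nat \<Rightarrow> (real^'n) set \<Rightarrow> (real^'n \<Rightarrow> real) set" where
  "Qface m k e = {q \<circ> inv (elem_map m E) | q E. q \<in> polys (\<lambda>_. k) \<and> E \<in> adjacent m e}"

section \<open>Reconstruction and projection\<close>

text \<open>
  The normal component of a field in \<open>Hdiv\<close> is single-valued on interior faces; accordingly, the
  face conditions are imposed on the trace from every adjacent element.
\<close>

definition is_reconstruction :: "('n::finite) dgmesh \<Rightarrow> real \<Rightarrow> nat \<Rightarrow>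
    ('n, real) broken \<Rightarrow> ('n, real^'n) broken \<Rightarrow> bool" where
  "is_reconstruction m \<sigma> k \<psi> \<gamma> \<longleftrightarrow> \<gamma> \<in> RTh m k \<and>
     (\<forall>e\<in>int_faces m. \<forall>q\<in>Qface m k e. \<forall>E\<in>adjacent m e.
        face_int e (\<lambda>x. (\<gamma> E x \<bullet> normal m e) * q x) =
        face_int e (\<lambda>x. (- (avg m (bgrad \<psi>) e x \<bullet> normal m e)
                          + \<sigma> / face_size m e * jump m \<psi> e x) * q x)) \<and>
     (\<forall>e\<in>N_faces m. \<forall>q\<in>Qface m k e. 
        face_int e (\<lambda>x. (btrace m \<gamma> e x \<bullet> normal m e) * q x) =
        face_int e (\<lambda>x. (- (btrace m (bgrad \<psi>) e x \<bullet> normal m e)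
                          + \<sigma> / face_size m e * btrace m \<psi> e x) * q x)) \<and>
     (\<forall>e\<in>D_faces m. \<forall>q\<in>Qface m k e. 
        face_int e (\<lambda>x. (btrace m \<gamma> e x \<bullet> normal m e) * q x) = 0) \<and>
     (k > 0 \<longrightarrow> (\<forall>E\<in>elems m. \<forall>r\<in>Psi_elem m k E.
        (LINT x:E|lborel. \<gamma> E x \<bullet> r x) =
          - (LINT x:E|lborel. bgrad \<psi> E x \<bullet> r x)
          + 1/2 * (\<Sum>e\<in>{e \<in> int_faces m. e facet_of E}.
                     face_int e (\<lambda>x. (r x \<bullet> normal m e) * jump m \<psi> e x))
          + (\<Sum>e\<in>{e \<in> N_faces m. e facet_of E}.
               face_int e (\<lambda>x. (r x \<bullet> normal m e) * btrace m \<psi> e x))))"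

definition reconstruction :: "('n::finite) dgmesh \<Rightarrow> real \<Rightarrow> nat \<Rightarrow>
    ('n, real) broken \<Rightarrow> ('n, real^'n) broken" where
  "reconstruction m \<sigma> k \<psi> = (THE \<gamma>. is_reconstruction m \<sigma> k \<psi> \<gamma>)"

definition pressure :: "('n::finite) dgmesh \<Rightarrow> (real^'n \<Rightarrow> real^'n) \<Rightarrow> real \<Rightarrow> nat \<Rightarrow>
    ('n, real^'n) broken \<Rightarrow> ('n, real) broken" where
  "pressure m g \<sigma> p w =
     (THE \<psi>. \<psi> \<in> Mh m (p - 1) \<and> (\<forall>q\<in>Mh m (p - 1). alpha m \<sigma> \<psi> q = bform m w q - rform m g q))"

definition RT_projection_deg :: "('n::finite) dgmesh \<Rightarrow> (real^'n \<Rightarrow> real^'n) \<Rightarrow> real \<Rightarrow> nat \<Rightarrow> nat \<Rightarrow>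
    ('n, real^'n) broken \<Rightarrow> ('n, real^'n) broken" where
  "RT_projection_deg m g \<sigma> p k w =
     (THE v. v \<in> Xh m p \<and>
        (\<forall>\<phi>\<in>Xh m p. l2 m v \<phi> = l2 m w \<phi> + l2 m (reconstruction m \<sigma> k (pressure m g \<sigma> p w)) \<phi>))"

definition RT_projection :: "('n::finite) dgmesh \<Rightarrow> (real^'n \<Rightarrow> real^'n) \<Rightarrow> real \<Rightarrow> nat \<Rightarrow>
    ('n, real^'n) broken \<Rightarrow> ('n, real^'n) broken" where
  "RT_projection m g \<sigma> p = RT_projection_deg m g \<sigma> p (p - 1)"

definition locally_conservative :: "('n::finite) dgmesh \<Rightarrow> (real^'n \<Rightarrow> real^'n) \<Rightarrow>
    ('n, real^'n) broken \<Rightarrow> bool" where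
  "locally_conservative m g v \<longleftrightarrow> (\<forall>E\<in>elems m.
     (\<Sum>e\<in>{e \<in> int_faces m. e facet_of E}. face_int e (\<lambda>x. avg m v e x \<bullet> outer_normal E e))
   + (\<Sum>e\<in>{e \<in> N_faces m. e facet_of E}. face_int e (\<lambda>x. btrace m v e x \<bullet> outer_normal E e))
   + (\<Sum>e\<in>{e \<in> D_faces m. e facet_of E}. face_int e (\<lambda>x. g x \<bullet> outer_normal E e)) = 0)"

end

theory Submission
  imports Defs
begin

text \<open>
  The correction added by the projection is tailored to the form \<open>bform\<close>. Elementwise integration by
  parts (\<open>bform_by_parts\<close>) rewrites this form as
  \<open>b(v, q) = \<Sum>\<^sub>E (v, grad q)\<^sub>E - \<Sum>\<^sub>e ({v} \<bullet> n, [q])\<^sub>e - \<Sum>\<^sub>e (v \<bullet> n, q)\<^sub>e\<close>, the sums over interior and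
  Neumann faces. If \<open>v\<close> is the reconstruction of \<open>\<psi>\<close>, every term on the right is a prescribed moment, and their sum is
  the negative of the elliptic form (\<open>bform_reconstruction\<close>). This requires the elementwise
  gradients of \<open>q\<close> to vanish or to be admissible interior test functions. Since a
  Raviart--Thomas field of degree \<open>k \<le> p - 1\<close> lies in the velocity space, the projected velocity is the sum of
  \<open>w\<close> and the reconstruction (\<open>RT_projection_deg_eq\<close>). Hence \<open>b(v, q) = b(w, q) - \<alpha>(\<psi>, q) = r(q)\<close>.

  For piecewise constant \<open>q\<close> the gradients vanish and every \<open>k\<close> is allowed; the indicator function of an element gives local
  conservation (\<open>galerkin_pw_const\<close>, \<open>conservative_of_galerkin\<close>). For \<open>p = 1\<close> the gradients of the pressure
  space vanish, and on rectangular meshes they are admissible for \<open>k = p - 1\<close> (\<open>grad_in_Psi\<close>). Then a second application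
  of the projection meets a vanishing right-hand side, a vanishing pressure and a vanishing correction.

  Most of the work shows that the objects defined by unique choice exist. The pressure exists by coercivity
  (\<open>pressure_exists\<close>). For the reconstruction there are three points. Its degrees of freedom must be unisolvent on every
  parallelepiped, where the interior moments couple all components through the Gram matrix of the edges
  (\<open>bubble_field_zero\<close>). The polynomial spaces on a face seen from its two elements must agree; two affine
  parametrisations of a common facet differ by a signed permutation of the coordinates
  (\<open>signed_permutation\<close>). Finally, equal moments must imply continuity of the normal component and thereby membership in
  \<open>Hdiv\<close> (\<open>reconstruction_exists\<close>, \<open>glue_Hdiv\<close>).

  Surface integrals are reduced to the reference cube by writing the prism over a facet as an affine image of the
  whole cube (\<open>face_int_side\<close>), and all integration by parts goes back to the fundamental theorem of calculus
  in one coordinate of the cube (\<open>cube_int_partial\<close>, \<open>gauss\<close>).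
\<close>

section \<open>Bilinear forms on finite-dimensional function spaces\<close>

text \<open>
  Gaussian elimination: one equation is used to eliminate one unknown, and the induction continues
  with one equation and one unknown fewer.
\<close>

lemma underdetermined_system:
  fixes A :: "'i \<Rightarrow> 'j \<Rightarrow> real"
  assumes "finite J" "finite I" "card J < card I"
  shows "\<exists>c. (\<exists>i\<in>I. c i \<noteq> 0) \<and> (\<forall>j\<in>J. (\<Sum>i\<in>I. c i * A i j) = 0)"
  using assms
proof (induction J arbitrary: A I rule: finite_induct)
  case empty
  then have "I \<noteq> {}" by auto
  then show ?case by (intro exI[of _ "\<lambda>_. 1"]) auto
next
  case (insert j0 J)
  show ?case
  proof (cases "\<forall>i\<in>I. A i j0 = 0")
    case True
    obtain c where c: "\<exists>i\<in>I. c i \<noteq> 0" "\<forall>j\<in>J. (\<Sum>i\<in>I. c i * A i j) = 0"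
      using insert.IH[of I A] insert.prems insert.hyps by auto
    then show ?thesis using True by (intro exI[of _ c]) (auto intro: sum.neutral)
  next
    case False
    then obtain i0 where i0: "i0 \<in> I" "A i0 j0 \<noteq> 0" by blast
    \<comment> \<open>The system after the elimination of the unknown \<open>i0\<close> from the equation \<open>j0\<close>.\<close>
  define A' where "A' i j = A i j - A i j0 / A i0 j0 * A i0 j" for i j
    have "card J < card (I - {i0})" using insert i0 by (simp add: card_Diff_singleton_if)
    then obtain c where c: "\<exists>i\<in>I-{i0}. c i \<noteq> 0"
      "\<forall>j\<in>J. (\<Sum>i\<in>I-{i0}. c i * A' i j) = 0"
      using insert.IH[of "I - {i0}" A'] insert.prems by auto
    define c' where "c' i = (if i = i0 then - (\<Sum>i\<in>I-{i0}. c i * A i j0) / A i0 j0 else c i)" for i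
    have split: "(\<Sum>i\<in>I. c' i * A i j) = c' i0 * A i0 j + (\<Sum>i\<in>I-{i0}. c i * A i j)" for j
      using i0 insert.prems by (subst sum.remove[of I i0]) (auto simp: c'_def intro!: sum.cong)
    have "(\<Sum>i\<in>I. c' i * A i j) = 0" if "j \<in> insert j0 J" for j
    proof (cases "j = j0")
      case True
      then show ?thesis using i0 by (simp add: split) (simp add: c'_def)
    next
      case False
      then have "0 = (\<Sum>i\<in>I-{i0}. c i * A' i j)" using c that by auto
      also have "\<dots> = (\<Sum>i\<in>I-{i0}. c i * A i j) - (\<Sum>i\<in>I-{i0}. c i * A i j0) / A i0 j0 * A i0 j"
        by (simp add: A'_def algebra_simps sum_subtractf sum_distrib_left sum_divide_distrib)
      finally show ?thesis by (simp add: split) (simp add: c'_def)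
    qed
    moreover have "\<exists>i\<in>I. c' i \<noteq> 0" using c by (auto simp: c'_def)
    ultimately show ?thesis by blast
  qed
qed

text \<open>
  The augmented homogeneous system, with one extra unknown that multiplies the negative right-hand
  side, has more unknowns than equations. Injectivity forces the extra unknown of a nontrivial
  solution to be nonzero, and one divides by it.
\<close>

lemma injective_system_solvable:
  fixes A :: "'i \<Rightarrow> 'i \<Rightarrow> real"
  assumes fin: "finite I"
    and inj: "\<And>c. (\<And>j. j \<in> I \<Longrightarrow> (\<Sum>i\<in>I. c i * A i j) = 0) \<Longrightarrow> (\<forall>i\<in>I. c i = 0)"
  shows "\<exists>c. \<forall>j\<in>I. (\<Sum>i\<in>I. c i * A i j) = L j"
proof -
  define A' where "A' i j = (case i of None \<Rightarrow> - L j | Some i \<Rightarrow> A i j)" for i j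
  have "card I < card (insert None (Some ` I))"
    using fin by (subst card_insert_disjoint) (auto simp: card_image)
  then obtain c where c: "\<exists>i\<in>insert None (Some ` I). c i \<noteq> 0"
    "\<forall>j\<in>I. (\<Sum>i\<in>insert None (Some ` I). c i * A' i j) = 0"
    using underdetermined_system[of I "insert None (Some ` I)" A'] fin by auto
  have sys: "(\<Sum>i\<in>I. c (Some i) * A i j) = c None * L j" if "j \<in> I" for j
    using c(2) that fin
    by (subst (asm) sum.insert) (auto simp: A'_def sum.reindex)
  have "c None \<noteq> 0"
  proof
    assume "c None = 0"
    with inj[of "\<lambda>i. c (Some i)"] sys have "\<forall>i\<in>I. c (Some i) = 0" by auto
    with c(1) \<open>c None = 0\<close> show False by auto
  qed
  then have "\<forall>j\<in>I. (\<Sum>i\<in>I. c (Some i) / c None * A i j) = L j"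
    using sys by (simp add: sum_divide_distrib[symmetric] divide_simps flip: sum_distrib_left)
  then show ?thesis by (intro exI[of _ "\<lambda>i. c (Some i) / c None"])
qed

definition lspan :: "'i set \<Rightarrow> ('i \<Rightarrow> 'x \<Rightarrow> real) \<Rightarrow> ('x \<Rightarrow> real) set" where
  "lspan I b = {v. \<exists>c. v = (\<lambda>x. \<Sum>i\<in>I. c i * b i x)}"

lemma lspan_zero: "(\<lambda>x. 0) \<in> lspan I b"
  unfolding lspan_def by (auto intro!: exI[of _ "\<lambda>_. 0"])

lemma lspan_comb: "u \<in> lspan I b \<Longrightarrow> v \<in> lspan I b \<Longrightarrow> (\<lambda>x. s * u x + t * v x) \<in> lspan I b"
  unfolding lspan_def
proof safe
  fix c d
  show "\<exists>e. (\<lambda>x. s * (\<Sum>i\<in>I. c i * b i x) + t * (\<Sum>i\<in>I. d i * b i x)) = (\<lambda>x. \<Sum>i\<in>I. e i * b i x)"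
    by (intro exI[of _ "\<lambda>i. s * c i + t * d i"])
      (simp add: sum_distrib_left sum.distrib algebra_simps)
qed

lemma lspan_sum:
  assumes "finite J" "\<And>i. i \<in> J \<Longrightarrow> v i \<in> lspan I b"
  shows "(\<lambda>x. \<Sum>i\<in>J. c i * v i x) \<in> lspan I b"
  using assms
proof (induction J rule: finite_induct)
  case empty then show ?case by (simp add: lspan_zero)
next
  case (insert j J)
  then show ?case using lspan_comb[of "v j" I b "\<lambda>x. \<Sum>i\<in>J. c i * v i x" "c j" 1] by simp
qed

lemma lspan_gen:
  assumes "finite I" "i \<in> I" shows "b i \<in> lspan I b"
  unfolding lspan_def mem_Collect_eq
  by (intro exI[of _ "\<lambda>j. if j = i then 1 else 0"])
    (use assms in \<open>auto simp: if_distrib[of "\<lambda>y. y * _"] cong: if_cong\<close>)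

lemma linear_on_lspan_sum:
  fixes L :: "('x \<Rightarrow> real) \<Rightarrow> real"
  assumes "finite J" "\<And>i. i \<in> J \<Longrightarrow> v i \<in> lspan I b"
    and lin: "\<And>u v s t. u \<in> lspan I b \<Longrightarrow> v \<in> lspan I b \<Longrightarrow> L (\<lambda>x. s * u x + t * v x) = s * L u + t * L v"
  shows "L (\<lambda>x. \<Sum>i\<in>J. c i * v i x) = (\<Sum>i\<in>J. c i * L (v i))"
  using assms(1,2)
proof (induction J rule: finite_induct)
  case empty
  show ?case using lin[OF lspan_zero lspan_zero, of 0 0] by simp
next
  case (insert j J)
  then show ?case
    using lin[of "v j" "\<lambda>x. \<Sum>i\<in>J. c i * v i x" "c j" 1] lspan_sum[of J v I b c] by simp
qed

text \<open>
  A generating subfamily of least cardinality is linearly independent.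
\<close>

lemma basis_of_lspan:
  fixes b :: "'i \<Rightarrow> 'x \<Rightarrow> real"
  assumes "finite I"
  obtains J where "J \<subseteq> I" "lspan J b = lspan I b"
    "\<And>c. (\<And>x. (\<Sum>i\<in>J. c i * b i x) = 0) \<Longrightarrow> \<forall>i\<in>J. c i = 0"
proof -
  define P where "P J \<longleftrightarrow> J \<subseteq> I \<and> lspan J b = lspan I b" for J
  define J where "J = arg_min card P"
  have J: "P J" and min: "\<And>K. P K \<Longrightarrow> card J \<le> card K"
    unfolding J_def by (rule arg_min_natI[of P I], simp add: P_def) (rule arg_min_nat_le)
  have finJ: "finite J" using J assms finite_subset by (auto simp: P_def)
  show ?thesis
  proof (rule that)
    show "J \<subseteq> I" "lspan J b = lspan I b" using J by (auto simp: P_def)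
    fix c assume c0: "\<And>x. (\<Sum>i\<in>J. c i * b i x) = 0"
    show "\<forall>i\<in>J. c i = 0"
    proof (rule ccontr)
      assume "\<not> ?thesis"
      then obtain j where j: "j \<in> J" "c j \<noteq> 0" by auto
      have bj: "b j x = (\<Sum>i\<in>J-{j}. (- c i / c j) * b i x)" for x
      proof -
        have "c j * b j x + (\<Sum>i\<in>J-{j}. c i * b i x) = 0"
          using c0[of x] sum.remove[OF finJ j(1), of "\<lambda>i. c i * b i x"] by simp
        then have "b j x = - (\<Sum>i\<in>J-{j}. c i * b i x) / c j"
          using j by (simp add: field_simps)
        then show ?thesis by (simp add: sum_divide_distrib sum_negf)
      qed
      have sub: "lspan J b \<subseteq> lspan (J - {j}) b"
      proof
        fix v assume "v \<in> lspan J b"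
        then obtain d where v: "v = (\<lambda>x. \<Sum>i\<in>J. d i * b i x)" by (auto simp: lspan_def)
        have "b i \<in> lspan (J-{j}) b" if "i \<in> J" for i
        proof (cases "i = j")
          case True
          have "b j = (\<lambda>x. \<Sum>i\<in>J-{j}. (- c i / c j) * b i x)" using bj by (rule ext)
          then show ?thesis using True unfolding lspan_def by (auto intro!: exI[of _ "\<lambda>i. - c i / c j"])
        next
          case False then show ?thesis using that finJ by (intro lspan_gen) auto
        qed
        then show "v \<in> lspan (J-{j}) b" unfolding v by (rule lspan_sum[OF finJ])
      qed
      have "lspan (J - {j}) b \<subseteq> lspan J b"
      proof
        fix v assume "v \<in> lspan (J - {j}) b"
        then obtain d where v: "v = (\<lambda>x. \<Sum>i\<in>J-{j}. d i * b i x)" by (auto simp: lspan_def)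
        show "v \<in> lspan J b" unfolding v using finJ by (intro lspan_sum lspan_gen) auto
      qed
      then have "P (J - {j})" using sub J by (auto simp: P_def)
      then have "card J \<le> card (J - {j})" by (rule min)
      then show False using j finJ by (metis card_Diff1_less not_less)
    qed
  qed
qed

text \<open>
  The common source of all discrete objects below: the moments on a face, the interior moments of
  the Raviart--Thomas field and the elliptic problem for the pressure are each an instance. The form
  need be neither symmetric nor definite, because the interior moments on a general parallelepiped give
  a form that is neither.
\<close>

lemma nondegenerate_form_solvable:
  fixes b :: "'i \<Rightarrow> 'x \<Rightarrow> real" and a :: "('x \<Rightarrow> real) \<Rightarrow> ('x \<Rightarrow> real) \<Rightarrow> real"
  assumes fin: "finite I"
    and lin1: "\<And>u v w s t. u \<in> lspan I b \<Longrightarrow> v \<in> lspan I b \<Longrightarrow> w \<in> lspan I b \<Longrightarrow>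
       a (\<lambda>x. s * u x + t * v x) w = s * a u w + t * a v w"
    and lin2: "\<And>u v w s t. u \<in> lspan I b \<Longrightarrow> v \<in> lspan I b \<Longrightarrow> w \<in> lspan I b \<Longrightarrow>
       a w (\<lambda>x. s * u x + t * v x) = s * a w u + t * a w v"
    and linL: "\<And>u v s t. u \<in> lspan I b \<Longrightarrow> v \<in> lspan I b \<Longrightarrow>
       L (\<lambda>x. s * u x + t * v x) = s * L u + t * L v"
    and nondeg: "\<And>v. v \<in> lspan I b \<Longrightarrow> (\<And>u. u \<in> lspan I b \<Longrightarrow> a v u = 0) \<Longrightarrow> v = (\<lambda>x. 0)"
  shows "\<exists>v\<in>lspan I b. \<forall>u\<in>lspan I b. a v u = L u"
proof -
  obtain J where J: "J \<subseteq> I" "lspan J b = lspan I b"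
    "\<And>c. (\<And>x. (\<Sum>i\<in>J. c i * b i x) = 0) \<Longrightarrow> \<forall>i\<in>J. c i = 0"
    using basis_of_lspan[OF fin] by metis
  have finJ: "finite J" using J(1) fin by (rule finite_subset)
  have gen: "b i \<in> lspan I b" if "i \<in> J" for i using lspan_gen[OF finJ that] J by auto
  have exp1: "a (\<lambda>x. \<Sum>i\<in>J. c i * b i x) w = (\<Sum>i\<in>J. c i * a (b i) w)" if "w \<in> lspan I b" for c w
    by (rule linear_on_lspan_sum[OF finJ gen]) (use lin1 that in auto)
  have exp2: "a w (\<lambda>x. \<Sum>i\<in>J. c i * b i x) = (\<Sum>i\<in>J. c i * a w (b i))" if "w \<in> lspan I b" for c w
    by (rule linear_on_lspan_sum[OF finJ gen]) (use lin2 that in auto)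
  have expL: "L (\<lambda>x. \<Sum>i\<in>J. c i * b i x) = (\<Sum>i\<in>J. c i * L (b i))" for c
    by (rule linear_on_lspan_sum[OF finJ gen]) (use linL in auto)
  have mem: "(\<lambda>x. \<Sum>i\<in>J. c i * b i x) \<in> lspan I b" for c
    using finJ gen by (rule lspan_sum)
  have "\<exists>c. \<forall>j\<in>J. (\<Sum>i\<in>J. c i * a (b i) (b j)) = L (b j)"
  proof (rule injective_system_solvable[OF finJ])
    fix c assume c0: "\<And>j. j \<in> J \<Longrightarrow> (\<Sum>i\<in>J. c i * a (b i) (b j)) = 0"
    have "(\<lambda>x. \<Sum>i\<in>J. c i * b i x) = (\<lambda>x. 0)"
    proof (rule nondeg[OF mem])
      fix u assume "u \<in> lspan I b"
      then obtain d where u: "u = (\<lambda>x. \<Sum>i\<in>J. d i * b i x)"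
        using J(2) unfolding lspan_def by blast
      show "a (\<lambda>x. \<Sum>i\<in>J. c i * b i x) u = 0"
        unfolding u exp2[OF mem] by (rule sum.neutral) (simp add: exp1 gen c0)
    qed
    then show "\<forall>i\<in>J. c i = 0" using J(3)[of c] by (simp add: fun_eq_iff)
  qed
  then obtain c where c: "\<And>j. j \<in> J \<Longrightarrow> (\<Sum>i\<in>J. c i * a (b i) (b j)) = L (b j)" by blast
  show ?thesis
  proof (intro bexI[of _ "\<lambda>x. \<Sum>i\<in>J. c i * b i x"] ballI mem)
    fix u assume "u \<in> lspan I b"
    then obtain d where u: "u = (\<lambda>x. \<Sum>i\<in>J. d i * b i x)"
      using J(2) unfolding lspan_def by blast
    show "a (\<lambda>x. \<Sum>i\<in>J. c i * b i x) u = L u"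
      unfolding u exp2[OF mem] expL by (rule sum.cong) (simp_all add: exp1 gen c)
  qed
qed

text \<open>
  Piecewise polynomials and vector fields with polynomial components are both families of functions
  that are chosen independently for each index.
\<close>

lemma lspan_blocks:
  fixes \<beta> :: "'j \<Rightarrow> 'a \<Rightarrow> 'x \<Rightarrow> real"
  assumes J: "finite J" and A: "\<And>j. finite (A j)"
  shows "u \<in> lspan (SIGMA j:J. A j) (\<lambda>(j,a) (j',x). if j' = j then \<beta> j a x else 0) \<longleftrightarrow>
    (\<forall>j\<in>J. (\<lambda>x. u (j, x)) \<in> lspan (A j) (\<beta> j)) \<and> (\<forall>j x. j \<notin> J \<longrightarrow> u (j, x) = 0)"
    (is "_ \<in> lspan ?I ?b \<longleftrightarrow> _")
proof -
  have expand: "(\<Sum>p\<in>?I. c p * ?b p (j, x)) = (if j \<in> J then \<Sum>a\<in>A j. c (j, a) * \<beta> j a x else 0)" for c j x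
  proof -
    have "(\<Sum>p\<in>?I. c p * ?b p (j, x)) = (\<Sum>(j',a)\<in>?I. c (j', a) * ?b (j', a) (j, x))"
      by (rule sum.cong) auto
    also have "\<dots> = (\<Sum>j'\<in>J. \<Sum>a\<in>A j'. c (j', a) * ?b (j', a) (j, x))"
      by (rule sum.Sigma[symmetric]) (use J A in auto)
    also have "\<dots> = (\<Sum>j'\<in>J. if j' = j then \<Sum>a\<in>A j. c (j, a) * \<beta> j a x else 0)"
      by (intro sum.cong) auto
    also have "\<dots> = (if j \<in> J then \<Sum>a\<in>A j. c (j, a) * \<beta> j a x else 0)" using J by simp
    finally show ?thesis .
  qed
  show ?thesis
  proof
    assume "u \<in> lspan ?I ?b"
    then obtain c where c: "u = (\<lambda>y. \<Sum>p\<in>?I. c p * ?b p y)" unfolding lspan_def by blast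
    have u: "u (j, x) = (if j \<in> J then \<Sum>a\<in>A j. c (j, a) * \<beta> j a x else 0)" for j x
      unfolding c by (rule expand)
    show "(\<forall>j\<in>J. (\<lambda>x. u (j, x)) \<in> lspan (A j) (\<beta> j)) \<and> (\<forall>j x. j \<notin> J \<longrightarrow> u (j, x) = 0)"
    proof (intro conjI ballI allI impI)
      fix j assume "j \<in> J"
      then have "(\<lambda>x. u (j, x)) = (\<lambda>x. \<Sum>a\<in>A j. c (j, a) * \<beta> j a x)" by (simp add: u)
      then show "(\<lambda>x. u (j, x)) \<in> lspan (A j) (\<beta> j)" unfolding lspan_def by (intro CollectI exI)
    qed (simp add: u)
  next
    assume u: "(\<forall>j\<in>J. (\<lambda>x. u (j, x)) \<in> lspan (A j) (\<beta> j)) \<and> (\<forall>j x. j \<notin> J \<longrightarrow> u (j, x) = 0)"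
    then have "\<forall>j\<in>J. \<exists>c. (\<lambda>x. u (j, x)) = (\<lambda>x. \<Sum>a\<in>A j. c a * \<beta> j a x)"
      unfolding lspan_def by blast
    from bchoice[OF this] obtain c where c: "\<forall>j\<in>J. (\<lambda>x. u (j, x)) = (\<lambda>x. \<Sum>a\<in>A j. c j a * \<beta> j a x)" ..
    have "u (j, x) = (\<Sum>p\<in>?I. (case p of (j, a) \<Rightarrow> c j a) * ?b p (j, x))" for j x
      unfolding expand using fun_cong[OF bspec[OF c, of j], of x] u by simp
    then have "u y = (\<Sum>p\<in>?I. (case p of (j, a) \<Rightarrow> c j a) * ?b p y)" for y
      by (cases y) (simp only:)
    then have "u = (\<lambda>y. \<Sum>p\<in>?I. (case p of (j, a) \<Rightarrow> c j a) * ?b p y)" by (rule ext)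
    then show "u \<in> lspan ?I ?b" unfolding lspan_def by (intro CollectI exI)
  qed
qed

text \<open>
  Used for the mean-value constraint: a generator on which the functional does not vanish is
  subtracted from the other generators in suitable multiples.
\<close>

lemma lspan_kernel:
  fixes b :: "'i \<Rightarrow> 'x \<Rightarrow> real"
  assumes fin: "finite I"
    and lin: "\<And>u v s t. u \<in> lspan I b \<Longrightarrow> v \<in> lspan I b \<Longrightarrow> L (\<lambda>x. s * u x + t * v x) = s * L u + t * (L v :: real)"
  shows "\<exists>b'. lspan I b' = {v \<in> lspan I b. L v = 0}"
proof -
  have gen: "b i \<in> lspan I b" if "i \<in> I" for i using fin that by (rule lspan_gen)
  have exp: "L (\<lambda>x. \<Sum>i\<in>I. c i * v i x) = (\<Sum>i\<in>I. c i * L (v i))" if "\<And>i. i \<in> I \<Longrightarrow> v i \<in> lspan I b" for c v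
    using fin that lin by (rule linear_on_lspan_sum)
  show ?thesis
  proof (cases "\<exists>i\<in>I. L (b i) \<noteq> 0")
    case False
    have "L v = 0" if v: "v \<in> lspan I b" for v
    proof -
      obtain c where "v = (\<lambda>x. \<Sum>i\<in>I. c i * b i x)" using v by (auto simp: lspan_def)
      then show ?thesis using exp[OF gen, where c=c] False by simp
    qed
    then show ?thesis by blast
  next
    case True
    then obtain k where k: "k \<in> I" "L (b k) \<noteq> 0" by blast
    define b' where "b' i = (\<lambda>x. 1 * b i x + (- L (b i) / L (b k)) * b k x)" for i
    have b': "b' i \<in> lspan I b" "L (b' i) = 0" if i: "i \<in> I" for i
    proof -
      show "b' i \<in> lspan I b" unfolding b'_def by (rule lspan_comb[OF gen[OF i] gen[OF k(1)]])
      have "L (b' i) = 1 * L (b i) + (- L (b i) / L (b k)) * L (b k)"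
        unfolding b'_def by (rule lin[OF gen[OF i] gen[OF k(1)]])
      then show "L (b' i) = 0" using k(2) by simp
    qed
    have "v \<in> lspan I b' \<longleftrightarrow> v \<in> lspan I b \<and> L v = 0" for v
    proof
      assume "v \<in> lspan I b'"
      then obtain c where v: "v = (\<lambda>x. \<Sum>i\<in>I. c i * b' i x)" unfolding lspan_def by blast
      show "v \<in> lspan I b \<and> L v = 0"
        unfolding v using lspan_sum[OF fin, of b' I b c] exp[where v=b' and c=c] b' by simp
    next
      assume v0: "v \<in> lspan I b \<and> L v = 0"
      then obtain c where v: "v = (\<lambda>x. \<Sum>i\<in>I. c i * b i x)" unfolding lspan_def by blast
      have z: "(\<Sum>i\<in>I. c i * L (b i)) = 0" using v0 exp[OF gen, where c=c] by (simp add: v)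
      have "(\<Sum>i\<in>I. c i * b' i x) = v x" for x
      proof -
        have "(\<Sum>i\<in>I. c i * b' i x) = (\<Sum>i\<in>I. c i * b i x) - (\<Sum>i\<in>I. c i * L (b i)) / L (b k) * b k x"
          by (simp add: b'_def algebra_simps sum.distrib sum_subtractf sum_negf sum_distrib_left sum_divide_distrib)
        then show ?thesis by (simp add: z v)
      qed
      then have "v = (\<lambda>x. \<Sum>i\<in>I. c i * b' i x)" by (intro ext) simp
      then show "v \<in> lspan I b'" unfolding lspan_def by blast
    qed
    then show ?thesis by (intro exI[of _ b']) blast
  qed
qed

section \<open>Polynomials of bounded degree in each variable\<close>

definition upd :: "'n \<Rightarrow> 'a \<Rightarrow> 'a^'n \<Rightarrow> 'a^'n::finite" where
  "upd i t x = (\<chi> j. if j = i then t else x $ j)"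

lemma upd_nth [simp]: "upd i t x $ j = (if j = i then t else x $ j)"
  by (simp add: upd_def)

lemma upd_upd [simp]: "upd i s (upd i t x) = upd i s x"
  by (simp add: vec_eq_iff)

lemma upd_same [simp]: "upd i (x $ i) x = x"
  by (simp add: vec_eq_iff)

lemma upd_decomp: "upd i t x = x + (t - x $ i) *\<^sub>R axis i (1::real)"
  by (simp add: vec_eq_iff axis_def)

lemma continuous_upd [continuous_intros]:
  fixes x :: "'b::topological_space \<Rightarrow> real^'n::finite"
  assumes "continuous_on S x" "continuous_on S t"
  shows "continuous_on S (\<lambda>y. upd i (t y) (x y))"
  unfolding upd_decomp by (intro continuous_intros assms)

definition monomial :: "('n::finite \<Rightarrow> nat) \<Rightarrow> real^'n \<Rightarrow> real" where
  "monomial a x = (\<Prod>i\<in>UNIV. x $ i ^ a i)"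

definition exponents :: "('n::finite \<Rightarrow> nat) \<Rightarrow> ('n \<Rightarrow> nat) set" where
  "exponents D = {a. \<forall>i. a i \<le> D i}"

lemma finite_exps [simp]: "finite (exponents D)"
proof -
  have "exponents D = PiE UNIV (\<lambda>i. {..D i})" by (auto simp: exponents_def PiE_def extensional_def)
  then show ?thesis by (simp add: finite_PiE)
qed

lemma polys_eq_lspan: "polys D = lspan (exponents D) monomial"
  by (auto simp: polys_def lspan_def exponents_def monomial_def fun_eq_iff)

lemma polys_zero [simp]: "(\<lambda>x. 0) \<in> polys D"
  unfolding polys_eq_lspan by (rule lspan_zero)

lemma polys_comb: "f \<in> polys D \<Longrightarrow> g \<in> polys D \<Longrightarrow> (\<lambda>x. s * f x + t * g x) \<in> polys D"
  unfolding polys_eq_lspan by (rule lspan_comb)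

lemma polys_add: "f \<in> polys D \<Longrightarrow> g \<in> polys D \<Longrightarrow> (\<lambda>x. f x + g x) \<in> polys D"
  using polys_comb[of f D g 1 1] by simp

lemma polys_diff: "f \<in> polys D \<Longrightarrow> g \<in> polys D \<Longrightarrow> (\<lambda>x. f x - g x) \<in> polys D"
  using polys_comb[of f D g 1 "-1"] by simp

lemma polys_cmult: "f \<in> polys D \<Longrightarrow> (\<lambda>x. c * f x) \<in> polys D"
  using polys_comb[of f D f c 0] by simp

lemma polys_sum: "finite J \<Longrightarrow> (\<And>i. i \<in> J \<Longrightarrow> f i \<in> polys D) \<Longrightarrow> (\<lambda>x. \<Sum>i\<in>J. f i x) \<in> polys D"
  using lspan_sum[of J f "exponents D" monomial "\<lambda>_. 1"] unfolding polys_eq_lspan by simp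

lemma mon_in_polys: "a \<in> exponents D \<Longrightarrow> monomial a \<in> polys D"
  unfolding polys_eq_lspan by (rule lspan_gen) auto

lemma polys_const [simp]: "(\<lambda>x. c) \<in> polys D"
proof -
  have "monomial (\<lambda>_. 0) \<in> polys D" by (rule mon_in_polys) (simp add: exponents_def)
  then show ?thesis using polys_cmult[of "monomial (\<lambda>_. 0)" D c] by (simp add: monomial_def)
qed

lemma polys_induct [consumes 1, case_names zero add monomial]:
  assumes "f \<in> polys D" "P (\<lambda>x. 0)" "\<And>f g. P f \<Longrightarrow> P g \<Longrightarrow> P (\<lambda>x. f x + g x)"
    "\<And>c a. a \<in> exponents D \<Longrightarrow> P (\<lambda>x. c * monomial a x)"
  shows "P f"
proof -
  obtain c where f: "f = (\<lambda>x. \<Sum>a\<in>exponents D. c a * monomial a x)"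
    using assms(1) unfolding polys_eq_lspan lspan_def by blast
  have "P (\<lambda>x. \<Sum>a\<in>A. c a * monomial a x)" if "finite A" "A \<subseteq> exponents D" for A
    using that by (induction A rule: finite_induct) (auto intro: assms)
  then show ?thesis unfolding f by auto
qed

lemma polys_mono:
  assumes "f \<in> polys D" "\<And>i. D i \<le> D' i" shows "f \<in> polys D'"
  using assms(1)
proof (induction rule: polys_induct)
  case (monomial c a)
  then have "a \<in> exponents D'" using assms(2) order_trans unfolding exponents_def by blast
  then show ?case by (intro polys_cmult mon_in_polys)
qed (auto intro: polys_add)

lemma mon_split: "monomial a x = x $ i ^ a i * monomial (a(i := 0)) x"
proof -
  have "monomial a x = x $ i ^ a i * (\<Prod>j\<in>UNIV-{i}. x $ j ^ a j)"
    unfolding monomial_def by (rule prod.remove) auto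
  moreover have "monomial (a(i:=0)) x = (\<Prod>j\<in>UNIV-{i}. x $ j ^ a j)"
    unfolding monomial_def by (subst prod.remove[of _ i]) auto
  ultimately show ?thesis by simp
qed

lemma mon_upd: "monomial a (upd i t x) = t ^ a i * monomial (a(i := 0)) x"
proof -
  have "monomial (a(i:=0)) (upd i t x) = monomial (a(i:=0)) x"
    unfolding monomial_def by (rule prod.cong) auto
  then show ?thesis by (subst mon_split[of _ _ i]) simp
qed

lemma polys_expand:
  assumes "f \<in> polys D"
  obtains u where "\<And>b. u b \<in> polys (D(i := 0))" "\<And>x. f x = (\<Sum>b\<le>D i. x $ i ^ b * u b x)"
proof -
  have "\<exists>u. (\<forall>b. u b \<in> polys (D(i := 0))) \<and> (\<forall>x. f x = (\<Sum>b\<le>D i. x $ i ^ b * u b x))"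
    using assms
  proof (induction rule: polys_induct)
    case zero
    show ?case by (intro exI[of _ "\<lambda>_ _. 0"]) auto
  next
    case (add f g)
    then obtain u v where "\<forall>b. u b \<in> polys (D(i := 0))" "\<forall>x. f x = (\<Sum>b\<le>D i. x $ i ^ b * u b x)"
      "\<forall>b. v b \<in> polys (D(i := 0))" "\<forall>x. g x = (\<Sum>b\<le>D i. x $ i ^ b * v b x)" by blast
    then show ?case
      by (intro exI[of _ "\<lambda>b x. u b x + v b x"]) (simp add: sum.distrib algebra_simps, simp add: fun_upd_def polys_add)
  next
    case (monomial c a)
    have "a(i:=0) \<in> exponents (D(i := 0))" "a i \<le> D i" using monomial by (auto simp: exponents_def)
    then have "(\<lambda>x. if b = a i then c * monomial (a(i:=0)) x else 0) \<in> polys (D(i := 0))" for b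
      by (cases "b = a i") (auto intro: mon_in_polys polys_cmult)
    moreover have "c * monomial a x = (\<Sum>b\<le>D i. x $ i ^ b * (if b = a i then c * monomial (a(i:=0)) x else 0))" for x
      using \<open>a i \<le> D i\<close> mon_split[of a x i] by (simp add: if_distrib[of "\<lambda>y. _ * y"] cong: if_cong)
    ultimately show ?case
      by (intro exI[of _ "\<lambda>b x. (if b = a i then c * monomial (a(i:=0)) x else 0)"]) blast
  qed
  then show ?thesis using that by blast
qed

lemma polys_indep: 
  assumes "f \<in> polys D" "D i = 0" shows "f (upd i t x) = f x"
  using assms(1)
proof (induction rule: polys_induct)
  case (monomial c a)
  then have "a i = 0" using assms(2) by (metis (mono_tags, lifting) exponents_def le_0_eq mem_Collect_eq)
  then show ?case by (simp add: mon_upd mon_split[of a _ i])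
qed auto

lemma polys_upd:
  assumes "f \<in> polys D" shows "(\<lambda>x. f (upd i t x)) \<in> polys (D(i := 0))"
  using assms
proof (induction rule: polys_induct)
  case (monomial c a)
  then have "a(i:=0) \<in> exponents (D(i:=0))" by (auto simp: exponents_def)
  then have "(\<lambda>x. c * t ^ a i * monomial (a(i:=0)) x) \<in> polys (D(i:=0))" by (intro polys_cmult mon_in_polys)
  then show ?case by (simp add: mon_upd mult.assoc fun_upd_def)
qed (auto intro: polys_add)

lemma mon_mult: "monomial a x * monomial a' x = monomial (\<lambda>i. a i + a' i) x"
  by (simp add: monomial_def prod.distrib power_add)

lemma polys_mult:
  assumes "f \<in> polys D" "g \<in> polys D'" shows "(\<lambda>x. f x * g x) \<in> polys (\<lambda>i. D i + D' i)"
  using assms(1)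
proof (induction rule: polys_induct)
  case (add f1 f2)
  from polys_add[OF add] show ?case by (simp add: distrib_right)
next
  case (monomial c a)
  from assms(2) show ?case
  proof (induction rule: polys_induct)
    case (add g1 g2)
    from polys_add[OF add] show ?case by (simp add: distrib_left)
  next
    case (monomial c' a')
    then have "(\<lambda>i. a i + a' i) \<in> exponents (\<lambda>i. D i + D' i)"
      using \<open>a \<in> exponents D\<close> by (auto simp: exponents_def add_mono)
    from polys_cmult[OF mon_in_polys[OF this], of "c * c'"] show ?case
      by (simp add: mon_mult[symmetric] mult_ac)
  qed simp
qed simp

lemma polys_power: "f \<in> polys D \<Longrightarrow> (\<lambda>x. f x ^ n) \<in> polys (\<lambda>i. n * D i)"
proof (induction n)
  case (Suc n)
  from polys_mult[OF Suc.prems Suc.IH[OF Suc.prems]] show ?case by simp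
qed simp

lemma polys_prod:
  assumes "finite J" "\<And>j. j \<in> J \<Longrightarrow> f j \<in> polys (D j)"
  shows "(\<lambda>x. \<Prod>j\<in>J. f j x) \<in> polys (\<lambda>i. \<Sum>j\<in>J. D j i)"
  using assms
proof (induction J rule: finite_induct)
  case (insert j J)
  from polys_mult[of "f j" "D j" "\<lambda>x. \<Prod>j\<in>J. f j x" "\<lambda>i. \<Sum>j\<in>J. D j i"] insert show ?case by simp
qed simp

lemma polys_mult_coord:
  assumes "f \<in> polys D" shows "(\<lambda>x. x $ i * f x) \<in> polys (D(i := Suc (D i)))"
  using assms
proof (induction rule: polys_induct)
  case (add f g)
  then show ?case using polys_add[OF add] by (simp add: algebra_simps)
next
  case (monomial c a)
  then have "a(i:=Suc (a i)) \<in> exponents (D(i:=Suc (D i)))" by (auto simp: exponents_def)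
  then have "(\<lambda>x. c * monomial (a(i:=Suc (a i))) x) \<in> polys (D(i:=Suc (D i)))" by (intro polys_cmult mon_in_polys)
  moreover have "c * monomial (a(i:=Suc (a i))) x = x $ i * (c * monomial a x)" for x
    using mon_split[of "a(i:=Suc (a i))" x i] mon_split[of a x i] by simp
  ultimately show ?case by (simp only:)
qed auto

lemma polys_coord: "D i \<ge> 1 \<Longrightarrow> (\<lambda>x. x $ i) \<in> polys D"
  using polys_mono[OF polys_mult_coord[OF polys_const[of 1 "\<lambda>_. 0"], of i], of D] by auto

lemma polys_mult_coord_pow:
  assumes "f \<in> polys D" "D i = 0" shows "(\<lambda>x. x $ i ^ b * f x) \<in> polys (D(i := b))"
proof (induction b)
  case 0 then show ?case using assms by (metis (no_types, lifting) fun_upd_triv lambda_one power_0 polys_mono order_refl mult_1 ext)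
next
  case (Suc b)
  have "(D(i := b))(i := Suc ((D(i := b)) i)) = D(i := Suc b)" by auto
  with polys_mult_coord[OF Suc, of i]
  have "(\<lambda>x. x $ i * (x $ i ^ b * f x)) \<in> polys (D(i := Suc b))" by (simp only:)
  then show ?case by (simp only: power_Suc mult.assoc)
qed

text \<open>
  Division by a linear factor in one variable. It turns the vanishing of a normal component on the
  two opposite faces of the cube into divisibility by the bubble function.
\<close>

lemma polys_factor:
  assumes "f \<in> polys D" "D i = Suc d"
  obtains u where "u \<in> polys (D(i := d))" "\<And>x. f x = f (upd i t x) + (x $ i - t) * u x"
proof -
  obtain v where v: "\<And>b. v b \<in> polys (D(i := 0))" "\<And>x. f x = (\<Sum>b\<le>D i. x $ i ^ b * v b x)"
    using polys_expand[OF assms(1)] by metis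
  define u where "u x = (\<Sum>b\<le>D i. (\<Sum>c<b. t ^ (b - Suc c) * (x $ i ^ c * v b x)))" for x
  have "f x = f (upd i t x) + (x $ i - t) * u x" for x
  proof -
    have "v b (upd i t x) = v b x" for b using polys_indep[OF v(1), of i b t x] by simp
    then have "f x - f (upd i t x) = (\<Sum>b\<le>D i. (x $ i ^ b - t ^ b) * v b x)"
      by (simp add: v(2) sum_subtractf algebra_simps)
    also have "\<dots> = (x $ i - t) * u x"
      unfolding u_def sum_distrib_left
      by (rule sum.cong) (auto simp: power_diff_sumr2 sum_distrib_left sum_distrib_right mult_ac)
    finally show ?thesis by simp
  qed
  moreover have "u \<in> polys (D(i := d))"
    unfolding u_def
  proof (intro polys_sum polys_cmult)
    fix b c assume "b \<in> {..D i}" "c \<in> {..<b}"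
    then have "c \<le> d" using assms by auto
    moreover have "(\<lambda>x. x $ i ^ c * v b x) \<in> polys (D(i := 0, i := c))"
      by (rule polys_mult_coord_pow[OF v(1)]) simp
    ultimately
    show "(\<lambda>x. x $ i ^ c * v b x) \<in> polys (D(i := d))" by (elim polys_mono) auto
  qed auto
  ultimately show ?thesis using that by blast
qed

subsection \<open>Polynomial functions and derivatives\<close>

lemma polys_real_polynomial_function:
  assumes "f \<in> polys D" shows "real_polynomial_function f"
  using assms
proof (induction rule: polys_induct)
  case (monomial c a)
  have "real_polynomial_function (\<lambda>x. x $ i)" for i :: 'a
    by (simp add: real_polynomial_function.intros(1) bounded_linear_vec_nth)
  then show ?case unfolding monomial_def
    by (intro real_polynomial_function.intros(4) real_polynomial_function.intros(2)
        real_polynomial_function_prod real_polynomial_function_power) auto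
qed (auto intro: real_polynomial_function.intros)

lemma rpf_continuous: "real_polynomial_function f \<Longrightarrow> continuous_on S f"
  by (simp add: continuous_on_polymonial_function real_polynomial_function_eq)

lemma rpf_differentiable:
  fixes f :: "real^'n::finite \<Rightarrow> real"
  shows "real_polynomial_function f \<Longrightarrow> f differentiable (at x)"
  by (simp add: differentiable_at_polynomial_function real_polynomial_function_eq)

lemma partial_eqI:
  assumes "(f has_derivative f') (at x)" shows "partial i f x = f' (axis i 1)"
  unfolding partial_def using frechet_derivative_at[OF assms] by simp

lemma has_derivative_partials:
  fixes f :: "real^'n::finite \<Rightarrow> real"
  assumes "f differentiable (at x)"
  shows "(f has_derivative (\<lambda>h. \<Sum>i\<in>UNIV. h $ i * partial i f x)) (at x)"
proof -
  have fd: "(f has_derivative frechet_derivative f (at x)) (at x)"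
    using assms by (simp add: frechet_derivative_works)
  then interpret linear "frechet_derivative f (at x)" by (rule has_derivative_linear)
  have "frechet_derivative f (at x) h = (\<Sum>i\<in>UNIV. h $ i * partial i f x)" for h
  proof -
    have "h = (\<Sum>i\<in>UNIV. (h $ i) *\<^sub>R axis i 1)" 
      by (metis basis_expansion scalar_mult_eq_scaleR)
    then have "frechet_derivative f (at x) h = frechet_derivative f (at x) (\<Sum>i\<in>UNIV. (h $ i) *\<^sub>R axis i 1)" by simp
    also have "\<dots> = (\<Sum>i\<in>UNIV. h $ i * partial i f x)" unfolding sum scale partial_def by simp
    finally show ?thesis .
  qed
  with fd show ?thesis by (metis (no_types, lifting) ext)
qed

lemma partial_line:
  fixes f :: "real^'n::finite \<Rightarrow> real"
  assumes "f differentiable (at (upd i t x))"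
  shows "((\<lambda>t. f (upd i t x)) has_real_derivative partial i f (upd i t x)) (at t)"
proof -
  have 1: "((\<lambda>t. upd i t x) has_derivative (\<lambda>h. h *\<^sub>R axis i 1)) (at t)"
    unfolding upd_decomp by (auto intro!: derivative_eq_intros)
  have "((\<lambda>t. f (upd i t x)) has_derivative (\<lambda>h. \<Sum>j\<in>UNIV. (h *\<^sub>R axis i 1) $ j * partial j f (upd i t x))) (at t)"
    using has_derivative_compose[OF 1 has_derivative_partials[OF assms]] .
  moreover have "(\<lambda>h. \<Sum>j\<in>UNIV. (h *\<^sub>R axis i 1) $ j * partial j f (upd i t x)) = (*) (partial i f (upd i t x))"
    by (auto simp: axis_def fun_eq_iff if_distrib[of "\<lambda>y. _ * y"] if_distrib[of "\<lambda>y. y * _"] cong: if_cong)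
  ultimately show ?thesis unfolding has_field_derivative_def by simp
qed

lemma partial_add:
  assumes "f differentiable (at x)" "g differentiable (at x)"
  shows "partial i (\<lambda>y. f y + g y) x = partial i f x + partial i g x"
proof -
  have "((\<lambda>y. f y + g y) has_derivative (\<lambda>h. frechet_derivative f (at x) h + frechet_derivative g (at x) h)) (at x)"
    by (intro has_derivative_add) (use assms frechet_derivative_works in auto)
  from partial_eqI[OF this] show ?thesis by (simp add: partial_def)
qed

lemma partial_mult:
  assumes "f differentiable (at x)" "g differentiable (at x)"
  shows "partial i (\<lambda>y. f y * g y) x = f x * partial i g x + partial i f x * g x"
proof -
  have "((\<lambda>y. f y * g y) has_derivative (\<lambda>h. f x * frechet_derivative g (at x) h + frechet_derivative f (at x) h * g x)) (at x)"
    by (intro has_derivative_mult) (use assms frechet_derivative_works in auto)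
  from partial_eqI[OF this] show ?thesis by (simp add: partial_def)
qed

lemma partial_const [simp]: "partial i (\<lambda>y. c) x = 0"
  using partial_eqI[OF has_derivative_const] by blast

lemma partial_cmult:
  assumes "f differentiable (at x)"
  shows "partial i (\<lambda>y. c * f y) x = c * partial i f x"
  using partial_mult[OF _ assms, of "\<lambda>_. c"] by simp

lemma partial_linear:
  assumes "bounded_linear f" shows "partial i f x = f (axis i 1)"
  using partial_eqI[OF bounded_linear_imp_has_derivative[OF assms]] .

lemma partial_sum:
  assumes "finite J" "\<And>j. j \<in> J \<Longrightarrow> f j differentiable (at x)"
  shows "partial i (\<lambda>y. \<Sum>j\<in>J. f j y) x = (\<Sum>j\<in>J. partial i (f j) x)"
proof -
  have "((\<lambda>y. \<Sum>j\<in>J. f j y) has_derivative (\<lambda>h. \<Sum>j\<in>J. frechet_derivative (f j) (at x) h)) (at x)"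
    by (intro has_derivative_sum) (use assms frechet_derivative_works in auto)
  from partial_eqI[OF this] show ?thesis by (simp add: partial_def)
qed

lemma rpf_partial:
  fixes f :: "real^'n::finite \<Rightarrow> real"
  assumes "real_polynomial_function f" shows "real_polynomial_function (partial i f)"
  using assms
proof (induction rule: real_polynomial_function.induct)
  case (linear f)
  then have "partial i f = (\<lambda>x. f (axis i 1))" by (auto simp: partial_linear)
  then show ?case by (simp add: real_polynomial_function.intros(2))
next
  case (const c)
  have "partial i (\<lambda>x::real^'n. c) = (\<lambda>x. 0)" by auto
  then show ?case by (simp add: real_polynomial_function.intros(2))
next
  case (add f g)
  then have "partial i (\<lambda>x. f x + g x) = (\<lambda>x. partial i f x + partial i g x)"
    by (auto simp: partial_add rpf_differentiable)
  then show ?case using add by (simp add: real_polynomial_function.intros(3))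
next
  case (mult f g)
  then have "partial i (\<lambda>x. f x * g x) = (\<lambda>x. f x * partial i g x + partial i f x * g x)"
    by (auto simp: partial_mult rpf_differentiable)
  then show ?case using mult by (simp add: real_polynomial_function.intros(3) real_polynomial_function.intros(4))
qed

lemma partial_mon:
  "partial i (monomial a) x = real (a i) * monomial (a(i := a i - 1)) x"
proof -
  have d: "monomial a differentiable (at (upd i (x $ i) x))"
    using polys_real_polynomial_function[OF mon_in_polys[of a a]] rpf_differentiable by (auto simp: exponents_def)
  have "((\<lambda>t. monomial a (upd i t x)) has_real_derivative partial i (monomial a) x) (at (x $ i))"
    using partial_line[OF d] by simp
  moreover have "((\<lambda>t. monomial a (upd i t x)) has_real_derivative (real (a i) * x $ i ^ (a i - 1) * monomial (a(i:=0)) x)) (at (x $ i))"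
    unfolding mon_upd by (auto intro!: derivative_eq_intros)
  ultimately have "partial i (monomial a) x = real (a i) * x $ i ^ (a i - 1) * monomial (a(i:=0)) x"
    by (rule DERIV_unique)
  moreover have "monomial (a(i := a i - 1)) x = x $ i ^ (a i - 1) * monomial (a(i := 0)) x"
    using mon_split[of "a(i := a i - 1)" x i] by simp
  ultimately show ?thesis by simp
qed

lemma polys_partial:
  assumes "f \<in> polys D" shows "partial i f \<in> polys (D(i := D i - 1))"
proof -
  have "real_polynomial_function f \<and> partial i f \<in> polys (D(i := D i - 1))"
    using assms
  proof (induction rule: polys_induct)
    case zero
    have "partial i (\<lambda>x. 0) = (\<lambda>x. 0)" by auto
    then show ?case by (simp add: real_polynomial_function.intros(2))
  next
    case (add f g)
    then have "partial i (\<lambda>x. f x + g x) = (\<lambda>x. partial i f x + partial i g x)"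
      by (auto simp: partial_add rpf_differentiable)
    with add show ?case by (auto intro: polys_add real_polynomial_function.intros(3))
  next
    case (monomial c a)
    have r: "real_polynomial_function (monomial a)" by (rule polys_real_polynomial_function[OF mon_in_polys[OF monomial]])
    have "a(i := a i - 1) \<in> exponents (D(i := D i - 1))" using monomial by (auto simp: exponents_def diff_le_mono fun_upd_def)
    moreover have "partial i (\<lambda>x. c * monomial a x) = (\<lambda>x. c * (real (a i) * monomial (a(i := a i - 1)) x))"
      by (auto simp: partial_cmult[OF rpf_differentiable[OF r]] partial_mon)
    ultimately show ?case using real_polynomial_function.intros(4)[OF real_polynomial_function.intros(2)[of c] r]
      by (simp only: polys_cmult mon_in_polys simp_thms)
  qed
  then show ?thesis ..
qed

lemma rpf_affine:
  fixes f :: "real^'m::finite \<Rightarrow> real" and A :: "real^'n::finite^'m"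
  assumes "real_polynomial_function f"
  shows "real_polynomial_function (\<lambda>x. f (A *v x + c))"
proof -
  have "real_polynomial_function (\<lambda>x. (A *v x + c) $ i)" for i
    unfolding vector_add_component
    by (intro real_polynomial_function.intros bounded_linear_compose[OF bounded_linear_vec_nth])
      (simp add: linear_conv_bounded_linear[symmetric])
  then have "polynomial_function (\<lambda>x. A *v x + c)"
    by (auto simp: polynomial_function_iff_Basis_inner Basis_vec_def inner_axis)
  from real_polynomial_function_compose[OF this assms] show ?thesis by (simp add: o_def)
qed

lemma partial_affine:
  fixes f :: "real^'m::finite \<Rightarrow> real" and A :: "real^'n::finite^'m"
  assumes "f differentiable (at (A *v x + c))"
  shows "partial j (\<lambda>x. f (A *v x + c)) x = (\<Sum>l\<in>UNIV. A $ l $ j * partial l f (A *v x + c))"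
proof -
  have "((\<lambda>x. A *v x + c) has_derivative (\<lambda>h. A *v h)) (at x)"
    by (auto intro!: derivative_eq_intros bounded_linear_imp_has_derivative simp: linear_conv_bounded_linear[symmetric])
  from has_derivative_compose[OF this has_derivative_partials[OF assms]]
  show ?thesis by (subst partial_eqI, assumption) (simp add: matrix_vector_mult_basis column_def)
qed

text \<open>
  On every line through a point of the open set the polynomial is a polynomial in one variable with
  infinitely many zeros.
\<close>

lemma rpf_eq_zero:
  fixes f :: "real^'n::finite \<Rightarrow> real"
  assumes f: "real_polynomial_function f" and "open S" "x0 \<in> S" and z: "\<And>x. x \<in> S \<Longrightarrow> f x = 0"
  shows "f x = 0"
proof -
  define g where "g t = f (x0 + t *\<^sub>R (x - x0))" for t :: real
  have "polynomial_function (\<lambda>t::real. x0 + t *\<^sub>R (x - x0))"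
    by (intro polynomial_function_add polynomial_function_const polynomial_function_mult) 
       (auto intro: polynomial_function_id)
  from real_polynomial_function_compose[OF this f] have "real_polynomial_function g"
    by (simp add: o_def g_def[abs_def])
  then obtain a n where g: "g = (\<lambda>t. \<Sum>i\<le>n. a i * t ^ i)"
    by (auto simp: real_polynomial_function_iff_sum)
  have "continuous (at 0) (\<lambda>t. x0 + t *\<^sub>R (x - x0))" by (intro continuous_intros)
  then have "((\<lambda>t. x0 + t *\<^sub>R (x - x0)) \<longlongrightarrow> x0) (at 0)" by (simp add: isCont_def)
  then have "\<forall>\<^sub>F t in at 0. x0 + t *\<^sub>R (x - x0) \<in> S" using assms(2,3) by (rule topological_tendstoD)
  then obtain d where d: "d > 0" "\<And>t. t \<noteq> 0 \<Longrightarrow> dist t 0 < d \<Longrightarrow> x0 + t *\<^sub>R (x - x0) \<in> S"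
    unfolding eventually_at by auto
  then have "{0<..<d} \<subseteq> {t. g t = 0}" using z by (auto simp: g_def)
  then have "infinite {t. g t = 0}" using d(1) infinite_Ioo finite_subset by blast
  then have "\<forall>i\<le>n. a i = 0" unfolding g using polyfun_finite_roots[of a n] by auto
  then have "g 1 = 0" by (simp add: g)
  then show ?thesis by (simp add: g_def)
qed

section \<open>Integration over the reference cube\<close>

subsection \<open>Exchanging a coordinate with an extra variable\<close>

lemma emeasure_box_cart:
  fixes l u :: "real^'n::finite"
  assumes "\<And>i. l $ i \<le> u $ i"
  shows "emeasure lborel (box l u) = (\<Prod>i\<in>UNIV. u $ i - l $ i)"
proof -
  have B: "(Basis :: (real^'n) set) = (\<lambda>i. axis i 1) ` UNIV" by (auto simp: Basis_vec_def)
  have inj: "inj (\<lambda>i::'n. axis i (1::real))" by (auto simp: inj_on_def axis_eq_axis)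
  have "emeasure lborel (box l u) = (\<Prod>b\<in>Basis. (u - l) \<bullet> b)"
    using assms by (intro emeasure_lborel_box) (auto simp: B inner_axis)
  also have "(\<Prod>b\<in>Basis. (u - l) \<bullet> b) = (\<Prod>i\<in>UNIV. u $ i - l $ i)"
    unfolding B by (subst prod.reindex[OF inj]) (simp add: inner_axis)
  finally show ?thesis .
qed

lemma box_nth: "x \<in> box l u \<longleftrightarrow> (\<forall>i. l $ i < x $ i \<and> x $ i < u $ i)" for x :: "real^'n::finite"
  by (simp add: mem_box_cart)

lemma box_Pair_eq: "box (a, b) (c, d) = box a c \<times> box b d"
  by (auto simp: box_def Basis_prod_def ball_Un)

lemma upd_in_box:
  "upd i s x \<in> box l u \<longleftrightarrow> (l $ i < s \<and> s < u $ i) \<and> (\<forall>j. j \<noteq> i \<longrightarrow> l $ j < x $ j \<and> x $ j < u $ j)"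
  "x \<in> box (upd i a l) (upd i b u) \<longleftrightarrow> (a < x $ i \<and> x $ i < b) \<and> (\<forall>j. j \<noteq> i \<longrightarrow> l $ j < x $ j \<and> x $ j < u $ j)"
  for x :: "real^'n::finite"
  unfolding box_nth by (auto split: if_splits)

lemma continuous_swap: "continuous_on UNIV (\<lambda>p::(real^'n::finite)\<times>real. (upd i (snd p) (fst p), fst p $ i))"
  by (intro continuous_intros)

text \<open>
  Exchanging the coordinate \<open>i\<close> with an extra real variable permutes the coordinates of the product
  space, hence preserves Lebesgue measure. All uses of Fubini below are consequences, so that no space
  of dimension one less than that of the domain has to be introduced.
\<close>

lemma distr_swap_coordinate:
  "distr lborel borel (\<lambda>p. (upd i (snd p) (fst p), fst p $ i)) = (lborel :: ((real^'n::finite)\<times>real) measure)"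
proof (rule lborel_eqI[symmetric])
  let ?T = "\<lambda>p::(real^'n)\<times>real. (upd i (snd p) (fst p), fst p $ i)"
  have [measurable]: "?T \<in> borel \<rightarrow>\<^sub>M borel"
    by (rule borel_measurable_continuous_onI[OF continuous_swap])
  fix l u :: "(real^'n)\<times>real"
  assume le: "\<And>b. b \<in> Basis \<Longrightarrow> l \<bullet> b \<le> u \<bullet> b"
  obtain l1 l2 u1 u2 where lu: "l = (l1, l2)" "u = (u1, u2)" by (cases l, cases u)
  have l1: "l1 $ j \<le> u1 $ j" for j
    using le[of "(axis j 1, 0)"] by (auto simp: lu Basis_prod_def inner_axis)
  have l2: "l2 \<le> u2" using le[of "(0,1)"] by (auto simp: lu Basis_prod_def)
  have pre: "?T -` box l u = box (upd i l2 l1) (upd i u2 u1) \<times> box (l1 $ i) (u1 $ i)"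
    unfolding lu box_Pair_eq by (auto simp: upd_in_box)
  have "emeasure (distr lborel borel ?T) (box l u) = emeasure lborel (box (upd i l2 l1) (upd i u2 u1) \<times> box (l1 $ i) (u1 $ i))"
    by (subst emeasure_distr) (auto simp: pre)
  also have "\<dots> = emeasure lborel (box (upd i l2 l1) (upd i u2 u1)) * emeasure lborel (box (l1 $ i) (u1 $ i))"
    unfolding lborel_prod[symmetric] by (subst lborel.emeasure_pair_measure_Times) auto
  also have "\<dots> = emeasure lborel (box l1 u1) * emeasure lborel (box l2 u2)"
  proof -
    have "(\<Prod>j\<in>UNIV. upd i u2 u1 $ j - upd i l2 l1 $ j) = (u2 - l2) * (\<Prod>j\<in>UNIV-{i}. u1 $ j - l1 $ j)"
      by (subst prod.remove[of _ i]) auto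
    moreover have "(\<Prod>j\<in>UNIV. u1 $ j - l1 $ j) = (u1 $ i - l1 $ i) * (\<Prod>j\<in>UNIV-{i}. u1 $ j - l1 $ j)"
      by (subst prod.remove[of _ i]) auto
    moreover have "emeasure lborel (box (upd i l2 l1) (upd i u2 u1)) = (\<Prod>j\<in>UNIV. upd i u2 u1 $ j - upd i l2 l1 $ j)"
      by (rule emeasure_box_cart) (use l1 l2 in auto)
    moreover have "emeasure lborel (box l1 u1) = (\<Prod>j\<in>UNIV. u1 $ j - l1 $ j)"
      by (rule emeasure_box_cart) (use l1 in auto)
    ultimately show ?thesis
      using l1 l2 by (simp add: prod_nonneg mult_ac flip: ennreal_mult)
  qed
  also have "\<dots> = emeasure lborel (box l1 u1 \<times> box l2 u2)"
    unfolding lborel_prod[symmetric] by (subst lborel.emeasure_pair_measure_Times) auto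
  also have "\<dots> = emeasure lborel (box l u)" by (simp add: lu box_Pair_eq)
  also have "\<dots> = (\<Prod>b\<in>Basis. (u - l) \<bullet> b)" by (rule emeasure_lborel_box[OF le])
  finally show "emeasure (distr lborel borel ?T) (box l u) = (\<Prod>b\<in>Basis. (u - l) \<bullet> b)" .
qed simp

lemma nn_integral_slice:
  fixes h :: "real^'n::finite \<Rightarrow> ennreal"
  assumes [measurable]: "h \<in> borel_measurable borel"
  shows "(\<integral>\<^sup>+x. h x \<partial>lborel) = (\<integral>\<^sup>+x. (\<integral>\<^sup>+s. h (upd i s x) \<partial>lborel) * indicator {0..1} (x $ i) \<partial>lborel)"
proof -
  let ?T = "\<lambda>p::(real^'n)\<times>real. (upd i (snd p) (fst p), fst p $ i)"
  have [measurable]: "?T \<in> borel \<rightarrow>\<^sub>M borel"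
    by (rule borel_measurable_continuous_onI[OF continuous_swap])
  have [measurable]: "(\<lambda>p::(real^'n)\<times>real. upd i (snd p) (fst p)) \<in> borel \<rightarrow>\<^sub>M borel"
    by (rule borel_measurable_continuous_onI) (intro continuous_intros)
  have [measurable]: "(\<lambda>x::real^'n. x $ i) \<in> borel \<rightarrow>\<^sub>M borel" 
    by (rule borel_measurable_continuous_onI) (intro continuous_intros)
  let ?H = "\<lambda>p::(real^'n)\<times>real. h (fst p) * indicator {0..1} (snd p)"
  have mH: "?H \<in> borel_measurable borel" unfolding borel_prod[symmetric] by measurable
  have mHT: "(\<lambda>p. ?H (?T p)) \<in> borel_measurable borel" by (rule measurable_compose[OF _ mH]) measurable
  have "(\<integral>\<^sup>+x. h x \<partial>lborel) = (\<integral>\<^sup>+x. \<integral>\<^sup>+s. h x * indicator {0..1::real} s \<partial>lborel \<partial>lborel)"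
    by (subst nn_integral_cmult) auto
  also have "\<dots> = (\<integral>\<^sup>+p. ?H p \<partial>lborel)"
    unfolding lborel_prod[symmetric]
    by (subst lborel.nn_integral_fst[symmetric]) (auto simp: mH lborel_prod)
  also have "\<dots> = (\<integral>\<^sup>+p. ?H p \<partial>distr lborel borel ?T)" by (simp only: distr_swap_coordinate)
  also have "\<dots> = (\<integral>\<^sup>+p. ?H (?T p) \<partial>lborel)" 
    by (rule nn_integral_distr) (use mH in auto)
  also have "\<dots> = (\<integral>\<^sup>+x. \<integral>\<^sup>+s. ?H (?T (x,s)) \<partial>lborel \<partial>lborel)"
    unfolding lborel_prod[symmetric]
    by (subst lborel.nn_integral_fst[symmetric]) (use mHT in \<open>auto simp: lborel_prod\<close>)
  also have "\<dots> = (\<integral>\<^sup>+x. (\<integral>\<^sup>+s. h (upd i s x) \<partial>lborel) * indicator {0..1} (x $ i) \<partial>lborel)"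
  proof (rule nn_integral_cong)
    fix x :: "real^'n"
    have [measurable]: "(\<lambda>s. upd i s x) \<in> borel \<rightarrow>\<^sub>M borel"
      by (rule borel_measurable_continuous_onI) (intro continuous_intros)
    show "(\<integral>\<^sup>+s. ?H (?T (x,s)) \<partial>lborel) = (\<integral>\<^sup>+s. h (upd i s x) \<partial>lborel) * indicator {0..1} (x $ i)"
      by (simp add: nn_integral_multc)
  qed
  finally show ?thesis .
qed

subsection \<open>Linear change of variables\<close>

lemma measurable_matvec [measurable]: "(\<lambda>x. A *v x + b) \<in> borel \<rightarrow>\<^sub>M borel" for A :: "real^'n::finite^'m::finite"
  by (rule borel_measurable_continuous_onI, rule continuous_on_add, rule linear_continuous_on,
      rule matrix_vector_mul_bounded_linear, rule continuous_on_const)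

lemma measurable_matvec' [measurable]: "(\<lambda>x. A *v x) \<in> borel \<rightarrow>\<^sub>M borel" for A :: "real^'n::finite^'m::finite"
  using measurable_matvec[of A 0] by simp

text \<open>
  Stated for extended nonnegative functions, so that no integrability is needed in the elimination steps.
\<close>

definition lborel_scales :: "real^'n::finite^'n \<Rightarrow> bool" where
  "lborel_scales A \<longleftrightarrow> (det A \<noteq> 0 \<longrightarrow>
     (\<forall>h\<in>borel_measurable borel. (\<integral>\<^sup>+x. h x \<partial>lborel) = ennreal \<bar>det A\<bar> * (\<integral>\<^sup>+x. h (A *v x) \<partial>lborel)))"

lemma lborel_scalesD:
  "lborel_scales A \<Longrightarrow> det A \<noteq> 0 \<Longrightarrow> h \<in> borel_measurable borel \<Longrightarrow>
    (\<integral>\<^sup>+x. h x \<partial>lborel) = ennreal \<bar>det A\<bar> * (\<integral>\<^sup>+x. h (A *v x) \<partial>lborel)"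
  unfolding lborel_scales_def by blast

lemma lborel_scales_mult:
  assumes "lborel_scales A" "lborel_scales B" shows "lborel_scales (A ** B)"
  unfolding lborel_scales_def
proof safe
  fix h :: "real^'a \<Rightarrow> ennreal" assume [measurable]: "h \<in> borel_measurable borel" and d: "det (A ** B) \<noteq> 0"
  then have dA: "det A \<noteq> 0" and dB: "det B \<noteq> 0" by (auto simp: det_mul)
  have "(\<integral>\<^sup>+x. h x \<partial>lborel) = ennreal \<bar>det A\<bar> * (\<integral>\<^sup>+x. h (A *v x) \<partial>lborel)"
    by (rule lborel_scalesD[OF assms(1) dA]) measurable
  also have "(\<integral>\<^sup>+x. h (A *v x) \<partial>lborel) = ennreal \<bar>det B\<bar> * (\<integral>\<^sup>+x. h (A *v (B *v x)) \<partial>lborel)"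
  proof -
    have "(\<lambda>x. h (A *v x)) \<in> borel_measurable borel" by measurable
    from lborel_scalesD[OF assms(2) dB this] show ?thesis .
  qed
  finally show "(\<integral>\<^sup>+x. h x \<partial>lborel) = ennreal \<bar>det (A ** B)\<bar> * (\<integral>\<^sup>+x. h (A ** B *v x) \<partial>lborel)"
    by (simp add: det_mul abs_mult ennreal_mult mult.assoc matrix_vector_mul_assoc)
qed

lemma lborel_scales_diagonal:
  fixes A :: "real^'n::finite^'n"
  assumes "\<And>i j. i \<noteq> j \<Longrightarrow> A $ i $ j = 0" shows "lborel_scales A"
  unfolding lborel_scales_def
proof safe
  fix h :: "real^'n \<Rightarrow> ennreal" assume [measurable]: "h \<in> borel_measurable borel" and d: "det A \<noteq> 0"
  have detA: "det A = (\<Prod>i\<in>UNIV. A $ i $ i)" by (rule det_diagonal[OF assms])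
  have B: "(Basis :: (real^'n) set) = (\<lambda>i. axis i 1) ` UNIV" by (auto simp: Basis_vec_def)
  have inj: "inj (\<lambda>i::'n. axis i (1::real))" by (auto simp: inj_on_def axis_eq_axis)
  define c where "c b = (\<Sum>i\<in>UNIV. A $ i $ i * b $ i)" for b :: "real^'n"
  have c: "c (axis i 1) = A $ i $ i" for i
    by (simp add: c_def axis_def if_distrib[of "\<lambda>y. _ * y"] cong: if_cong)
  have nz: "c j \<noteq> 0" if "j \<in> Basis" for j using that d by (auto simp: B c detA)
  have T: "A *v x = 0 + (\<Sum>j\<in>Basis. (c j * (x \<bullet> j)) *\<^sub>R j)" for x
  proof -
    have "(\<Sum>j\<in>Basis. (c j * (x \<bullet> j)) *\<^sub>R j) = (\<Sum>i\<in>UNIV. (A $ i $ i * x $ i) *\<^sub>R axis i 1)"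
      unfolding B by (subst sum.reindex[OF inj]) (simp add: c inner_axis)
    moreover have "(A *v x) $ k = (\<Sum>i\<in>UNIV. (A $ i $ i * x $ i) *\<^sub>R axis i 1) $ k" for k
    proof -
      have "(A *v x) $ k = A $ k $ k * x $ k"
        unfolding matrix_vector_mult_def vec_lambda_beta
        by (subst sum.remove[of _ k]) (auto simp: assms intro!: sum.neutral)
      then show ?thesis by (simp add: axis_def if_distrib[of "\<lambda>y. _ * y"] cong: if_cong)
    qed
    ultimately show ?thesis by (simp add: vec_eq_iff)
  qed
  have p: "(\<Prod>j\<in>Basis. \<bar>c j\<bar>) = \<bar>det A\<bar>"
    unfolding B by (subst prod.reindex[OF inj]) (simp add: c detA abs_prod)
  have "lborel = density (distr lborel borel (\<lambda>x. A *v x)) (\<lambda>_. \<bar>det A\<bar>)"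
    using lborel_affine_euclidean[of c 0] nz p T by simp
  then have "(\<integral>\<^sup>+x. h x \<partial>lborel) = (\<integral>\<^sup>+x. h x \<partial>density (distr lborel borel (\<lambda>x. A *v x)) (\<lambda>_. \<bar>det A\<bar>))"
    by simp
  also have "\<dots> = ennreal \<bar>det A\<bar> * (\<integral>\<^sup>+x. h (A *v x) \<partial>lborel)"
    by (subst nn_integral_density) (auto simp: nn_integral_distr nn_integral_cmult)
  finally show "(\<integral>\<^sup>+x. h x \<partial>lborel) = ennreal \<bar>det A\<bar> * (\<integral>\<^sup>+x. h (A *v x) \<partial>lborel)" .
qed

lemma lborel_scales_swap:
  fixes m n :: "'n::finite"
  assumes "m \<noteq> n"
  shows "lborel_scales ((\<chi> i j. mat 1 $ i $ Transposition.transpose m n j) :: real^'n^'n)"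
  unfolding lborel_scales_def
proof safe
  let ?A = "(\<chi> i j. mat 1 $ i $ Transposition.transpose m n j) :: real^'n^'n"
  let ?p = "Transposition.transpose m n"
  fix h :: "real^'n \<Rightarrow> ennreal" assume [measurable]: "h \<in> borel_measurable borel"
  have p: "?p permutes UNIV" by (simp add: permutes_swap_id)
  have d: "\<bar>det ?A\<bar> = 1"
    using det_permute_columns[OF p, of "mat 1 :: real^'n^'n"] by (simp add: abs_mult sign_def)
  have A: "(?A *v x) $ k = x $ ?p k" for x k
  proof -
    have "(?A *v x) $ k = (\<Sum>j\<in>UNIV. (if k = ?p j then 1 else 0) * x $ j)"
      by (simp add: matrix_vector_mult_def mat_def)
    also have "\<dots> = (\<Sum>j\<in>UNIV. (if j = ?p k then x $ j else 0))"
      by (rule sum.cong) auto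
    finally show ?thesis by simp
  qed
  have "lborel = distr lborel borel (\<lambda>x. ?A *v x)"
  proof (rule lborel_eqI)
    fix l u :: "real^'n" assume le: "\<And>b. b \<in> Basis \<Longrightarrow> l \<bullet> b \<le> u \<bullet> b"
    have le': "l $ j \<le> u $ j" for j using le[of "axis j 1"] by (auto simp: inner_axis)
    have inv: "?p (?p k) = k" for k by simp
    have "(\<lambda>x. ?A *v x) -` box l u = box (\<chi> k. l $ ?p k) (\<chi> k. u $ ?p k)"
    proof (rule set_eqI)
      fix x
      have "(\<forall>k. l $ k < x $ ?p k \<and> x $ ?p k < u $ k) \<longleftrightarrow> (\<forall>k. l $ ?p k < x $ k \<and> x $ k < u $ ?p k)"
        using inv by metis
      then show "x \<in> (\<lambda>x. ?A *v x) -` box l u \<longleftrightarrow> x \<in> box (\<chi> k. l $ ?p k) (\<chi> k. u $ ?p k)"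
        unfolding vimage_eq box_nth A by simp
    qed
    then have "emeasure (distr lborel borel (\<lambda>x. ?A *v x)) (box l u) = emeasure lborel (box (\<chi> k. l $ ?p k) (\<chi> k. u $ ?p k))"
      by (subst emeasure_distr) auto
    also have "\<dots> = (\<Prod>k\<in>UNIV. u $ ?p k - l $ ?p k)"
      by (subst emeasure_box_cart) (auto simp: le')
    also have "(\<Prod>k\<in>UNIV. u $ ?p k - l $ ?p k) = (\<Prod>k\<in>UNIV. u $ k - l $ k)"
      using prod.permute[OF p, of "\<lambda>k. u $ k - l $ k"] by (simp add: o_def)
    also have "ennreal \<dots> = emeasure lborel (box l u)" by (subst emeasure_box_cart) (auto simp: le')
    also have "\<dots> = (\<Prod>b\<in>Basis. (u - l) \<bullet> b)" by (rule emeasure_lborel_box[OF le])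
    finally show "emeasure (distr lborel borel (\<lambda>x. ?A *v x)) (box l u) = (\<Prod>b\<in>Basis. (u - l) \<bullet> b)" .
  qed simp
  then have "(\<integral>\<^sup>+x. h x \<partial>lborel) = (\<integral>\<^sup>+x. h x \<partial>distr lborel borel (\<lambda>x. ?A *v x))" by simp
  also have "\<dots> = (\<integral>\<^sup>+x. h (?A *v x) \<partial>lborel)" by (rule nn_integral_distr) auto
  finally show "(\<integral>\<^sup>+x. h x \<partial>lborel) = ennreal \<bar>det ?A\<bar> * (\<integral>\<^sup>+x. h (?A *v x) \<partial>lborel)" by (simp add: d)
qed

text \<open>
  A shear translates one coordinate by an amount that depends only on the others, and integrals over
  that coordinate are invariant under translation.
\<close>

lemma lborel_scales_shear:
  fixes m n :: "'n::finite"
  assumes "m \<noteq> n"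
  shows "lborel_scales ((\<chi> i j. if i = m \<and> j = n then c else of_bool (i = j)) :: real^'n^'n)"
  unfolding lborel_scales_def
proof safe
  let ?A = "(\<chi> i j. if i = m \<and> j = n then c else of_bool (i = j)) :: real^'n^'n"
  fix h :: "real^'n \<Rightarrow> ennreal" assume [measurable]: "h \<in> borel_measurable borel"
  have A: "?A *v x = upd m (x $ m + c * x $ n) x" for x
  proof -
    have "(?A *v x) $ k = upd m (x $ m + c * x $ n) x $ k" for k
    proof (cases "k = m")
      case True
      have "(?A *v x) $ k = (\<Sum>j\<in>UNIV. (if j = n then c * x $ j else 0) + (if j = m then x $ j else 0))"
        unfolding matrix_vector_mult_def using True assms by (auto intro!: sum.cong)
      then show ?thesis using True by (simp add: sum.distrib)
    next
      case False
      have "(?A *v x) $ k = (\<Sum>j\<in>UNIV. (if j = k then x $ j else 0))"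
        unfolding matrix_vector_mult_def using False by (auto intro!: sum.cong)
      then show ?thesis using False by simp
    qed
    then show ?thesis by (simp add: vec_eq_iff)
  qed
  have "?A = (\<chi> i j. if j = n then ((mat 1 :: real^'n^'n) *v (axis n 1 + c *\<^sub>R axis m 1)) $ i else mat 1 $ i $ j)"
    using assms unfolding matrix_vector_mul_lid by (auto simp: vec_eq_iff mat_def axis_def)
  then have d: "det ?A = 1"
    using cramer_lemma[of n "mat 1 :: real^'n^'n" "axis n 1 + c *\<^sub>R axis m 1"] assms by (simp add: axis_def)
  have "(\<integral>\<^sup>+x. h (?A *v x) \<partial>lborel) = (\<integral>\<^sup>+x. (\<integral>\<^sup>+s. h (?A *v upd m s x) \<partial>lborel) * indicator {0..1} (x $ m) \<partial>lborel)"
    by (rule nn_integral_slice) measurable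
  also have "\<dots> = (\<integral>\<^sup>+x. (\<integral>\<^sup>+s. h (upd m s x) \<partial>lborel) * indicator {0..1} (x $ m) \<partial>lborel)"
  proof (rule nn_integral_cong)
    fix x :: "real^'n"
    have [measurable]: "(\<lambda>s. upd m s x) \<in> borel \<rightarrow>\<^sub>M borel"
      by (rule borel_measurable_continuous_onI) (intro continuous_intros)
    have "(\<integral>\<^sup>+s. h (upd m s x) \<partial>lborel) = (\<integral>\<^sup>+s. h (upd m s x) \<partial>distr lborel borel ((+) (c * x $ n)))"
      by (simp add: lborel_distr_plus)
    also have "\<dots> = (\<integral>\<^sup>+s. h (upd m (c * x $ n + s) x) \<partial>lborel)" by (rule nn_integral_distr) auto
    finally show "(\<integral>\<^sup>+s. h (?A *v upd m s x) \<partial>lborel) * indicator {0..1} (x $ m) = 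
        (\<integral>\<^sup>+s. h (upd m s x) \<partial>lborel) * indicator {0..1} (x $ m)"
      using assms by (auto simp: A add.commute)
  qed
  also have "\<dots> = (\<integral>\<^sup>+x. h x \<partial>lborel)" by (rule nn_integral_slice[symmetric]) measurable
  finally show "(\<integral>\<^sup>+x. h x \<partial>lborel) = ennreal \<bar>det ?A\<bar> * (\<integral>\<^sup>+x. h (?A *v x) \<partial>lborel)"
    by (simp only: d) simp
qed

lemma lborel_scales_all: "lborel_scales A"
proof (rule induct_matrix_elementary)
  fix A :: "real^'a^'a" and i assume "row i A = 0"
  then have "det A = 0" by (rule det_zero_row)
  then show "lborel_scales A" by (simp add: lborel_scales_def)
qed (auto intro: lborel_scales_mult lborel_scales_diagonal lborel_scales_swap lborel_scales_shear)

text \<open>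
  The change of variables formula for affine maps, over an index type that is merely finite; obtained
  from the factorisation of a matrix into elementary ones.
\<close>

lemma lborel_affine_density:
  fixes A :: "real^'n::finite^'n"
  assumes "det A \<noteq> 0"
  shows "lborel = density (distr lborel borel (\<lambda>x. A *v x + b)) (\<lambda>_. ennreal \<bar>det A\<bar>)"
proof (rule measure_eqI)
  fix S :: "(real^'n) set" assume "S \<in> sets lborel"
  then have S [measurable]: "S \<in> sets borel" by simp
  have "emeasure (density (distr lborel borel (\<lambda>x. A *v x + b)) (\<lambda>_. ennreal \<bar>det A\<bar>)) S = 
     ennreal \<bar>det A\<bar> * emeasure (distr lborel borel (\<lambda>x. A *v x + b)) S"
    using S by (subst emeasure_density) (auto simp: nn_integral_cmult)
  also have "emeasure (distr lborel borel (\<lambda>x. A *v x + b)) S = (\<integral>\<^sup>+x. indicator S x \<partial>distr lborel borel (\<lambda>x. A *v x + b))"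
    by simp
  also have "\<dots> = (\<integral>\<^sup>+x. indicator S (A *v x + b) \<partial>lborel)"
    by (rule nn_integral_distr) auto
  also have "ennreal \<bar>det A\<bar> * \<dots> = (\<integral>\<^sup>+x. indicator S (x + b) \<partial>lborel)"
  proof -
    have "(\<lambda>x. indicator S (x + b) :: ennreal) \<in> borel_measurable borel" by measurable
    from lborel_scalesD[OF lborel_scales_all assms this] show ?thesis by simp
  qed
  also have "\<dots> = (\<integral>\<^sup>+x. indicator S x \<partial>distr lborel borel ((+) b))"
    by (subst nn_integral_distr) (auto simp: add.commute)
  finally show "emeasure lborel S = emeasure (density (distr lborel borel (\<lambda>x. A *v x + b)) (\<lambda>_. ennreal \<bar>det A\<bar>)) S"
    by (simp add: lborel_distr_plus)
qed simp

lemma integral_affine: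
  fixes A :: "real^'n::finite^'n" and h :: "real^'n \<Rightarrow> real"
  assumes "det A \<noteq> 0" and [measurable]: "h \<in> borel_measurable borel"
  shows "(LINT x|lborel. h x) = \<bar>det A\<bar> * (LINT x|lborel. h (A *v x + b))"
proof -
  have "(LINT x|lborel. h x) = (LINT x|density (distr lborel borel (\<lambda>x. A *v x + b)) (\<lambda>_. ennreal \<bar>det A\<bar>). h x)"
    using lborel_affine_density[OF assms(1)] by simp
  also have "\<dots> = \<bar>det A\<bar> * (LINT x|lborel. h (A *v x + b))"
    by (subst integral_density) (auto simp: integral_distr)
  finally show ?thesis .
qed


subsection \<open>Integrals over the reference cube\<close>

lemma ref_cube_eq: "ref_cube = cbox 0 (1 :: real^'n::finite)"
  by (auto simp: ref_cube_def mem_box_cart)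

lemma compact_ref_cube [simp]: "compact (ref_cube :: (real^'n::finite) set)"
  by (simp add: ref_cube_eq)

lemma measurable_ref_cube [measurable]: "ref_cube \<in> sets borel"
  by (simp add: ref_cube_eq)

lemma upd_in_cube: "upd i s x \<in> ref_cube \<longleftrightarrow> s \<in> {0..1} \<and> (\<forall>j. j \<noteq> i \<longrightarrow> x $ j \<in> {0..1})"
  by (auto simp: ref_cube_def)

text \<open>
  Face integrals are also expressed as integrals over the full cube, of functions that are constant in
  one coordinate.
\<close>

definition cube_int :: "(real^'n::finite \<Rightarrow> real) \<Rightarrow> real" where
  "cube_int f = (LINT x:ref_cube|lborel. f x)"

lemma set_integrable_continuous:
  fixes f :: "'a::euclidean_space \<Rightarrow> 'b::{banach, second_countable_topology}"
  assumes "compact S" "continuous_on UNIV f"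
  shows "set_integrable lborel S f"
  unfolding set_integrable_def using borel_integrable_compact[of S f] assms continuous_on_subset by blast

lemma cube_int_add: "continuous_on UNIV f \<Longrightarrow> continuous_on UNIV g \<Longrightarrow> cube_int (\<lambda>x. f x + g x) = cube_int f + cube_int g"
  unfolding cube_int_def by (intro set_integral_add set_integrable_continuous compact_ref_cube)

lemma cube_int_cmult [simp]: "cube_int (\<lambda>x. c * f x) = c * cube_int f"
  unfolding cube_int_def by simp

lemma cube_int_diff: "continuous_on UNIV f \<Longrightarrow> continuous_on UNIV g \<Longrightarrow> cube_int (\<lambda>x. f x - g x) = cube_int f - cube_int g"
  unfolding cube_int_def by (intro set_integral_diff set_integrable_continuous compact_ref_cube)

lemma cube_int_zero [simp]: "cube_int (\<lambda>x. 0) = 0"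
  by (simp add: cube_int_def)

lemma cube_int_sum:
  assumes "finite J" "\<And>j. j \<in> J \<Longrightarrow> continuous_on UNIV (f j)"
  shows "cube_int (\<lambda>x. \<Sum>j\<in>J. f j x) = (\<Sum>j\<in>J. cube_int (f j))"
  using assms
proof (induction J rule: finite_induct)
  case (insert j J)
  then have "cube_int (\<lambda>x. f j x + (\<Sum>j\<in>J. f j x)) = cube_int (f j) + cube_int (\<lambda>x. \<Sum>j\<in>J. f j x)"
    by (intro cube_int_add continuous_on_sum) auto
  with insert show ?case by simp
qed simp

text \<open>
  Fubini in one coordinate: integrating over the coordinate \<open>i\<close> first and then over the whole cube
  counts that coordinate with total mass one.
\<close>

lemma cube_int_slice:
  fixes h :: "real^'n::finite \<Rightarrow> real"
  assumes h: "continuous_on UNIV h"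
  shows "cube_int h = cube_int (\<lambda>x. LINT s:{0..1}|lborel. h (upd i s x))"
proof -
  let ?T = "\<lambda>p::(real^'n)\<times>real. (upd i (snd p) (fst p), fst p $ i)"
  have T [measurable]: "?T \<in> borel \<rightarrow>\<^sub>M borel"
    by (rule borel_measurable_continuous_onI[OF continuous_swap])
  let ?H = "\<lambda>p::(real^'n)\<times>real. indicator (ref_cube \<times> {0..1}) p *\<^sub>R h (fst p)"
  have comp: "compact (ref_cube \<times> {0..1::real} :: ((real^'n)\<times>real) set)" by (intro compact_Times) auto
  have I: "integrable lborel ?H"
    by (rule borel_integrable_compact[OF comp]) (intro continuous_on_compose2[OF h] continuous_intros, auto)
  have mH: "?H \<in> borel_measurable borel" using borel_measurable_integrable[OF I] by simp
  have IT: "integrable lborel (\<lambda>p. ?H (?T p))"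
    by (rule integrable_distr[of ?T lborel lborel ?H]) (use I distr_swap_coordinate[of i] in \<open>auto simp: measurable_lborel1 cong: distr_cong\<close>)
  have "cube_int h = (LINT x|lborel. LINT s|lborel. ?H (x, s))"
    unfolding cube_int_def set_lebesgue_integral_def
    by (intro Bochner_Integration.integral_cong refl) (auto simp: indicator_times)
  also have "\<dots> = (LINT p|lborel. ?H p)"
    unfolding lborel_prod[symmetric] using I by (subst lborel_pair.integral_fst) (auto simp: lborel_prod case_prod_unfold)
  also have "\<dots> = (LINT p|distr lborel borel ?T. ?H p)" by (simp only: distr_swap_coordinate)
  also have "\<dots> = (LINT p|lborel. ?H (?T p))" 
    by (rule integral_distr) (use mH in auto)
  also have "\<dots> = (LINT x|lborel. LINT s|lborel. ?H (?T (x, s)))"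
    unfolding lborel_prod[symmetric] using IT by (subst lborel_pair.integral_fst) (auto simp: lborel_prod case_prod_unfold)
  also have "\<dots> = cube_int (\<lambda>x. LINT s:{0..1}|lborel. h (upd i s x))"
    unfolding cube_int_def set_lebesgue_integral_def
  proof (intro Bochner_Integration.integral_cong refl)
    fix x :: "real^'n"
    have "x \<in> ref_cube \<longleftrightarrow> x $ i \<in> {0..1} \<and> (\<forall>j. j \<noteq> i \<longrightarrow> x $ j \<in> {0..1})"
      using upd_in_cube[of i "x $ i" x] by simp
    then have "?H (?T (x, s)) = indicator ref_cube x *\<^sub>R (indicator {0..1} s *\<^sub>R h (upd i s x))" for s
      by (auto simp: indicator_def upd_in_cube)
    then show "(LINT s|lborel. ?H (?T (x, s))) = indicator ref_cube x *\<^sub>R (LINT s|lborel. indicator {0..1} s *\<^sub>R h (upd i s x))"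
      by (simp only: integral_scaleR_right)
  qed
  finally show ?thesis .
qed

text \<open>
  The divergence theorem on the cube for one component, as the fundamental theorem of calculus on each
  segment. The boundary terms are written as integrals over the whole cube of functions that do not
  depend on the coordinate \<open>i\<close>; face integrals take the same form in the sequel.
\<close>

lemma cube_int_partial:
  fixes f :: "real^'n::finite \<Rightarrow> real"
  assumes d: "\<And>x. f differentiable (at x)" and c: "continuous_on UNIV (partial i f)"
  shows "cube_int (partial i f) = cube_int (\<lambda>x. f (upd i 1 x)) - cube_int (\<lambda>x. f (upd i 0 x))"
proof -
  have cf: "continuous_on UNIV f"
    using d differentiable_imp_continuous_within by (auto simp: continuous_on_eq_continuous_within)
  have "cube_int (partial i f) = cube_int (\<lambda>x. LINT s:{0..1}|lborel. partial i f (upd i s x))"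
    by (rule cube_int_slice[OF c])
  also have "\<dots> = cube_int (\<lambda>x. f (upd i 1 x) - f (upd i 0 x))"
  proof (rule arg_cong[where f=cube_int], rule ext)
    fix x
    have "(LINT s:{0..1}|lborel. partial i f (upd i s x)) = (\<integral>s. partial i f (upd i s x) * indicator {0..1} s \<partial>lborel)"
      by (simp add: set_lebesgue_integral_def mult.commute)
    also have "\<dots> = f (upd i 1 x) - f (upd i 0 x)"
    proof (rule integral_FTC_Icc_real)
      fix s :: real
      show "((\<lambda>t. f (upd i t x)) has_real_derivative partial i f (upd i s x)) (at s)"
        by (rule partial_line[OF d])
      have "continuous_on UNIV (\<lambda>s. partial i f (upd i s x))"
        by (rule continuous_on_compose2[OF c]) (auto intro!: continuous_intros)
      then show "isCont (\<lambda>s. partial i f (upd i s x)) s" by (simp add: continuous_on_eq_continuous_at)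
    qed simp
    finally show "(LINT s:{0..1}|lborel. partial i f (upd i s x)) = f (upd i 1 x) - f (upd i 0 x)" .
  qed
  also have "\<dots> = cube_int (\<lambda>x. f (upd i 1 x)) - cube_int (\<lambda>x. f (upd i 0 x))"
    by (intro cube_int_diff continuous_on_compose2[OF cf] continuous_intros) auto
  finally show ?thesis .
qed

lemma cube_int_prod_1d:
  fixes G :: "real^'n::finite \<Rightarrow> real" and \<phi> :: "real \<Rightarrow> real"
  assumes "continuous_on UNIV \<phi>" "continuous_on UNIV G" and ind: "\<And>x t. G (upd i t x) = G x"
  shows "cube_int (\<lambda>x. \<phi> (x $ i) * G x) = (LINT s:{0..1}|lborel. \<phi> s) * cube_int G"
proof -
  have "cube_int (\<lambda>x. \<phi> (x $ i) * G x) = cube_int (\<lambda>x. LINT s:{0..1}|lborel. \<phi> (upd i s x $ i) * G (upd i s x))"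
    by (rule cube_int_slice) (intro continuous_intros assms continuous_on_compose2[OF assms(1)], auto)
  then show ?thesis by (simp add: ind)
qed

text \<open>
  A nonnegative continuous function is detected by its integral at interior points.
\<close>

lemma set_integral_eq_0_imp:
  fixes f :: "'a::euclidean_space \<Rightarrow> real"
  assumes "compact K" and c: "continuous_on UNIV f" and nn: "\<And>x. x \<in> K \<Longrightarrow> f x \<ge> 0"
    and z: "(LINT x:K|lborel. f x) = 0" and x: "x \<in> interior K"
  shows "f x = 0"
proof (rule ccontr)
  assume "f x \<noteq> 0"
  let ?g = "\<lambda>x. indicator K x *\<^sub>R f x"
  have "integrable lborel ?g" using set_integrable_continuous[OF assms(1) c] by (simp add: set_integrable_def)
  moreover have "AE x in lborel. 0 \<le> ?g x" using nn by (intro AE_I2) (auto simp: indicator_def)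
  ultimately have "AE x in lborel. ?g x = 0"
    using z integral_nonneg_eq_0_iff_AE[of lborel ?g] by (simp add: set_lebesgue_integral_def)
  then have ae: "AE x in lborel. x \<in> interior K \<longrightarrow> f x = 0"
    by eventually_elim (use interior_subset in \<open>auto simp: indicator_def split: if_splits\<close>)
  define S where "S = interior K \<inter> f -` (-{0})"
  have "open S" unfolding S_def by (rule continuous_open_preimage[OF continuous_on_subset[OF c]]) auto
  moreover have "x \<in> S" using \<open>f x \<noteq> 0\<close> x by (auto simp: S_def)
  moreover have "AE x in lborel. x \<notin> S" using ae by eventually_elim (auto simp: S_def)
  then have "emeasure lborel S = 0"
    using \<open>open S\<close> by (subst (asm) AE_iff_measurable[of S]) auto
  then have "S \<in> null_sets lborel" using \<open>open S\<close> by (auto simp: null_sets_def)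
  then have "negligible S" unfolding negligible_iff_null_sets by (rule null_sets_completionI)
  ultimately show False using open_not_negligible[of S] by auto
qed

lemma interior_ref_cube: "interior ref_cube = box 0 (1::real^'n::finite)"
  by (simp add: ref_cube_eq)

lemma center_in_interior: "(\<chi> i. 1/2) \<in> interior (ref_cube :: (real^'n::finite) set)"
  by (simp add: interior_ref_cube box_nth)

lemma cube_int_eq_0_imp:
  fixes f :: "real^'n::finite \<Rightarrow> real"
  assumes "continuous_on UNIV f" "\<And>x. x \<in> ref_cube \<Longrightarrow> f x \<ge> 0" "cube_int f = 0" "x \<in> interior ref_cube"
  shows "f x = 0"
  using set_integral_eq_0_imp[OF compact_ref_cube assms(1,2) assms(3)[unfolded cube_int_def] assms(4)] .

lemma rpf_zero_on_cube:
  fixes f :: "real^'n::finite \<Rightarrow> real"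
  assumes "real_polynomial_function f" "\<And>x. x \<in> interior ref_cube \<Longrightarrow> f x = 0"
  shows "f x = 0"
  using rpf_eq_zero[OF assms(1) open_interior center_in_interior assms(2)] .

lemma rpf_square_cint_0:
  fixes f :: "real^'n::finite \<Rightarrow> real"
  assumes "real_polynomial_function f" "cube_int (\<lambda>x. f x * f x) = 0"
  shows "f x = 0"
proof (rule rpf_zero_on_cube[OF assms(1)])
  fix x :: "real^'n" assume "x \<in> interior ref_cube"
  then have "f x * f x = 0"
    by (intro cube_int_eq_0_imp[OF _ _ assms(2)] continuous_intros rpf_continuous assms(1)) auto
  then show "f x = 0" by simp
qed

section \<open>The Raviart--Thomas element on the reference cube\<close>

lemmas polys_continuous = rpf_continuous[OF polys_real_polynomial_function]

definition bubble :: "'n \<Rightarrow> real^'n::finite \<Rightarrow> real" where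
  "bubble i x = x $ i * (1 - x $ i)"

lemma continuous_bub [continuous_intros]: "continuous_on S (bubble i)"
  unfolding bubble_def by (intro continuous_intros)

text \<open>
  The weight acts in one variable only. Integrating the other variables against the test function
  leaves a polynomial \<open>U\<close> in one variable of degree at most \<open>D i\<close> which is orthogonal to all powers up
  to that degree for the weight \<open>s (1 - s)\<close>. Testing with \<open>U\<close> itself gives \<open>U = 0\<close>, so orthogonality
  holds against every power of \<open>x $ i\<close>.
\<close>

lemma bubble_orthogonal_lift:
  fixes u :: "real^'n::finite \<Rightarrow> real"
  assumes u: "u \<in> polys D'" "D' i \<le> D i"
    and orth: "\<And>q. q \<in> polys D \<Longrightarrow> cube_int (\<lambda>x. bubble i x * u x * q x) = 0"
    and q: "q \<in> polys (D(i := N))"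
  shows "cube_int (\<lambda>x. bubble i x * u x * q x) = 0"
proof -
  obtain uc where uc: "\<And>c. uc c \<in> polys (D'(i := 0))" "\<And>x. u x = (\<Sum>c\<le>D' i. x $ i ^ c * uc c x)"
    using polys_expand[OF u(1)] by metis
  obtain qb where qb: "\<And>b. qb b \<in> polys (D(i := 0))" "\<And>x. q x = (\<Sum>b\<le>N. x $ i ^ b * qb b x)"
    using polys_expand[OF q, of i] by auto
  have zero: "cube_int (\<lambda>x. bubble i x * u x * (x $ i ^ a * q' x)) = 0" if q': "q' \<in> polys (D(i := 0))" for a q'
  proof -
    define C where "C c = cube_int (\<lambda>x. uc c x * q' x)" for c
    define U where "U s = (\<Sum>c\<le>D' i. C c * s ^ c)" for s :: real
    let ?J = "\<lambda>\<phi>. LINT s:{0..1::real}|lborel. \<phi> s :: real"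
    have Jsum: "?J (\<lambda>s. \<Sum>c\<le>D' i. f c s) = (\<Sum>c\<le>D' i. ?J (f c))"
      if "\<And>c. continuous_on UNIV (f c)" for f
    proof -
      have "integrable lborel (\<lambda>s. indicator {0..1} s *\<^sub>R f c s)" for c
        using set_integrable_continuous[of "{0..1::real}" "f c"] that by (simp add: set_integrable_def)
      then show ?thesis
        unfolding set_lebesgue_integral_def scaleR_sum_right by (rule Bochner_Integration.integral_sum)
    qed
    have mom: "cube_int (\<lambda>x. bubble i x * u x * (x $ i ^ a * q' x)) = ?J (\<lambda>s. s * (1 - s) * s ^ a * U s)" for a
    proof -
      have "cube_int (\<lambda>x. bubble i x * u x * (x $ i ^ a * q' x)) =
        cube_int (\<lambda>x. \<Sum>c\<le>D' i. (x $ i * (1 - x $ i) * x $ i ^ (a + c)) * (uc c x * q' x))"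
        by (simp add: uc(2) bubble_def sum_distrib_left sum_distrib_right power_add mult_ac)
      also have "\<dots> = (\<Sum>c\<le>D' i. cube_int (\<lambda>x. (x $ i * (1 - x $ i) * x $ i ^ (a + c)) * (uc c x * q' x)))"
        by (intro cube_int_sum continuous_intros polys_continuous[OF uc(1)] polys_continuous[OF q']) auto
      also have "\<dots> = (\<Sum>c\<le>D' i. ?J (\<lambda>s. s * (1 - s) * s ^ (a + c)) * C c)"
        unfolding C_def
        by (intro sum.cong refl cube_int_prod_1d continuous_intros polys_continuous[OF uc(1)] polys_continuous[OF q'])
          (simp add: polys_indep[OF uc(1)] polys_indep[OF q'])
      also have "\<dots> = (\<Sum>c\<le>D' i. ?J (\<lambda>s. C c * (s * (1 - s) * s ^ (a + c))))"
        by (simp add: mult.commute)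
      also have "\<dots> = ?J (\<lambda>s. \<Sum>c\<le>D' i. C c * (s * (1 - s) * s ^ (a + c)))"
        by (rule Jsum[symmetric]) (intro continuous_intros)
      also have "\<dots> = ?J (\<lambda>s. s * (1 - s) * s ^ a * U s)"
        by (simp add: U_def sum_distrib_left power_add mult_ac)
      finally show ?thesis .
    qed
    have m0: "?J (\<lambda>s. s * (1 - s) * s ^ a * U s) = 0" if "a \<le> D i" for a
    proof -
      have "(\<lambda>x. x $ i ^ a * q' x) \<in> polys (D(i := 0, i := a))" by (rule polys_mult_coord_pow[OF q']) simp
      then have "(\<lambda>x. x $ i ^ a * q' x) \<in> polys D" using that by (elim polys_mono) auto
      from orth[OF this] show ?thesis using mom[of a] by simp
    qed
    have cU: "continuous_on UNIV U" unfolding U_def by (intro continuous_intros)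
    have "?J (\<lambda>s. s * (1 - s) * U s * U s) = ?J (\<lambda>s. \<Sum>c\<le>D' i. C c * (s * (1 - s) * s ^ c * U s))"
    proof -
      have "(\<Sum>c\<le>D' i. C c * (s * (1 - s) * s ^ c * U s)) = s * (1 - s) * U s * (\<Sum>c\<le>D' i. C c * s ^ c)" for s
        by (simp add: sum_distrib_left mult_ac)
      then show ?thesis by (simp add: U_def[symmetric])
    qed
    also have "\<dots> = (\<Sum>c\<le>D' i. ?J (\<lambda>s. C c * (s * (1 - s) * s ^ c * U s)))"
      by (rule Jsum) (intro continuous_intros cU)
    also have "\<dots> = 0" using m0 u(2) by (intro sum.neutral) auto
    finally have J0: "?J (\<lambda>s. s * (1 - s) * U s * U s) = 0" .
    have U0: "s * (1 - s) * U s * U s = 0" if "s \<in> {0<..<1}" for s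
    proof (rule set_integral_eq_0_imp[OF _ _ _ J0])
      show "0 \<le> s * (1 - s) * U s * U s" if "s \<in> {0..1}" for s
        using that by (auto simp: mult.assoc)
    qed (use that cU in \<open>auto intro!: continuous_intros\<close>)
    have "s * (1 - s) * s ^ a * U s = 0" if "s \<in> {0..1}" for s
      using U0[of s] that by (cases "s = 0 \<or> s = 1") auto
    then have "?J (\<lambda>s. s * (1 - s) * s ^ a * U s) = ?J (\<lambda>s. 0)"
      by (intro set_lebesgue_integral_cong) auto
    then show ?thesis unfolding mom by simp
  qed
  have "cube_int (\<lambda>x. bubble i x * u x * q x) = cube_int (\<lambda>x. \<Sum>b\<le>N. bubble i x * u x * (x $ i ^ b * qb b x))"
    by (simp add: qb(2) sum_distrib_left)
  also have "\<dots> = (\<Sum>b\<le>N. cube_int (\<lambda>x. bubble i x * u x * (x $ i ^ b * qb b x)))"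
    by (intro cube_int_sum continuous_intros polys_continuous[OF u(1)] polys_continuous[OF qb(1)]) auto
  also have "\<dots> = 0" by (intro sum.neutral) (simp add: zero qb(1))
  finally show ?thesis .
qed

lemma matvec_inner_expand:
  fixes B :: "real^'n::finite^'n"
  shows "(B *v v) \<bullet> (B *v r) = (\<Sum>j\<in>UNIV. \<Sum>i\<in>UNIV. (column i B \<bullet> column j B) * (v $ i * r $ j))"
proof -
  have e: "B *v v = (\<Sum>i\<in>UNIV. v $ i *\<^sub>R column i B)" for v
    by (simp add: matrix_mult_sum scalar_mult_eq_scaleR)
  show ?thesis
    unfolding e[of r] inner_sum_right unfolding e inner_sum_left
    by (simp add: mult_ac)
qed

text \<open>
  The interior moments of Piola transformed fields on an element with matrix \<open>B\<close>, up to the determinant.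
\<close>

definition Bform :: "real^'n::finite^'n \<Rightarrow> ('n \<Rightarrow> real^'n \<Rightarrow> real) \<Rightarrow> ('n \<Rightarrow> real^'n \<Rightarrow> real) \<Rightarrow> real" where
  "Bform B v r = cube_int (\<lambda>x. (B *v (\<chi> i. v i x)) \<bullet> (B *v (\<chi> i. r i x)))"

lemma Bform_expand:
  assumes "\<And>i. continuous_on UNIV (v i)" "\<And>i. continuous_on UNIV (r i)"
  shows "Bform B v r = (\<Sum>j\<in>UNIV. \<Sum>i\<in>UNIV. (column i B \<bullet> column j B) * cube_int (\<lambda>x. v i x * r j x))"
  unfolding Bform_def matvec_inner_expand
  by (simp add: cube_int_sum assms continuous_on_sum continuous_on_mult)

lemma matrix_inv_mult:
  fixes B :: "real^'n::finite^'n"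
  assumes "invertible B" shows "matrix_inv B ** B = mat 1" "B ** matrix_inv B = mat 1"
  using someI_ex[OF assms[unfolded invertible_def]] unfolding matrix_inv_def by auto

definition psideg :: "nat \<Rightarrow> 'n \<Rightarrow> 'n \<Rightarrow> nat" where
  "psideg k i j = k - (if i = j then 1 else 0)"

definition rtdeg :: "nat \<Rightarrow> 'n \<Rightarrow> 'n \<Rightarrow> nat" where
  "rtdeg k i j = k + (if i = j then 1 else 0)"

text \<open>
  The Gram matrix of the columns of \<open>B\<close> couples the components, and the test space for the component
  \<open>j\<close> misses the degree \<open>k\<close> in the variable \<open>j\<close>; so the field itself is not an admissible test function
  and positive definiteness cannot be applied at once. The claim is therefore proved for test functions
  that have degree \<open>k\<close> only in the directions of a set \<open>S\<close>, by induction on \<open>S\<close>. The components with index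
  in \<open>S\<close> are orthogonal to such a function by the induction hypothesis and the preceding lemma. For the
  others the test function is admissible, so that a principal minor of the Gram matrix annihilates
  the vector of moments, which is then zero. For \<open>S = UNIV\<close> the field may be tested with itself.
\<close>

lemma bubble_field_zero:
  fixes B :: "real^'n::finite^'n"
  assumes B: "invertible B" and k: "k > 0"
    and w: "\<And>i. w i \<in> polys (psideg k i)"
    and orth: "\<And>r. (\<And>i. r i \<in> polys (psideg k i)) \<Longrightarrow> Bform B (\<lambda>i x. bubble i x * w i x) r = 0"
  shows "w i x = 0"
proof -
  define v where "v i x = bubble i x * w i x" for i x
  have cw: "continuous_on UNIV (w i)" for i by (rule polys_continuous[OF w])
  have cv: "continuous_on UNIV (v i)" for i unfolding v_def by (intro continuous_intros cw)
  have test: "(\<Sum>i\<in>UNIV. (column i B \<bullet> column j B) * cube_int (\<lambda>x. v i x * q x)) = 0"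
    if q: "q \<in> polys (psideg k j)" for j q
  proof -
    define r where "r i = (if i = j then q else (\<lambda>x. 0))" for i
    have r: "r i \<in> polys (psideg k i)" for i using q by (auto simp: r_def)
    have "0 = Bform B v r" using orth[OF r] by (simp add: v_def[abs_def])
    also have "\<dots> = (\<Sum>j'\<in>UNIV. \<Sum>i\<in>UNIV. (column i B \<bullet> column j' B) * cube_int (\<lambda>x. v i x * r j' x))"
      by (rule Bform_expand[OF cv polys_continuous[OF r]])
    also have "\<dots> = (\<Sum>i\<in>UNIV. (column i B \<bullet> column j B) * cube_int (\<lambda>x. v i x * r j x))"
      by (subst sum.remove[of _ j]) (auto simp: r_def)
    finally show ?thesis by (simp add: r_def)
  qed
  define deg where "deg S j = (if j \<in> S then k else k - 1)" for S and j :: 'n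
  have claim: "cube_int (\<lambda>x. v i x * q x) = 0" if "q \<in> polys ((deg S)(i := N))" for S i N q
    using finite[of S] that
  proof (induction S arbitrary: i N q rule: finite_psubset_induct)
    case (psubset S)
    have in_S: "cube_int (\<lambda>x. v i x * q x) = 0" if "i \<in> S" "q \<in> polys ((deg S)(i := N))" for i N q
    proof (rule psubset.IH[of "S - {i}" q i N])
      have "(deg (S - {i}))(i := N) = (deg S)(i := N)" by (auto simp: deg_def)
      then show "q \<in> polys ((deg (S - {i}))(i := N))" using that by simp
    qed (use that in auto)
    \<comment> \<open>The moments of all components against a single \<open>q\<close>, as a vector \<open>z\<close> with \<open>B *v z = 0\<close>.\<close>
    have on_S: "cube_int (\<lambda>x. v i x * q x) = 0" if q: "q \<in> polys (deg S)" for i q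
    proof -
      define z where "z = (\<chi> i. cube_int (\<lambda>x. v i x * q x))"
      have zS: "z $ i = 0" if "i \<in> S" for i
        unfolding z_def using in_S[OF that, of q "deg S i"] q by simp
      have nS: "(\<Sum>i\<in>UNIV. (column i B \<bullet> column j B) * z $ i) = 0" if "j \<notin> S" for j
      proof -
        have "q \<in> polys (psideg k j)"
          using q by (rule polys_mono) (use that in \<open>auto simp: deg_def psideg_def\<close>)
        from test[OF this] show ?thesis by (simp add: z_def)
      qed
      have "(B *v z) \<bullet> (B *v z) = (\<Sum>j\<in>UNIV. (\<Sum>i\<in>UNIV. (column i B \<bullet> column j B) * z $ i) * z $ j)"
        unfolding matvec_inner_expand sum_distrib_right mult.assoc ..
      also have "\<dots> = 0" using zS nS by (intro sum.neutral) auto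
      finally have "B *v z = 0" by simp
      then have "matrix_inv B *v (B *v z) = 0" by simp
      then have "z = 0" using B by (simp add: matrix_vector_mul_assoc matrix_inv_mult)
      then show ?thesis by (simp add: z_def vec_eq_iff)
    qed
    show ?case
    proof (cases "i \<in> S")
      case True then show ?thesis using in_S psubset.prems by blast
    next
      case False
      show ?thesis unfolding v_def
      proof (rule bubble_orthogonal_lift[OF w])
        show "psideg k i i \<le> deg S i" using False by (simp add: psideg_def deg_def)
        show "cube_int (\<lambda>x. bubble i x * w i x * q x) = 0" if "q \<in> polys (deg S)" for q
          using on_S[OF that, of i] by (simp add: v_def)
      qed (rule psubset.prems)
    qed
  qed
  have vp: "v i \<in> polys ((deg UNIV)(i := Suc k))" for i
  proof -
    have p1: "(\<lambda>x. x $ i * w i x) \<in> polys ((psideg k i)(i := k))"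
      using polys_mult_coord[OF w, of i i] k by (simp add: psideg_def)
    then have "(\<lambda>x. x $ i * (x $ i * w i x)) \<in> polys ((psideg k i)(i := Suc k))"
      using polys_mult_coord[OF p1, of i] by simp
    from polys_diff[OF polys_mono[OF p1] polys_mono[OF this], of "(deg UNIV)(i := Suc k)"]
    have "(\<lambda>x. x $ i * w i x - x $ i * (x $ i * w i x)) \<in> polys ((deg UNIV)(i := Suc k))"
      by (auto simp: psideg_def deg_def)
    then show ?thesis by (simp add: v_def[abs_def] bubble_def algebra_simps)
  qed
  have v0: "v i x = 0" for x
    using rpf_square_cint_0[OF polys_real_polynomial_function[OF vp] claim[OF vp]] .
  show ?thesis
  proof (rule rpf_zero_on_cube[OF polys_real_polynomial_function[OF w]])
    fix x :: "real^'n" assume "x \<in> interior ref_cube"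
    then have "x $ i \<noteq> 0" "x $ i \<noteq> 1" by (auto simp: interior_ref_cube box_nth less_le)
    then show "w i x = 0" using v0[of x] by (auto simp: v_def bubble_def)
  qed
qed

text \<open>
  Unisolvence for a general invertible \<open>B\<close>. Face moments of full degree make the normal components
  vanish on the faces, which splits off the bubble functions and leaves the previous lemma.
\<close>

lemma RT_reference_unique:
  fixes B :: "real^'n::finite^'n"
  assumes B: "invertible B"
    and v: "\<And>i. v i \<in> polys (rtdeg k i)"
    and face: "\<And>i a q. a \<in> {0,1} \<Longrightarrow> q \<in> polys (\<lambda>_. k) \<Longrightarrow> cube_int (\<lambda>x. v i (upd i a x) * q (upd i a x)) = 0"
    and inner: "\<And>r. k > 0 \<Longrightarrow> (\<And>i. r i \<in> polys (psideg k i)) \<Longrightarrow> Bform B v r = 0"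
  shows "v i x = 0"
proof -
  have trace: "v i (upd i a x) = 0" if a: "a \<in> {0,1}" for i a x
  proof -
    let ?q = "\<lambda>x. v i (upd i a x)"
    have q: "?q \<in> polys ((rtdeg k i)(i := 0))" by (rule polys_upd[OF v])
    then have "?q \<in> polys (\<lambda>_. k)" by (rule polys_mono) (simp add: rtdeg_def)
    from face[OF a this, of i] have "cube_int (\<lambda>x. ?q x * ?q x) = 0" by simp
    from rpf_square_cint_0[OF polys_real_polynomial_function[OF q] this] show ?thesis .
  qed
  have "\<exists>u. u \<in> polys ((rtdeg k i)(i := k)) \<and> (\<forall>x. v i x = x $ i * u x)" for i
  proof -
    have "rtdeg k i i = Suc k" by (simp add: rtdeg_def)
    from polys_factor[OF v[of i] this]
    obtain u where "u \<in> polys ((rtdeg k i)(i := k))" "\<And>x. v i x = v i (upd i 0 x) + (x $ i - 0) * u x"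
      by blast
    then show ?thesis using trace[of 0 i] by auto
  qed
  then obtain u where u: "\<And>i. u i \<in> polys ((rtdeg k i)(i := k))" "\<And>i x. v i x = x $ i * u i x" by metis
  have u1: "u i (upd i 1 x) = 0" for i x using trace[of 1 i x] u(2)[of i "upd i 1 x"] by simp
  show ?thesis
  proof (cases "k = 0")
    case True
    then have "u i (upd i 1 x) = u i x" by (intro polys_indep[OF u(1)]) simp
    then show ?thesis using u1 u(2) by simp
  next
    case False
    then obtain k' where k': "k = Suc k'" by (cases k) auto
    have deg: "(rtdeg k i)(i := k, i := k') = psideg k i" for i by (auto simp: rtdeg_def psideg_def k')
    have "\<exists>w. w \<in> polys (psideg k i) \<and> (\<forall>x. u i x = (x $ i - 1) * w x)" for i
    proof -
      have "((rtdeg k i)(i := k)) i = Suc k'" by (simp add: k')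
      from polys_factor[OF u(1)[of i] this]
      obtain w where "w \<in> polys ((rtdeg k i)(i := k, i := k'))" "\<And>x. u i x = u i (upd i 1 x) + (x $ i - 1) * w x"
        by blast
      then show ?thesis using u1[of i] unfolding deg by auto
    qed
    then obtain w where w: "\<And>i. w i \<in> polys (psideg k i)" "\<And>i x. u i x = (x $ i - 1) * w i x" by metis
    define w' where "w' i x = - 1 * w i x" for i x
    have w': "w' i \<in> polys (psideg k i)" for i unfolding w'_def by (rule polys_cmult[OF w(1)])
    have vw: "v i x = bubble i x * w' i x" for i x by (simp add: u(2) w(2) w'_def bubble_def algebra_simps)
    then have veq: "v = (\<lambda>i x. bubble i x * w' i x)" by (intro ext)
    have "w' i x = 0"
    proof (rule bubble_field_zero[OF B _ w'])
      show "Bform B (\<lambda>i x. bubble i x * w' i x) r = 0" if "\<And>i. r i \<in> polys (psideg k i)" for r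
        using inner[OF _ that] False unfolding veq by blast
    qed (use False in simp)
    then show ?thesis by (simp add: vw)
  qed
qed

lemma face_riesz:
  fixes H :: "real^'n::finite \<Rightarrow> real"
  assumes "continuous_on UNIV H"
  shows "\<exists>f\<in>polys D. \<forall>q\<in>polys D. cube_int (\<lambda>x. f x * q x) = cube_int (\<lambda>x. H x * q x)"
  unfolding polys_eq_lspan
proof (rule nondegenerate_form_solvable, goal_cases)
  case 1 then show ?case by simp
next
  case (2 u v w s t)
  then have c: "continuous_on UNIV u" "continuous_on UNIV v" "continuous_on UNIV w"
    unfolding polys_eq_lspan[symmetric] by (auto intro: polys_continuous)
  have "cube_int (\<lambda>x. (s * u x + t * v x) * w x) = cube_int (\<lambda>x. s * (u x * w x) + t * (v x * w x))"
    by (simp add: algebra_simps)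
  also have "\<dots> = cube_int (\<lambda>x. s * (u x * w x)) + cube_int (\<lambda>x. t * (v x * w x))"
    by (intro cube_int_add continuous_intros c)
  finally show ?case by simp
next
  case (3 u v w s t)
  then have c: "continuous_on UNIV u" "continuous_on UNIV v" "continuous_on UNIV w"
    unfolding polys_eq_lspan[symmetric] by (auto intro: polys_continuous)
  have "cube_int (\<lambda>x. w x * (s * u x + t * v x)) = cube_int (\<lambda>x. s * (w x * u x) + t * (w x * v x))"
    by (simp add: algebra_simps)
  also have "\<dots> = cube_int (\<lambda>x. s * (w x * u x)) + cube_int (\<lambda>x. t * (w x * v x))"
    by (intro cube_int_add continuous_intros c)
  finally show ?case by simp
next
  case (4 u v s t)
  then have c: "continuous_on UNIV u" "continuous_on UNIV v"
    unfolding polys_eq_lspan[symmetric] by (auto intro: polys_continuous)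
  have "cube_int (\<lambda>x. H x * (s * u x + t * v x)) = cube_int (\<lambda>x. s * (H x * u x) + t * (H x * v x))"
    by (simp add: algebra_simps)
  also have "\<dots> = cube_int (\<lambda>x. s * (H x * u x)) + cube_int (\<lambda>x. t * (H x * v x))"
    by (intro cube_int_add continuous_intros c assms)
  finally show ?case by simp
next
  case (5 v)
  have "cube_int (\<lambda>x. v x * v x) = 0" using 5(2)[OF 5(1)] .
  from rpf_square_cint_0[OF polys_real_polynomial_function[OF 5(1)[folded polys_eq_lspan]] this] show ?case
    by (rule ext)
qed

lemma Bform_comb1:
  assumes "\<And>i. continuous_on UNIV (u i)" "\<And>i. continuous_on UNIV (v i)" "\<And>i. continuous_on UNIV (r i)"
  shows "Bform B (\<lambda>i x. s * u i x + t * v i x) r = s * Bform B u r + t * Bform B v r"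
proof -
  have e: "cube_int (\<lambda>x. (s * u i x + t * v i x) * r j x) = s * cube_int (\<lambda>x. u i x * r j x) + t * cube_int (\<lambda>x. v i x * r j x)" for i j
  proof -
    have "cube_int (\<lambda>x. (s * u i x + t * v i x) * r j x) = cube_int (\<lambda>x. s * (u i x * r j x) + t * (v i x * r j x))"
      by (simp add: algebra_simps)
    also have "\<dots> = cube_int (\<lambda>x. s * (u i x * r j x)) + cube_int (\<lambda>x. t * (v i x * r j x))"
      by (intro cube_int_add continuous_intros assms)
    finally show ?thesis by simp
  qed
  have "Bform B (\<lambda>i x. s * u i x + t * v i x) r = (\<Sum>j\<in>UNIV. \<Sum>i\<in>UNIV. (column i B \<bullet> column j B) * (s * cube_int (\<lambda>x. u i x * r j x) + t * cube_int (\<lambda>x. v i x * r j x)))"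
    by (subst Bform_expand) (auto intro!: continuous_intros assms simp: e)
  also have "\<dots> = s * Bform B u r + t * Bform B v r"
    unfolding Bform_expand[OF assms(1,3)] Bform_expand[OF assms(2,3)] 
    by (simp add: sum_distrib_left sum.distrib algebra_simps)
  finally show ?thesis .
qed

lemma Bform_commute: "Bform B u r = Bform B r u"
  unfolding Bform_def by (simp add: inner_commute)

lemma bubble_field_exists:
  fixes B :: "real^'n::finite^'n"
  assumes B: "invertible B" and k: "k > 0"
    and L: "\<And>u v s t. (\<And>i. u i \<in> polys (psideg k i)) \<Longrightarrow> (\<And>i. v i \<in> polys (psideg k i)) \<Longrightarrow>
       L (\<lambda>i x. s * u i x + t * v i x) = s * L u + t * L v"
  shows "\<exists>w. (\<forall>i. w i \<in> polys (psideg k i)) \<and>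
     (\<forall>r. (\<forall>i. r i \<in> polys (psideg k i)) \<longrightarrow> Bform B (\<lambda>i x. bubble i x * w i x) r = L r)"
proof -
  define I where "I = (SIGMA i:(UNIV::'n set). exponents (psideg k i))"
  define b :: "'n \<times> ('n \<Rightarrow> nat) \<Rightarrow> 'n \<times> (real^'n) \<Rightarrow> real" where "b = (\<lambda>(i,a) (i',x). if i' = i then monomial a x else 0)"
  have sp: "u \<in> lspan I b \<longleftrightarrow> (\<forall>i. (\<lambda>x. u (i, x)) \<in> polys (psideg k i))" for u
    unfolding I_def b_def polys_eq_lspan
    using lspan_blocks[of UNIV "\<lambda>i. exponents (psideg k i)" u "\<lambda>_. monomial"] by simp
  have cont: "continuous_on UNIV (\<lambda>x. u (i, x))" if "u \<in> lspan I b" for u i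
    using that sp polys_continuous by blast
  have "\<exists>w\<in>lspan I b. \<forall>r\<in>lspan I b. Bform B (\<lambda>i x. bubble i x * w (i,x)) (\<lambda>i x. r (i,x)) = L (\<lambda>i x. r (i,x))"
  proof (rule nondegenerate_form_solvable, goal_cases)
    case 1 then show ?case by (auto simp: I_def)
  next
    case (2 u v w s t)
    have "Bform B (\<lambda>i x. s * (bubble i x * u (i, x)) + t * (bubble i x * v (i, x))) (\<lambda>i x. w (i, x)) =
       s * Bform B (\<lambda>i x. bubble i x * u (i, x)) (\<lambda>i x. w (i, x)) + t * Bform B (\<lambda>i x. bubble i x * v (i, x)) (\<lambda>i x. w (i, x))"
      by (rule Bform_comb1) (use 2 in \<open>auto intro!: continuous_intros cont\<close>)
    then show ?case by (simp add: algebra_simps)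
  next
    case (3 u v w s t)
    have "Bform B (\<lambda>i x. s * u (i, x) + t * v (i, x)) (\<lambda>i x. bubble i x * w (i, x)) =
       s * Bform B (\<lambda>i x. u (i, x)) (\<lambda>i x. bubble i x * w (i, x)) + t * Bform B (\<lambda>i x. v (i, x)) (\<lambda>i x. bubble i x * w (i, x))"
      by (rule Bform_comb1) (use 3 in \<open>auto intro!: continuous_intros cont\<close>)
    then show ?case by (simp add: Bform_commute)
  next
    case (4 u v s t)
    then show ?case using L[of "\<lambda>i x. u (i,x)" "\<lambda>i x. v (i,x)" s t] by (simp add: sp)
  next
    case (5 v)
    have "v (i, x) = 0" for i x
    proof (rule bubble_field_zero[OF B k])
      show "(\<lambda>x. v (i, x)) \<in> polys (psideg k i)" for i using 5(1) sp by blast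
      show "Bform B (\<lambda>i x. bubble i x * v (i, x)) r = 0" if "\<And>i. r i \<in> polys (psideg k i)" for r
        using 5(2)[of "\<lambda>(i,x). r i x"] that by (simp add: sp)
    qed
    then show ?case by auto
  qed
  then obtain w where w: "w \<in> lspan I b"
    "\<And>r. r \<in> lspan I b \<Longrightarrow> Bform B (\<lambda>i x. bubble i x * w (i,x)) (\<lambda>i x. r (i,x)) = L (\<lambda>i x. r (i,x))" by blast
  show ?thesis
  proof (intro exI[of _ "\<lambda>i x. w (i,x)"] conjI allI impI)
    show "(\<lambda>x. w (i, x)) \<in> polys (psideg k i)" for i using w(1) sp by blast
    fix r :: "'n \<Rightarrow> real^'n \<Rightarrow> real" assume "\<forall>i. r i \<in> polys (psideg k i)"
    then show "Bform B (\<lambda>i x. bubble i x * w (i,x)) r = L r" using w(2)[of "\<lambda>(i,x). r i x"] by (simp add: sp)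
  qed
qed

text \<open>
  The face moments are met by interpolating linearly, in the coordinate \<open>i\<close>, between the Riesz
  representatives on two opposite faces. A bubble field, which does not disturb the faces, corrects the
  interior moments.
\<close>

lemma RT_reference_exists:
  fixes B :: "real^'n::finite^'n" and H :: "'n \<Rightarrow> real \<Rightarrow> real^'n \<Rightarrow> real"
  assumes B: "invertible B" and H: "\<And>i a. continuous_on UNIV (H i a)"
    and L: "\<And>u v s t. k > 0 \<Longrightarrow> (\<And>i. u i \<in> polys (psideg k i)) \<Longrightarrow> (\<And>i. v i \<in> polys (psideg k i)) \<Longrightarrow>
       L (\<lambda>i x. s * u i x + t * v i x) = s * L u + t * L v"
  shows "\<exists>v. (\<forall>i. v i \<in> polys (rtdeg k i)) \<and>
     (\<forall>i. \<forall>a\<in>{0,1}. \<forall>q\<in>polys (\<lambda>_. k). cube_int (\<lambda>x. v i (upd i a x) * q (upd i a x)) = cube_int (\<lambda>x. H i a (upd i a x) * q (upd i a x))) \<and>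
     (k > 0 \<longrightarrow> (\<forall>r. (\<forall>i. r i \<in> polys (psideg k i)) \<longrightarrow> Bform B v r = L r))"
proof -
  have "\<exists>f. f \<in> polys ((\<lambda>_. k)(i := 0)) \<and> (\<forall>q\<in>polys ((\<lambda>_. k)(i := 0)). cube_int (\<lambda>x. f x * q x) = cube_int (\<lambda>x. H i a (upd i a x) * q x))" for i a
  proof -
    have "continuous_on UNIV (\<lambda>x. H i a (upd i a x))"
      by (intro continuous_on_compose2[OF H] continuous_intros) auto
    from face_riesz[OF this] show ?thesis by blast
  qed
  then obtain f where f: "\<And>i a. f i a \<in> polys ((\<lambda>_. k)(i := 0))"
    "\<And>i a q. q \<in> polys ((\<lambda>_. k)(i := 0)) \<Longrightarrow> cube_int (\<lambda>x. f i a x * q x) = cube_int (\<lambda>x. H i a (upd i a x) * q x)" by metis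
  have fu: "f i a (upd i t x) = f i a x" for i a t x by (rule polys_indep[OF f(1)]) simp
  define v0 where "v0 i x = f i 0 x + x $ i * (f i 1 x - f i 0 x)" for i x
  have v0: "v0 i \<in> polys (rtdeg k i)" for i
  proof -
    have "(\<lambda>x. x $ i * (f i 1 x - f i 0 x)) \<in> polys ((\<lambda>_. k)(i := 0, i := Suc (((\<lambda>_. k)(i := 0)) i)))"
      by (intro polys_mult_coord polys_diff f)
    then have 1: "(\<lambda>x. x $ i * (f i 1 x - f i 0 x)) \<in> polys (rtdeg k i)"
      by (rule polys_mono) (auto simp: rtdeg_def)
    have "f i 0 \<in> polys (rtdeg k i)" by (rule polys_mono[OF f(1)]) (auto simp: rtdeg_def)
    from polys_add[OF this 1] show ?thesis unfolding v0_def .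
  qed
  obtain w where w: "\<And>i. k > 0 \<Longrightarrow> w i \<in> polys (psideg k i)" "\<And>i. k = 0 \<Longrightarrow> w i = (\<lambda>x. 0)"
     "\<And>r. k > 0 \<Longrightarrow> (\<And>i. r i \<in> polys (psideg k i)) \<Longrightarrow> Bform B (\<lambda>i x. bubble i x * w i x) r = L r - Bform B v0 r"
  proof (cases "k > 0")
    case True
    have "\<exists>w. (\<forall>i. w i \<in> polys (psideg k i)) \<and>
     (\<forall>r. (\<forall>i. r i \<in> polys (psideg k i)) \<longrightarrow> Bform B (\<lambda>i x. bubble i x * w i x) r = L r - Bform B v0 r)"
    proof (rule bubble_field_exists[OF B True])
      fix u v :: "'n \<Rightarrow> real^'n \<Rightarrow> real" and s t assume uv: "\<And>i. u i \<in> polys (psideg k i)" "\<And>i. v i \<in> polys (psideg k i)"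
      have "Bform B (\<lambda>i x. s * u i x + t * v i x) v0 = s * Bform B u v0 + t * Bform B v v0"
        by (intro Bform_comb1 polys_continuous[OF uv(1)] polys_continuous[OF uv(2)] polys_continuous[OF v0])
      then show "L (\<lambda>i x. s * u i x + t * v i x) - Bform B v0 (\<lambda>i x. s * u i x + t * v i x) = s * (L u - Bform B v0 u) + t * (L v - Bform B v0 v)"
        using L[OF True uv] by (simp add: Bform_commute[of B v0] algebra_simps)
    qed
    then show ?thesis using that True by blast
  next
    case False
    then show ?thesis by (intro that[of "\<lambda>i x. 0"]) auto
  qed
  define v where "v i x = v0 i x + bubble i x * w i x" for i x
  have bw: "(\<lambda>x. bubble i x * w i x) \<in> polys (rtdeg k i)" for i
  proof (cases "k > 0")
    case True
    have p1: "(\<lambda>x. x $ i * w i x) \<in> polys ((psideg k i)(i := k))"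
      using polys_mult_coord[OF w(1)[OF True], of i i] True by (simp add: psideg_def)
    then have "(\<lambda>x. x $ i * (x $ i * w i x)) \<in> polys ((psideg k i)(i := Suc k))"
      using polys_mult_coord[OF p1, of i] by simp
    from polys_diff[OF polys_mono[OF p1] polys_mono[OF this], of "rtdeg k i"]
    have "(\<lambda>x. x $ i * w i x - x $ i * (x $ i * w i x)) \<in> polys (rtdeg k i)"
      by (auto simp: psideg_def rtdeg_def)
    then show ?thesis by (simp add: bubble_def algebra_simps)
  qed (simp add: w)
  show ?thesis
  proof (intro exI[of _ v] conjI allI ballI impI)
    show "v i \<in> polys (rtdeg k i)" for i unfolding v_def by (intro polys_add v0 bw)
    fix i :: 'n and a :: real and q :: "real^'n \<Rightarrow> real" assume a: "a \<in> {0,1}" and q: "q \<in> polys (\<lambda>_. k)"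
    have "v i (upd i a x) = f i a x" for x using a by (auto simp: v_def v0_def bubble_def fu)
    then show "cube_int (\<lambda>x. v i (upd i a x) * q (upd i a x)) = cube_int (\<lambda>x. H i a (upd i a x) * q (upd i a x))"
      using f(2)[OF polys_upd[OF q, of i a], of a] by simp
  next
    fix r :: "'n \<Rightarrow> real^'n \<Rightarrow> real" assume k: "k > 0" and r: "\<forall>i. r i \<in> polys (psideg k i)"
    have "Bform B (\<lambda>i x. 1 * v0 i x + 1 * (bubble i x * w i x)) r = 1 * Bform B v0 r + 1 * Bform B (\<lambda>i x. bubble i x * w i x) r"
      by (intro Bform_comb1 polys_continuous[OF v0] polys_continuous[OF bw]) (use r polys_continuous in blast)
    then have "Bform B v r = Bform B v0 r + Bform B (\<lambda>i x. bubble i x * w i x) r"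
      by (simp add: v_def[abs_def])
    then show "Bform B v r = L r" using w(3)[OF k] r by simp
  qed
qed

section \<open>Parallelepipeds\<close>

lemma continuous_matvec [continuous_intros]:
  fixes A :: "real^'n::finite^'m::finite"
  shows "continuous_on S f \<Longrightarrow> continuous_on S (\<lambda>x. A *v f x)"
  by (rule bounded_linear.continuous_on[OF matrix_vector_mul_bounded_linear])

locale parallelepiped =
  fixes B :: "real^'n::finite^'n" and b :: "real^'n"
  assumes invertible: "invertible B"
begin

definition mu :: "real^'n \<Rightarrow> real^'n" where "mu x = B *v x + b"
definition r :: "'n \<Rightarrow> real^'n" where "r i = matrix_inv B $ i"
definition nu :: "real^'n \<Rightarrow> real^'n" where "nu y = matrix_inv B *v (y - b)"
definition body :: "(real^'n) set" where "body = mu ` ref_cube"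
definition side :: "'n \<Rightarrow> real \<Rightarrow> (real^'n) set" where "side i a = {y \<in> body. nu y $ i = a}"
definition unit_normal :: "'n \<Rightarrow> real \<Rightarrow> real^'n" where "unit_normal i a = ((2 * a - 1) / norm (r i)) *\<^sub>R r i"

lemma nu_mu [simp]: "nu (mu x) = x"
  using matrix_inv_mult[OF invertible] by (simp add: nu_def mu_def matrix_vector_mul_assoc)

lemma mu_nu [simp]: "mu (nu y) = y"
  using matrix_inv_mult[OF invertible] by (simp add: nu_def mu_def matrix_vector_mul_assoc)

lemma inv_mu: "inv mu = nu"
  by (rule inv_equality) simp_all

lemma det_nz: "det B \<noteq> 0"
  using invertible by (simp add: invertible_det_nz)

lemma nu_nth: "nu y $ i = r i \<bullet> (y - b)"
  unfolding nu_def r_def by (rule matrix_vector_mul_component)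

lemma r_nz: "r i \<noteq> 0"
proof
  assume "r i = 0"
  then have "nu y $ i = 0" for y by (simp add: nu_nth)
  from this[of "mu 1"] show False by simp
qed

lemma continuous_mu [continuous_intros]: "continuous_on S f \<Longrightarrow> continuous_on S (\<lambda>x. mu (f x))"
  unfolding mu_def by (intro continuous_on_add continuous_on_const continuous_matvec)

lemma continuous_nu [continuous_intros]: "continuous_on S f \<Longrightarrow> continuous_on S (\<lambda>x. nu (f x))"
  unfolding nu_def by (intro continuous_on_diff continuous_on_const continuous_matvec)

lemma mem_mu_image: "y \<in> mu ` S \<longleftrightarrow> nu y \<in> S"
  by (metis image_iff mu_nu nu_mu)

lemma body_iff: "y \<in> body \<longleftrightarrow> nu y \<in> ref_cube"
  unfolding body_def by (rule mem_mu_image)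

lemma body_nth: "y \<in> body \<longleftrightarrow> (\<forall>i. 0 \<le> nu y $ i \<and> nu y $ i \<le> 1)"
  by (simp add: body_iff ref_cube_def)

lemma compact_body: "compact body"
  unfolding body_def by (intro compact_continuous_image continuous_intros compact_ref_cube)

lemma mu_eq: "mu = (+) b \<circ> (*v) B"
  by (auto simp: mu_def)

lemma inj_B: "inj ((*v) B)"
  using invertible by (simp add: inj_matrix_vector_mult)

lemma interior_body: "interior body = {y. \<forall>i. 0 < nu y $ i \<and> nu y $ i < 1}"
proof -
  have "interior body = mu ` interior ref_cube"
    unfolding body_def mu_eq image_comp[symmetric] interior_translation
    by (subst interior_injective_linear_image) (use inj_B in auto)
  also have "\<dots> = {y. \<forall>i. 0 < nu y $ i \<and> nu y $ i < 1}"
    unfolding interior_ref_cube by (auto simp: box_nth mem_mu_image)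
  finally show ?thesis .
qed

lemma convex_body: "convex body"
  unfolding body_def mu_eq image_comp[symmetric] ref_cube_eq
  by (intro convex_translation convex_linear_image) auto

lemma polyhedron_body: "polyhedron body"
  unfolding body_def mu_eq image_comp[symmetric] ref_cube_eq
  by (intro polytope_imp_polyhedron) (simp add: polytope_translation_eq polytope_linear_image polytope_interval)

definition center :: "'n \<Rightarrow> real \<Rightarrow> real^'n" where "center i a = upd i a (\<chi> j. 1/2)"

lemma center_nth: "center i a $ j = (if j = i then a else 1/2)"
  by (simp add: center_def)

lemma center_in_side: "a \<in> {0,1} \<Longrightarrow> mu (center i a) \<in> side i a"
  by (auto simp: side_def body_nth center_nth)

lemma rel_interior_body: "rel_interior body = interior body"
proof (rule rel_interior_nonempty_interior)
  have "mu (\<chi> i. 1/2) \<in> interior body" by (simp add: interior_body)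
  then show "interior body \<noteq> {}" by auto
qed

lemma rel_frontier_body: "rel_frontier body = body - interior body"
  using compact_body by (simp add: rel_frontier_def rel_interior_body compact_imp_closed)

lemma side_hyperplane: "side i a = body \<inter> {y. r i \<bullet> y = a + r i \<bullet> b}"
  by (auto simp: side_def nu_nth inner_diff_right)

lemma side_face: assumes "a \<in> {0,1}" shows "side i a face_of body"
proof -
  have "r i \<bullet> y \<ge> 0 + r i \<bullet> b" "r i \<bullet> y \<le> 1 + r i \<bullet> b" if "y \<in> body" for y
    using that by (auto simp: body_nth nu_nth inner_diff_right algebra_simps)
  then show ?thesis using assms face_of_Int_supporting_hyperplane_le[OF convex_body, of "r i" "1 + r i \<bullet> b"]
      face_of_Int_supporting_hyperplane_ge[OF convex_body, of "0 + r i \<bullet> b" "r i"]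
    unfolding side_hyperplane by blast
qed

lemma side_ne_body: assumes "a \<in> {0,1}" shows "side i a \<noteq> body"
proof -
  have "mu (\<chi> i. 1/2) \<in> body" "mu (\<chi> i. 1/2) \<notin> side i a" using assms by (auto simp: body_nth side_def)
  then show ?thesis by auto
qed

text \<open>
  A relative interior point of the facet lies on some side; a face meeting the relative interior of
  the facet contains it, and the dimensions leave no room for a strict inclusion.
\<close>

lemma facet_is_side:
  assumes e: "e facet_of body" shows "\<exists>i. \<exists>a\<in>{0,1}. e = side i a"
proof -
  have ef: "e face_of body" and ne: "e \<noteq> {}" and ad: "aff_dim e = aff_dim body - 1"
    using e by (auto simp: facet_of_def)
  have "e \<noteq> body" using e by auto
  have "convex e" using ef by (rule face_of_imp_convex)
  then obtain x where x: "x \<in> rel_interior e" using ne rel_interior_eq_empty by blast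
  then have xe: "x \<in> e" using rel_interior_subset by blast
  have xb: "x \<in> body" using xe ef face_of_imp_subset by blast
  have "x \<notin> interior body"
  proof
    assume "x \<in> interior body"
    then have "e \<inter> rel_interior body \<noteq> {}" using xe by (auto simp: rel_interior_body)
    from subset_of_face_of[OF ef _ this] have "body \<subseteq> e" by auto
    then show False using \<open>e \<noteq> body\<close> ef face_of_imp_subset by blast
  qed
  with xb obtain i where "nu x $ i \<le> 0 \<or> nu x $ i \<ge> 1" by (auto simp: interior_body not_less)
  moreover have "0 \<le> nu x $ i \<and> nu x $ i \<le> 1" using xb by (auto simp: body_nth)
  ultimately obtain a where a: "a \<in> {0,1}" "nu x $ i = a" by force
  let ?G = "side i a"
  have "x \<in> ?G" using xb a by (auto simp: side_def)
  then have "e \<subseteq> ?G"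
    by (intro subset_of_face_of[OF side_face[OF a(1)]]) (use x ef face_of_imp_subset in auto)
  moreover have "e = ?G"
  proof (rule ccontr)
    assume "e \<noteq> ?G"
    have "e face_of ?G" using ef \<open>e \<subseteq> ?G\<close> by (rule face_of_subset) (auto simp: side_def)
    then have "aff_dim e < aff_dim ?G"
      using \<open>e \<noteq> ?G\<close> face_of_aff_dim_lt face_of_imp_convex[OF side_face[OF a(1)]] by blast
    moreover have "aff_dim ?G < aff_dim body"
      by (rule face_of_aff_dim_lt[OF convex_body side_face[OF a(1)] side_ne_body[OF a(1)]])
    ultimately show False using ad by simp
  qed
  ultimately show ?thesis using a by blast
qed

lemma side_eqD:
  assumes "side i a = side j a'" "a \<in> {0,1}" "a' \<in> {0,1}" shows "i = j \<and> a = a'"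
proof -
  have "mu (center i a) \<in> side j a'" using center_in_side[OF assms(2)] assms(1) by blast
  then show ?thesis using assms by (auto simp: side_def center_nth split: if_splits)
qed

text \<open>
  The centre of a side lies on the relative frontier, hence on some facet, and the only side that
  contains it is the given one.
\<close>

lemma side_facet:
  assumes a: "a \<in> {0,1}" shows "side i a facet_of body"
proof -
  have "mu (center i a) \<in> body - interior body"
    using center_in_side[OF a] a unfolding interior_body
    by (auto simp: side_def center_nth intro!: exI[of _ i])
  then have "mu (center i a) \<in> \<Union>{F. F facet_of body}"
    using rel_frontier_of_polyhedron[OF polyhedron_body] rel_frontier_body by auto
  then obtain F where F: "F facet_of body" "mu (center i a) \<in> F" by auto
  then obtain j a' where j: "a' \<in> {0,1}" "F = side j a'" using facet_is_side by blast
  have "j = i \<and> a' = a" using F(2) j a by (auto simp: side_def center_nth split: if_splits)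
  then show ?thesis using F j by simp
qed

lemma facets_body: "{e. e facet_of body} = (\<lambda>(i,a). side i a) ` (UNIV \<times> {0,1})"
  using facet_is_side side_facet by (auto simp: image_iff)

lemma inj_sides: "inj_on (\<lambda>(i,a). side i a) (UNIV \<times> {0,1})"
  by (auto simp: inj_on_def dest: side_eqD)

lemma affine_hull_side:
  assumes a: "a \<in> {0,1}" shows "affine hull (side i a) = {y. nu y $ i = a}"
proof -
  have eq: "{y. nu y $ i = a} = {y. r i \<bullet> y = a + r i \<bullet> b}" by (auto simp: nu_nth inner_diff_right)
  have "side i a \<noteq> {}" using center_in_side[OF a] by auto
  have sub: "affine hull (side i a) \<subseteq> {y. r i \<bullet> y = a + r i \<bullet> b}"
    by (rule hull_minimal) (auto simp: side_hyperplane affine_hyperplane)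
  have "aff_dim body = DIM(real^'n)"
    by (rule aff_dim_nonempty_interior) (use rel_interior_body center_in_side in \<open>auto simp: interior_body intro!: exI[of _ "mu (\<chi> i. 1/2)"]\<close>)
  then have "aff_dim (side i a) = DIM(real^'n) - 1" using side_facet[OF a, of i] by (simp add: facet_of_def)
  then have "affine hull (side i a) = {y. r i \<bullet> y = a + r i \<bullet> b}"
    using sub \<open>side i a \<noteq> {}\<close> r_nz by (intro affine_dim_equal affine_hyperplane) (auto simp: aff_dim_hyperplane)
  then show ?thesis by (simp add: eq)
qed

lemma face_proj_side:
  assumes a: "a \<in> {0,1}"
  shows "face_proj (side i a) y = y - ((nu y $ i - a) / (r i \<bullet> r i)) *\<^sub>R r i"
proof -
  let ?p = "y - ((nu y $ i - a) / (r i \<bullet> r i)) *\<^sub>R r i"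
  have rr: "r i \<bullet> r i \<noteq> 0" using r_nz by simp
  have p: "nu ?p $ i = a"
  proof -
    have "nu ?p $ i = nu y $ i - (nu y $ i - a) / (r i \<bullet> r i) * (r i \<bullet> r i)"
      by (simp add: nu_nth inner_diff_right)
    then show ?thesis using rr by simp
  qed
  have "?p = closest_point {y. nu y $ i = a} y"
  proof (rule closest_point_unique)
    have eq: "{y. nu y $ i = a} = {y. r i \<bullet> y = a + r i \<bullet> b}" by (auto simp: nu_nth inner_diff_right)
    show "convex {y. nu y $ i = a}" "closed {y. nu y $ i = a}"
      unfolding eq by (rule convex_hyperplane closed_hyperplane)+
    show "?p \<in> {y. nu y $ i = a}" using p by simp
    show "\<forall>z\<in>{y. nu y $ i = a}. dist y ?p \<le> dist y z"
    proof
      fix z assume "z \<in> {y. nu y $ i = a}"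
      then have z: "r i \<bullet> (?p - z) = 0" using p by (simp add: nu_nth inner_diff_right)
      have "y - z = (y - ?p) + (?p - z)" by simp
      moreover have "orthogonal (y - ?p) (?p - z)" using z by (simp add: orthogonal_def)
      ultimately have "(norm (y - z))\<^sup>2 = (norm (y - ?p))\<^sup>2 + (norm (?p - z))\<^sup>2"
        using norm_add_Pythagorean by metis
      then have "(norm (y - ?p))\<^sup>2 \<le> (norm (y - z))\<^sup>2" by simp
      then show "dist y ?p \<le> dist y z" unfolding dist_norm by (rule power2_le_imp_le) simp
    qed
  qed
  then show ?thesis unfolding face_proj_def affine_hull_side[OF a] by simp
qed

lemma norm_nrm: "a \<in> {0,1} \<Longrightarrow> norm (unit_normal i a) = 1"
  using r_nz by (auto simp: unit_normal_def)

lemma r_nrm: "r i \<bullet> unit_normal i a = (2 * a - 1) * norm (r i)"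
  using r_nz[of i] by (simp add: unit_normal_def dot_square_norm power2_eq_square)

text \<open>
  A vector that is orthogonal to all edges except the one in direction \<open>i\<close> is a multiple of the row
  \<open>i\<close> of the inverse matrix.
\<close>

lemma normal_direction:
  assumes a: "a \<in> {0,1}" and flat: "\<And>l t. l \<noteq> i \<Longrightarrow> n \<bullet> (B *v axis l 1) = 0"
  shows "n = (n \<bullet> (B *v axis i 1)) *\<^sub>R r i"
proof -
  have "n \<bullet> w = ((n \<bullet> (B *v axis i 1)) *\<^sub>R r i) \<bullet> w" for w
  proof -
    have "w = B *v (matrix_inv B *v w)"
      using matrix_inv_mult[OF invertible] by (simp add: matrix_vector_mul_assoc)
    also have "\<dots> = (\<Sum>l\<in>UNIV. (matrix_inv B *v w) $ l *\<^sub>R (B *v axis l 1))"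
      unfolding matrix_vector_mult_basis
      by (simp only: matrix_mult_sum[of B "matrix_inv B *v w"] scalar_mult_eq_scaleR)
    finally have "n \<bullet> w = n \<bullet> (\<Sum>l\<in>UNIV. (matrix_inv B *v w) $ l *\<^sub>R (B *v axis l 1))" by simp
    also have "\<dots> = (\<Sum>l\<in>UNIV. (matrix_inv B *v w) $ l * (n \<bullet> (B *v axis l 1)))"
      by (simp add: inner_sum_right)
    also have "\<dots> = (matrix_inv B *v w) $ i * (n \<bullet> (B *v axis i 1))"
      by (subst sum.remove[of _ i]) (auto simp: flat)
    finally show ?thesis by (simp add: r_def matrix_vector_mul_component)
  qed
  then show ?thesis by (metis vector_eq_rdot)
qed

lemma mu_upd_center: "mu (upd l t (center i a)) - mu (center i a) = (t - center i a $ l) *\<^sub>R (B *v axis l 1)"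
  by (simp add: mu_def upd_decomp algebra_simps matrix_vector_mult_scaleR)

lemma outer_normal_side:
  assumes a: "a \<in> {0,1}" shows "outer_normal body (side i a) = unit_normal i a"
  unfolding outer_normal_def
proof (rule the_equality)
  have "unit_normal i a \<bullet> (x - y) \<le> 0" if "y \<in> side i a" "x \<in> body" for x y
  proof -
    have "unit_normal i a \<bullet> (x - y) = (2 * a - 1) / norm (r i) * (nu x $ i - a)"
    proof -
      have "r i \<bullet> (x - y) = nu x $ i - a" using that by (auto simp: side_def nu_nth inner_diff_right)
      then show ?thesis by (simp add: unit_normal_def)
    qed
    also have "\<dots> \<le> 0" using a that r_nz[of i] by (auto simp: body_nth divide_simps)
    finally show ?thesis .
  qed
  then show "norm (unit_normal i a) = 1 \<and> (\<forall>y\<in>side i a. \<forall>x\<in>body. unit_normal i a \<bullet> (x - y) \<le> 0)"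
    using norm_nrm[OF a] by blast
next
  fix n assume n: "norm n = 1 \<and> (\<forall>y\<in>side i a. \<forall>x\<in>body. n \<bullet> (x - y) \<le> 0)"
  have le: "(t - center i a $ l) * (n \<bullet> (B *v axis l 1)) \<le> 0" if "t \<in> {0,1}" for t l
  proof -
    have "mu (upd l t (center i a)) \<in> body"
      using that a by (auto simp: body_nth center_nth)
    then have "n \<bullet> (mu (upd l t (center i a)) - mu (center i a)) \<le> 0"
      using n center_in_side[OF a] by blast
    then show ?thesis unfolding mu_upd_center by simp
  qed
  have flat: "n \<bullet> (B *v axis l 1) = 0" if "l \<noteq> i" for l
    using le[of 0 l] le[of 1 l] that by (simp add: center_nth)
  define c where "c = n \<bullet> (B *v axis i 1)"
  have nc: "n = c *\<^sub>R r i" using normal_direction[OF a, of i n] flat by (simp add: c_def)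
  then have "\<bar>c\<bar> * norm (r i) = 1" using n by simp
  moreover have "(2 * a - 1) * c \<ge> 0" using le[of "1 - a" i] a by (auto simp: center_nth c_def)
  ultimately have "c = (2 * a - 1) / norm (r i)" using a r_nz[of i] by (auto simp: field_simps abs_if split: if_splits)
  then show "n = unit_normal i a" by (simp add: nc unit_normal_def)
qed

subsection \<open>Integrals over bodies and faces\<close>

lemma body_integral:
  fixes h :: "real^'n \<Rightarrow> real"
  assumes [measurable]: "h \<in> borel_measurable borel"
  shows "(LINT y:body|lborel. h y) = \<bar>det B\<bar> * cube_int (\<lambda>x. h (mu x))"
proof -
  have [measurable]: "body \<in> sets borel" using compact_body by (rule borel_compact)
  have "(LINT y:body|lborel. h y) = \<bar>det B\<bar> * (LINT x|lborel. indicator body (B *v x + b) *\<^sub>R h (B *v x + b))"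
    unfolding set_lebesgue_integral_def by (rule integral_affine[OF det_nz]) measurable
  also have "(LINT x|lborel. indicator body (B *v x + b) *\<^sub>R h (B *v x + b)) = cube_int (\<lambda>x. h (mu x))"
    unfolding cube_int_def set_lebesgue_integral_def mu_def[symmetric]
    by (rule Bochner_Integration.integral_cong) (auto simp: indicator_def body_iff)
  finally show ?thesis .
qed

text \<open>
  The right prism of height one in the definition of the surface measure, with the hyperplane of the side
  as its middle section.
\<close>

definition prism :: "'n \<Rightarrow> real \<Rightarrow> (real^'n) set" where
  "prism i a = {x. face_proj (side i a) x \<in> side i a \<and> dist x (face_proj (side i a) x) \<le> 1/2}"

definition prism_matrix :: "'n \<Rightarrow> real \<Rightarrow> real^'n^'n" where
  "prism_matrix i a = (\<chi> k l. if l = i then unit_normal i a $ k else B $ k $ l)"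

lemma prism_map:
  "prism_matrix i a *v x + (b + a *\<^sub>R column i B - (1/2) *\<^sub>R unit_normal i a) = mu (upd i a x) + (x $ i - 1/2) *\<^sub>R unit_normal i a"
proof -
  have "(prism_matrix i a *v x) $ k = (x $ i) * unit_normal i a $ k + (\<Sum>l\<in>UNIV-{i}. B $ k $ l * x $ l)" for k
    unfolding matrix_vector_mult_def prism_matrix_def by (subst sum.remove[of _ i]) auto
  moreover have "(B *v upd i a x) $ k = B $ k $ i * a + (\<Sum>l\<in>UNIV-{i}. B $ k $ l * x $ l)" for k
    unfolding matrix_vector_mult_def by (subst sum.remove[of _ i]) auto
  ultimately show ?thesis
    by (simp add: vec_eq_iff mu_def column_def algebra_simps)
qed

text \<open>
  The linear part of the prism map is \<open>B\<close> with one column replaced by the normal, so Cramer's rule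
  gives its determinant.
\<close>

lemma det_prism_matrix: "a \<in> {0,1} \<Longrightarrow> \<bar>det (prism_matrix i a)\<bar> = \<bar>det B\<bar> * norm (r i)"
proof -
  assume a: "a \<in> {0,1}"
  have e: "B *v (matrix_inv B *v unit_normal i a) = unit_normal i a"
    using matrix_inv_mult[OF invertible] by (simp add: matrix_vector_mul_assoc)
  have "det (prism_matrix i a) = (matrix_inv B *v unit_normal i a) $ i * det B"
    using cramer_lemma[of i B "matrix_inv B *v unit_normal i a"] unfolding prism_matrix_def e .
  also have "(matrix_inv B *v unit_normal i a) $ i = (2 * a - 1) * norm (r i)"
    using r_nrm by (simp add: r_def matrix_vector_mul_component)
  finally show ?thesis using a by (auto simp: abs_mult)
qed

lemma face_proj_prism_map:
  assumes a: "a \<in> {0,1}"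
  shows "face_proj (side i a) (mu (upd i a x) + s *\<^sub>R unit_normal i a) = mu (upd i a x)"
proof -
  have "nu (mu (upd i a x) + s *\<^sub>R unit_normal i a) $ i = nu (mu (upd i a x)) $ i + s * (r i \<bullet> unit_normal i a)"
    unfolding nu_nth by (simp add: inner_add_right inner_diff_right)
  then have "nu (mu (upd i a x) + s *\<^sub>R unit_normal i a) $ i - a = s * (2 * a - 1) * norm (r i)"
    by (simp add: r_nrm)
  then have "((nu (mu (upd i a x) + s *\<^sub>R unit_normal i a) $ i - a) / (r i \<bullet> r i)) *\<^sub>R r i = s *\<^sub>R unit_normal i a"
    using r_nz[of i] by (simp add: unit_normal_def dot_square_norm power2_eq_square)
  then show ?thesis unfolding face_proj_side[OF a] by simp
qed

lemma continuous_face_proj: "a \<in> {0,1} \<Longrightarrow> continuous_on S (face_proj (side i a))"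
proof -
  assume "a \<in> {0,1}"
  then have "face_proj (side i a) = (\<lambda>y. y - ((nu y $ i - a) / (r i \<bullet> r i)) *\<^sub>R r i)"
    by (intro ext face_proj_side)
  then show ?thesis by (simp only:) (intro continuous_intros, use r_nz in auto)
qed

lemma closed_side: "closed (side i a)"
  unfolding side_hyperplane using compact_body by (intro closed_Int closed_hyperplane compact_imp_closed)

lemma compact_side: "compact (side i a)"
  unfolding side_hyperplane using compact_body by (intro compact_Int_closed closed_hyperplane)

lemma measurable_side: "side i a \<in> sets borel"
  using closed_side by (rule borel_closed)

lemma measurable_prism: assumes "a \<in> {0,1}" shows "prism i a \<in> sets borel"
proof -
  have [measurable]: "face_proj (side i a) \<in> borel \<rightarrow>\<^sub>M borel"
    by (rule borel_measurable_continuous_onI[OF continuous_face_proj[OF assms]])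
  note measurable_side [measurable]
  show ?thesis unfolding prism_def by measurable
qed

lemma prism_map_iff:
  assumes a: "a \<in> {0,1}"
  shows "mu (upd i a x) + (x $ i - 1/2) *\<^sub>R unit_normal i a \<in> prism i a \<longleftrightarrow> x \<in> ref_cube"
proof -
  have "mu (upd i a x) \<in> side i a \<longleftrightarrow> (\<forall>j. j \<noteq> i \<longrightarrow> x $ j \<in> {0..1})"
    using a by (auto simp: side_def body_iff upd_in_cube)
  moreover have "x \<in> ref_cube \<longleftrightarrow> x $ i \<in> {0..1} \<and> (\<forall>j. j \<noteq> i \<longrightarrow> x $ j \<in> {0..1})"
    using upd_in_cube[of i "x $ i" x] by simp
  moreover have "\<bar>x $ i - 1/2\<bar> \<le> 1/2 \<longleftrightarrow> x $ i \<in> {0..1}"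
    unfolding atLeastAtMost_iff by arith
  moreover have "dist (mu (upd i a x) + (x $ i - 1/2) *\<^sub>R unit_normal i a) (mu (upd i a x)) = \<bar>x $ i - 1/2\<bar>"
    using norm_nrm[OF a, of i] by (simp add: dist_norm)
  ultimately show ?thesis
    unfolding prism_def mem_Collect_eq face_proj_prism_map[OF a] by (simp only:) blast
qed

text \<open>
  The prism over a facet that defines the surface measure is the image of the whole cube under an affine
  map which runs along the facet in all coordinates but \<open>i\<close> and along the normal in the coordinate \<open>i\<close>.
  The change of variables therefore replaces a surface integral by an integral over the cube.
\<close>

lemma face_int_side:
  fixes f :: "real^'n \<Rightarrow> real"
  assumes a: "a \<in> {0,1}" and f [measurable]: "f \<in> borel_measurable borel"
  shows "face_int (side i a) f = \<bar>det B\<bar> * norm (r i) * cube_int (\<lambda>x. f (mu (upd i a x)))"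
proof -
  let ?p = "face_proj (side i a)"
  have [measurable]: "?p \<in> borel \<rightarrow>\<^sub>M borel"
    by (rule borel_measurable_continuous_onI[OF continuous_face_proj[OF a]])
  note measurable_side [measurable] measurable_prism[OF a, measurable]
  let ?h = "\<lambda>y. indicator (prism i a) y *\<^sub>R (indicator (side i a) (?p y) *\<^sub>R f (?p y))"
  have "face_int (side i a) f = (LINT y|restrict_space lborel (prism i a). indicator (side i a) (?p y) *\<^sub>R f (?p y))"
    unfolding face_int_def surf_def set_lebesgue_integral_def prism_def[symmetric]
    by (rule integral_distr)
      (auto intro!: measurable_restrict_space1 borel_measurable_scaleR borel_measurable_indicator f measurable_side)
  also have "\<dots> = (LINT y|lborel. ?h y)"
    by (subst integral_restrict_space) (auto simp: measurable_prism[OF a])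
  also have "\<dots> = \<bar>det (prism_matrix i a)\<bar> * (LINT x|lborel. ?h (prism_matrix i a *v x + (b + a *\<^sub>R column i B - (1/2) *\<^sub>R unit_normal i a)))"
    by (rule integral_affine) (use det_prism_matrix[OF a, of i] det_nz r_nz[of i] in auto)
  also have "(LINT x|lborel. ?h (prism_matrix i a *v x + (b + a *\<^sub>R column i B - (1/2) *\<^sub>R unit_normal i a))) = cube_int (\<lambda>x. f (mu (upd i a x)))"
    unfolding cube_int_def set_lebesgue_integral_def prism_map face_proj_prism_map[OF a]
  proof (rule Bochner_Integration.integral_cong[OF refl])
    fix x
    have "x \<in> ref_cube \<Longrightarrow> mu (upd i a x) \<in> side i a"
      using a by (auto simp: side_def body_iff ref_cube_def)
    then show "indicator (prism i a) (mu (upd i a x) + (x $ i - 1 / 2) *\<^sub>R unit_normal i a) *\<^sub>R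
         indicator (side i a) (mu (upd i a x)) *\<^sub>R f (mu (upd i a x)) = indicator ref_cube x *\<^sub>R f (mu (upd i a x))"
      using prism_map_iff[OF a, of i x] by (auto simp: indicator_def)
  qed
  finally show ?thesis by (simp add: det_prism_matrix[OF a])
qed

lemma finite_surf_side:
  assumes a: "a \<in> {0,1}" shows "finite_measure (surf (side i a))"
proof -
  have [measurable]: "face_proj (side i a) \<in> borel \<rightarrow>\<^sub>M borel"
    by (rule borel_measurable_continuous_onI[OF continuous_face_proj[OF a]])
  have "prism i a \<subseteq> (\<lambda>x. mu (upd i a x) + (x $ i - 1/2) *\<^sub>R unit_normal i a) ` ref_cube"
  proof
    fix y assume y: "y \<in> prism i a"
    define A where "A = prism_matrix i a"
    have "det A \<noteq> 0" using det_prism_matrix[OF a, of i] det_nz r_nz[of i] by (auto simp: A_def)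
    then have "invertible A" by (simp add: invertible_det_nz)
    then obtain x where "A *v x = y - (b + a *\<^sub>R column i B - (1/2) *\<^sub>R unit_normal i a)"
      using matrix_inv_mult(2)[of A] by (metis matrix_vector_mul_assoc matrix_vector_mul_lid)
    then have "y = mu (upd i a x) + (x $ i - 1/2) *\<^sub>R unit_normal i a"
      unfolding prism_map[symmetric] A_def by simp
    moreover from this y have "x \<in> ref_cube" using prism_map_iff[OF a] by simp
    ultimately show "y \<in> (\<lambda>x. mu (upd i a x) + (x $ i - 1/2) *\<^sub>R unit_normal i a) ` ref_cube" by blast
  qed
  moreover have "compact ((\<lambda>x. mu (upd i a x) + (x $ i - 1/2) *\<^sub>R unit_normal i a) ` ref_cube)"
    by (intro compact_continuous_image continuous_intros compact_ref_cube)
  ultimately have "bounded (prism i a)" using bounded_subset compact_imp_bounded by blast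
  then have fin: "emeasure lborel (prism i a) < \<infinity>" by (rule emeasure_bounded_finite)
  show ?thesis
  proof (rule finite_measureI)
    have "emeasure (surf (side i a)) (space (surf (side i a))) = emeasure (restrict_space lborel (prism i a)) (space (restrict_space lborel (prism i a)))"
      unfolding surf_def prism_def[symmetric] 
      by (subst emeasure_distr) (auto intro!: measurable_restrict_space1)
    also have "\<dots> = emeasure lborel (prism i a)"
      by (subst emeasure_restrict_space) (auto simp: measurable_prism[OF a] space_restrict_space)
    finally show "emeasure (surf (side i a)) (space (surf (side i a))) \<noteq> \<infinity>" using fin by simp
  qed
qed

text \<open>
  The contravariant transformation turns the divergence on the body into the divergence on the cube,
  where the fundamental theorem applies. The factors in \<open>face_int_side\<close> cancel the norm in the unit normal.
\<close>

lemma gauss: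
  fixes F :: "real^'n \<Rightarrow> real^'n"
  assumes d: "\<And>l x. (\<lambda>y. F y $ l) differentiable (at x)"
    and c: "\<And>k l. continuous_on UNIV (partial k (\<lambda>y. F y $ l))"
  shows "(LINT y:body|lborel. divergence F y) = (\<Sum>i\<in>UNIV. \<Sum>a\<in>{0,1}. face_int (side i a) (\<lambda>y. F y \<bullet> unit_normal i a))"
proof -
  have cF: "continuous_on UNIV (\<lambda>y. F y $ l)" for l
    using differentiable_imp_continuous_within[OF d] by (simp add: continuous_on_eq_continuous_within)
  have cF': "continuous_on UNIV F" using continuous_on_vec_lambda[of UNIV "\<lambda>l y. F y $ l"] cF by simp
  define Fh where "Fh i x = (\<Sum>l\<in>UNIV. r i $ l * F (mu x) $ l)" for i x
  have Fh_inner: "Fh i x = r i \<bullet> F (mu x)" for i x by (simp add: Fh_def inner_vec_def)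
  have dm: "(\<lambda>x. F (mu x) $ l) differentiable (at x)" for l x
  proof -
    have "mu differentiable (at x)"
      unfolding mu_def by (intro differentiable_add differentiable_const linear_imp_differentiable matrix_vector_mul_linear)
    from differentiable_chain_at[OF this d[of l "mu x"]] show ?thesis by (simp add: o_def)
  qed
  have pm: "partial i (\<lambda>x. F (mu x) $ l) x = (\<Sum>k\<in>UNIV. B $ k $ i * partial k (\<lambda>y. F y $ l) (mu x))" for i l x
    unfolding mu_def by (rule partial_affine) (use d in auto)
  have dFh: "Fh i differentiable (at x)" for i x
    unfolding Fh_def[abs_def] by (intro differentiable_sum) (auto simp: dm)
  have pFh: "partial i (Fh i) x = (\<Sum>l\<in>UNIV. r i $ l * (\<Sum>k\<in>UNIV. B $ k $ i * partial k (\<lambda>y. F y $ l) (mu x)))" for i x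
    unfolding Fh_def[abs_def] using dm
    by (subst partial_sum) (auto simp: partial_cmult pm intro!: differentiable_mult)
  have cpk: "continuous_on UNIV (\<lambda>x. partial k (\<lambda>y. F y $ l) (mu x))" for k l
    by (intro continuous_on_compose2[OF c] continuous_intros) auto
  have cpFh: "continuous_on UNIV (partial i (Fh i))" for i
    unfolding pFh[abs_def] by (intro continuous_intros cpk)
  have div: "divergence F (mu x) = (\<Sum>i\<in>UNIV. partial i (Fh i) x)" for x
  proof -
    have "(\<Sum>i\<in>UNIV. partial i (Fh i) x) = (\<Sum>i\<in>UNIV. \<Sum>l\<in>UNIV. \<Sum>k\<in>UNIV. (B $ k $ i * r i $ l) * partial k (\<lambda>y. F y $ l) (mu x))"
      by (simp add: pFh sum_distrib_left mult_ac)
    also have "\<dots> = (\<Sum>l\<in>UNIV. \<Sum>i\<in>UNIV. \<Sum>k\<in>UNIV. (B $ k $ i * r i $ l) * partial k (\<lambda>y. F y $ l) (mu x))"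
      by (rule sum.swap)
    also have "\<dots> = (\<Sum>l\<in>UNIV. \<Sum>k\<in>UNIV. \<Sum>i\<in>UNIV. (B $ k $ i * r i $ l) * partial k (\<lambda>y. F y $ l) (mu x))"
      by (intro sum.cong refl sum.swap)
    also have "\<dots> = (\<Sum>l\<in>UNIV. \<Sum>k\<in>UNIV. (if k = l then partial k (\<lambda>y. F y $ l) (mu x) else 0))"
    proof (intro sum.cong refl)
      fix l k
      have "(\<Sum>i\<in>UNIV. B $ k $ i * r i $ l) = (B ** matrix_inv B) $ k $ l"
        by (simp add: matrix_matrix_mult_def r_def)
      also have "\<dots> = (if k = l then 1 else 0)"
        using matrix_inv_mult[OF invertible] by (simp add: mat_def)
      finally show "(\<Sum>i\<in>UNIV. (B $ k $ i * r i $ l) * partial k (\<lambda>y. F y $ l) (mu x)) = (if k = l then partial k (\<lambda>y. F y $ l) (mu x) else 0)"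
        by (simp add: sum_distrib_right[symmetric])
    qed
    finally show ?thesis by (simp add: divergence_def)
  qed
  have "(LINT y:body|lborel. divergence F y) = \<bar>det B\<bar> * cube_int (\<lambda>x. divergence F (mu x))"
  proof (rule body_integral)
    have "continuous_on UNIV (divergence F)" unfolding divergence_def[abs_def] by (intro continuous_intros c)
    then show "divergence F \<in> borel_measurable borel" by (rule borel_measurable_continuous_onI)
  qed
  also have "cube_int (\<lambda>x. divergence F (mu x)) = (\<Sum>i\<in>UNIV. cube_int (partial i (Fh i)))"
    unfolding div by (intro cube_int_sum cpFh) auto
  also have "\<dots> = (\<Sum>i\<in>UNIV. cube_int (\<lambda>x. Fh i (upd i 1 x)) - cube_int (\<lambda>x. Fh i (upd i 0 x)))"
    by (intro sum.cong refl cube_int_partial dFh cpFh)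
  also have "\<bar>det B\<bar> * \<dots> = (\<Sum>i\<in>UNIV. \<Sum>a\<in>{0,1}. face_int (side i a) (\<lambda>y. F y \<bullet> unit_normal i a))"
    unfolding sum_distrib_left
  proof (intro sum.cong refl)
    fix i
    have "face_int (side i a) (\<lambda>y. F y \<bullet> unit_normal i a) = (2 * a - 1) * (\<bar>det B\<bar> * cube_int (\<lambda>x. Fh i (upd i a x)))" if "a \<in> {0,1}" for a
    proof -
      have "face_int (side i a) (\<lambda>y. F y \<bullet> unit_normal i a) = \<bar>det B\<bar> * norm (r i) * cube_int (\<lambda>x. F (mu (upd i a x)) \<bullet> unit_normal i a)"
        by (rule face_int_side[OF that]) (intro borel_measurable_continuous_onI continuous_intros cF')
      also have "(\<lambda>x. F (mu (upd i a x)) \<bullet> unit_normal i a) = (\<lambda>x. ((2 * a - 1) / norm (r i)) * Fh i (upd i a x))"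
        by (auto simp: unit_normal_def Fh_inner inner_commute)
      also have "cube_int \<dots> = ((2 * a - 1) / norm (r i)) * cube_int (\<lambda>x. Fh i (upd i a x))" by (rule cube_int_cmult)
      finally show ?thesis using r_nz[of i] by simp
    qed
    from this[of 0] this[of 1]
    show "\<bar>det B\<bar> * (cube_int (\<lambda>x. Fh i (upd i 1 x)) - cube_int (\<lambda>x. Fh i (upd i 0 x))) = (\<Sum>a\<in>{0,1}. face_int (side i a) (\<lambda>y. F y \<bullet> unit_normal i a))"
      by (simp add: right_diff_distrib)
  qed
  finally show ?thesis .
qed


lemma inward_from_side:
  assumes a: "a \<in> {0,1}" and y: "nu y $ i = a" "\<And>l. l \<noteq> i \<Longrightarrow> 0 < nu y $ l \<and> nu y $ l < 1"
  shows "\<forall>\<^sub>F t in at_right 0. y - t *\<^sub>R unit_normal i a \<in> interior body"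
proof -
  have e: "nu (y - t *\<^sub>R unit_normal i a) $ l = nu y $ l - t * (r l \<bullet> unit_normal i a)" for t l
    by (simp add: nu_nth inner_diff_right)
  have lim: "((\<lambda>t. nu y $ l - t * (r l \<bullet> unit_normal i a)) \<longlongrightarrow> nu y $ l) (at_right 0)" for l
    by (auto intro!: tendsto_eq_intros)
  have "\<forall>\<^sub>F t in at_right 0. 0 < nu (y - t *\<^sub>R unit_normal i a) $ l \<and> nu (y - t *\<^sub>R unit_normal i a) $ l < 1" for l
  proof (cases "l = i")
    case False
    have "\<forall>\<^sub>F t in at_right 0. 0 < nu y $ l - t * (r l \<bullet> unit_normal i a)"
      by (rule order_tendstoD(1)[OF lim]) (use y False in auto)
    moreover have "\<forall>\<^sub>F t in at_right 0. nu y $ l - t * (r l \<bullet> unit_normal i a) < 1"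
      by (rule order_tendstoD(2)[OF lim]) (use y False in auto)
    ultimately show ?thesis unfolding e by eventually_elim simp
  next
    case True
    have "\<forall>\<^sub>F t in at_right 0. t \<in> {0<..<1 / norm (r i)}"
      using r_nz[of i] by (intro eventually_at_right_real) auto
    then show ?thesis
    proof eventually_elim
      case (elim t)
      then have "0 < t * norm (r i)" "t * norm (r i) < 1" using r_nz[of i] by (auto simp: field_simps)
      then show ?case unfolding e True r_nrm y(1) using a by auto
    qed
  qed
  then have "\<forall>\<^sub>F t in at_right 0. \<forall>l\<in>UNIV. 0 < nu (y - t *\<^sub>R unit_normal i a) $ l \<and> nu (y - t *\<^sub>R unit_normal i a) $ l < 1"
    by (intro eventually_ball_finite) auto
  then show ?thesis by (simp add: interior_body)
qed

end

subsection \<open>Two parallelepipeds with a common facet\<close>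

locale facet_pair = P: parallelepiped B b + P': parallelepiped B' b'
  for B :: "real^'n::finite^'n" and b and B' :: "real^'n^'n" and b' +
  fixes i i' :: 'n and a a' :: real
  assumes a: "a \<in> {0,1}" and a': "a' \<in> {0,1}" and eq: "P.side i a = P'.side i' a'"
begin

text \<open>
  The centre of a facet is its centre of symmetry, and this does not depend on the parametrisation.
\<close>

lemma center_other:
  assumes "l \<noteq> i'"
  shows "0 < P'.nu (P.mu (P.center i a)) $ l \<and> P'.nu (P.mu (P.center i a)) $ l < 1"
proof -
  let ?c = "P.mu (P.center i a)"
  define refl where "refl z = 2 *\<^sub>R ?c - z" for z
  have refl_side: "refl z \<in> P'.side i' a'" if "z \<in> P'.side i' a'" for z
  proof -
    have z: "z \<in> P.side i a" using that eq by simp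
    have "P.nu (refl z) = 2 *\<^sub>R P.center i a - P.nu z"
    proof -
      have "P.nu (refl z) $ k = 2 * P.nu ?c $ k - P.nu z $ k" for k
        unfolding P.nu_nth refl_def by (simp add: inner_diff_right algebra_simps)
      then show ?thesis by (simp add: vec_eq_iff)
    qed
    then have "refl z \<in> P.side i a" using z a
      by (auto simp: P.side_def P.body_nth P.center_nth split: if_splits)
    then show ?thesis using eq by simp
  qed
  have nr: "P'.nu (refl z) $ l = 2 * P'.nu ?c $ l - P'.nu z $ l" for z
    unfolding P'.nu_nth refl_def by (simp add: inner_diff_right algebra_simps)
  have z: "P'.mu (upd l t (P'.center i' a')) \<in> P'.side i' a'" if "t \<in> {0,1}" for t
    using that a' assms by (auto simp: P'.side_def P'.body_nth P'.center_nth)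
  have "0 \<le> 2 * P'.nu ?c $ l - t \<and> 2 * P'.nu ?c $ l - t \<le> 1" if "t \<in> {0,1}" for t
  proof -
    let ?z = "P'.mu (upd l t (P'.center i' a'))"
    have "0 \<le> P'.nu (refl ?z) $ l \<and> P'.nu (refl ?z) $ l \<le> 1"
      using refl_side[OF z[OF that]] by (simp add: P'.side_def P'.body_nth)
    then show ?thesis unfolding nr by simp
  qed
  from this[of 0] this[of 1] show ?thesis by auto
qed

text \<open>
  Both normals are unit vectors orthogonal to the facet. If they were equal, points slightly inside one
  body below the centre of the facet would be interior to the other body as well.
\<close>

lemma opposite_normal:
  assumes disj: "interior P.body \<inter> interior P'.body = {}"
  shows "P'.unit_normal i' a' = - P.unit_normal i a"
proof -
  let ?n = "P.unit_normal i a" and ?n' = "P'.unit_normal i' a'" and ?c = "P.mu (P.center i a)"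
  have flat': "?n' \<bullet> (x - y) = 0" if "x \<in> P.side i a" "y \<in> P.side i a" for x y
  proof -
    have "P'.nu x $ i' = P'.nu y $ i'" using that unfolding eq by (simp add: P'.side_def)
    then show ?thesis by (simp add: P'.unit_normal_def P'.nu_nth inner_diff_right)
  qed
  have "?n' \<bullet> (B *v axis l 1) = 0" if "l \<noteq> i" for l
  proof -
    have "P.mu (upd l 1 (P.center i a)) \<in> P.side i a"
      using that a by (auto simp: P.side_def P.body_nth P.center_nth)
    from flat'[OF this P.center_in_side[OF a]] show ?thesis
      unfolding P.mu_upd_center using that by (simp add: P.center_nth)
  qed
  then obtain c where c: "?n' = c *\<^sub>R P.r i" using P.normal_direction[OF a, of i ?n'] by metis
  have "\<bar>c\<bar> * norm (P.r i) = 1" using P'.norm_nrm[OF a', of i'] unfolding c by simp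
  then have "c = 1 / norm (P.r i) \<or> c = - 1 / norm (P.r i)"
    using P.r_nz[of i] by (auto simp: field_simps abs_if split: if_splits)
  then have "?n' = ?n \<or> ?n' = - ?n" using a unfolding c P.unit_normal_def by auto
  moreover have "?n' \<noteq> ?n"
  proof
    assume "?n' = ?n"
    have "P.nu ?c $ i = a" using a by (simp add: P.center_nth)
    then have "\<forall>\<^sub>F t in at_right 0. ?c - t *\<^sub>R ?n \<in> interior P.body"
      by (intro P.inward_from_side[OF a]) (auto simp: P.center_nth)
    moreover have "P'.nu ?c $ i' = a'" using P.center_in_side[OF a, of i] unfolding eq by (simp add: P'.side_def)
    then have "\<forall>\<^sub>F t in at_right 0. ?c - t *\<^sub>R ?n' \<in> interior P'.body"
      by (intro P'.inward_from_side[OF a'] center_other)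
    ultimately have "\<forall>\<^sub>F t in at_right (0::real). False"
      by eventually_elim (use \<open>?n' = ?n\<close> disj in auto)
    then show False by simp
  qed
  ultimately show ?thesis by blast
qed

definition M where "M = matrix_inv B' ** B"

lemma nu_mu_affine: "P'.nu (P.mu x) - P'.nu (P.mu y) = M *v (x - y)"
  unfolding P'.nu_def P.mu_def M_def
  by (simp add: matrix_vector_mul_assoc[symmetric] matrix_vector_mult_diff_distrib[symmetric])

lemma nu_mu_side: "x \<in> ref_cube \<Longrightarrow> x $ i = a \<Longrightarrow> P'.nu (P.mu x) \<in> ref_cube \<and> P'.nu (P.mu x) $ i' = a'"
proof -
  assume "x \<in> ref_cube" "x $ i = a"
  then have "P.mu x \<in> P.side i a" by (simp add: P.side_def P.body_iff)
  then show ?thesis unfolding eq by (simp add: P'.side_def P'.body_iff)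
qed

lemma M_row: "l \<noteq> i \<Longrightarrow> M $ i' $ l = 0"
proof -
  assume l: "l \<noteq> i"
  let ?x = "upd l 1 (P.center i a)" and ?y = "upd l 0 (P.center i a)"
  have "?x \<in> ref_cube" "?x $ i = a" "?y \<in> ref_cube" "?y $ i = a"
    using a l by (auto simp: ref_cube_def P.center_nth)
  then have "(P'.nu (P.mu ?x) - P'.nu (P.mu ?y)) $ i' = 0" using nu_mu_side by simp
  moreover have "?x - ?y = axis l 1" by (auto simp: vec_eq_iff axis_def)
  ultimately show ?thesis
    unfolding nu_mu_affine by (simp add: matrix_vector_mult_basis column_def)
qed

lemma M_row_sum: "m \<noteq> i' \<Longrightarrow> (\<Sum>l\<in>UNIV-{i}. \<bar>M $ m $ l\<bar>) \<le> 1"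
proof -
  let ?x = "upd i a (\<chi> l. if M $ m $ l > 0 then 1 else 0)" and ?y = "upd i a (\<chi> l. if M $ m $ l > 0 then 0 else 1)"
  have "?x \<in> ref_cube" "?x $ i = a" "?y \<in> ref_cube" "?y $ i = a"
    using a by (auto simp: ref_cube_def)
  then have "P'.nu (P.mu ?x) \<in> ref_cube" "P'.nu (P.mu ?y) \<in> ref_cube" using nu_mu_side by blast+
  then have "(P'.nu (P.mu ?x) - P'.nu (P.mu ?y)) $ m \<le> 1"
    by (simp add: ref_cube_def) (smt (verit))
  moreover have "(M *v (?x - ?y)) $ m = (\<Sum>l\<in>UNIV-{i}. \<bar>M $ m $ l\<bar>)"
    unfolding matrix_vector_mult_def vec_lambda_beta
    by (subst sum.remove[of _ i]) (auto intro!: sum.cong simp: abs_if split: if_splits)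
  ultimately show ?thesis unfolding nu_mu_affine by simp
qed

end

context facet_pair begin

interpretation swap: facet_pair B' b' B b i' i a' a
  by unfold_locales (use a a' eq in auto)

text \<open>
  The change between the two parametrisations maps one face of the cube onto another, so each of
  its rows has sum of moduli at most one, and the same holds for the inverse. Then every column contains an
  entry of modulus one, which is alone in its row.
\<close>

lemma signed_permutation:
  obtains \<pi> where "inj_on \<pi> (UNIV - {i'})" "\<And>m l. m \<noteq> i' \<Longrightarrow> l \<noteq> i \<Longrightarrow> l \<noteq> \<pi> m \<Longrightarrow> M $ m $ l = 0"
proof -
  have ex: "\<exists>m. m \<noteq> i' \<and> \<bar>M $ m $ l\<bar> \<ge> 1" if l: "l \<noteq> i" for l
  proof (rule ccontr)
    assume "\<not> ?thesis"
    then have lt: "\<bar>M $ m $ l\<bar> < 1" if "m \<noteq> i'" for m using that by force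
    let ?N = "swap.M"
    have "?N ** M = mat 1"
      unfolding swap.M_def M_def
      by (metis P.invertible P'.invertible matrix_inv_mult matrix_mul_assoc matrix_mul_lid)
    then have "1 = (?N ** M) $ l $ l" by (simp add: mat_def)
    also have "\<dots> = (\<Sum>m\<in>UNIV-{i'}. ?N $ l $ m * M $ m $ l)"
      unfolding matrix_matrix_mult_def vec_lambda_beta
      by (subst sum.remove[of _ i']) (auto simp: M_row[OF l])
    finally have one: "(\<Sum>m\<in>UNIV-{i'}. ?N $ l $ m * M $ m $ l) = 1" by simp
    then obtain m0 where m0: "m0 \<in> UNIV - {i'}" "?N $ l $ m0 \<noteq> 0"
      by (metis (no_types, lifting) mult_zero_left sum.neutral zero_neq_one)
    have "(\<Sum>m\<in>UNIV-{i'}. ?N $ l $ m * M $ m $ l) < (\<Sum>m\<in>UNIV-{i'}. \<bar>?N $ l $ m\<bar>)"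
    proof (rule sum_strict_mono_ex1)
      show "\<forall>m\<in>UNIV-{i'}. ?N $ l $ m * M $ m $ l \<le> \<bar>?N $ l $ m\<bar>"
      proof
        fix m assume "m \<in> UNIV - {i'}"
        then have "\<bar>?N $ l $ m\<bar> * \<bar>M $ m $ l\<bar> \<le> \<bar>?N $ l $ m\<bar> * 1"
          using lt[of m] by (intro mult_left_mono) auto
        then show "?N $ l $ m * M $ m $ l \<le> \<bar>?N $ l $ m\<bar>" by (simp add: abs_mult[symmetric])
      qed
      have "\<bar>?N $ l $ m0\<bar> * \<bar>M $ m0 $ l\<bar> < \<bar>?N $ l $ m0\<bar> * 1"
        using lt[of m0] m0 by (intro mult_strict_left_mono) auto
      then have "?N $ l $ m0 * M $ m0 $ l < \<bar>?N $ l $ m0\<bar>" by (simp add: abs_mult[symmetric])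
      then show "\<exists>m\<in>UNIV-{i'}. ?N $ l $ m * M $ m $ l < \<bar>?N $ l $ m\<bar>" using m0 by blast
    qed simp
    also have "\<dots> \<le> 1" by (rule swap.M_row_sum[OF l])
    finally show False using one by simp
  qed
  then obtain \<rho> where \<rho>: "\<And>l. l \<noteq> i \<Longrightarrow> \<rho> l \<noteq> i' \<and> \<bar>M $ \<rho> l $ l\<bar> \<ge> 1" by metis
  have zero: "M $ \<rho> l $ l' = 0" if l: "l \<noteq> i" "l' \<noteq> i" "l' \<noteq> l" for l l'
  proof -
    have "\<bar>M $ \<rho> l $ l\<bar> + \<bar>M $ \<rho> l $ l'\<bar> = (\<Sum>k\<in>{l,l'}. \<bar>M $ \<rho> l $ k\<bar>)" using l by simp
    also have "\<dots> \<le> (\<Sum>k\<in>UNIV-{i}. \<bar>M $ \<rho> l $ k\<bar>)" using l by (intro sum_mono2) auto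
    also have "\<dots> \<le> 1" using \<rho>[OF l(1)] by (intro M_row_sum) auto
    finally show ?thesis using \<rho>[OF l(1)] by auto
  qed
  have inj: "inj_on \<rho> (UNIV - {i})"
  proof (rule inj_onI)
    fix l l' assume *: "l \<in> UNIV - {i}" "l' \<in> UNIV - {i}" "\<rho> l = \<rho> l'"
    show "l = l'"
    proof (rule ccontr)
      assume "l \<noteq> l'"
      then have "M $ \<rho> l' $ l' = 0" using zero[of l l'] * by simp
      then show False using \<rho>[of l'] * by auto
    qed
  qed
  have "\<rho> ` (UNIV - {i}) \<subseteq> UNIV - {i'}" using \<rho> by auto
  moreover have "card (\<rho> ` (UNIV - {i})) = card (UNIV - {i'})" using inj by (simp add: card_image)
  ultimately have surj: "\<rho> ` (UNIV - {i}) = UNIV - {i'}" by (intro card_subset_eq) auto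
  define \<pi> where "\<pi> = inv_into (UNIV - {i}) \<rho>"
  show ?thesis
  proof (rule that)
    show "inj_on \<pi> (UNIV - {i'})" unfolding \<pi>_def surj[symmetric] by (rule inj_on_inv_into) simp
    fix m l assume m: "m \<noteq> i'" and l: "l \<noteq> i" "l \<noteq> \<pi> m"
    have "m \<in> \<rho> ` (UNIV - {i})" using m surj by auto
    then have "\<pi> m \<in> UNIV - {i}" "\<rho> (\<pi> m) = m" unfolding \<pi>_def by (rule inv_into_into, rule f_inv_into_f)
    then show "M $ m $ l = 0" using zero[of "\<pi> m" l] l by auto
  qed
qed

text \<open>
  After a permutation and affine changes of single variables a polynomial still has degree at most
  \<open>k\<close> in each variable; so the polynomial spaces on a common facet that come from the two sides coincide.
\<close>

lemma face_polynomial_transfer: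
  assumes q: "q \<in> polys (\<lambda>_. k)"
  shows "\<exists>q'\<in>polys (\<lambda>_. k). \<forall>y\<in>P.side i a. q (P'.nu y) = q' (P.nu y)"
proof -
  obtain \<pi> where \<pi>: "inj_on \<pi> (UNIV - {i'})" "\<And>m l. m \<noteq> i' \<Longrightarrow> l \<noteq> i \<Longrightarrow> l \<noteq> \<pi> m \<Longrightarrow> M $ m $ l = 0"
    using signed_permutation by blast
  define c0 where "c0 = P'.nu (P.mu (upd i a 0))"
  have T: "P'.nu (P.mu (upd i a x)) $ m = c0 $ m + (\<Sum>l\<in>UNIV-{i}. M $ m $ l * x $ l)" for x m
  proof -
    have "P'.nu (P.mu (upd i a x)) - c0 = M *v (upd i a x - upd i a 0)" unfolding c0_def by (rule nu_mu_affine)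
    then have "P'.nu (P.mu (upd i a x)) $ m - c0 $ m = (M *v (upd i a x - upd i a 0)) $ m"
      by (metis vector_minus_component)
    also have "\<dots> = (\<Sum>l\<in>UNIV-{i}. M $ m $ l * x $ l)"
      unfolding matrix_vector_mult_def vec_lambda_beta by (subst sum.remove[of _ i]) (auto intro!: sum.cong)
    finally show ?thesis by simp
  qed
  have deg1: "(\<lambda>x. P'.nu (P.mu (upd i a x)) $ m) \<in> polys (\<lambda>l. if m \<noteq> i' \<and> l = \<pi> m then 1 else 0)" for m
  proof (cases "m = i'")
    case True
    then show ?thesis unfolding T by (simp add: M_row)
  next
    case False
    define c where "c = (if \<pi> m = i then 0 else M $ m $ \<pi> m)"
    have e: "(\<Sum>l\<in>UNIV-{i}. M $ m $ l * x $ l) = c * x $ \<pi> m" for x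
    proof (cases "\<pi> m = i")
      case True
      then have "(\<Sum>l\<in>UNIV-{i}. M $ m $ l * x $ l) = 0" using \<pi>(2)[OF False] by (intro sum.neutral) auto
      then show ?thesis using True by (simp add: c_def)
    next
      case nt: False
      have "(\<Sum>l\<in>UNIV-{i}. M $ m $ l * x $ l) = M $ m $ \<pi> m * x $ \<pi> m + (\<Sum>l\<in>UNIV-{i}-{\<pi> m}. M $ m $ l * x $ l)"
        using nt by (intro sum.remove) auto
      moreover have "(\<Sum>l\<in>UNIV-{i}-{\<pi> m}. M $ m $ l * x $ l) = 0"
        using \<pi>(2)[OF False] by (intro sum.neutral) auto
      ultimately show ?thesis using nt by (simp add: c_def)
    qed
    have "(\<lambda>x. x $ \<pi> m) \<in> polys (\<lambda>l. if m \<noteq> i' \<and> l = \<pi> m then 1 else 0)"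
      by (rule polys_coord) (use False in simp)
    from polys_add[OF polys_const polys_cmult[OF this]] show ?thesis unfolding T e .
  qed
  have "(\<lambda>x. q (P'.nu (P.mu (upd i a x)))) \<in> polys (\<lambda>_. k)"
    using q
  proof (induction rule: polys_induct)
    case (monomial c \<alpha>)
    have "(\<lambda>x. monomial \<alpha> (P'.nu (P.mu (upd i a x)))) \<in> polys (\<lambda>l. \<Sum>m\<in>UNIV. \<alpha> m * (if m \<noteq> i' \<and> l = \<pi> m then 1 else 0))"
      unfolding monomial_def by (rule polys_prod, simp, rule polys_power[OF deg1])
    moreover have "(\<Sum>m\<in>UNIV. \<alpha> m * (if m \<noteq> i' \<and> l = \<pi> m then 1 else 0)) \<le> k" for l
    proof -
      have "(\<Sum>m\<in>UNIV. \<alpha> m * (if m \<noteq> i' \<and> l = \<pi> m then 1 else 0)) = (\<Sum>m\<in>{m \<in> UNIV-{i'}. \<pi> m = l}. \<alpha> m)"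
        by (rule sum.mono_neutral_cong_right) auto
      also have "\<dots> \<le> k"
      proof (cases "\<exists>m. m \<noteq> i' \<and> \<pi> m = l")
        case True
        then obtain m where m: "m \<noteq> i'" "\<pi> m = l" by blast
        then have "{m \<in> UNIV-{i'}. \<pi> m = l} = {m}" using \<pi>(1) by (auto simp: inj_on_def)
        then show ?thesis using monomial by (simp add: exponents_def)
      next
        case False
        then have e: "{m \<in> UNIV-{i'}. \<pi> m = l} = {}" by blast
        show ?thesis unfolding e by simp
      qed
      finally show ?thesis .
    qed
    ultimately have "(\<lambda>x. monomial \<alpha> (P'.nu (P.mu (upd i a x)))) \<in> polys (\<lambda>_. k)" by (rule polys_mono)
    then show ?case by (rule polys_cmult)
  qed (auto intro: polys_add)
  moreover have "q (P'.nu y) = q (P'.nu (P.mu (upd i a (P.nu y))))" if "y \<in> P.side i a" for y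
  proof -
    have "upd i a (P.nu y) = P.nu y" using that by (auto simp: P.side_def)
    then show ?thesis by simp
  qed
  ultimately show ?thesis by (intro bexI[of _ "\<lambda>x. q (P'.nu (P.mu (upd i a x)))"]) auto
qed

end

section \<open>Elements and faces of a mesh\<close>

lemma rpf_component:
  assumes "real_polynomial_function f" shows "real_polynomial_function (\<lambda>x. c * f x)"
  using real_polynomial_function.intros(4)[OF real_polynomial_function.intros(2) assms] .

lemma continuous_vec_components:
  fixes v :: "'a::topological_space \<Rightarrow> real^'n::finite"
  assumes "\<And>i. continuous_on S (\<lambda>x. v x $ i)" shows "continuous_on S v"
  using continuous_on_vec_lambda[of S "\<lambda>i x. v x $ i"] assms by simp

definition poly_field :: "(real^'n::finite \<Rightarrow> real^'n) \<Rightarrow> bool" where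
  "poly_field v \<longleftrightarrow> (\<forall>i. real_polynomial_function (\<lambda>x. v x $ i))"

lemma poly_field_continuous: "poly_field v \<Longrightarrow> continuous_on S v"
  unfolding poly_field_def by (intro continuous_vec_components rpf_continuous) blast

lemma poly_field_inner: "poly_field v \<Longrightarrow> real_polynomial_function (\<lambda>x. v x \<bullet> n)"
  unfolding poly_field_def inner_vec_def
  by (intro real_polynomial_function_sum) (auto intro: real_polynomial_function.intros)

lemma poly_field_zero [simp]: "poly_field (\<lambda>x. 0)"
  by (auto simp: poly_field_def intro: real_polynomial_function.intros)

lemma poly_field_comb: "poly_field u \<Longrightarrow> poly_field v \<Longrightarrow> poly_field (\<lambda>x. s *\<^sub>R u x + t *\<^sub>R v x)"
  by (simp add: poly_field_def real_polynomial_function.intros(3) rpf_component)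

lemma poly_field_grad: "real_polynomial_function q \<Longrightarrow> poly_field (grad q)"
  by (simp add: poly_field_def grad_def rpf_partial)

locale element =
  fixes m :: "('n::finite) dgmesh" and E :: "(real^'n) set"
  assumes inv: "invertible (Bmat m E)" and E_eq: "E = elem_map m E ` ref_cube"
begin

sublocale P: parallelepiped "Bmat m E" "bvec m E"
  by unfold_locales (rule inv)

lemma mu_eq: "P.mu = elem_map m E"
  by (auto simp: P.mu_def elem_map_def)

lemma nu_eq: "inv (elem_map m E) = P.nu"
  using P.inv_mu by (simp add: mu_eq)

lemma body_eq: "P.body = E"
  using E_eq by (simp add: P.body_def mu_eq)

lemma facet_E: "e facet_of E \<Longrightarrow> \<exists>i. \<exists>a\<in>{0,1}. e = P.side i a"
  using P.facet_is_side by (simp add: body_eq)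

lemma side_facet_E: "a \<in> {0,1} \<Longrightarrow> P.side i a facet_of E"
  using P.side_facet by (simp add: body_eq)

lemma outer_normal_E: "a \<in> {0,1} \<Longrightarrow> outer_normal E (P.side i a) = P.unit_normal i a"
  using P.outer_normal_side by (simp add: body_eq)

lemma finite_facets: "finite {e. e facet_of E}"
  using P.facets_body by (simp add: body_eq)

lemma gauss_E:
  assumes "\<And>l x. (\<lambda>y. F y $ l) differentiable (at x)" "\<And>k l. continuous_on UNIV (partial k (\<lambda>y. F y $ l))"
  shows "(LINT y:E|lborel. divergence F y) = (\<Sum>e | e facet_of E. face_int e (\<lambda>y. F y \<bullet> outer_normal E e))"
proof -
  have "(\<Sum>e | e facet_of E. face_int e (\<lambda>y. F y \<bullet> outer_normal E e)) =
    (\<Sum>(i,a)\<in>UNIV \<times> {0,1}. face_int (P.side i a) (\<lambda>y. F y \<bullet> outer_normal E (P.side i a)))"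
    using P.facets_body sum.reindex[OF P.inj_sides] by (simp add: body_eq case_prod_unfold o_def)
  also have "\<dots> = (\<Sum>i\<in>UNIV. \<Sum>a\<in>{0,1}. face_int (P.side i a) (\<lambda>y. F y \<bullet> outer_normal E (P.side i a)))"
    by (rule sum.cartesian_product[symmetric])
  also have "\<dots> = (\<Sum>i\<in>UNIV. \<Sum>a\<in>{0,1}. face_int (P.side i a) (\<lambda>y. F y \<bullet> P.unit_normal i a))"
    by (intro sum.cong refl) (simp only: outer_normal_E)
  finally show ?thesis using P.gauss[OF assms] by (simp add: body_eq)
qed

lemma face_int_combination:
  assumes e: "e facet_of E" and f: "continuous_on UNIV f" and g: "continuous_on UNIV g"
  shows "face_int e (\<lambda>x. s * f x + t * g x) = s * face_int e f + t * face_int e g"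
proof -
  obtain i a where a: "a \<in> {0,1}" and e: "e = P.side i a" using facet_E[OF e] by blast
  have c: "continuous_on UNIV (\<lambda>x. h (P.mu (upd i a x)))" if "continuous_on UNIV h" for h :: "real^'n \<Rightarrow> real"
    by (intro continuous_on_compose2[OF that] continuous_intros) auto
  have fi: "face_int e h = \<bar>det (Bmat m E)\<bar> * norm (P.r i) * cube_int (\<lambda>x. h (P.mu (upd i a x)))" if "continuous_on UNIV h" for h
    unfolding e by (rule P.face_int_side[OF a borel_measurable_continuous_onI[OF that]])
  have "cube_int (\<lambda>x. s * f (P.mu (upd i a x)) + t * g (P.mu (upd i a x))) = 
      cube_int (\<lambda>x. s * f (P.mu (upd i a x))) + cube_int (\<lambda>x. t * g (P.mu (upd i a x)))"
    by (intro cube_int_add continuous_intros c f g)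
  then show ?thesis
    by (subst (1 2 3) fi) (auto intro!: continuous_intros f g simp: algebra_simps)
qed

lemma rpf_mu: "real_polynomial_function f \<Longrightarrow> real_polynomial_function (\<lambda>x. f (P.mu x))"
  unfolding P.mu_def by (rule rpf_affine)

lemma nu_affine: "P.nu x = matrix_inv (Bmat m E) *v x + (- (matrix_inv (Bmat m E) *v bvec m E))"
  by (simp add: P.nu_def matrix_vector_mult_diff_distrib)

lemma rpf_nu: "real_polynomial_function f \<Longrightarrow> real_polynomial_function (\<lambda>x. f (P.nu x))"
proof -
  assume f: "real_polynomial_function f"
  show ?thesis unfolding nu_affine by (rule rpf_affine[OF f])
qed

lemma rpf_upd:
  fixes f :: "real^'n \<Rightarrow> real"
  assumes f: "real_polynomial_function f" shows "real_polynomial_function (\<lambda>x. f (upd i a x))"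
proof -
  define A :: "real^'n^'n" where "A = (\<chi> k l. if k = l \<and> k \<noteq> i then 1 else 0)"
  have e: "upd i a x = A *v x + a *\<^sub>R axis i 1" for x :: "real^'n"
  proof -
    have "(A *v x) $ k = (if k = i then 0 else x $ k)" for k
    proof -
      have "(A *v x) $ k = (\<Sum>l\<in>UNIV. if l = k then (if k = i then 0 else x $ k) else 0)"
        unfolding matrix_vector_mult_def A_def vec_lambda_beta by (rule sum.cong) auto
      then show ?thesis by simp
    qed
    then show ?thesis by (simp add: vec_eq_iff axis_def)
  qed
  show ?thesis unfolding e by (rule rpf_affine[OF f])
qed

lemma face_int_square_zero:
  assumes e: "e facet_of E" and f: "real_polynomial_function f" and z: "face_int e (\<lambda>x. f x * f x) = 0"
    and x: "x \<in> e"
  shows "f x = 0"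
proof -
  obtain i a where a: "a \<in> {0,1}" and e: "e = P.side i a" using facet_E[OF e] by blast
  have rf: "real_polynomial_function (\<lambda>x. f (P.mu (upd i a x)))" by (rule rpf_upd[OF rpf_mu[OF f]])
  have "\<bar>det (Bmat m E)\<bar> * norm (P.r i) * cube_int (\<lambda>x. f (P.mu (upd i a x)) * f (P.mu (upd i a x))) = 0"
    using P.face_int_side[OF a, of "\<lambda>x. f x * f x" i] z
    by (simp add: e borel_measurable_continuous_onI continuous_on_mult rpf_continuous f)
  then have "cube_int (\<lambda>x. f (P.mu (upd i a x)) * f (P.mu (upd i a x))) = 0"
    using P.det_nz P.r_nz[of i] by simp
  from rpf_square_cint_0[OF rf this, of "P.nu x"] have "f (P.mu (upd i a (P.nu x))) = 0" .
  moreover have "upd i a (P.nu x) = P.nu x" using x by (auto simp: e P.side_def)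
  ultimately show ?thesis by simp
qed

lemma body_integral_square_zero:
  assumes f: "poly_field f" and z: "(LINT x:E|lborel. f x \<bullet> f x) = 0"
  shows "f x = 0"
proof -
  have c: "continuous_on UNIV (\<lambda>x. f x \<bullet> f x)" by (intro continuous_intros poly_field_continuous f)
  have fin: "f y = 0" if "y \<in> interior E" for y
    using set_integral_eq_0_imp[OF _ c _ z that] P.compact_body by (simp add: body_eq)
  have "f x $ i = 0" for i
  proof (rule rpf_eq_zero[of "\<lambda>x. f x $ i"])
    show "real_polynomial_function (\<lambda>x. f x $ i)" using f by (simp add: poly_field_def)
    show "open (interior E)" by simp
    have "P.mu (\<chi> i. 1/2) \<in> interior P.body" by (simp add: P.interior_body)
    then show "P.mu (\<chi> i. 1/2) \<in> interior E" by (simp only: body_eq)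
  qed (simp add: fin)
  then show ?thesis by (simp add: vec_eq_iff)
qed

subsection \<open>The local Raviart--Thomas space\<close>

lemma RT_elem_eq: "RT_elem m k E = piola m E ` {v. \<forall>i. (\<lambda>x. v x $ i) \<in> polys (rtdeg k i)}"
  by (simp add: RT_elem_def rtdeg_def[abs_def])

lemma Psi_elem_eq: "Psi_elem m k E = piola m E ` {v. \<forall>i. (\<lambda>x. v x $ i) \<in> polys (psideg k i)}"
  by (simp add: Psi_elem_def psideg_def[abs_def])

lemma piola_eq: "piola m E v y = (1 / \<bar>det (Bmat m E)\<bar>) *\<^sub>R (Bmat m E *v v (P.nu y))"
  by (simp add: piola_def nu_eq)

lemma piola_component: "piola m E v y $ i = (\<Sum>j\<in>UNIV. (Bmat m E $ i $ j / \<bar>det (Bmat m E)\<bar>) * v (P.nu y) $ j)"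
  by (simp add: piola_eq matrix_vector_mult_def sum_distrib_left sum_divide_distrib)

lemma piola_poly_field:
  assumes "\<And>i. real_polynomial_function (\<lambda>x. v x $ i)" shows "poly_field (piola m E v)"
  unfolding poly_field_def piola_component
  using rpf_nu[OF assms] by (intro allI real_polynomial_function_sum rpf_component) auto

lemma RT_elem_poly_field: "v \<in> RT_elem m k E \<Longrightarrow> poly_field v"
proof -
  assume "v \<in> RT_elem m k E"
  then obtain u where u: "v = piola m E u" "\<And>i. (\<lambda>x. u x $ i) \<in> polys (rtdeg k i)" unfolding RT_elem_eq by auto
  show ?thesis unfolding u(1) by (rule piola_poly_field[OF polys_real_polynomial_function[OF u(2)]])
qed

lemma Psi_elem_poly_field: "v \<in> Psi_elem m k E \<Longrightarrow> poly_field v"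
proof -
  assume "v \<in> Psi_elem m k E"
  then obtain u where u: "v = piola m E u" "\<And>i. (\<lambda>x. u x $ i) \<in> polys (psideg k i)" unfolding Psi_elem_eq by auto
  show ?thesis unfolding u(1) by (rule piola_poly_field[OF polys_real_polynomial_function[OF u(2)]])
qed

lemma piola_normal:
  "piola m E v (P.mu x) \<bullet> P.unit_normal i a = (2 * a - 1) / (\<bar>det (Bmat m E)\<bar> * norm (P.r i)) * v x $ i"
proof -
  have "P.r i \<bullet> (Bmat m E *v w) = w $ i" for w
  proof -
    have "P.r i \<bullet> (Bmat m E *v w) = (matrix_inv (Bmat m E) *v (Bmat m E *v w)) $ i"
      by (simp add: P.r_def matrix_vector_mul_component)
    also have "\<dots> = w $ i" using matrix_inv_mult[OF inv] by (simp add: matrix_vector_mul_assoc)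
    finally show ?thesis .
  qed
  then show ?thesis by (simp add: piola_eq P.unit_normal_def inner_commute[of _ "P.r i"])
qed

lemma piola_face_moment:
  assumes a: "a \<in> {0,1}" and v: "\<And>i. real_polynomial_function (\<lambda>x. v x $ i)" and q: "q \<in> polys D"
  shows "face_int (P.side i a) (\<lambda>x. (piola m E v x \<bullet> P.unit_normal i a) * q (P.nu x)) =
    (2 * a - 1) * cube_int (\<lambda>x. v (upd i a x) $ i * q (upd i a x))"
proof -
  have "face_int (P.side i a) (\<lambda>x. (piola m E v x \<bullet> P.unit_normal i a) * q (P.nu x)) =
     \<bar>det (Bmat m E)\<bar> * norm (P.r i) * cube_int (\<lambda>x. (piola m E v (P.mu (upd i a x)) \<bullet> P.unit_normal i a) * q (P.nu (P.mu (upd i a x))))"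
    by (rule P.face_int_side[OF a])
      (intro borel_measurable_continuous_onI continuous_intros poly_field_continuous piola_poly_field v
         rpf_continuous rpf_nu polys_real_polynomial_function[OF q])
  also have "cube_int (\<lambda>x. (piola m E v (P.mu (upd i a x)) \<bullet> P.unit_normal i a) * q (P.nu (P.mu (upd i a x)))) =
     cube_int (\<lambda>x. ((2 * a - 1) / (\<bar>det (Bmat m E)\<bar> * norm (P.r i))) * (v (upd i a x) $ i * q (upd i a x)))"
    unfolding piola_normal by (simp add: mult.assoc)
  also have "\<dots> = ((2 * a - 1) / (\<bar>det (Bmat m E)\<bar> * norm (P.r i))) * cube_int (\<lambda>x. v (upd i a x) $ i * q (upd i a x))"
    by (rule cube_int_cmult)
  finally show ?thesis using P.det_nz P.r_nz[of i] by simp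
qed

lemma piola_body_moment:
  assumes v: "\<And>i. real_polynomial_function (\<lambda>x. v x $ i)" and w: "\<And>i. real_polynomial_function (\<lambda>x. w x $ i)"
  shows "\<bar>det (Bmat m E)\<bar> * (LINT x:E|lborel. piola m E v x \<bullet> piola m E w x) = Bform (Bmat m E) (\<lambda>i x. v x $ i) (\<lambda>i x. w x $ i)"
proof -
  define d where "d = \<bar>det (Bmat m E)\<bar>"
  have d: "d \<noteq> 0" using P.det_nz by (simp add: d_def)
  have "(LINT x:P.body|lborel. piola m E v x \<bullet> piola m E w x) = d * cube_int (\<lambda>x. piola m E v (P.mu x) \<bullet> piola m E w (P.mu x))"
    unfolding d_def by (rule P.body_integral)
      (intro borel_measurable_continuous_onI continuous_intros poly_field_continuous piola_poly_field v w)
  also have "cube_int (\<lambda>x. piola m E v (P.mu x) \<bullet> piola m E w (P.mu x)) = cube_int (\<lambda>x. (1 / d * (1 / d)) * ((Bmat m E *v v x) \<bullet> (Bmat m E *v w x)))"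
    by (simp add: piola_eq d_def[symmetric])
  also have "\<dots> = (1 / d * (1 / d)) * Bform (Bmat m E) (\<lambda>i x. v x $ i) (\<lambda>i x. w x $ i)"
    unfolding Bform_def cube_int_cmult by simp
  finally show ?thesis using d by (simp add: body_eq d_def[symmetric])
qed

lemma RT_element_unique:
  assumes v: "v \<in> RT_elem m k E"
    and face: "\<And>e q. e facet_of E \<Longrightarrow> q \<in> polys (\<lambda>_. k) \<Longrightarrow>
       face_int e (\<lambda>x. (v x \<bullet> outer_normal E e) * q (inv (elem_map m E) x)) = 0"
    and inner: "\<And>w. k > 0 \<Longrightarrow> w \<in> Psi_elem m k E \<Longrightarrow> (LINT x:E|lborel. v x \<bullet> w x) = 0"
  shows "v = (\<lambda>x. 0)"
proof -
  obtain u where u: "v = piola m E u" "\<And>i. (\<lambda>x. u x $ i) \<in> polys (rtdeg k i)" using v unfolding RT_elem_eq by auto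
  have ru: "real_polynomial_function (\<lambda>x. u x $ i)" for i by (rule polys_real_polynomial_function[OF u(2)])
  have "u x $ i = 0" for i x
  proof (rule RT_reference_unique[OF inv, of "\<lambda>i x. u x $ i"])
    show "(\<lambda>x. u x $ i) \<in> polys (rtdeg k i)" for i by (rule u(2))
  next
    fix i and a :: real and q :: "real^'n \<Rightarrow> real" assume a: "a \<in> {0,1}" and q: "q \<in> polys (\<lambda>_. k)"
    have "(2 * a - 1) * cube_int (\<lambda>x. u (upd i a x) $ i * q (upd i a x)) = 0"
      using face[OF side_facet_E[OF a, of i] q] piola_face_moment[OF a ru q, of i]
      by (simp add: outer_normal_E[OF a] nu_eq u(1))
    then show "cube_int (\<lambda>x. u (upd i a x) $ i * q (upd i a x)) = 0" using a by auto
  next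
    fix w :: "'n \<Rightarrow> real^'n \<Rightarrow> real" assume k: "k > 0" and w: "\<And>i. w i \<in> polys (psideg k i)"
    let ?w = "\<lambda>x. \<chi> i. w i x"
    have "piola m E ?w \<in> Psi_elem m k E" unfolding Psi_elem_eq using w by auto
    from inner[OF k this] show "Bform (Bmat m E) (\<lambda>i x. u x $ i) w = 0"
      using piola_body_moment[OF ru, of ?w] polys_real_polynomial_function[OF w] by (simp add: u(1))
  qed
  then show ?thesis by (auto simp: u(1) piola_eq vec_eq_iff matrix_vector_mult_def)
qed

text \<open>
  The Piola map makes the face moments on the element equal, up to sign, to those on the cube, and the
  interior moments equal to the form \<open>Bform\<close> up to the determinant.
\<close>

lemma RT_element_exists:
  assumes H: "\<And>e. continuous_on UNIV (H e)"
    and L: "\<And>u v s t. k > 0 \<Longrightarrow> u \<in> Psi_elem m k E \<Longrightarrow> v \<in> Psi_elem m k E \<Longrightarrow>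
       L (\<lambda>x. s *\<^sub>R u x + t *\<^sub>R v x) = s * L u + t * (L v :: real)"
  shows "\<exists>v\<in>RT_elem m k E.
     (\<forall>e q. e facet_of E \<longrightarrow> q \<in> polys (\<lambda>_. k) \<longrightarrow>
        face_int e (\<lambda>x. (v x \<bullet> outer_normal E e) * q (inv (elem_map m E) x)) =
        face_int e (\<lambda>x. H e x * q (inv (elem_map m E) x))) \<and>
     (k > 0 \<longrightarrow> (\<forall>w\<in>Psi_elem m k E. (LINT x:E|lborel. v x \<bullet> w x) = L w))"
proof -
  let ?d = "\<bar>det (Bmat m E)\<bar>"
  define H' where "H' i a z = ((2 * a - 1) * (?d * norm (P.r i))) * H (P.side i a) (P.mu z)" for i a z
  define L' where "L' w = ?d * L (piola m E (\<lambda>x. \<chi> i. w i x))" for w :: "'n \<Rightarrow> real^'n \<Rightarrow> real"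
  have cH': "continuous_on UNIV (H' i a)" for i a
    unfolding H'_def[abs_def] by (intro continuous_intros continuous_on_compose2[OF H]) auto
  have linL': "L' (\<lambda>i x. s * u i x + t * v i x) = s * L' u + t * L' v"
    if "k > 0" "\<And>i. u i \<in> polys (psideg k i)" "\<And>i. v i \<in> polys (psideg k i)" for u v s t
  proof -
    have "piola m E (\<lambda>x. \<chi> i. s * u i x + t * v i x) = (\<lambda>x. s *\<^sub>R piola m E (\<lambda>x. \<chi> i. u i x) x + t *\<^sub>R piola m E (\<lambda>x. \<chi> i. v i x) x)"
      by (auto simp: vec_eq_iff piola_component sum.distrib sum_distrib_left algebra_simps)
    moreover have "piola m E (\<lambda>x. \<chi> i. u i x) \<in> Psi_elem m k E" "piola m E (\<lambda>x. \<chi> i. v i x) \<in> Psi_elem m k E"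
      unfolding Psi_elem_eq using that by auto
    ultimately show ?thesis unfolding L'_def using L[OF that(1)] by (simp add: algebra_simps)
  qed
  have "\<exists>v. (\<forall>i. v i \<in> polys (rtdeg k i)) \<and>
     (\<forall>i. \<forall>a\<in>{0,1}. \<forall>q\<in>polys (\<lambda>_. k). cube_int (\<lambda>x. v i (upd i a x) * q (upd i a x)) = cube_int (\<lambda>x. H' i a (upd i a x) * q (upd i a x))) \<and>
     (k > 0 \<longrightarrow> (\<forall>r. (\<forall>i. r i \<in> polys (psideg k i)) \<longrightarrow> Bform (Bmat m E) v r = L' r))"
    by (rule RT_reference_exists[OF inv cH']) (rule linL')
  then obtain u where u': "\<forall>i. u i \<in> polys (rtdeg k i)"
     "\<forall>i. \<forall>a\<in>{0,1}. \<forall>q\<in>polys (\<lambda>_. k). cube_int (\<lambda>x. u i (upd i a x) * q (upd i a x)) = cube_int (\<lambda>x. H' i a (upd i a x) * q (upd i a x))"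
     "k > 0 \<longrightarrow> (\<forall>r. (\<forall>i. r i \<in> polys (psideg k i)) \<longrightarrow> Bform (Bmat m E) u r = L' r)"
    by (elim exE conjE)
  have u: "\<And>i. u i \<in> polys (rtdeg k i)"
    "\<And>i a q. a \<in> {0,1} \<Longrightarrow> q \<in> polys (\<lambda>_. k) \<Longrightarrow> cube_int (\<lambda>x. u i (upd i a x) * q (upd i a x)) = cube_int (\<lambda>x. H' i a (upd i a x) * q (upd i a x))"
    "\<And>w. k > 0 \<Longrightarrow> (\<And>i. w i \<in> polys (psideg k i)) \<Longrightarrow> Bform (Bmat m E) u w = L' w"
    using u' by blast+
  let ?u = "\<lambda>x. \<chi> i. u i x"
  have ru: "real_polynomial_function (\<lambda>x. ?u x $ i)" for i using polys_real_polynomial_function[OF u(1)] by simp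
  show ?thesis
  proof (intro bexI[of _ "piola m E ?u"] conjI allI impI ballI)
    show "piola m E ?u \<in> RT_elem m k E" unfolding RT_elem_eq using u(1) by auto
    fix e q assume "e facet_of E" and q: "q \<in> polys (\<lambda>_::'n. k)"
    then obtain i a where a: "a \<in> {0,1}" and e: "e = P.side i a" using facet_E by blast
    have "face_int e (\<lambda>x. (piola m E ?u x \<bullet> outer_normal E e) * q (inv (elem_map m E) x)) =
        (2 * a - 1) * cube_int (\<lambda>x. H' i a (upd i a x) * q (upd i a x))"
      unfolding e outer_normal_E[OF a] nu_eq piola_face_moment[OF a ru q] using u(2)[OF a q, of i] by simp
    also have "\<dots> = (2 * a - 1) * cube_int (\<lambda>x. ((2 * a - 1) * (?d * norm (P.r i))) * (H (P.side i a) (P.mu (upd i a x)) * q (upd i a x)))"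
      unfolding H'_def by (simp only: mult.assoc)
    also have "\<dots> = ?d * norm (P.r i) * cube_int (\<lambda>x. H (P.side i a) (P.mu (upd i a x)) * q (upd i a x))"
      unfolding cube_int_cmult using a by auto
    also have "\<dots> = face_int e (\<lambda>x. H e x * q (inv (elem_map m E) x))"
      unfolding e nu_eq
      by (subst P.face_int_side[OF a])
        (intro borel_measurable_continuous_onI continuous_intros H
          rpf_continuous[OF rpf_nu[OF polys_real_polynomial_function[OF q]]], simp)
    finally show "face_int e (\<lambda>x. (piola m E ?u x \<bullet> outer_normal E e) * q (inv (elem_map m E) x)) =
        face_int e (\<lambda>x. H e x * q (inv (elem_map m E) x))" .
  next
    fix w assume k: "k > 0" and "w \<in> Psi_elem m k E"
    then obtain z where z: "w = piola m E z" "\<And>i. (\<lambda>x. z x $ i) \<in> polys (psideg k i)" unfolding Psi_elem_eq by auto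
    have "?d * (LINT x:E|lborel. piola m E ?u x \<bullet> w x) = Bform (Bmat m E) u (\<lambda>i x. z x $ i)"
      using piola_body_moment[OF ru, of z] polys_real_polynomial_function[OF z(2)] by (simp add: z(1))
    also have "\<dots> = ?d * L w" using u(3)[OF k z(2)] by (simp add: L'_def z(1))
    finally show "(LINT x:E|lborel. piola m E ?u x \<bullet> w x) = L w" using P.det_nz by simp
  qed
qed

lemma RT_elem_trace:
  assumes v: "v \<in> RT_elem m k E" and e: "e facet_of E"
  shows "\<exists>q\<in>polys (\<lambda>_. k). \<forall>x\<in>e. v x \<bullet> outer_normal E e = q (inv (elem_map m E) x)"
proof -
  obtain i a where a: "a \<in> {0,1}" and e: "e = P.side i a" using facet_E[OF e] by blast
  obtain u where u: "v = piola m E u" "\<And>i. (\<lambda>x. u x $ i) \<in> polys (rtdeg k i)" using v unfolding RT_elem_eq by auto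
  let ?q = "\<lambda>x. (2 * a - 1) / (\<bar>det (Bmat m E)\<bar> * norm (P.r i)) * u (upd i a x) $ i"
  have "(\<lambda>x. u (upd i a x) $ i) \<in> polys (\<lambda>_. k)"
    using polys_upd[OF u(2)[of i], of i a] by (rule polys_mono) (simp add: rtdeg_def)
  then have "?q \<in> polys (\<lambda>_. k)" by (rule polys_cmult)
  moreover have "v x \<bullet> outer_normal E e = ?q (inv (elem_map m E) x)" if "x \<in> e" for x
  proof -
    have "upd i a (P.nu x) = P.nu x" using that by (auto simp: e P.side_def)
    then show ?thesis
      using piola_normal[of u "P.nu x" i a] unfolding e outer_normal_E[OF a] u(1) nu_eq P.mu_nu by (simp only:)
  qed
  ultimately show ?thesis by (intro bexI[of _ ?q] ballI)
qed

lemma RT_elem_components: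
  assumes "v \<in> RT_elem m k E" shows "\<exists>q\<in>polys (\<lambda>_. Suc k). (\<lambda>x. v x $ i) = q \<circ> inv (elem_map m E)"
proof -
  obtain u where u: "v = piola m E u" "\<And>i. (\<lambda>x. u x $ i) \<in> polys (rtdeg k i)" using assms unfolding RT_elem_eq by auto
  have "(\<lambda>x. \<Sum>j\<in>UNIV. (Bmat m E $ i $ j / \<bar>det (Bmat m E)\<bar>) * u x $ j) \<in> polys (\<lambda>_. Suc k)"
    by (rule polys_sum, simp, rule polys_cmult, rule polys_mono[OF u(2)], simp add: rtdeg_def)
  moreover have "(\<lambda>x. v x $ i) = (\<lambda>x. \<Sum>j\<in>UNIV. (Bmat m E $ i $ j / \<bar>det (Bmat m E)\<bar>) * u x $ j) \<circ> inv (elem_map m E)"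
    unfolding u(1) piola_component nu_eq o_def ..
  ultimately show ?thesis by blast
qed

lemma RT_elem_comb:
  assumes "u \<in> RT_elem m k E" "v \<in> RT_elem m k E" shows "(\<lambda>x. s *\<^sub>R u x + t *\<^sub>R v x) \<in> RT_elem m k E"
proof -
  obtain u' where u: "u = piola m E u'" "\<And>i. (\<lambda>x. u' x $ i) \<in> polys (rtdeg k i)" using assms(1) unfolding RT_elem_eq by auto
  obtain v' where v: "v = piola m E v'" "\<And>i. (\<lambda>x. v' x $ i) \<in> polys (rtdeg k i)" using assms(2) unfolding RT_elem_eq by auto
  have "(\<lambda>x. s *\<^sub>R u x + t *\<^sub>R v x) = piola m E (\<lambda>x. s *\<^sub>R u' x + t *\<^sub>R v' x)"
    by (auto simp: u v vec_eq_iff piola_component sum.distrib sum_distrib_left algebra_simps)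
  moreover have "(\<lambda>x. (s *\<^sub>R u' x + t *\<^sub>R v' x) $ i) \<in> polys (rtdeg k i)" for i
    using polys_comb[OF u(2) v(2)] by simp
  ultimately show ?thesis unfolding RT_elem_eq by blast
qed

lemma RT_elem_zero: "(\<lambda>x. 0) \<in> RT_elem m k E"
  unfolding RT_elem_eq by (rule image_eqI[of _ _ "\<lambda>x. 0"]) (auto simp: piola_eq)

text \<open>
  If the columns of \<open>B\<close> are orthogonal, the rows of its inverse are multiples of the columns of \<open>B\<close>.
  The covariant transformation of gradients and the contravariant Piola map then agree up to diagonal
  scaling, and differentiation lowers the degree in the variable concerned.
\<close>

lemma grad_in_Psi:
  assumes q: "q \<in> polys (\<lambda>_. k)" and orth: "\<And>i j. i \<noteq> j \<Longrightarrow> column i (Bmat m E) \<bullet> column j (Bmat m E) = 0"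
  shows "grad (q \<circ> inv (elem_map m E)) \<in> Psi_elem m k E"
proof -
  let ?B = "Bmat m E"
  define u where "u x = (\<chi> l. (\<bar>det ?B\<bar> / (norm (column l ?B))\<^sup>2) * partial l q x)" for x
  have "(\<lambda>x. u x $ l) \<in> polys (psideg k l)" for l
  proof -
    have e: "psideg k l = (\<lambda>_::'n. k)(l := k - 1)" by (auto simp: psideg_def)
    show ?thesis unfolding u_def vec_lambda_beta e by (rule polys_cmult[OF polys_partial[OF q, of l]])
  qed
  moreover have "grad (q \<circ> inv (elem_map m E)) = piola m E u"
  proof
    fix y
    have cn: "column l ?B \<noteq> 0" for l
    proof
      assume z: "column l ?B = 0"
      then have "?B *v axis l 1 = 0" by (simp add: matrix_vector_mult_basis)
      then have "axis l (1::real) = (0::real^'n)" using P.inj_B by (metis injD matrix_vector_mult_0_right)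
      then show False by (simp add: axis_eq_0_iff)
    qed
    have rl: "P.r l = (1 / (norm (column l ?B))\<^sup>2) *\<^sub>R column l ?B" for l
    proof -
      have "matrix_inv ?B *v column j ?B = axis j 1" for j
        using matrix_inv_mult[OF inv] by (simp add: matrix_vector_mult_basis[symmetric] matrix_vector_mul_assoc)
      then have "(matrix_inv ?B *v column j ?B) $ l = (if j = l then 1 else 0)" for j l
        by (simp add: axis_def)
      then have r1: "P.r l \<bullet> column j ?B = (if j = l then 1 else 0)" for j l
        by (simp add: P.r_def matrix_vector_mul_component)
      have step: "P.r l \<bullet> (?B *v w) = ((1 / (norm (column l ?B))\<^sup>2) *\<^sub>R column l ?B) \<bullet> (?B *v w)" for w
        unfolding matrix_mult_sum scalar_mult_eq_scaleR inner_sum_right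
        using cn[of l] by (intro sum.cong refl) (auto simp: r1 orth dot_square_norm)
      have "P.r l \<bullet> w = ((1 / (norm (column l ?B))\<^sup>2) *\<^sub>R column l ?B) \<bullet> w" for w
        using step[of "matrix_inv ?B *v w"] matrix_inv_mult[OF inv] by (simp add: matrix_vector_mul_assoc)
      then show ?thesis using vector_eq_rdot by blast
    qed
    have dq: "q differentiable (at x)" for x by (rule rpf_differentiable[OF polys_real_polynomial_function[OF q]])
    have "grad (q \<circ> inv (elem_map m E)) y $ k = piola m E u y $ k" for k
    proof -
      have nu: "(q \<circ> inv (elem_map m E)) = (\<lambda>x. q (matrix_inv ?B *v x + (- (matrix_inv ?B *v bvec m E))))"
        unfolding o_def nu_eq nu_affine ..
      have "grad (q \<circ> inv (elem_map m E)) y $ k = (\<Sum>l\<in>UNIV. matrix_inv ?B $ l $ k * partial l q (P.nu y))"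
        unfolding grad_def vec_lambda_beta nu partial_affine[OF dq] nu_affine ..
      also have "\<dots> = (\<Sum>l\<in>UNIV. P.r l $ k * partial l q (P.nu y))" by (simp add: P.r_def)
      also have "\<dots> = piola m E u y $ k"
        unfolding piola_component u_def rl using P.det_nz by (intro sum.cong refl) (simp add: column_def)
      finally show ?thesis .
    qed
    then show "grad (q \<circ> inv (elem_map m E)) y = piola m E u y" by (simp add: vec_eq_iff)
  qed
  ultimately show ?thesis unfolding Psi_elem_eq by auto
qed

end

section \<open>Integration by parts on a mesh\<close>

definition C1 :: "(real^'n::finite \<Rightarrow> real) \<Rightarrow> bool" where
  "C1 f \<longleftrightarrow> (\<forall>x. f differentiable (at x)) \<and> (\<forall>k. continuous_on UNIV (partial k f))"

lemma C1_rpf: "real_polynomial_function f \<Longrightarrow> C1 f"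
  by (simp add: C1_def rpf_differentiable rpf_continuous rpf_partial)

lemma C1_continuous: "C1 f \<Longrightarrow> continuous_on UNIV f"
  unfolding C1_def using differentiable_imp_continuous_within by (auto simp: continuous_on_eq_continuous_within)

lemma C1_mult: "C1 f \<Longrightarrow> C1 g \<Longrightarrow> C1 (\<lambda>x. f x * g x)"
proof -
  assume f: "C1 f" and g: "C1 g"
  then have "partial k (\<lambda>x. f x * g x) = (\<lambda>x. f x * partial k g x + partial k f x * g x)" for k
    by (auto simp: C1_def partial_mult)
  then show ?thesis using f g C1_continuous[OF f] C1_continuous[OF g]
    by (auto simp: C1_def intro!: continuous_intros differentiable_mult)
qed

lemma divergence_continuous: "poly_field v \<Longrightarrow> continuous_on S (divergence v)"
  unfolding divergence_def[abs_def] poly_field_def by (intro continuous_intros rpf_continuous rpf_partial) auto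

lemma divergence_product:
  assumes "C1 q" "poly_field v"
  shows "divergence (\<lambda>x. q x *\<^sub>R v x) x = q x * divergence v x + v x \<bullet> grad q x"
proof -
  have "partial i (\<lambda>y. q y * v y $ i) x = q x * partial i (\<lambda>y. v y $ i) x + partial i q x * v x $ i" for i
    using assms by (intro partial_mult) (auto simp: C1_def poly_field_def rpf_differentiable)
  then show ?thesis
    by (simp add: divergence_def sum.distrib sum_distrib_left inner_vec_def grad_def mult.commute)
qed

lemma face_int_cong: "(\<And>x. x \<in> e \<Longrightarrow> f x = g x) \<Longrightarrow> face_int e f = face_int e g"
  unfolding face_int_def set_lebesgue_integral_def
  by (rule Bochner_Integration.integral_cong[OF refl]) (auto simp: indicator_def)

lemma face_int_cmult: "face_int e (\<lambda>x. c * f x) = c * face_int e f"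
  unfolding face_int_def by simp

lemma face_int_zero [simp]: "face_int e (\<lambda>x. 0) = 0"
  unfolding face_int_def by simp

lemma face_int_minus: "face_int e (\<lambda>x. - f x) = - face_int e f"
  using face_int_cmult[of e "-1" f] by simp

context element begin

lemma compact_E: "compact E" using P.compact_body by (simp add: body_eq)

lemma convex_E: "convex E" using P.convex_body by (simp add: body_eq)

lemma set_integrable_E: "continuous_on UNIV f \<Longrightarrow> set_integrable lborel E (f :: _ \<Rightarrow> real)"
  by (rule set_integrable_continuous[OF compact_E])

lemma gauss_product:
  assumes q: "C1 q" and v: "poly_field v"
  shows "(LINT x:E|lborel. divergence v x * q x) + (LINT x:E|lborel. v x \<bullet> grad q x) =
    (\<Sum>e | e facet_of E. face_int e (\<lambda>x. q x * (v x \<bullet> outer_normal E e)))"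
proof -
  have cg: "continuous_on UNIV (grad q)" 
    by (rule continuous_vec_components) (use q in \<open>simp add: grad_def C1_def\<close>)
  have "(LINT x:E|lborel. divergence (\<lambda>x. q x *\<^sub>R v x) x) = 
    (LINT x:E|lborel. divergence v x * q x + v x \<bullet> grad q x)"
    unfolding divergence_product[OF q v] by (simp add: mult.commute)
  also have "\<dots> = (LINT x:E|lborel. divergence v x * q x) + (LINT x:E|lborel. v x \<bullet> grad q x)"
    by (intro set_integral_add set_integrable_E continuous_intros divergence_continuous v C1_continuous q poly_field_continuous cg)
  finally have "(LINT x:E|lborel. divergence v x * q x) + (LINT x:E|lborel. v x \<bullet> grad q x) = (LINT x:E|lborel. divergence (\<lambda>x. q x *\<^sub>R v x) x)" by simp
  also have "\<dots> = (\<Sum>e | e facet_of E. face_int e (\<lambda>y. (q y *\<^sub>R v y) \<bullet> outer_normal E e))"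
  proof (rule gauss_E)
    have "C1 (\<lambda>y. q y * v y $ l)" for l
      by (intro C1_mult q C1_rpf) (use v in \<open>simp add: poly_field_def\<close>)
    then show "(\<lambda>y. (q y *\<^sub>R v y) $ l) differentiable (at x)" "continuous_on UNIV (partial k (\<lambda>y. (q y *\<^sub>R v y) $ l))" for k l x
      by (simp_all add: C1_def)
  qed
  finally show ?thesis by simp
qed

end

locale mesh =
  fixes m :: "('n::finite) dgmesh"
  assumes mesh: "affine_mesh m"
begin

lemma
  shows open_dom: "open (dom m)"
    and GammaD_frontier: "GammaD m \<subseteq> frontier (dom m)"
    and finite_elems: "finite (elems m)"
    and elems_props: "\<forall>E\<in>elems m. invertible (Bmat m E) \<and> E = elem_map m E ` ref_cube \<and> interior E \<subseteq> dom m"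
    and elems_cover: "\<Union>(elems m) = closure (dom m)"
    and elems_disjoint: "\<forall>E\<in>elems m. \<forall>E'\<in>elems m. E \<noteq> E' \<longrightarrow> interior E \<inter> interior E' = {}"
    and face_cases: "faces m = int_faces m \<union> D_faces m \<union> N_faces m"
    and int_adjacent: "\<forall>e\<in>int_faces m. elem1 m e \<noteq> elem2 m e \<and> adjacent m e = {elem1 m e, elem2 m e}"
    and bdry_adjacent: "\<forall>e\<in>D_faces m \<union> N_faces m. \<exists>!E. E \<in> adjacent m e"
  using mesh unfolding affine_mesh_def by - (elim conjE, assumption)+

lemma elem: "E \<in> elems m \<Longrightarrow> element m E"
  unfolding element_def by (drule bspec[OF elems_props], elim conjE, intro conjI)

lemma elem_interior: "E \<in> elems m \<Longrightarrow> interior E \<subseteq> dom m"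
  by (drule bspec[OF elems_props], elim conjE)

lemma interiors_disjoint: "E \<in> elems m \<Longrightarrow> E' \<in> elems m \<Longrightarrow> E \<noteq> E' \<Longrightarrow> interior E \<inter> interior E' = {}"
  using elems_disjoint by blast

lemma faces_iff: "e \<in> faces m \<longleftrightarrow> (\<exists>E\<in>elems m. e facet_of E)"
  by (simp add: faces_def)

lemma finite_faces: "finite (faces m)"
proof -
  have "faces m = (\<Union>E\<in>elems m. {e. e facet_of E})" by (auto simp: faces_def)
  then show ?thesis using finite_elems element.finite_facets[OF elem] by simp
qed

lemma faces_sub: "int_faces m \<subseteq> faces m" "D_faces m \<subseteq> faces m" "N_faces m \<subseteq> faces m"
  by (auto simp: int_faces_def D_faces_def N_faces_def)

lemma finite_face_kinds [simp]: "finite (int_faces m)" "finite (D_faces m)" "finite (N_faces m)"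
  using faces_sub finite_faces finite_subset by blast+

lemma face_convex_ne: "e \<in> faces m \<Longrightarrow> convex e \<and> rel_interior e \<noteq> {}"
  unfolding faces_iff facet_of_def using face_of_imp_convex rel_interior_eq_empty by blast

lemma frontier_dom: "frontier (dom m) \<inter> dom m = {}"
  using open_dom by (simp add: frontier_def interior_open Diff_Int_distrib2)

lemma face_kinds_disjoint:
  "int_faces m \<inter> D_faces m = {}" "int_faces m \<inter> N_faces m = {}" "D_faces m \<inter> N_faces m = {}"
proof -
  have *: "rel_interior e \<noteq> {}" if "e \<in> faces m" for e using face_convex_ne[OF that] by simp
  show "int_faces m \<inter> D_faces m = {}" "int_faces m \<inter> N_faces m = {}" "D_faces m \<inter> N_faces m = {}"
    using * GammaD_frontier frontier_dom unfolding int_faces_def D_faces_def N_faces_def GammaN_def by blast+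
qed

lemma adjacent_int: "e \<in> int_faces m \<Longrightarrow> adjacent m e = {elem1 m e, elem2 m e}" "e \<in> int_faces m \<Longrightarrow> elem1 m e \<noteq> elem2 m e"
  using int_adjacent by blast+

lemma adjacent_bdry: "e \<in> D_faces m \<union> N_faces m \<Longrightarrow> adjacent m e = {bdry_elem m e}"
proof -
  assume "e \<in> D_faces m \<union> N_faces m"
  then have ex: "\<exists>!E. E \<in> adjacent m e" using bdry_adjacent by blast
  then have "bdry_elem m e \<in> adjacent m e" unfolding bdry_elem_def by (rule theI')
  with ex show ?thesis by blast
qed

lemma elem12: assumes "e \<in> int_faces m"
  shows "elem1 m e \<in> elems m" "elem2 m e \<in> elems m" "e facet_of elem1 m e" "e facet_of elem2 m e"
  using adjacent_int(1)[OF assms] unfolding adjacent_def by blast+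

lemma bdry_elem: assumes "e \<in> D_faces m \<union> N_faces m"
  shows "bdry_elem m e \<in> elems m" "e facet_of bdry_elem m e"
  using adjacent_bdry[OF assms] unfolding adjacent_def by blast+

lemma normal_int: "e \<in> int_faces m \<Longrightarrow> normal m e = outer_normal (elem1 m e) e"
  by (simp add: normal_def)

lemma normal_bdry: "e \<in> D_faces m \<union> N_faces m \<Longrightarrow> normal m e = outer_normal (bdry_elem m e) e"
  using face_kinds_disjoint by (auto simp: normal_def)

lemma facet_pair:
  assumes "E \<in> elems m" "E' \<in> elems m" "e facet_of E" "e facet_of E'"
  obtains i i' a a' where "facet_pair (Bmat m E) (bvec m E) (Bmat m E') (bvec m E') i i' a a'"
    "e = parallelepiped.side (Bmat m E) (bvec m E) i a" "e = parallelepiped.side (Bmat m E') (bvec m E') i' a'"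
    "a \<in> {0,1}" "a' \<in> {0,1}"
proof -
  interpret E: element m E by (rule elem[OF assms(1)])
  interpret E': element m E' by (rule elem[OF assms(2)])
  obtain i a where a: "a \<in> {0,1}" "e = E.P.side i a" using E.facet_E[OF assms(3)] by blast
  obtain i' a' where a': "a' \<in> {0,1}" "e = E'.P.side i' a'" using E'.facet_E[OF assms(4)] by blast
  have "facet_pair (Bmat m E) (bvec m E) (Bmat m E') (bvec m E') i i' a a'"
    by unfold_locales (use a a' in auto)
  then show ?thesis using that a a' by blast
qed

lemma opposite_normals:
  assumes e: "e \<in> int_faces m"
  shows "outer_normal (elem2 m e) e = - normal m e"
proof -
  note el = elem12[OF e]
  interpret E: element m "elem1 m e" by (rule elem[OF el(1)])
  interpret E': element m "elem2 m e" by (rule elem[OF el(2)])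
  obtain i i' a a' where fp: "facet_pair (Bmat m (elem1 m e)) (bvec m (elem1 m e)) (Bmat m (elem2 m e)) (bvec m (elem2 m e)) i i' a a'"
    "e = E.P.side i a" "e = E'.P.side i' a'" "a \<in> {0,1}" "a' \<in> {0,1}"
    by (rule facet_pair[OF el])
  have "interior E.P.body \<inter> interior E'.P.body = {}"
    unfolding E.body_eq E'.body_eq by (rule interiors_disjoint[OF el(1,2) adjacent_int(2)[OF e]])
  from facet_pair.opposite_normal[OF fp(1) this]
  have "E'.P.unit_normal i' a' = - E.P.unit_normal i a" .
  moreover have "outer_normal (elem2 m e) e = E'.P.unit_normal i' a'" using E'.outer_normal_E[OF fp(5), of i'] fp(3) by simp
  moreover have "outer_normal (elem1 m e) e = E.P.unit_normal i a" using E.outer_normal_E[OF fp(4), of i] fp(2) by simp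
  ultimately show ?thesis using e by (simp add: normal_int)
qed

lemma face_polynomial_transfer:
  assumes "E \<in> elems m" "E' \<in> elems m" "e facet_of E" "e facet_of E'" and q: "q \<in> polys (\<lambda>_. k)"
  shows "\<exists>q'\<in>polys (\<lambda>_. k). \<forall>x\<in>e. q (inv (elem_map m E') x) = q' (inv (elem_map m E) x)"
proof -
  interpret E: element m E by (rule elem[OF assms(1)])
  interpret E': element m E' by (rule elem[OF assms(2)])
  obtain i i' a a' where fp: "facet_pair (Bmat m E) (bvec m E) (Bmat m E') (bvec m E') i i' a a'"
    "e = E.P.side i a" "e = E'.P.side i' a'"
    by (rule facet_pair[OF assms(1-4)])
  from facet_pair.face_polynomial_transfer[OF fp(1) q]
  show ?thesis unfolding E.nu_eq E'.nu_eq fp(2) .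
qed

lemma face_int_combination:
  assumes "e \<in> faces m" "continuous_on UNIV f" "continuous_on UNIV g"
  shows "face_int e (\<lambda>x. s * f x + t * g x) = s * face_int e f + t * face_int e g"
proof -
  obtain E where "E \<in> elems m" "e facet_of E" using assms(1) unfolding faces_iff by blast
  from element.face_int_combination[OF elem[OF this(1)] this(2) assms(2,3)] show ?thesis .
qed

lemma face_int_add:
  assumes "e \<in> faces m" "continuous_on UNIV f" "continuous_on UNIV g"
  shows "face_int e (\<lambda>x. f x + g x) = face_int e f + face_int e g"
  using face_int_combination[OF assms, of 1 1] by simp

lemma face_int_diff:
  assumes "e \<in> faces m" "continuous_on UNIV f" "continuous_on UNIV g"
  shows "face_int e (\<lambda>x. f x - g x) = face_int e f - face_int e g"
  using face_int_combination[OF assms, of 1 "-1"] by simp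

text \<open>
  An interior face is a facet of exactly two elements and a boundary face of exactly one; this is where
  the absence of hanging nodes enters.
\<close>

lemma sum_elements_facets:
  "(\<Sum>E\<in>elems m. \<Sum>e | e facet_of E. f E e) =
    (\<Sum>e\<in>int_faces m. f (elem1 m e) e + f (elem2 m e) e) +
    (\<Sum>e\<in>D_faces m. f (bdry_elem m e) e) + (\<Sum>e\<in>N_faces m. f (bdry_elem m e) e :: real)"
proof -
  have "(\<Sum>E\<in>elems m. \<Sum>e | e facet_of E. f E e) = (\<Sum>E\<in>elems m. \<Sum>e | e \<in> faces m \<and> e facet_of E. f E e)"
    by (intro sum.cong refl) (auto simp: faces_iff)
  also have "\<dots> = (\<Sum>e\<in>faces m. \<Sum>E | E \<in> elems m \<and> e facet_of E. f E e)"
    by (rule sum.swap_restrict[OF finite_elems finite_faces])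
  also have "\<dots> = (\<Sum>e\<in>faces m. \<Sum>E\<in>adjacent m e. f E e)" by (simp add: adjacent_def)
  also have "\<dots> = (\<Sum>e\<in>int_faces m. \<Sum>E\<in>adjacent m e. f E e) + (\<Sum>e\<in>D_faces m. \<Sum>E\<in>adjacent m e. f E e)
      + (\<Sum>e\<in>N_faces m. \<Sum>E\<in>adjacent m e. f E e)"
    unfolding face_cases using face_kinds_disjoint by (subst sum.union_disjoint, auto)+
  also have "(\<Sum>e\<in>int_faces m. \<Sum>E\<in>adjacent m e. f E e) = (\<Sum>e\<in>int_faces m. f (elem1 m e) e + f (elem2 m e) e)"
    using adjacent_int by (intro sum.cong refl) simp
  also have "(\<Sum>e\<in>D_faces m. \<Sum>E\<in>adjacent m e. f E e) = (\<Sum>e\<in>D_faces m. f (bdry_elem m e) e)"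
    using adjacent_bdry by (intro sum.cong refl) simp
  also have "(\<Sum>e\<in>N_faces m. \<Sum>E\<in>adjacent m e. f E e) = (\<Sum>e\<in>N_faces m. f (bdry_elem m e) e)"
    using adjacent_bdry by (intro sum.cong refl) simp
  finally show ?thesis .
qed

text \<open>
  On an interior face the two outer normals are opposite, and the jump of the product is
  \<open>[v q] = [v] {q} + {v} [q]\<close>. The first term cancels against the face term in the definition of the form, as
  do the terms on Dirichlet faces. What remains contains no derivative of \<open>v\<close>.
\<close>

lemma bform_by_parts:
  assumes v: "\<And>E. poly_field (v E)" and q: "\<And>E. real_polynomial_function (q E)"
  shows "bform m v q = (\<Sum>E\<in>elems m. LINT x:E|lborel. v E x \<bullet> bgrad q E x)
    - (\<Sum>e\<in>int_faces m. face_int e (\<lambda>x. (avg m v e x \<bullet> normal m e) * jump m q e x))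
    - (\<Sum>e\<in>N_faces m. face_int e (\<lambda>x. (btrace m v e x \<bullet> normal m e) * btrace m q e x))"
proof -
  define f where "f E e = face_int e (\<lambda>x. q E x * (v E x \<bullet> outer_normal E e))" for E e
  have cv: "continuous_on UNIV (v E)" for E by (rule poly_field_continuous[OF v])
  have cq: "continuous_on UNIV (q E)" for E by (rule rpf_continuous[OF q])
  have "(\<Sum>E\<in>elems m. LINT x:E|lborel. divergence (v E) x * q E x) + (\<Sum>E\<in>elems m. LINT x:E|lborel. v E x \<bullet> bgrad q E x) = (\<Sum>E\<in>elems m. \<Sum>e | e facet_of E. f E e)"
    unfolding sum.distrib[symmetric] f_def bgrad_def
    by (intro sum.cong refl element.gauss_product[OF elem] C1_rpf v q)
  also have "\<dots> = (\<Sum>e\<in>int_faces m. f (elem1 m e) e + f (elem2 m e) e) +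
    (\<Sum>e\<in>D_faces m. f (bdry_elem m e) e) + (\<Sum>e\<in>N_faces m. f (bdry_elem m e) e)"
    by (rule sum_elements_facets)
  also have "(\<Sum>e\<in>int_faces m. f (elem1 m e) e + f (elem2 m e) e) =
     (\<Sum>e\<in>int_faces m. face_int e (\<lambda>x. (jump m v e x \<bullet> normal m e) * avg m q e x))
     + (\<Sum>e\<in>int_faces m. face_int e (\<lambda>x. (avg m v e x \<bullet> normal m e) * jump m q e x))"
    unfolding sum.distrib[symmetric]
  proof (intro sum.cong refl)
    fix e assume e: "e \<in> int_faces m"
    then have ef: "e \<in> faces m" using faces_sub by auto
    have "f (elem1 m e) e + f (elem2 m e) e = face_int e (\<lambda>x. q (elem1 m e) x * (v (elem1 m e) x \<bullet> normal m e) + q (elem2 m e) x * (v (elem2 m e) x \<bullet> (- normal m e)))"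
      unfolding f_def opposite_normals[OF e] normal_int[OF e, symmetric]
      by (intro face_int_add[symmetric] ef continuous_intros cv cq)
    also have "\<dots> = face_int e (\<lambda>x. (jump m v e x \<bullet> normal m e) * avg m q e x + (avg m v e x \<bullet> normal m e) * jump m q e x)"
      by (rule face_int_cong) (simp add: jump_def avg_def inner_diff_left inner_add_left field_simps)
    also have "\<dots> = face_int e (\<lambda>x. (jump m v e x \<bullet> normal m e) * avg m q e x) + face_int e (\<lambda>x. (avg m v e x \<bullet> normal m e) * jump m q e x)"
      unfolding jump_def avg_def by (intro face_int_add ef continuous_intros cv cq)
    finally show "f (elem1 m e) e + f (elem2 m e) e = face_int e (\<lambda>x. (jump m v e x \<bullet> normal m e) * avg m q e x) + face_int e (\<lambda>x. (avg m v e x \<bullet> normal m e) * jump m q e x)" .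
  qed
  also have "(\<Sum>e\<in>D_faces m. f (bdry_elem m e) e) = (\<Sum>e\<in>D_faces m. face_int e (\<lambda>x. (btrace m v e x \<bullet> normal m e) * btrace m q e x))"
    by (intro sum.cong refl) (simp add: f_def btrace_def normal_bdry mult.commute)
  also have "(\<Sum>e\<in>N_faces m. f (bdry_elem m e) e) = (\<Sum>e\<in>N_faces m. face_int e (\<lambda>x. (btrace m v e x \<bullet> normal m e) * btrace m q e x))"
    by (intro sum.cong refl) (simp add: f_def btrace_def normal_bdry mult.commute)
  finally show ?thesis unfolding bform_def by simp
qed

subsection \<open>Piecewise polynomial fields with continuous normal components\<close>

lemma AE_not_frontier: "AE x in lborel. \<forall>E\<in>elems m. x \<notin> frontier E"
proof -
  have "AE x in lborel. x \<notin> frontier E" if "E \<in> elems m" for E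
  proof -
    have "negligible (frontier E)" using element.convex_E[OF elem[OF that]] by (rule negligible_convex_frontier)
    then have "frontier E \<in> null_sets (completion lborel)" by (simp add: negligible_iff_null_sets)
    then have "frontier E \<in> null_sets lborel" by (subst (asm) null_sets_completion_iff) (auto simp: borel_closed)
    then show ?thesis by (rule AE_not_in)
  qed
  then show ?thesis using finite_elems by (simp add: AE_finite_all)
qed

text \<open>
  The elements cover the domain and overlap only in their frontiers, which are null sets by convexity.
\<close>

lemma dom_split:
  fixes H :: "real^'n \<Rightarrow> 'a::{banach, second_countable_topology}"
  assumes H: "\<And>E x. E \<in> elems m \<Longrightarrow> x \<in> interior E \<Longrightarrow> H x = h E x"
  shows "AE x in lborel. indicator (dom m) x *\<^sub>R H x = (\<Sum>E\<in>elems m. indicator E x *\<^sub>R h E x)"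
  using AE_not_frontier
proof eventually_elim
  case (elim x)
  have int: "x \<in> E \<longleftrightarrow> x \<in> interior E" if "E \<in> elems m" for E
  proof -
    have "closed E" using element.compact_E[OF elem[OF that]] by (rule compact_imp_closed)
    then have "x \<in> E \<Longrightarrow> x \<in> interior E" using elim that by (auto simp: frontier_def)
    then show ?thesis using interior_subset by blast
  qed
  have dom: "x \<in> dom m \<longleftrightarrow> (\<exists>E\<in>elems m. x \<in> interior E)"
  proof
    assume "x \<in> dom m"
    then have "x \<in> \<Union>(elems m)" using elems_cover closure_subset by blast
    then show "\<exists>E\<in>elems m. x \<in> interior E" using int by auto
  next
    assume "\<exists>E\<in>elems m. x \<in> interior E"
    then show "x \<in> dom m" using elem_interior by blast
  qed
  show ?case
  proof (cases "x \<in> dom m")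
    case True
    then obtain E0 where E0: "E0 \<in> elems m" "x \<in> interior E0" using dom by blast
    have "x \<notin> E" if "E \<in> elems m - {E0}" for E
      using interiors_disjoint[of E E0] int[of E] that E0 by blast
    then have "(\<Sum>E\<in>elems m. indicator E x *\<^sub>R h E x) = indicator E0 x *\<^sub>R h E0 x"
      using E0 finite_elems by (subst sum.remove[of _ E0]) (auto simp: indicator_def intro!: sum.neutral)
    then show ?thesis using True E0 int H by (simp add: indicator_def)
  next
    case False
    then have "x \<notin> E" if "E \<in> elems m" for E using dom int that by blast
    then show ?thesis using False by (simp add: indicator_def)
  qed
qed

lemma dom_integral:
  fixes H :: "real^'n \<Rightarrow> real"
  assumes H: "\<And>E x. E \<in> elems m \<Longrightarrow> x \<in> interior E \<Longrightarrow> H x = h E x"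
    and mH [measurable]: "H \<in> borel_measurable borel" and h: "\<And>E. E \<in> elems m \<Longrightarrow> continuous_on UNIV (h E)"
  shows "set_integrable lborel (dom m) H" "(LINT x:dom m|lborel. H x) = (\<Sum>E\<in>elems m. LINT x:E|lborel. h E x)"
proof -
  have [measurable]: "dom m \<in> sets borel" using open_dom by simp
  have hi: "integrable lborel (\<lambda>x. indicator E x *\<^sub>R h E x)" if "E \<in> elems m" for E
    using element.set_integrable_E[OF elem[OF that] h[OF that]] by (simp add: set_integrable_def)
  have si: "integrable lborel (\<lambda>x. \<Sum>E\<in>elems m. indicator E x *\<^sub>R h E x)" using hi by (rule Bochner_Integration.integrable_sum)
  have m1: "(\<lambda>x. indicator (dom m) x *\<^sub>R H x) \<in> borel_measurable lborel" by measurable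
  have m2: "(\<lambda>x. \<Sum>E\<in>elems m. indicator E x *\<^sub>R h E x) \<in> borel_measurable lborel"
    using si by (rule borel_measurable_integrable)
  note ae = dom_split[of H h, OF H]
  show "set_integrable lborel (dom m) H"
    unfolding set_integrable_def using integrable_cong_AE[OF m1 m2 ae] si by simp
  have "(LINT x|lborel. indicator (dom m) x *\<^sub>R H x) = (LINT x|lborel. (\<Sum>E\<in>elems m. indicator E x *\<^sub>R h E x))"
    by (rule integral_cong_AE[OF m1 m2 ae])
  also have "\<dots> = (\<Sum>E\<in>elems m. (LINT x|lborel. indicator E x *\<^sub>R h E x))"
    using hi by (rule Bochner_Integration.integral_sum)
  finally show "(LINT x:dom m|lborel. H x) = (\<Sum>E\<in>elems m. LINT x:E|lborel. h E x)"
    unfolding set_lebesgue_integral_def .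
qed

lemma glue_interior: 
  assumes "E \<in> elems m" "x \<in> interior E" shows "glue m v x = v E x"
proof -
  have "(THE E. E \<in> elems m \<and> x \<in> interior E) = E"
  proof (rule the_equality)
    fix E' assume "E' \<in> elems m \<and> x \<in> interior E'"
    then show "E' = E" using interiors_disjoint[of E' E] assms by blast
  qed (use assms in simp)
  then show ?thesis using assms by (auto simp: glue_def)
qed

lemma glue_sum: "glue m v x = (\<Sum>E\<in>elems m. indicator (interior E) x *\<^sub>R v E x)"
  for v :: "('n, 'a::real_normed_vector) broken"
proof (cases "\<exists>E\<in>elems m. x \<in> interior E")
  case True
  then obtain E0 where E0: "E0 \<in> elems m" "x \<in> interior E0" by blast
  have "x \<notin> interior E" if "E \<in> elems m - {E0}" for E
    using interiors_disjoint[of E E0] that E0 by blast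
  then have "(\<Sum>E\<in>elems m. indicator (interior E) x *\<^sub>R v E x) = indicator (interior E0) x *\<^sub>R v E0 x"
    using E0 finite_elems by (subst sum.remove[of _ E0]) (auto simp: indicator_def intro!: sum.neutral)
  then show ?thesis using E0 by (simp add: glue_interior)
next
  case False
  then have "(\<Sum>E\<in>elems m. indicator (interior E) x *\<^sub>R v E x) = 0"
    by (intro sum.neutral) (auto simp: indicator_def)
  then show ?thesis using False by (simp add: glue_def)
qed

lemma glue_measurable:
  fixes v :: "('n, 'a::{real_normed_vector, second_countable_topology}) broken"
  assumes "\<And>E. continuous_on UNIV (v E)"
  shows "glue m v \<in> borel_measurable borel"
  unfolding glue_sum[abs_def]
  by (intro borel_measurable_sum borel_measurable_scaleR borel_measurable_indicator
      borel_measurable_continuous_onI assms borel_open open_interior)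

lemma glue_L2:
  fixes v :: "('n, 'a::{real_normed_vector, second_countable_topology}) broken"
  assumes v: "\<And>E. continuous_on UNIV (v E)"
  shows "glue m v \<in> L2 (dom m)"
proof -
  note [measurable] = glue_measurable[OF v]
  have [measurable]: "dom m \<in> sets borel" using open_dom by simp
  have "set_borel_measurable lborel (dom m) (glue m v)" unfolding set_borel_measurable_def by measurable
  moreover have "set_integrable lborel (dom m) (\<lambda>x. (norm (glue m v x))\<^sup>2)"
    by (rule dom_integral(1)[where h="\<lambda>E x. (norm (v E x))\<^sup>2"]) (auto simp: glue_interior intro!: continuous_intros v)
  ultimately show ?thesis by (simp add: L2_def)
qed

lemma boundary_face_frontier:
  assumes "e \<in> D_faces m \<union> N_faces m" shows "e \<subseteq> frontier (dom m)"
proof -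
  have ef: "e \<in> faces m" using assms faces_sub by auto
  have "rel_interior e \<subseteq> frontier (dom m)"
    using assms GammaD_frontier by (auto simp: D_faces_def N_faces_def GammaN_def)
  then have "closure (rel_interior e) \<subseteq> frontier (dom m)" by (rule closure_minimal) simp
  moreover have "e \<subseteq> closure (rel_interior e)"
    using face_convex_ne[OF ef] convex_closure_rel_interior closure_subset by blast
  ultimately show ?thesis by blast
qed

text \<open>
  The weak divergence is the elementwise one: after integrating by parts on each element, the face terms
  cancel on interior faces, and on boundary faces the test function vanishes.
\<close>

lemma glue_Hdiv:
  assumes v: "\<And>E. poly_field (v E)"
    and cont: "\<And>e x. e \<in> int_faces m \<Longrightarrow> x \<in> e \<Longrightarrow> v (elem1 m e) x \<bullet> normal m e = v (elem2 m e) x \<bullet> normal m e"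
  shows "glue m v \<in> Hdiv (dom m)"
proof -
  let ?w = "\<lambda>E. divergence (v E)"
  have cv: "continuous_on UNIV (v E)" for E by (rule poly_field_continuous[OF v])
  have cw: "continuous_on UNIV (?w E)" for E by (rule divergence_continuous[OF v])
  have "(LINT x:dom m|lborel. glue m v x \<bullet> grad \<phi> x) = - (LINT x:dom m|lborel. glue m ?w x * \<phi> x)"
    if t: "test_function (dom m) \<phi>" for \<phi>
  proof -
    have "continuously_diff (Suc 0) \<phi>" using t unfolding test_function_def by blast
    then have C1: "C1 \<phi>" by (simp add: C1_def)
    have c\<phi>: "continuous_on UNIV \<phi>" by (rule C1_continuous[OF C1])
    have cg: "continuous_on UNIV (grad \<phi>)"
      by (rule continuous_vec_components) (use C1 in \<open>simp add: grad_def C1_def\<close>)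
    have zero: "\<phi> x = 0" if "e \<in> D_faces m \<union> N_faces m" "x \<in> e" for e x
    proof -
      have "x \<notin> dom m" using boundary_face_frontier[OF that(1)] that(2) frontier_dom by blast
      then show ?thesis using t unfolding test_function_def by blast
    qed
    note [measurable] = glue_measurable[OF cv] glue_measurable[OF cw]
      borel_measurable_continuous_onI[OF c\<phi>] borel_measurable_continuous_onI[OF cg]
    define f where "f E e = face_int e (\<lambda>x. \<phi> x * (v E x \<bullet> outer_normal E e))" for E e
    have 1: "(LINT x:dom m|lborel. glue m v x \<bullet> grad \<phi> x) = (\<Sum>E\<in>elems m. LINT x:E|lborel. v E x \<bullet> grad \<phi> x)"
      by (rule dom_integral(2)) (auto simp: glue_interior intro!: continuous_intros cv cg)
    have 2: "(LINT x:dom m|lborel. glue m ?w x * \<phi> x) = (\<Sum>E\<in>elems m. LINT x:E|lborel. ?w E x * \<phi> x)"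
      by (rule dom_integral(2)) (auto simp: glue_interior intro!: continuous_intros cw c\<phi>)
    have "(LINT x:dom m|lborel. glue m ?w x * \<phi> x) + (LINT x:dom m|lborel. glue m v x \<bullet> grad \<phi> x) = (\<Sum>E\<in>elems m. \<Sum>e | e facet_of E. f E e)"
      unfolding 1 2 f_def sum.distrib[symmetric]
      by (intro sum.cong refl element.gauss_product[OF elem] C1 v)
    also have "\<dots> = (\<Sum>e\<in>int_faces m. f (elem1 m e) e + f (elem2 m e) e) +
      (\<Sum>e\<in>D_faces m. f (bdry_elem m e) e) + (\<Sum>e\<in>N_faces m. f (bdry_elem m e) e)"
      by (rule sum_elements_facets)
    finally have tot: "(LINT x:dom m|lborel. glue m ?w x * \<phi> x) + (LINT x:dom m|lborel. glue m v x \<bullet> grad \<phi> x) =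
      (\<Sum>e\<in>int_faces m. f (elem1 m e) e + f (elem2 m e) e) +
      (\<Sum>e\<in>D_faces m. f (bdry_elem m e) e) + (\<Sum>e\<in>N_faces m. f (bdry_elem m e) e)" .
    have "f (elem1 m e) e + f (elem2 m e) e = 0" if e: "e \<in> int_faces m" for e
    proof -
      have "f (elem2 m e) e = face_int e (\<lambda>x. - (\<phi> x * (v (elem1 m e) x \<bullet> normal m e)))"
        unfolding f_def opposite_normals[OF e] by (rule face_int_cong) (simp add: cont[OF e])
      then show ?thesis by (simp add: face_int_minus f_def normal_int[OF e])
    qed
    then have i0: "(\<Sum>e\<in>int_faces m. f (elem1 m e) e + f (elem2 m e) e) = 0" by (intro sum.neutral) auto
    have "f (bdry_elem m e) e = 0" if e: "e \<in> D_faces m \<union> N_faces m" for e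
    proof -
      have "f (bdry_elem m e) e = face_int e (\<lambda>x. 0)"
        unfolding f_def by (rule face_int_cong) (simp add: zero[OF e])
      then show ?thesis by simp
    qed
    then have b0: "(\<Sum>e\<in>D_faces m. f (bdry_elem m e) e) = 0" "(\<Sum>e\<in>N_faces m. f (bdry_elem m e) e) = 0"
      by (auto intro!: sum.neutral)
    show ?thesis using tot i0 b0 by simp
  qed
  moreover have "glue m v \<in> L2 (dom m)" "glue m ?w \<in> L2 (dom m)" by (rule glue_L2[OF cv], rule glue_L2[OF cw])
  ultimately show ?thesis unfolding Hdiv_def by blast
qed

end

section \<open>Bilinearity of the discrete forms\<close>

lemma sum_combination:
  assumes "\<And>x. x \<in> S \<Longrightarrow> f x = s * g x + t * (h x :: real)"
  shows "sum f S = s * sum g S + t * sum h S"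
  by (simp add: assms sum.distrib sum_distrib_left)

context element begin

lemma body_integral_combination:
  fixes f g :: "real^'n \<Rightarrow> real"
  assumes "continuous_on UNIV f" "continuous_on UNIV g"
  shows "(LINT x:E|lborel. s * f x + t * g x) = s * (LINT x:E|lborel. f x) + t * (LINT x:E|lborel. g x :: real)"
proof -
  have "(LINT x:E|lborel. s * f x + t * g x) = (LINT x:E|lborel. s * f x) + (LINT x:E|lborel. t * g x)"
    by (intro set_integral_add set_integrable_E continuous_intros assms)
  then show ?thesis by simp
qed

lemma body_integral_square_zero_scalar:
  assumes f: "real_polynomial_function f" and z: "(LINT x:E|lborel. f x * f x) = 0"
  shows "f x = 0"
proof -
  define i :: 'n where "i = undefined"
  have "f x *\<^sub>R axis i (1::real) = (0 :: real^'n)"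
  proof (rule body_integral_square_zero[of "\<lambda>x. f x *\<^sub>R axis i (1::real)"])
    have "real_polynomial_function (\<lambda>x. f x * axis i 1 $ j)" for j
      using rpf_component[OF f, of "axis i 1 $ j"] by (simp add: mult.commute)
    then show "poly_field (\<lambda>x. f x *\<^sub>R axis i (1::real))" by (simp add: poly_field_def)
    show "(LINT x:E|lborel. f x *\<^sub>R axis i 1 \<bullet> f x *\<^sub>R axis i (1::real)) = 0" using z by (simp add: inner_axis)
  qed
  then show ?thesis by (simp add: axis_eq_0_iff)
qed

end

definition rpf_broken :: "('n::finite, real) broken \<Rightarrow> bool" where
  "rpf_broken q \<longleftrightarrow> (\<forall>E. real_polynomial_function (q E))"

definition poly_broken :: "('n::finite, real^'n) broken \<Rightarrow> bool" where
  "poly_broken v \<longleftrightarrow> (\<forall>E. poly_field (v E))"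

lemma rpf_brokenD: "rpf_broken q \<Longrightarrow> real_polynomial_function (q E)"
  by (simp add: rpf_broken_def)

lemma poly_brokenD: "poly_broken v \<Longrightarrow> poly_field (v E)"
  by (simp add: poly_broken_def)

lemma rpf_broken_continuous [continuous_intros]: "rpf_broken q \<Longrightarrow> continuous_on S (q E)"
  by (rule rpf_continuous[OF rpf_brokenD])

lemma poly_broken_continuous [continuous_intros]: "poly_broken v \<Longrightarrow> continuous_on S (v E)"
  by (rule poly_field_continuous[OF poly_brokenD])

lemma poly_broken_bgrad: "rpf_broken q \<Longrightarrow> poly_broken (bgrad q)"
  by (simp add: poly_broken_def bgrad_def poly_field_grad rpf_brokenD)

lemma rpf_broken_comb: "rpf_broken u \<Longrightarrow> rpf_broken v \<Longrightarrow> rpf_broken (\<lambda>E x. s * u E x + t * v E x)"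
  by (simp add: rpf_broken_def real_polynomial_function.intros(3) rpf_component)

lemma poly_broken_comb: "poly_broken u \<Longrightarrow> poly_broken v \<Longrightarrow> poly_broken (\<lambda>E x. s *\<^sub>R u E x + t *\<^sub>R v E x)"
  by (simp add: poly_broken_def poly_field_comb)

lemma bgrad_comb:
  assumes "rpf_broken u" "rpf_broken v"
  shows "bgrad (\<lambda>E x. s * u E x + t * v E x) E x = s *\<^sub>R bgrad u E x + t *\<^sub>R bgrad v E x"
proof -
  have "partial i (\<lambda>y. s * u E y + t * v E y) x = s * partial i (u E) x + t * partial i (v E) x" for i
    using assms by (subst partial_add)
      (auto simp: partial_cmult rpf_differentiable rpf_brokenD intro!: rpf_differentiable rpf_component)
  then show ?thesis by (simp add: bgrad_def grad_def vec_eq_iff)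
qed

lemma continuous_jump_scalar: "rpf_broken q \<Longrightarrow> continuous_on S (jump m q e)"
  unfolding jump_def[abs_def] by (intro continuous_intros)

lemma continuous_avg: "poly_broken v \<Longrightarrow> continuous_on S (avg m v e)"
  unfolding avg_def[abs_def] by (intro continuous_intros)

lemma continuous_btrace_scalar: "rpf_broken q \<Longrightarrow> continuous_on S (btrace m q e)"
  unfolding btrace_def by (intro continuous_intros)

lemma continuous_btrace: "poly_broken v \<Longrightarrow> continuous_on S (btrace m v e)"
  unfolding btrace_def by (intro continuous_intros)

lemmas trace_continuous = continuous_jump_scalar continuous_avg continuous_btrace_scalar continuous_btrace

lemma jump_comb: "jump m (\<lambda>E x. s * u E x + t * v E x) e x = s * jump m u e x + t * jump m v e x" for u v :: "('n::finite, real) broken"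
  by (simp add: jump_def algebra_simps)

lemma avg_comb: "avg m (\<lambda>E x. s *\<^sub>R u E x + t *\<^sub>R v E x) e x = s *\<^sub>R avg m u e x + t *\<^sub>R avg m v e x"
  by (simp add: avg_def algebra_simps)

lemma btrace_comb: "btrace m (\<lambda>E x. s * u E x + t * v E x) e x = s * btrace m u e x + t * btrace m v e x" for u v :: "('n::finite, real) broken"
  by (simp add: btrace_def)

lemma btrace_comb_vec: "btrace m (\<lambda>E x. s *\<^sub>R u E x + t *\<^sub>R v E x) e x = s *\<^sub>R btrace m u e x + t *\<^sub>R btrace m v e x"
  by (simp add: btrace_def)

context mesh begin

lemma bform_parts:
  assumes "poly_broken v" "rpf_broken q"
  shows "bform m v q = (\<Sum>E\<in>elems m. LINT x:E|lborel. v E x \<bullet> bgrad q E x)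
    - (\<Sum>e\<in>int_faces m. face_int e (\<lambda>x. (avg m v e x \<bullet> normal m e) * jump m q e x))
    - (\<Sum>e\<in>N_faces m. face_int e (\<lambda>x. (btrace m v e x \<bullet> normal m e) * btrace m q e x))"
  using bform_by_parts[of v q] assms by (simp add: poly_broken_def rpf_broken_def)

lemma face_sum_combination:
  fixes f g h :: "('n, real) broken"
  assumes "S \<subseteq> faces m" "\<And>e. continuous_on UNIV (f e)" "\<And>e. continuous_on UNIV (g e)"
    "\<And>e x. h e x = s * f e x + t * g e x"
  shows "(\<Sum>e\<in>S. c e * face_int e (h e)) = s * (\<Sum>e\<in>S. c e * face_int e (f e)) + t * (\<Sum>e\<in>S. c e * face_int e (g e))"
proof (rule sum_combination)
  fix e assume "e \<in> S"
  then have "face_int e (\<lambda>x. s * f e x + t * g e x) = s * face_int e (f e) + t * face_int e (g e)"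
    using assms(1) by (intro face_int_combination assms(2,3)) auto
  moreover have "h e = (\<lambda>x. s * f e x + t * g e x)" using assms(4) by (intro ext)
  ultimately show "c e * face_int e (h e) = s * (c e * face_int e (f e)) + t * (c e * face_int e (g e))"
    by (simp add: algebra_simps)
qed

lemmas face_sum_combination' = face_sum_combination[where c="\<lambda>_. 1", unfolded mult_1]

lemma elem_sum_combination:
  fixes f g h :: "('n, real) broken"
  assumes "\<And>E. continuous_on UNIV (f E)" "\<And>E. continuous_on UNIV (g E)"
    "\<And>E x. h E x = s * f E x + t * g E x"
  shows "(\<Sum>E\<in>elems m. LINT x:E|lborel. h E x) = s * (\<Sum>E\<in>elems m. LINT x:E|lborel. f E x) + t * (\<Sum>E\<in>elems m. LINT x:E|lborel. g E x)"
proof (rule sum_combination)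
  fix E assume "E \<in> elems m"
  from element.body_integral_combination[OF elem[OF this] assms(1,2)]
  show "(LINT x:E|lborel. h E x) = s * (LINT x:E|lborel. f E x) + t * (LINT x:E|lborel. g E x)"
    unfolding assms(3) .
qed

lemma bform_left:
  assumes u: "poly_broken u" and v: "poly_broken v" and q: "rpf_broken q"
  shows "bform m (\<lambda>E x. s *\<^sub>R u E x + t *\<^sub>R v E x) q = s * bform m u q + t * bform m v q"
proof -
  note c = trace_continuous u v q poly_broken_bgrad[OF q]
  have "(\<Sum>E\<in>elems m. LINT x:E|lborel. (s *\<^sub>R u E x + t *\<^sub>R v E x) \<bullet> bgrad q E x) =
     s * (\<Sum>E\<in>elems m. LINT x:E|lborel. u E x \<bullet> bgrad q E x) + t * (\<Sum>E\<in>elems m. LINT x:E|lborel. v E x \<bullet> bgrad q E x)"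
    by (rule elem_sum_combination) (intro continuous_intros c, intro continuous_intros c, simp add: inner_add_left)
  moreover have "(\<Sum>e\<in>int_faces m. face_int e (\<lambda>x. (avg m (\<lambda>E x. s *\<^sub>R u E x + t *\<^sub>R v E x) e x \<bullet> normal m e) * jump m q e x)) =
     s * (\<Sum>e\<in>int_faces m. face_int e (\<lambda>x. (avg m u e x \<bullet> normal m e) * jump m q e x)) +
     t * (\<Sum>e\<in>int_faces m. face_int e (\<lambda>x. (avg m v e x \<bullet> normal m e) * jump m q e x))"
    by (rule face_sum_combination'[OF faces_sub(1)]) (intro continuous_intros c, intro continuous_intros c, simp add: avg_comb inner_add_left algebra_simps)
  moreover have "(\<Sum>e\<in>N_faces m. face_int e (\<lambda>x. (btrace m (\<lambda>E x. s *\<^sub>R u E x + t *\<^sub>R v E x) e x \<bullet> normal m e) * btrace m q e x)) =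
     s * (\<Sum>e\<in>N_faces m. face_int e (\<lambda>x. (btrace m u e x \<bullet> normal m e) * btrace m q e x)) +
     t * (\<Sum>e\<in>N_faces m. face_int e (\<lambda>x. (btrace m v e x \<bullet> normal m e) * btrace m q e x))"
    by (rule face_sum_combination'[OF faces_sub(3)]) (intro continuous_intros c, intro continuous_intros c, simp add: btrace_comb_vec inner_add_left algebra_simps)
  ultimately show ?thesis
    unfolding bform_parts[OF poly_broken_comb[OF u v] q] bform_parts[OF u q] bform_parts[OF v q]
    by (simp add: algebra_simps)
qed

lemma bform_right:
  assumes v: "poly_broken v" and q: "rpf_broken q" and r: "rpf_broken r"
  shows "bform m v (\<lambda>E x. s * q E x + t * r E x) = s * bform m v q + t * bform m v r"
proof -
  note c = trace_continuous v q r poly_broken_bgrad[OF q] poly_broken_bgrad[OF r]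
  have "(\<Sum>E\<in>elems m. LINT x:E|lborel. v E x \<bullet> bgrad (\<lambda>E x. s * q E x + t * r E x) E x) =
     s * (\<Sum>E\<in>elems m. LINT x:E|lborel. v E x \<bullet> bgrad q E x) + t * (\<Sum>E\<in>elems m. LINT x:E|lborel. v E x \<bullet> bgrad r E x)"
    by (rule elem_sum_combination) (intro continuous_intros c, intro continuous_intros c, simp add: bgrad_comb[OF q r] inner_add_right)
  moreover have "(\<Sum>e\<in>int_faces m. face_int e (\<lambda>x. (avg m v e x \<bullet> normal m e) * jump m (\<lambda>E x. s * q E x + t * r E x) e x)) =
     s * (\<Sum>e\<in>int_faces m. face_int e (\<lambda>x. (avg m v e x \<bullet> normal m e) * jump m q e x)) +
     t * (\<Sum>e\<in>int_faces m. face_int e (\<lambda>x. (avg m v e x \<bullet> normal m e) * jump m r e x))"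
    by (rule face_sum_combination'[OF faces_sub(1)]) (intro continuous_intros c, intro continuous_intros c, simp add: jump_comb algebra_simps)
  moreover have "(\<Sum>e\<in>N_faces m. face_int e (\<lambda>x. (btrace m v e x \<bullet> normal m e) * btrace m (\<lambda>E x. s * q E x + t * r E x) e x)) =
     s * (\<Sum>e\<in>N_faces m. face_int e (\<lambda>x. (btrace m v e x \<bullet> normal m e) * btrace m q e x)) +
     t * (\<Sum>e\<in>N_faces m. face_int e (\<lambda>x. (btrace m v e x \<bullet> normal m e) * btrace m r e x))"
    by (rule face_sum_combination'[OF faces_sub(3)]) (intro continuous_intros c, intro continuous_intros c, simp add: btrace_comb algebra_simps)
  ultimately show ?thesis
    unfolding bform_parts[OF v rpf_broken_comb[OF q r]] bform_parts[OF v q] bform_parts[OF v r]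
    by (simp add: algebra_simps)
qed

lemma j0form_left:
  assumes u: "rpf_broken u" and v: "rpf_broken v" and q: "rpf_broken q"
  shows "j0form m \<sigma> (\<lambda>E x. s * u E x + t * v E x) q = s * j0form m \<sigma> u q + t * j0form m \<sigma> v q"
proof -
  note c = trace_continuous u v q poly_broken_bgrad[OF q]
  let ?w = "\<lambda>E x. s * u E x + t * v E x"
  have 1: "(\<Sum>e\<in>int_faces m. face_int e (\<lambda>x. (avg m (bgrad q) e x \<bullet> normal m e) * jump m ?w e x)) =
    s * (\<Sum>e\<in>int_faces m. face_int e (\<lambda>x. (avg m (bgrad q) e x \<bullet> normal m e) * jump m u e x)) +
    t * (\<Sum>e\<in>int_faces m. face_int e (\<lambda>x. (avg m (bgrad q) e x \<bullet> normal m e) * jump m v e x))"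
    by (rule face_sum_combination'[OF faces_sub(1)]) (intro continuous_intros c, intro continuous_intros c, simp add: jump_comb algebra_simps)
  have 2: "(\<Sum>e\<in>int_faces m. \<sigma> / face_size m e * face_int e (\<lambda>x. jump m q e x * jump m ?w e x)) =
    s * (\<Sum>e\<in>int_faces m. \<sigma> / face_size m e * face_int e (\<lambda>x. jump m q e x * jump m u e x)) +
    t * (\<Sum>e\<in>int_faces m. \<sigma> / face_size m e * face_int e (\<lambda>x. jump m q e x * jump m v e x))"
    by (rule face_sum_combination[OF faces_sub(1)]) (intro continuous_intros c, intro continuous_intros c, simp add: jump_comb algebra_simps)
  have 3: "(\<Sum>e\<in>N_faces m. face_int e (\<lambda>x. (btrace m (bgrad q) e x \<bullet> normal m e) * btrace m ?w e x)) =
    s * (\<Sum>e\<in>N_faces m. face_int e (\<lambda>x. (btrace m (bgrad q) e x \<bullet> normal m e) * btrace m u e x)) +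
    t * (\<Sum>e\<in>N_faces m. face_int e (\<lambda>x. (btrace m (bgrad q) e x \<bullet> normal m e) * btrace m v e x))"
    by (rule face_sum_combination'[OF faces_sub(3)]) (intro continuous_intros c, intro continuous_intros c, simp add: btrace_comb algebra_simps)
  have 4: "(\<Sum>e\<in>N_faces m. \<sigma> / face_size m e * face_int e (\<lambda>x. btrace m q e x * btrace m ?w e x)) =
    s * (\<Sum>e\<in>N_faces m. \<sigma> / face_size m e * face_int e (\<lambda>x. btrace m q e x * btrace m u e x)) +
    t * (\<Sum>e\<in>N_faces m. \<sigma> / face_size m e * face_int e (\<lambda>x. btrace m q e x * btrace m v e x))"
    by (rule face_sum_combination[OF faces_sub(3)]) (intro continuous_intros c, intro continuous_intros c, simp add: btrace_comb algebra_simps)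
  show ?thesis unfolding j0form_def 1 2 3 4 by (simp add: algebra_simps)
qed

lemma j0form_right:
  assumes u: "rpf_broken u" and v: "rpf_broken v" and q: "rpf_broken q"
  shows "j0form m \<sigma> q (\<lambda>E x. s * u E x + t * v E x) = s * j0form m \<sigma> q u + t * j0form m \<sigma> q v"
proof -
  note c = trace_continuous u v q poly_broken_bgrad[OF u] poly_broken_bgrad[OF v]
  let ?w = "\<lambda>E x. s * u E x + t * v E x"
  have bg: "bgrad ?w = (\<lambda>E x. s *\<^sub>R bgrad u E x + t *\<^sub>R bgrad v E x)" by (intro ext bgrad_comb u v)
  have 1: "(\<Sum>e\<in>int_faces m. face_int e (\<lambda>x. (avg m (bgrad ?w) e x \<bullet> normal m e) * jump m q e x)) =
    s * (\<Sum>e\<in>int_faces m. face_int e (\<lambda>x. (avg m (bgrad u) e x \<bullet> normal m e) * jump m q e x)) +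
    t * (\<Sum>e\<in>int_faces m. face_int e (\<lambda>x. (avg m (bgrad v) e x \<bullet> normal m e) * jump m q e x))"
    by (rule face_sum_combination'[OF faces_sub(1)]) (intro continuous_intros c, intro continuous_intros c, simp add: bg avg_comb inner_add_left algebra_simps)
  have 2: "(\<Sum>e\<in>int_faces m. \<sigma> / face_size m e * face_int e (\<lambda>x. jump m ?w e x * jump m q e x)) =
    s * (\<Sum>e\<in>int_faces m. \<sigma> / face_size m e * face_int e (\<lambda>x. jump m u e x * jump m q e x)) +
    t * (\<Sum>e\<in>int_faces m. \<sigma> / face_size m e * face_int e (\<lambda>x. jump m v e x * jump m q e x))"
    by (rule face_sum_combination[OF faces_sub(1)]) (intro continuous_intros c, intro continuous_intros c, simp add: jump_comb algebra_simps)
  have 3: "(\<Sum>e\<in>N_faces m. face_int e (\<lambda>x. (btrace m (bgrad ?w) e x \<bullet> normal m e) * btrace m q e x)) =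
    s * (\<Sum>e\<in>N_faces m. face_int e (\<lambda>x. (btrace m (bgrad u) e x \<bullet> normal m e) * btrace m q e x)) +
    t * (\<Sum>e\<in>N_faces m. face_int e (\<lambda>x. (btrace m (bgrad v) e x \<bullet> normal m e) * btrace m q e x))"
    by (rule face_sum_combination'[OF faces_sub(3)]) (intro continuous_intros c, intro continuous_intros c, simp add: bg btrace_comb_vec inner_add_left algebra_simps)
  have 4: "(\<Sum>e\<in>N_faces m. \<sigma> / face_size m e * face_int e (\<lambda>x. btrace m ?w e x * btrace m q e x)) =
    s * (\<Sum>e\<in>N_faces m. \<sigma> / face_size m e * face_int e (\<lambda>x. btrace m u e x * btrace m q e x)) +
    t * (\<Sum>e\<in>N_faces m. \<sigma> / face_size m e * face_int e (\<lambda>x. btrace m v e x * btrace m q e x))"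
    by (rule face_sum_combination[OF faces_sub(3)]) (intro continuous_intros c, intro continuous_intros c, simp add: btrace_comb algebra_simps)
  show ?thesis unfolding j0form_def 1 2 3 4 by (simp add: algebra_simps)
qed

lemma alpha_left:
  assumes "rpf_broken u" "rpf_broken v" "rpf_broken q"
  shows "alpha m \<sigma> (\<lambda>E x. s * u E x + t * v E x) q = s * alpha m \<sigma> u q + t * alpha m \<sigma> v q"
proof -
  have "bgrad (\<lambda>E x. s * u E x + t * v E x) = (\<lambda>E x. s *\<^sub>R bgrad u E x + t *\<^sub>R bgrad v E x)"
    by (intro ext bgrad_comb assms)
  then show ?thesis unfolding alpha_def
    using bform_left[OF poly_broken_bgrad[OF assms(1)] poly_broken_bgrad[OF assms(2)] assms(3)] j0form_left[OF assms]
    by (simp add: algebra_simps)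
qed

lemma alpha_right:
  assumes "rpf_broken u" "rpf_broken v" "rpf_broken q"
  shows "alpha m \<sigma> q (\<lambda>E x. s * u E x + t * v E x) = s * alpha m \<sigma> q u + t * alpha m \<sigma> q v"
  unfolding alpha_def
  using bform_right[OF poly_broken_bgrad[OF assms(3)] assms(1,2)] j0form_right[OF assms]
  by (simp add: algebra_simps)

text \<open>
  The surface measure of a face is finite, so square integrable data are integrable, also after
  multiplication with a polynomial, which is bounded on the face.
\<close>

lemma data_integrable:
  assumes g: "dirichlet_data m g" and e: "e \<in> D_faces m" and q: "real_polynomial_function q"
  shows "set_integrable (surf e) e (\<lambda>x. (g x \<bullet> n) * q x)"
proof -
  obtain E where E: "E \<in> elems m" "e facet_of E" using e faces_sub(2) faces_iff by blast
  interpret E: element m E by (rule elem[OF E(1)])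
  obtain i a where a: "a \<in> {0,1}" "e = E.P.side i a" using E.facet_E[OF E(2)] by blast
  have fin: "finite_measure (surf e)" unfolding a(2) by (rule E.P.finite_surf_side[OF a(1)])
  have comp: "compact e" unfolding a(2) by (rule E.P.compact_side)
  have sets: "sets (surf e) = sets borel" by (simp add: surf_def)
  have me: "e \<in> sets (surf e)" using comp by (simp add: sets borel_compact)
  have mg: "(\<lambda>x. indicator e x *\<^sub>R g x) \<in> borel_measurable (surf e)"
    and ig: "integrable (surf e) (\<lambda>x. indicator e x *\<^sub>R (norm (g x))\<^sup>2)"
    using g e unfolding dirichlet_data_def set_borel_measurable_def set_integrable_def by blast+
  have ie: "integrable (surf e) (\<lambda>x. indicator e x :: real)"
    using me finite_measure.emeasure_finite[OF fin, of e] by (intro integrable_real_indicator) (auto simp: less_top)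
  have mq: "q \<in> borel_measurable (surf e)"
    using borel_measurable_continuous_onI[OF rpf_continuous[OF q]] by (simp add: measurable_cong_sets[OF sets refl])
  obtain C where C: "\<And>x. x \<in> e \<Longrightarrow> \<bar>q x\<bar> \<le> C" "C \<ge> 0"
  proof -
    have "bounded (q ` e)" by (intro compact_imp_bounded compact_continuous_image rpf_continuous q comp)
    then obtain C where "\<forall>y\<in>q ` e. norm y \<le> C" unfolding bounded_iff by blast
    then show ?thesis by (intro that[of "max C 0"]) (auto simp: le_max_iff_disj)
  qed
  show ?thesis unfolding set_integrable_def
  proof (rule Bochner_Integration.integrable_bound)
    show "integrable (surf e) (\<lambda>x. (norm n * C) * (indicator e x + indicator e x *\<^sub>R (norm (g x))\<^sup>2))"
      using ie ig by (intro integrable_mult_right Bochner_Integration.integrable_add)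
    have "(\<lambda>x. ((indicator e x *\<^sub>R g x) \<bullet> n) * q x) \<in> borel_measurable (surf e)"
      using mg mq by measurable
    then show "(\<lambda>x. indicator e x *\<^sub>R ((g x \<bullet> n) * q x)) \<in> borel_measurable (surf e)" by (simp add: mult.assoc)
    show "AE x in surf e. norm (indicator e x *\<^sub>R ((g x \<bullet> n) * q x)) \<le> norm ((norm n * C) * (indicator e x + indicator e x *\<^sub>R (norm (g x))\<^sup>2))"
    proof (rule AE_I2)
      fix x
      show "norm (indicator e x *\<^sub>R ((g x \<bullet> n) * q x)) \<le> norm ((norm n * C) * (indicator e x + indicator e x *\<^sub>R (norm (g x))\<^sup>2))"
      proof (cases "x \<in> e")
        case True
        have "norm (g x) \<le> 1 + (norm (g x))\<^sup>2"
          using zero_le_power2[of "norm (g x) - 1"] by (simp add: power2_diff) (smt (verit) norm_ge_zero)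
        then have "\<bar>g x \<bullet> n\<bar> \<le> (1 + (norm (g x))\<^sup>2) * norm n"
          using Cauchy_Schwarz_ineq2[of "g x" n] mult_right_mono[of "norm (g x)" "1 + (norm (g x))\<^sup>2" "norm n"] by simp
        then have "\<bar>g x \<bullet> n\<bar> * \<bar>q x\<bar> \<le> ((1 + (norm (g x))\<^sup>2) * norm n) * C"
          using C True by (intro mult_mono) auto
        then show ?thesis using True C(2) by (simp add: abs_mult mult_ac)
      qed simp
    qed
  qed
qed

lemma rform_comb:
  assumes g: "dirichlet_data m g" and u: "rpf_broken u" and v: "rpf_broken v"
  shows "rform m g (\<lambda>E x. s * u E x + t * v E x) = s * rform m g u + t * rform m g v"
  unfolding rform_def
proof (rule sum_combination)
  fix e assume e: "e \<in> D_faces m"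
  have "face_int e (\<lambda>x. s * ((g x \<bullet> normal m e) * btrace m u e x) + t * ((g x \<bullet> normal m e) * btrace m v e x)) =
    face_int e (\<lambda>x. s * ((g x \<bullet> normal m e) * btrace m u e x)) + face_int e (\<lambda>x. t * ((g x \<bullet> normal m e) * btrace m v e x))"
    unfolding face_int_def btrace_def
    by (intro set_integral_add set_integrable_mult_right data_integrable[OF g e] rpf_brokenD u v)
  then show "face_int e (\<lambda>x. (g x \<bullet> normal m e) * btrace m (\<lambda>E x. s * u E x + t * v E x) e x) =
      s * face_int e (\<lambda>x. (g x \<bullet> normal m e) * btrace m u e x) + t * face_int e (\<lambda>x. (g x \<bullet> normal m e) * btrace m v e x)"
    unfolding face_int_cmult by (simp add: btrace_comb algebra_simps)
qed

section \<open>The auxiliary elliptic problem\<close>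

text \<open>
  The broken polynomials, uncurried and as the span of a finite family.
\<close>

definition qspan :: "nat \<Rightarrow> (((real^'n) set \<times> (real^'n)) \<Rightarrow> real) set" where
  "qspan l = lspan (SIGMA E:elems m. exponents (\<lambda>_. l)) (\<lambda>(E, a) (E', x). if E' = E then monomial a (inv (elem_map m E) x) else 0)"

lemma inv_surj_composition:
  assumes "E \<in> elems m"
  shows "(\<lambda>x. u x) \<in> lspan (exponents D) (\<lambda>a x. monomial a (inv (elem_map m E) x)) \<longleftrightarrow> (\<exists>q\<in>polys D. u = q \<circ> inv (elem_map m E))"
proof
  assume "(\<lambda>x. u x) \<in> lspan (exponents D) (\<lambda>a x. monomial a (inv (elem_map m E) x))"
  then obtain c where "u = (\<lambda>x. \<Sum>a\<in>exponents D. c a * monomial a (inv (elem_map m E) x))" unfolding lspan_def by blast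
  moreover have "(\<lambda>x. \<Sum>a\<in>exponents D. c a * monomial a x) \<in> polys D" unfolding polys_eq_lspan lspan_def by blast
  ultimately show "\<exists>q\<in>polys D. u = q \<circ> inv (elem_map m E)" by (intro bexI[of _ "\<lambda>x. \<Sum>a\<in>exponents D. c a * monomial a x"]) auto
next
  assume "\<exists>q\<in>polys D. u = q \<circ> inv (elem_map m E)"
  then obtain q where q: "q \<in> polys D" and u: "u = q \<circ> inv (elem_map m E)" by (elim bexE)
  obtain c where "q = (\<lambda>x. \<Sum>a\<in>exponents D. c a * monomial a x)" using q unfolding polys_eq_lspan lspan_def by blast
  then have "u = (\<lambda>x. \<Sum>a\<in>exponents D. c a * monomial a (inv (elem_map m E) x))" unfolding u by auto
  then show "(\<lambda>x. u x) \<in> lspan (exponents D) (\<lambda>a x. monomial a (inv (elem_map m E) x))" unfolding lspan_def by (intro CollectI exI)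
qed

lemma qspan_iff: "u \<in> qspan l \<longleftrightarrow> curry u \<in> Qh m l"
proof -
  have "u \<in> qspan l \<longleftrightarrow> (\<forall>E\<in>elems m. (\<lambda>x. u (E, x)) \<in> lspan (exponents (\<lambda>_. l)) (\<lambda>a x. monomial a (inv (elem_map m E) x))) \<and> (\<forall>E x. E \<notin> elems m \<longrightarrow> u (E, x) = 0)"
    unfolding qspan_def
    using lspan_blocks[OF finite_elems, of "\<lambda>_. exponents (\<lambda>_. l)" u "\<lambda>E a x. monomial a (inv (elem_map m E) x)"] by simp
  also have "\<dots> \<longleftrightarrow> curry u \<in> Qh m l"
    unfolding Qh_def mem_Collect_eq curry_def
    by (intro arg_cong2[where f="(\<and>)"] ball_cong refl inv_surj_composition) (auto simp: fun_eq_iff)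
  finally show ?thesis .
qed

lemma Qh_rpf: "q \<in> Qh m l \<Longrightarrow> rpf_broken q"
  unfolding rpf_broken_def
proof
  fix E assume q: "q \<in> Qh m l"
  show "real_polynomial_function (q E)"
  proof (cases "E \<in> elems m")
    case True
    then obtain p where p: "p \<in> polys (\<lambda>_. l)" "q E = p \<circ> inv (elem_map m E)" using q unfolding Qh_def by blast
    then show ?thesis
      using element.rpf_nu[OF elem[OF True] polys_real_polynomial_function[OF p(1)]] element.nu_eq[OF elem[OF True]]
      by (simp add: o_def)
  next
    case False
    then have "q E = (\<lambda>_. 0)" using q unfolding Qh_def by blast
    then show ?thesis by (simp add: real_polynomial_function.intros(2))
  qed
qed

lemma Mh_sub: "q \<in> Mh m l \<Longrightarrow> q \<in> Qh m l"
  by (simp add: Mh_def)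

lemma Mh_span: "\<exists>b. \<forall>u. u \<in> lspan (SIGMA E:elems m. exponents (\<lambda>_::'n. l)) b \<longleftrightarrow> curry u \<in> Mh m l"
proof -
  define L :: "((real^'n) set \<times> (real^'n) \<Rightarrow> real) \<Rightarrow> real" where
    "L u = (if dirichlet_case m then \<Sum>E\<in>elems m. LINT x:E|lborel. u (E, x) else 0)" for u
  have "\<exists>b'. lspan (SIGMA E:elems m. exponents (\<lambda>_::'n. l)) b' = {v \<in> qspan l. L v = 0}"
    unfolding qspan_def
  proof (rule lspan_kernel)
    show "finite (SIGMA E:elems m. exponents (\<lambda>_::'n. l))" using finite_elems by auto
    fix u v s t assume "u \<in> lspan (SIGMA E:elems m. exponents (\<lambda>_::'n. l)) (\<lambda>(E, a) (E', x). if E' = E then monomial a (inv (elem_map m E) x) else 0)"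
      "v \<in> lspan (SIGMA E:elems m. exponents (\<lambda>_::'n. l)) (\<lambda>(E, a) (E', x). if E' = E then monomial a (inv (elem_map m E) x) else 0)"
    then have uv: "rpf_broken (curry u)" "rpf_broken (curry v)"
      unfolding qspan_def[symmetric] qspan_iff by (auto intro: Qh_rpf)
    have "(\<Sum>E\<in>elems m. LINT x:E|lborel. s * u (E, x) + t * v (E, x)) = s * (\<Sum>E\<in>elems m. LINT x:E|lborel. u (E, x)) + t * (\<Sum>E\<in>elems m. LINT x:E|lborel. v (E, x))"
      using rpf_broken_continuous[OF uv(1)] rpf_broken_continuous[OF uv(2)]
      by (intro elem_sum_combination) (auto simp: curry_def)
    then show "L (\<lambda>x. s * u x + t * v x) = s * L u + t * L v" by (simp add: L_def)
  qed
  then obtain b where b: "lspan (SIGMA E:elems m. exponents (\<lambda>_::'n. l)) b = {v \<in> qspan l. L v = 0}" by blast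
  have "u \<in> lspan (SIGMA E:elems m. exponents (\<lambda>_::'n. l)) b \<longleftrightarrow> curry u \<in> Mh m l" for u
    unfolding b by (auto simp: qspan_iff Mh_def L_def curry_def)
  then show ?thesis by blast
qed

text \<open>
  Coercivity makes the form definite on the finite-dimensional space, which gives both existence and
  uniqueness.
\<close>

lemma pressure_exists:
  assumes co: "coercive_on m \<sigma> (Mh m l)"
    and F: "\<And>u v s t. u \<in> Mh m l \<Longrightarrow> v \<in> Mh m l \<Longrightarrow> F (\<lambda>E x. s * u E x + t * v E x) = s * F u + t * F v"
  shows "\<exists>!\<psi>. \<psi> \<in> Mh m l \<and> (\<forall>q\<in>Mh m l. alpha m \<sigma> \<psi> q = F q)"
proof -
  let ?I = "SIGMA E:elems m. exponents (\<lambda>_::'n. l)"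
  obtain b where b: "\<And>u. u \<in> lspan ?I b \<longleftrightarrow> curry u \<in> Mh m l" using Mh_span by blast
  have rpf: "rpf_broken q" if "q \<in> Mh m l" for q using that by (rule Qh_rpf[OF Mh_sub])
  have comb: "(\<lambda>E x. s * u E x + t * v E x) \<in> Mh m l" if "u \<in> Mh m l" "v \<in> Mh m l" for u v s t
    using lspan_comb[of "case_prod u" ?I b "case_prod v" s t] that by (simp add: b curry_def)
  have definite: "v = (\<lambda>E x. 0)" if v: "v \<in> Mh m l" and z: "alpha m \<sigma> v v = 0" for v
  proof -
    obtain c where c: "c > 0" "c * l2 m v v \<le> 0" using co v z unfolding coercive_on_def by metis
    have nn: "0 \<le> (LINT x:E|lborel. v E x \<bullet> v E x)" for E
      unfolding set_lebesgue_integral_def by (intro integral_nonneg_AE AE_I2) (auto simp: indicator_def)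
    have "l2 m v v \<le> 0" using c by (simp add: mult_le_0_iff)
    then have "l2 m v v = 0" using nn unfolding l2_def by (intro antisym sum_nonneg) auto
    then have z: "(LINT x:E|lborel. v E x * v E x) = 0" if "E \<in> elems m" for E
      using sum_nonneg_eq_0_iff[OF finite_elems nn] that unfolding l2_def by simp
    have "v E x = 0" for E x
    proof (cases "E \<in> elems m")
      case True
      show ?thesis by (rule element.body_integral_square_zero_scalar[OF elem[OF True] rpf_brokenD[OF rpf[OF v]] z[OF True]])
    next
      case False
      then show ?thesis using Mh_sub[OF v] unfolding Qh_def by auto
    qed
    then show ?thesis by (intro ext)
  qed
  have "\<exists>v\<in>lspan ?I b. \<forall>u\<in>lspan ?I b. alpha m \<sigma> (curry v) (curry u) = F (curry u)"
  proof (rule nondegenerate_form_solvable, goal_cases)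
    case 1 then show ?case using finite_elems by auto
  next
    case (2 u v w s t)
    then show ?case using alpha_left[OF rpf rpf rpf, of "curry u" "curry v" "curry w"] by (simp add: b curry_def)
  next
    case (3 u v w s t)
    then show ?case using alpha_right[OF rpf rpf rpf, of "curry u" "curry v" "curry w"] by (simp add: b curry_def)
  next
    case (4 u v s t)
    then show ?case using F[of "curry u" "curry v" s t] by (simp add: b curry_def)
  next
    case (5 v)
    then have "curry v = (\<lambda>E x. 0)" using 5(2)[OF 5(1)] by (intro definite) (simp_all add: b)
    then show ?case by (metis (no_types, lifting) curry_conv ext surj_pair)
  qed
  then obtain v where v: "v \<in> lspan ?I b" "\<And>u. u \<in> lspan ?I b \<Longrightarrow> alpha m \<sigma> (curry v) (curry u) = F (curry u)" by blast
  show ?thesis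
  proof (rule ex1I[of _ "curry v"])
    show "curry v \<in> Mh m l \<and> (\<forall>q\<in>Mh m l. alpha m \<sigma> (curry v) q = F q)"
      using v(1) v(2)[of "case_prod q" for q] by (auto simp: b)
    fix \<psi> assume \<psi>: "\<psi> \<in> Mh m l \<and> (\<forall>q\<in>Mh m l. alpha m \<sigma> \<psi> q = F q)"
    let ?d = "\<lambda>E x. 1 * \<psi> E x + (-1) * curry v E x"
    have vM: "curry v \<in> Mh m l" using v(1) b by blast
    have dM: "?d \<in> Mh m l" by (rule comb) (use \<psi> vM in blast)+
    have "alpha m \<sigma> (curry v) ?d = F ?d" using v(2)[of "case_prod ?d"] dM by (simp add: b)
    then have "alpha m \<sigma> ?d ?d = 0"
      using alpha_left[OF rpf rpf rpf, of \<psi> "curry v" ?d \<sigma> 1 "-1"] \<psi> vM dM by simp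
    from definite[OF dM this] show "\<psi> = curry v" by (simp add: fun_eq_iff)
  qed
qed

end

section \<open>The reconstruction\<close>

lemma Qh_element: "q \<in> Qh m k \<Longrightarrow> E \<in> elems m \<Longrightarrow> \<exists>p\<in>polys (\<lambda>_. k). q E = p \<circ> inv (elem_map m E)"
  by (simp add: Qh_def)

lemma QfaceI: "p \<in> polys (\<lambda>_. k) \<Longrightarrow> E \<in> adjacent m e \<Longrightarrow> p \<circ> inv (elem_map m E) \<in> Qface m k e"
  unfolding Qface_def by (intro CollectI exI conjI) (rule refl)

lemma Qh_in_Qface:
  assumes "q \<in> Qh m k" "E \<in> adjacent m e" shows "q E \<in> Qface m k e"
proof -
  obtain p where "p \<in> polys (\<lambda>_. k)" "q E = p \<circ> inv (elem_map m E)"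
    using Qh_element[OF assms(1), of E] assms(2) unfolding adjacent_def by blast
  then show ?thesis using QfaceI[OF _ assms(2)] by simp
qed

text \<open>
  The flux is zero on Dirichlet faces, which are neither interior nor Neumann faces.
\<close>

definition recon_flux :: "('n::finite) dgmesh \<Rightarrow> real \<Rightarrow> ('n, real) broken \<Rightarrow> (real^'n) set \<Rightarrow> real^'n \<Rightarrow> real" where
  "recon_flux m \<sigma> \<psi> e x =
     (if e \<in> int_faces m then - (avg m (bgrad \<psi>) e x \<bullet> normal m e) + \<sigma> / face_size m e * jump m \<psi> e x
      else if e \<in> N_faces m then - (btrace m (bgrad \<psi>) e x \<bullet> normal m e) + \<sigma> / face_size m e * btrace m \<psi> e x
      else 0)"

definition recon_moment :: "('n::finite) dgmesh \<Rightarrow> ('n, real) broken \<Rightarrow> (real^'n) set \<Rightarrow> (real^'n \<Rightarrow> real^'n) \<Rightarrow> real" where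
  "recon_moment m \<psi> E r = - (LINT x:E|lborel. bgrad \<psi> E x \<bullet> r x)
     + 1/2 * (\<Sum>e\<in>{e \<in> int_faces m. e facet_of E}. face_int e (\<lambda>x. (r x \<bullet> normal m e) * jump m \<psi> e x))
     + (\<Sum>e\<in>{e \<in> N_faces m. e facet_of E}. face_int e (\<lambda>x. (r x \<bullet> normal m e) * btrace m \<psi> e x))"

lemma recon_flux_continuous: "rpf_broken \<psi> \<Longrightarrow> continuous_on S (recon_flux m \<sigma> \<psi> e)"
proof -
  assume \<psi>: "rpf_broken \<psi>"
  note c = trace_continuous \<psi> poly_broken_bgrad[OF \<psi>]
  show ?thesis
    unfolding recon_flux_def[abs_def]
    by (cases "e \<in> int_faces m"; cases "e \<in> N_faces m"; simp only: if_True if_False) (intro continuous_intros c)+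
qed

context mesh begin

lemma facet_face: "E \<in> elems m \<Longrightarrow> e facet_of E \<Longrightarrow> e \<in> faces m"
  by (auto simp: faces_iff)

lemma facet_adjacent: "E \<in> elems m \<Longrightarrow> e facet_of E \<Longrightarrow> E \<in> adjacent m e"
  by (simp add: adjacent_def)

text \<open>
  The normal of an interior face points out of its first element and into its second.
\<close>

lemma outer_normal_sign:
  assumes E: "E \<in> elems m" "e facet_of E"
  shows "\<exists>s\<in>{1, -1}. outer_normal E e = s *\<^sub>R normal m e"
proof -
  have ad: "E \<in> adjacent m e" by (rule facet_adjacent[OF E])
  consider (i) "e \<in> int_faces m" | (b) "e \<in> D_faces m \<union> N_faces m" using facet_face[OF E] face_cases by blast
  then show ?thesis
  proof cases
    case i
    then consider "E = elem1 m e" | "E = elem2 m e" using ad adjacent_int(1)[OF i] by blast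
    then show ?thesis
    proof cases
      case 1 then show ?thesis using normal_int[OF i] by (intro bexI[of _ 1]) auto
    next
      case 2 then show ?thesis using opposite_normals[OF i] by (intro bexI[of _ "-1"]) auto
    qed
  next
    case b
    then have "E = bdry_elem m e" using ad adjacent_bdry[OF b] by blast
    then show ?thesis using normal_bdry[OF b] by (intro bexI[of _ 1]) auto
  qed
qed

lemma RTh_poly: "\<gamma> \<in> RTh m k \<Longrightarrow> poly_broken \<gamma>"
  unfolding poly_broken_def
proof
  fix E assume \<gamma>: "\<gamma> \<in> RTh m k"
  show "poly_field (\<gamma> E)"
  proof (cases "E \<in> elems m")
    case True
    then have "\<gamma> E \<in> RT_elem m k E" using \<gamma> unfolding RTh_def by blast
    then show ?thesis by (rule element.RT_elem_poly_field[OF elem[OF True]])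
  next
    case False
    then have "\<gamma> E = (\<lambda>_. 0)" using \<gamma> unfolding RTh_def by blast
    then show ?thesis by simp
  qed
qed

text \<open>
  The three kinds of face conditions are conditions on the trace from each adjacent element, with one
  prescribed flux per face. In this form they split into independent problems on the elements.
\<close>

lemma is_reconstruction_iff:
  "is_reconstruction m \<sigma> k \<psi> \<gamma> \<longleftrightarrow> \<gamma> \<in> RTh m k \<and>
     (\<forall>E\<in>elems m. \<forall>e. e facet_of E \<longrightarrow> (\<forall>q\<in>Qface m k e.
        face_int e (\<lambda>x. (\<gamma> E x \<bullet> normal m e) * q x) = face_int e (\<lambda>x. recon_flux m \<sigma> \<psi> e x * q x))) \<and>
     (k > 0 \<longrightarrow> (\<forall>E\<in>elems m. \<forall>r\<in>Psi_elem m k E. (LINT x:E|lborel. \<gamma> E x \<bullet> r x) = recon_moment m \<psi> E r))"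
proof -
  define A where "A E e q \<longleftrightarrow> face_int e (\<lambda>x. (\<gamma> E x \<bullet> normal m e) * q x) = face_int e (\<lambda>x. recon_flux m \<sigma> \<psi> e x * q x)" for E e q
  have i: "A E e q \<longleftrightarrow> face_int e (\<lambda>x. (\<gamma> E x \<bullet> normal m e) * q x) =
        face_int e (\<lambda>x. (- (avg m (bgrad \<psi>) e x \<bullet> normal m e) + \<sigma> / face_size m e * jump m \<psi> e x) * q x)"
    if "e \<in> int_faces m" for E e q using that by (simp add: A_def recon_flux_def)
  have n: "A (bdry_elem m e) e q \<longleftrightarrow> face_int e (\<lambda>x. (btrace m \<gamma> e x \<bullet> normal m e) * q x) =
        face_int e (\<lambda>x. (- (btrace m (bgrad \<psi>) e x \<bullet> normal m e) + \<sigma> / face_size m e * btrace m \<psi> e x) * q x)"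
    if "e \<in> N_faces m" for e q
  proof -
    have "e \<notin> int_faces m" using that face_kinds_disjoint by blast
    then show ?thesis using that by (simp add: A_def recon_flux_def btrace_def)
  qed
  have d: "A (bdry_elem m e) e q \<longleftrightarrow> face_int e (\<lambda>x. (btrace m \<gamma> e x \<bullet> normal m e) * q x) = 0"
    if "e \<in> D_faces m" for e q
  proof -
    have "e \<notin> int_faces m" "e \<notin> N_faces m" using that face_kinds_disjoint by blast+
    then show ?thesis by (simp add: A_def recon_flux_def btrace_def)
  qed
  have faces: "(\<forall>E\<in>elems m. \<forall>e. e facet_of E \<longrightarrow> (\<forall>q\<in>Qface m k e. A E e q)) \<longleftrightarrow>
     (\<forall>e\<in>int_faces m. \<forall>q\<in>Qface m k e. \<forall>E\<in>adjacent m e. A E e q) \<and>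
     (\<forall>e\<in>N_faces m. \<forall>q\<in>Qface m k e. A (bdry_elem m e) e q) \<and>
     (\<forall>e\<in>D_faces m. \<forall>q\<in>Qface m k e. A (bdry_elem m e) e q)" (is "?l \<longleftrightarrow> ?r")
  proof
    assume l: ?l
    show ?r
    proof (intro conjI ballI)
      fix e q E assume "e \<in> int_faces m" "q \<in> Qface m k e" "E \<in> adjacent m e"
      then show "A E e q" using l by (simp add: adjacent_def)
    next
      fix e q assume "e \<in> N_faces m" "q \<in> Qface m k e"
      then show "A (bdry_elem m e) e q" using l bdry_elem[of e] by simp
    next
      fix e q assume "e \<in> D_faces m" "q \<in> Qface m k e"
      then show "A (bdry_elem m e) e q" using l bdry_elem[of e] by simp
    qed
  next
    assume r: ?r
    show ?l
    proof (intro ballI allI impI)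
      fix E e q assume E: "E \<in> elems m" "e facet_of E" and q: "q \<in> Qface m k e"
      have ad: "E \<in> adjacent m e" by (rule facet_adjacent[OF E])
      consider "e \<in> int_faces m" | "e \<in> D_faces m" | "e \<in> N_faces m" using facet_face[OF E] face_cases by blast
      then show "A E e q"
      proof cases
        case 1 then show ?thesis using r q ad by simp
      next
        case 2
        then have "E = bdry_elem m e" using ad adjacent_bdry[of e] by simp
        then show ?thesis using r q 2 by simp
      next
        case 3
        then have "E = bdry_elem m e" using ad adjacent_bdry[of e] by simp
        then show ?thesis using r q 3 by simp
      qed
    qed
  qed
  show ?thesis
    unfolding is_reconstruction_def recon_moment_def[symmetric] A_def[symmetric] faces
    using i n d by (simp cong: conj_cong)
qed

lemma reconstruction_unique:
  assumes "is_reconstruction m \<sigma> k \<psi> \<gamma>" "is_reconstruction m \<sigma> k \<psi> \<gamma>'"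
  shows "\<gamma> = \<gamma>'"
proof (rule ext)
  fix E
  have RT: "\<gamma> \<in> RTh m k" "\<gamma>' \<in> RTh m k" using assms unfolding is_reconstruction_def by blast+
  show "\<gamma> E = \<gamma>' E"
  proof (cases "E \<in> elems m")
    case True
    interpret E: element m E by (rule elem[OF True])
    let ?d = "\<lambda>x. 1 *\<^sub>R \<gamma> E x + (-1) *\<^sub>R \<gamma>' E x"
    have RE: "\<gamma> E \<in> RT_elem m k E" "\<gamma>' E \<in> RT_elem m k E" using RT True unfolding RTh_def by blast+
    note cont = poly_field_continuous[OF E.RT_elem_poly_field[OF RE(1)]] poly_field_continuous[OF E.RT_elem_poly_field[OF RE(2)]]
    have "?d = (\<lambda>x. 0)"
    proof (rule E.RT_element_unique)
      show "?d \<in> RT_elem m k E" by (rule E.RT_elem_comb[OF RE])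
    next
      fix e q assume e: "e facet_of E" and q: "q \<in> polys (\<lambda>_::'n. k)"
      obtain s where s: "outer_normal E e = s *\<^sub>R normal m e" using outer_normal_sign[OF True e] by blast
      have qf: "(\<lambda>x. q (inv (elem_map m E) x)) \<in> Qface m k e"
        using QfaceI[OF q facet_adjacent[OF True e]] by (simp add: o_def)
      have cq: "continuous_on UNIV (\<lambda>x. q (inv (elem_map m E) x))"
        unfolding E.nu_eq by (rule rpf_continuous[OF E.rpf_nu[OF polys_real_polynomial_function[OF q]]])
      have "face_int e (\<lambda>x. (\<gamma> E x \<bullet> normal m e) * q (inv (elem_map m E) x)) = face_int e (\<lambda>x. (\<gamma>' E x \<bullet> normal m e) * q (inv (elem_map m E) x))"
        using assms qf True e unfolding is_reconstruction_iff by simp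
      moreover have "face_int e (\<lambda>x. s * ((\<gamma> E x \<bullet> normal m e) * q (inv (elem_map m E) x)) + (-s) * ((\<gamma>' E x \<bullet> normal m e) * q (inv (elem_map m E) x))) =
         s * face_int e (\<lambda>x. (\<gamma> E x \<bullet> normal m e) * q (inv (elem_map m E) x)) + (-s) * face_int e (\<lambda>x. (\<gamma>' E x \<bullet> normal m e) * q (inv (elem_map m E) x))"
        by (intro E.face_int_combination[OF e] continuous_intros cont cq)
      moreover have "(?d x \<bullet> outer_normal E e) * q (inv (elem_map m E) x) = s * ((\<gamma> E x \<bullet> normal m e) * q (inv (elem_map m E) x)) + (-s) * ((\<gamma>' E x \<bullet> normal m e) * q (inv (elem_map m E) x))" for x
        by (simp add: s inner_diff_left algebra_simps)
      ultimately show "face_int e (\<lambda>x. (?d x \<bullet> outer_normal E e) * q (inv (elem_map m E) x)) = 0" by simp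
    next
      fix r assume k: "k > 0" and r: "r \<in> Psi_elem m k E"
      have cr: "continuous_on UNIV r" by (rule poly_field_continuous[OF E.Psi_elem_poly_field[OF r]])
      have "(LINT x:E|lborel. \<gamma> E x \<bullet> r x) = (LINT x:E|lborel. \<gamma>' E x \<bullet> r x)"
        using assms k True r unfolding is_reconstruction_iff by simp
      moreover have "(LINT x:E|lborel. 1 * (\<gamma> E x \<bullet> r x) + (-1) * (\<gamma>' E x \<bullet> r x)) = 1 * (LINT x:E|lborel. \<gamma> E x \<bullet> r x) + (-1) * (LINT x:E|lborel. \<gamma>' E x \<bullet> r x)"
        by (intro E.body_integral_combination continuous_intros cont cr)
      ultimately show "(LINT x:E|lborel. ?d x \<bullet> r x) = 0" by (simp add: inner_diff_left)
    qed
    then show ?thesis by (simp add: fun_eq_iff)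
  next
    case False
    then show ?thesis using RT unfolding RTh_def by auto
  qed
qed

lemma recon_moment_combination:
  assumes \<psi>: "rpf_broken \<psi>" and E: "E \<in> elems m" and u: "poly_field u" and v: "poly_field v"
  shows "recon_moment m \<psi> E (\<lambda>x. s *\<^sub>R u x + t *\<^sub>R v x) = s * recon_moment m \<psi> E u + t * recon_moment m \<psi> E v"
proof -
  note c = trace_continuous \<psi> poly_broken_bgrad[OF \<psi>] poly_field_continuous[OF u] poly_field_continuous[OF v]
  have "(LINT x:E|lborel. s * (bgrad \<psi> E x \<bullet> u x) + t * (bgrad \<psi> E x \<bullet> v x)) =
    s * (LINT x:E|lborel. bgrad \<psi> E x \<bullet> u x) + t * (LINT x:E|lborel. bgrad \<psi> E x \<bullet> v x)"
    by (intro element.body_integral_combination[OF elem[OF E]] continuous_intros c)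
  then have 1: "(LINT x:E|lborel. bgrad \<psi> E x \<bullet> (s *\<^sub>R u x + t *\<^sub>R v x)) =
    s * (LINT x:E|lborel. bgrad \<psi> E x \<bullet> u x) + t * (LINT x:E|lborel. bgrad \<psi> E x \<bullet> v x)"
    by (simp add: inner_add_right)
  have sub: "{e \<in> int_faces m. e facet_of E} \<subseteq> faces m" "{e \<in> N_faces m. e facet_of E} \<subseteq> faces m" using faces_sub by auto
  have 2: "(\<Sum>e\<in>{e \<in> int_faces m. e facet_of E}. face_int e (\<lambda>x. ((s *\<^sub>R u x + t *\<^sub>R v x) \<bullet> normal m e) * jump m \<psi> e x)) =
    s * (\<Sum>e\<in>{e \<in> int_faces m. e facet_of E}. face_int e (\<lambda>x. (u x \<bullet> normal m e) * jump m \<psi> e x)) +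
    t * (\<Sum>e\<in>{e \<in> int_faces m. e facet_of E}. face_int e (\<lambda>x. (v x \<bullet> normal m e) * jump m \<psi> e x))"
    by (rule face_sum_combination'[OF sub(1)]) (intro continuous_intros c, intro continuous_intros c, simp add: inner_add_left algebra_simps)
  have 3: "(\<Sum>e\<in>{e \<in> N_faces m. e facet_of E}. face_int e (\<lambda>x. ((s *\<^sub>R u x + t *\<^sub>R v x) \<bullet> normal m e) * btrace m \<psi> e x)) =
    s * (\<Sum>e\<in>{e \<in> N_faces m. e facet_of E}. face_int e (\<lambda>x. (u x \<bullet> normal m e) * btrace m \<psi> e x)) +
    t * (\<Sum>e\<in>{e \<in> N_faces m. e facet_of E}. face_int e (\<lambda>x. (v x \<bullet> normal m e) * btrace m \<psi> e x))"
    by (rule face_sum_combination'[OF sub(2)]) (intro continuous_intros c, intro continuous_intros c, simp add: inner_add_left algebra_simps)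
  show ?thesis unfolding recon_moment_def 1 2 3 by (simp add: algebra_simps)
qed

text \<open>
  The local fields are determined element by element. On an interior face the conditions from both
  sides use the polynomials of both parametrisations, which agree on the face. Hence the difference of the
  two normal traces is orthogonal to itself, the normal component is continuous, and the glued field lies
  in \<open>Hdiv\<close>.
\<close>

lemma reconstruction_exists:
  assumes \<psi>: "rpf_broken \<psi>"
  shows "\<exists>\<gamma>. is_reconstruction m \<sigma> k \<psi> \<gamma>"
proof -
  \<comment> \<open>The sign between the fixed normal of the face and the outer normal of the element.\<close>
  define sg where "sg E e = (SOME s. s \<in> {1, -1} \<and> outer_normal E e = s *\<^sub>R normal m e)" for E e
  have sg: "sg E e \<in> {1,-1}" "outer_normal E e = sg E e *\<^sub>R normal m e" if "E \<in> elems m" "e facet_of E" for E e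
    using someI_ex[OF outer_normal_sign[OF that, unfolded Bex_def]] by (auto simp: sg_def)
  have nsg: "normal m e = sg E e *\<^sub>R outer_normal E e" if "E \<in> elems m" "e facet_of E" for E e
    using sg[OF that] by auto
  have "\<forall>E\<in>elems m. \<exists>v. v \<in> RT_elem m k E \<and>
     (\<forall>e q. e facet_of E \<longrightarrow> q \<in> polys (\<lambda>_. k) \<longrightarrow>
        face_int e (\<lambda>x. (v x \<bullet> outer_normal E e) * q (inv (elem_map m E) x)) =
        face_int e (\<lambda>x. (sg E e * recon_flux m \<sigma> \<psi> e x) * q (inv (elem_map m E) x))) \<and>
     (k > 0 \<longrightarrow> (\<forall>w\<in>Psi_elem m k E. (LINT x:E|lborel. v x \<bullet> w x) = recon_moment m \<psi> E w))"
  proof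
    fix E assume E: "E \<in> elems m"
    interpret E: element m E by (rule elem[OF E])
    show "\<exists>v. v \<in> RT_elem m k E \<and>
     (\<forall>e q. e facet_of E \<longrightarrow> q \<in> polys (\<lambda>_. k) \<longrightarrow>
        face_int e (\<lambda>x. (v x \<bullet> outer_normal E e) * q (inv (elem_map m E) x)) =
        face_int e (\<lambda>x. (sg E e * recon_flux m \<sigma> \<psi> e x) * q (inv (elem_map m E) x))) \<and>
     (k > 0 \<longrightarrow> (\<forall>w\<in>Psi_elem m k E. (LINT x:E|lborel. v x \<bullet> w x) = recon_moment m \<psi> E w))"
      unfolding Bex_def[symmetric]
    proof (rule E.RT_element_exists)
      show "continuous_on UNIV (\<lambda>x. sg E e * recon_flux m \<sigma> \<psi> e x)" for e
        by (intro continuous_intros recon_flux_continuous \<psi>)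
      fix u v s t assume "u \<in> Psi_elem m k E" "v \<in> Psi_elem m k E"
      then show "recon_moment m \<psi> E (\<lambda>x. s *\<^sub>R u x + t *\<^sub>R v x) = s * recon_moment m \<psi> E u + t * recon_moment m \<psi> E v"
        by (intro recon_moment_combination[OF \<psi> E] E.Psi_elem_poly_field)
    qed
  qed
  from bchoice[OF this] obtain \<gamma>0 where \<gamma>0: "\<forall>E\<in>elems m. \<gamma>0 E \<in> RT_elem m k E \<and>
     (\<forall>e q. e facet_of E \<longrightarrow> q \<in> polys (\<lambda>_. k) \<longrightarrow>
        face_int e (\<lambda>x. (\<gamma>0 E x \<bullet> outer_normal E e) * q (inv (elem_map m E) x)) =
        face_int e (\<lambda>x. (sg E e * recon_flux m \<sigma> \<psi> e x) * q (inv (elem_map m E) x))) \<and>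
     (k > 0 \<longrightarrow> (\<forall>w\<in>Psi_elem m k E. (LINT x:E|lborel. \<gamma>0 E x \<bullet> w x) = recon_moment m \<psi> E w))" ..
  define \<gamma> where "\<gamma> E = (if E \<in> elems m then \<gamma>0 E else (\<lambda>x. 0))" for E
  have RE: "\<gamma> E \<in> RT_elem m k E" if "E \<in> elems m" for E using \<gamma>0 that by (simp add: \<gamma>_def)
  have pb: "poly_field (\<gamma> E)" for E
    by (cases "E \<in> elems m") (auto simp: element.RT_elem_poly_field[OF elem RE], simp add: \<gamma>_def)
  note c\<gamma> = poly_field_continuous[OF pb]
  have inner: "(LINT x:E|lborel. \<gamma> E x \<bullet> r x) = recon_moment m \<psi> E r" if "k > 0" "E \<in> elems m" "r \<in> Psi_elem m k E" for E r
    using \<gamma>0 that by (simp add: \<gamma>_def)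
  have face: "face_int e (\<lambda>x. (\<gamma> E x \<bullet> normal m e) * q x) = face_int e (\<lambda>x. recon_flux m \<sigma> \<psi> e x * q x)"
    if E: "E \<in> elems m" "e facet_of E" and q: "q \<in> Qface m k e" for E e q
  proof -
    obtain p E' where p: "p \<in> polys (\<lambda>_. k)" "E' \<in> adjacent m e" and qp: "q = p \<circ> inv (elem_map m E')"
      using q unfolding Qface_def by (elim CollectE exE conjE)
    have E': "E' \<in> elems m" "e facet_of E'" using p(2) by (simp_all add: adjacent_def)
    from face_polynomial_transfer[OF E(1) E'(1) E(2) E'(2) p(1)]
    obtain p' where p': "p' \<in> polys (\<lambda>_. k)" "\<forall>x\<in>e. p (inv (elem_map m E') x) = p' (inv (elem_map m E) x)" by (elim bexE)
    let ?s = "sg E e"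
    have s2: "?s * ?s = 1" using sg(1)[OF E] by auto
    have "face_int e (\<lambda>x. (\<gamma> E x \<bullet> normal m e) * q x) = face_int e (\<lambda>x. ?s * ((\<gamma> E x \<bullet> outer_normal E e) * p' (inv (elem_map m E) x)))"
      unfolding nsg[OF E] by (rule face_int_cong) (simp add: qp p'(2))
    also have "\<dots> = ?s * face_int e (\<lambda>x. (?s * recon_flux m \<sigma> \<psi> e x) * p' (inv (elem_map m E) x))"
      unfolding face_int_cmult using \<gamma>0 E p'(1) by (simp add: \<gamma>_def)
    also have "\<dots> = face_int e (\<lambda>x. (?s * ?s) * (recon_flux m \<sigma> \<psi> e x * p' (inv (elem_map m E) x)))"
      unfolding face_int_cmult[symmetric] by (simp only: mult.assoc)
    also have "\<dots> = face_int e (\<lambda>x. recon_flux m \<sigma> \<psi> e x * q x)"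
      unfolding s2 by (rule face_int_cong) (simp add: qp p'(2))
    finally show ?thesis .
  qed
  have nc: "\<gamma> (elem1 m e) x \<bullet> normal m e = \<gamma> (elem2 m e) x \<bullet> normal m e" if e: "e \<in> int_faces m" and x: "x \<in> e" for e x
  proof -
    note el = elem12[OF e]
    have ef: "e \<in> faces m" using e faces_sub by auto
    let ?d = "\<lambda>x. \<gamma> (elem1 m e) x \<bullet> normal m e - \<gamma> (elem2 m e) x \<bullet> normal m e"
    have tr: "\<exists>q\<in>Qface m k e. continuous_on UNIV q \<and> (\<forall>x\<in>e. \<gamma> E x \<bullet> normal m e = sg E e * q x)" if E: "E \<in> elems m" "e facet_of E" for E
    proof -
      from element.RT_elem_trace[OF elem[OF E(1)] RE[OF E(1)] E(2)]
      obtain q where q: "q \<in> polys (\<lambda>_. k)" "\<forall>x\<in>e. \<gamma> E x \<bullet> outer_normal E e = q (inv (elem_map m E) x)" by (elim bexE)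
      show ?thesis
      proof (intro bexI[of _ "q \<circ> inv (elem_map m E)"] conjI ballI)
        show "q \<circ> inv (elem_map m E) \<in> Qface m k e" by (rule QfaceI[OF q(1) facet_adjacent[OF E]])
        show "continuous_on UNIV (q \<circ> inv (elem_map m E))"
          unfolding element.nu_eq[OF elem[OF E(1)]] o_def
          by (rule rpf_continuous[OF element.rpf_nu[OF elem[OF E(1)] polys_real_polynomial_function[OF q(1)]]])
        fix x assume "x \<in> e"
        then show "\<gamma> E x \<bullet> normal m e = sg E e * (q \<circ> inv (elem_map m E)) x" unfolding nsg[OF E] using q(2) by simp
      qed
    qed
    obtain q1 where q1: "q1 \<in> Qface m k e" "continuous_on UNIV q1" "\<forall>x\<in>e. \<gamma> (elem1 m e) x \<bullet> normal m e = sg (elem1 m e) e * q1 x"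
      using tr[OF el(1,3)] by (elim bexE conjE)
    obtain q2 where q2: "q2 \<in> Qface m k e" "continuous_on UNIV q2" "\<forall>x\<in>e. \<gamma> (elem2 m e) x \<bullet> normal m e = sg (elem2 m e) e * q2 x"
      using tr[OF el(2,4)] by (elim bexE conjE)
    have cd: "continuous_on UNIV ?d" by (intro continuous_intros c\<gamma>)
    have orth: "face_int e (\<lambda>x. ?d x * q x) = 0" if q: "q \<in> Qface m k e" "continuous_on UNIV q" for q
    proof -
      have "face_int e (\<lambda>x. ?d x * q x) = face_int e (\<lambda>x. (\<gamma> (elem1 m e) x \<bullet> normal m e) * q x - (\<gamma> (elem2 m e) x \<bullet> normal m e) * q x)"
        by (simp add: algebra_simps)
      also have "\<dots> = face_int e (\<lambda>x. (\<gamma> (elem1 m e) x \<bullet> normal m e) * q x) - face_int e (\<lambda>x. (\<gamma> (elem2 m e) x \<bullet> normal m e) * q x)"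
        by (intro face_int_diff ef continuous_intros c\<gamma> q)
      finally show ?thesis using face[OF el(1,3) q(1)] face[OF el(2,4) q(1)] by simp
    qed
    have alg: "D * (s * a - t * b) = s * (D * a) + (- t) * (D * b)" for D s a t b :: real by (simp add: algebra_simps)
    have "face_int e (\<lambda>x. ?d x * ?d x) = face_int e (\<lambda>x. sg (elem1 m e) e * (?d x * q1 x) + (- sg (elem2 m e) e) * (?d x * q2 x))"
    proof (rule face_int_cong)
      fix x assume "x \<in> e"
      then have d: "?d x = sg (elem1 m e) e * q1 x - sg (elem2 m e) e * q2 x" using q1(3) q2(3) by simp
      have "?d x * ?d x = ?d x * (sg (elem1 m e) e * q1 x - sg (elem2 m e) e * q2 x)"
        using arg_cong[OF d, of "\<lambda>t. ?d x * t"] .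
      also have "\<dots> = sg (elem1 m e) e * (?d x * q1 x) + (- sg (elem2 m e) e) * (?d x * q2 x)"
        by (rule alg)
      finally show "?d x * ?d x = sg (elem1 m e) e * (?d x * q1 x) + (- sg (elem2 m e) e) * (?d x * q2 x)" .
    qed
    also have "\<dots> = sg (elem1 m e) e * face_int e (\<lambda>x. ?d x * q1 x) + (- sg (elem2 m e) e) * face_int e (\<lambda>x. ?d x * q2 x)"
      by (rule face_int_combination[OF ef]) (intro continuous_on_mult cd q1(2) q2(2))+
    also have "\<dots> = 0" using orth[OF q1(1,2)] orth[OF q2(1,2)] by simp
    finally have z: "face_int e (\<lambda>x. ?d x * ?d x) = 0" .
    have "real_polynomial_function (\<lambda>x. \<gamma> (elem1 m e) x \<bullet> normal m e + (-1) * (\<gamma> (elem2 m e) x \<bullet> normal m e))"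
      by (intro real_polynomial_function.intros(3) rpf_component poly_field_inner pb)
    then have "real_polynomial_function ?d" by simp
    from element.face_int_square_zero[OF elem[OF el(1)] el(3) this z x] show ?thesis by simp
  qed
  have "glue m \<gamma> \<in> Hdiv (dom m)" by (rule glue_Hdiv[OF pb nc])
  then have "\<gamma> \<in> RTh m k" unfolding RTh_def using RE by (simp add: \<gamma>_def)
  then have "is_reconstruction m \<sigma> k \<psi> \<gamma>" unfolding is_reconstruction_iff using face inner by blast
  then show ?thesis by blast
qed

lemma reconstruction_is: "rpf_broken \<psi> \<Longrightarrow> is_reconstruction m \<sigma> k \<psi> (reconstruction m \<sigma> k \<psi>)"
proof -
  assume "rpf_broken \<psi>"
  then have "\<exists>!\<gamma>. is_reconstruction m \<sigma> k \<psi> \<gamma>" using reconstruction_exists reconstruction_unique by blast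
  from theI'[OF this] show ?thesis unfolding reconstruction_def .
qed

lemma reconstruction_eqI: "is_reconstruction m \<sigma> k \<psi> \<gamma> \<Longrightarrow> reconstruction m \<sigma> k \<psi> = \<gamma>"
  unfolding reconstruction_def using reconstruction_unique by (intro the_equality)

lemma sum_recon_moment:
  assumes \<psi>: "rpf_broken \<psi>" and q: "rpf_broken q"
  shows "(\<Sum>E\<in>elems m. recon_moment m \<psi> E (bgrad q E)) = - (\<Sum>E\<in>elems m. LINT x:E|lborel. bgrad \<psi> E x \<bullet> bgrad q E x)
    + (\<Sum>e\<in>int_faces m. face_int e (\<lambda>x. (avg m (bgrad q) e x \<bullet> normal m e) * jump m \<psi> e x))
    + (\<Sum>e\<in>N_faces m. face_int e (\<lambda>x. (btrace m (bgrad q) e x \<bullet> normal m e) * btrace m \<psi> e x))"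
proof -
  note c = trace_continuous \<psi> q poly_broken_bgrad[OF q]
  define fi where "fi E e = 1/2 * face_int e (\<lambda>x. (bgrad q E x \<bullet> normal m e) * jump m \<psi> e x)" for E e
  define fn where "fn E e = face_int e (\<lambda>x. (bgrad q E x \<bullet> normal m e) * btrace m \<psi> e x)" for E e
  define f where "f E e = (if e \<in> int_faces m then fi E e else 0) + (if e \<in> N_faces m then fn E e else 0)" for E e
  have "recon_moment m \<psi> E (bgrad q E) = - (LINT x:E|lborel. bgrad \<psi> E x \<bullet> bgrad q E x) + (\<Sum>e | e facet_of E. f E e)" if E: "E \<in> elems m" for E
  proof -
    have fin: "finite {e. e facet_of E}" by (rule element.finite_facets[OF elem[OF E]])
    have "{e \<in> int_faces m. e facet_of E} = {e \<in> {e. e facet_of E}. e \<in> int_faces m}"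
      "{e \<in> N_faces m. e facet_of E} = {e \<in> {e. e facet_of E}. e \<in> N_faces m}" by auto
    then show ?thesis
      unfolding recon_moment_def f_def sum.distrib sum_distrib_left
      by (simp only: sum.inter_filter[OF fin] fi_def fn_def)
  qed
  then have "(\<Sum>E\<in>elems m. recon_moment m \<psi> E (bgrad q E)) = - (\<Sum>E\<in>elems m. LINT x:E|lborel. bgrad \<psi> E x \<bullet> bgrad q E x) + (\<Sum>E\<in>elems m. \<Sum>e | e facet_of E. f E e)"
    by (simp add: sum.distrib sum_negf sum_subtractf)
  also have "(\<Sum>E\<in>elems m. \<Sum>e | e facet_of E. f E e) = (\<Sum>e\<in>int_faces m. f (elem1 m e) e + f (elem2 m e) e) +
    (\<Sum>e\<in>D_faces m. f (bdry_elem m e) e) + (\<Sum>e\<in>N_faces m. f (bdry_elem m e) e)"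
    by (rule sum_elements_facets)
  also have "(\<Sum>e\<in>int_faces m. f (elem1 m e) e + f (elem2 m e) e) = (\<Sum>e\<in>int_faces m. face_int e (\<lambda>x. (avg m (bgrad q) e x \<bullet> normal m e) * jump m \<psi> e x))"
  proof (rule sum.cong[OF refl])
    fix e assume e: "e \<in> int_faces m"
    then have "e \<notin> N_faces m" using face_kinds_disjoint by blast
    then have "f (elem1 m e) e + f (elem2 m e) e = 1/2 * face_int e (\<lambda>x. (bgrad q (elem1 m e) x \<bullet> normal m e) * jump m \<psi> e x) + 1/2 * face_int e (\<lambda>x. (bgrad q (elem2 m e) x \<bullet> normal m e) * jump m \<psi> e x)"
      using e by (simp add: f_def fi_def)
    also have "\<dots> = face_int e (\<lambda>x. 1/2 * ((bgrad q (elem1 m e) x \<bullet> normal m e) * jump m \<psi> e x) + 1/2 * ((bgrad q (elem2 m e) x \<bullet> normal m e) * jump m \<psi> e x))"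
      by (intro face_int_combination[symmetric] continuous_intros c) (use e faces_sub in blast)
    also have "\<dots> = face_int e (\<lambda>x. (avg m (bgrad q) e x \<bullet> normal m e) * jump m \<psi> e x)"
      by (rule face_int_cong) (simp add: avg_def inner_add_left distrib_right)
    finally show "f (elem1 m e) e + f (elem2 m e) e = face_int e (\<lambda>x. (avg m (bgrad q) e x \<bullet> normal m e) * jump m \<psi> e x)" .
  qed
  also have "(\<Sum>e\<in>D_faces m. f (bdry_elem m e) e) = 0"
    using face_kinds_disjoint by (intro sum.neutral) (auto simp: f_def)
  also have "(\<Sum>e\<in>N_faces m. f (bdry_elem m e) e) = (\<Sum>e\<in>N_faces m. face_int e (\<lambda>x. (btrace m (bgrad q) e x \<bullet> normal m e) * btrace m \<psi> e x))"
  proof (rule sum.cong[OF refl])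
    fix e assume e: "e \<in> N_faces m"
    then have "e \<notin> int_faces m" using face_kinds_disjoint by blast
    then show "f (bdry_elem m e) e = face_int e (\<lambda>x. (btrace m (bgrad q) e x \<bullet> normal m e) * btrace m \<psi> e x)"
      using e by (simp add: f_def fn_def btrace_def)
  qed
  finally show ?thesis by simp
qed

text \<open>
  The key identity. After integration by parts, the form sees the reconstructed field only through its
  moments against \<open>bgrad q\<close> on the elements and against the traces of \<open>q\<close> on interior and Neumann faces.
  These are the moments that the reconstruction prescribes, and together they are \<open>- alpha m \<sigma> \<psi> q\<close>. The
  condition on \<open>bgrad q\<close> makes it an admissible interior test function.
\<close>

lemma bform_reconstruction:
  assumes \<psi>: "rpf_broken \<psi>" and rec: "is_reconstruction m \<sigma> k \<psi> \<gamma>" and q: "q \<in> Qh m k"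
    and grad: "\<And>E. E \<in> elems m \<Longrightarrow> bgrad q E = (\<lambda>x. 0) \<or> k > 0 \<and> bgrad q E \<in> Psi_elem m k E"
  shows "bform m \<gamma> q = - alpha m \<sigma> \<psi> q"
proof -
  have \<gamma>: "poly_broken \<gamma>" using rec RTh_poly unfolding is_reconstruction_def by blast
  have rq: "rpf_broken q" by (rule Qh_rpf[OF q])
  note c = trace_continuous \<gamma> rq \<psi> poly_broken_bgrad[OF \<psi>]
  let ?n = "\<lambda>e. normal m e"
  have vol: "(\<Sum>E\<in>elems m. LINT x:E|lborel. \<gamma> E x \<bullet> bgrad q E x) = (\<Sum>E\<in>elems m. recon_moment m \<psi> E (bgrad q E))"
  proof (rule sum.cong[OF refl])
    fix E assume E: "E \<in> elems m"
    from grad[OF E] show "(LINT x:E|lborel. \<gamma> E x \<bullet> bgrad q E x) = recon_moment m \<psi> E (bgrad q E)"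
    proof
      assume "bgrad q E = (\<lambda>x. 0)"
      then show ?thesis by (simp add: recon_moment_def)
    next
      assume "k > 0 \<and> bgrad q E \<in> Psi_elem m k E"
      then show ?thesis using rec E unfolding is_reconstruction_iff by blast
    qed
  qed
  have int: "(\<Sum>e\<in>int_faces m. face_int e (\<lambda>x. (avg m \<gamma> e x \<bullet> ?n e) * jump m q e x)) =
    (-1) * (\<Sum>e\<in>int_faces m. face_int e (\<lambda>x. (avg m (bgrad \<psi>) e x \<bullet> ?n e) * jump m q e x)) +
    1 * (\<Sum>e\<in>int_faces m. \<sigma> / face_size m e * face_int e (\<lambda>x. jump m q e x * jump m \<psi> e x))"
  proof (rule sum_combination)
    fix e assume e: "e \<in> int_faces m"
    note el = elem12[OF e]
    have ef: "e \<in> faces m" using e faces_sub by auto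
    have one: "face_int e (\<lambda>x. (avg m \<gamma> e x \<bullet> ?n e) * p x) = face_int e (\<lambda>x. recon_flux m \<sigma> \<psi> e x * p x)"
      if p: "p \<in> Qface m k e" "continuous_on UNIV p" for p
    proof -
      have "face_int e (\<lambda>x. (avg m \<gamma> e x \<bullet> ?n e) * p x) = face_int e (\<lambda>x. 1/2 * ((\<gamma> (elem1 m e) x \<bullet> ?n e) * p x) + 1/2 * ((\<gamma> (elem2 m e) x \<bullet> ?n e) * p x))"
        by (rule face_int_cong) (simp add: avg_def inner_add_left distrib_right)
      also have "\<dots> = 1/2 * face_int e (\<lambda>x. (\<gamma> (elem1 m e) x \<bullet> ?n e) * p x) + 1/2 * face_int e (\<lambda>x. (\<gamma> (elem2 m e) x \<bullet> ?n e) * p x)"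
        by (intro face_int_combination ef continuous_intros c p)
      also have "\<dots> = face_int e (\<lambda>x. recon_flux m \<sigma> \<psi> e x * p x)"
        using rec el p(1) unfolding is_reconstruction_iff by simp
      finally show ?thesis .
    qed
    have qf: "q (elem1 m e) \<in> Qface m k e" "q (elem2 m e) \<in> Qface m k e"
      using adjacent_int(1)[OF e] by (auto intro!: Qh_in_Qface[OF q])
    have "face_int e (\<lambda>x. (avg m \<gamma> e x \<bullet> ?n e) * jump m q e x) = face_int e (\<lambda>x. (avg m \<gamma> e x \<bullet> ?n e) * q (elem1 m e) x - (avg m \<gamma> e x \<bullet> ?n e) * q (elem2 m e) x)"
      by (simp add: jump_def right_diff_distrib)
    also have "\<dots> = face_int e (\<lambda>x. (avg m \<gamma> e x \<bullet> ?n e) * q (elem1 m e) x) - face_int e (\<lambda>x. (avg m \<gamma> e x \<bullet> ?n e) * q (elem2 m e) x)"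
      by (intro face_int_diff ef continuous_intros c)
    also have "\<dots> = face_int e (\<lambda>x. recon_flux m \<sigma> \<psi> e x * q (elem1 m e) x) - face_int e (\<lambda>x. recon_flux m \<sigma> \<psi> e x * q (elem2 m e) x)"
      using one[OF qf(1)] one[OF qf(2)] rpf_broken_continuous[OF rq] by simp
    also have "\<dots> = face_int e (\<lambda>x. recon_flux m \<sigma> \<psi> e x * q (elem1 m e) x - recon_flux m \<sigma> \<psi> e x * q (elem2 m e) x)"
      by (intro face_int_diff[symmetric] ef continuous_intros c recon_flux_continuous \<psi>)
    also have "\<dots> = face_int e (\<lambda>x. (-1) * ((avg m (bgrad \<psi>) e x \<bullet> ?n e) * jump m q e x) + \<sigma> / face_size m e * (jump m q e x * jump m \<psi> e x))"
      by (rule face_int_cong) (use e in \<open>simp add: recon_flux_def jump_def algebra_simps\<close>)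
    also have "\<dots> = (-1) * face_int e (\<lambda>x. (avg m (bgrad \<psi>) e x \<bullet> ?n e) * jump m q e x) + \<sigma> / face_size m e * face_int e (\<lambda>x. jump m q e x * jump m \<psi> e x)"
      by (intro face_int_combination ef continuous_intros c)
    finally show "face_int e (\<lambda>x. (avg m \<gamma> e x \<bullet> ?n e) * jump m q e x) =
      (-1) * face_int e (\<lambda>x. (avg m (bgrad \<psi>) e x \<bullet> ?n e) * jump m q e x) + 1 * (\<sigma> / face_size m e * face_int e (\<lambda>x. jump m q e x * jump m \<psi> e x))"
      by simp
  qed
  have neu: "(\<Sum>e\<in>N_faces m. face_int e (\<lambda>x. (btrace m \<gamma> e x \<bullet> ?n e) * btrace m q e x)) =
    (-1) * (\<Sum>e\<in>N_faces m. face_int e (\<lambda>x. (btrace m (bgrad \<psi>) e x \<bullet> ?n e) * btrace m q e x)) +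
    1 * (\<Sum>e\<in>N_faces m. \<sigma> / face_size m e * face_int e (\<lambda>x. btrace m q e x * btrace m \<psi> e x))"
  proof (rule sum_combination)
    fix e assume e: "e \<in> N_faces m"
    then have eb: "e \<in> D_faces m \<union> N_faces m" by simp
    have ni: "e \<notin> int_faces m" using e face_kinds_disjoint by blast
    have ef: "e \<in> faces m" using e faces_sub by auto
    have qf: "q (bdry_elem m e) \<in> Qface m k e"
      using adjacent_bdry[OF eb] by (auto intro!: Qh_in_Qface[OF q])
    have "face_int e (\<lambda>x. (btrace m \<gamma> e x \<bullet> ?n e) * btrace m q e x) = face_int e (\<lambda>x. recon_flux m \<sigma> \<psi> e x * q (bdry_elem m e) x)"
      using rec bdry_elem[OF eb] qf unfolding is_reconstruction_iff btrace_def by simp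
    also have "\<dots> = face_int e (\<lambda>x. (-1) * ((btrace m (bgrad \<psi>) e x \<bullet> ?n e) * btrace m q e x) + \<sigma> / face_size m e * (btrace m q e x * btrace m \<psi> e x))"
      by (rule face_int_cong) (use e ni in \<open>simp add: recon_flux_def btrace_def algebra_simps\<close>)
    also have "\<dots> = (-1) * face_int e (\<lambda>x. (btrace m (bgrad \<psi>) e x \<bullet> ?n e) * btrace m q e x) + \<sigma> / face_size m e * face_int e (\<lambda>x. btrace m q e x * btrace m \<psi> e x)"
      by (intro face_int_combination ef continuous_intros c)
    finally show "face_int e (\<lambda>x. (btrace m \<gamma> e x \<bullet> ?n e) * btrace m q e x) =
      (-1) * face_int e (\<lambda>x. (btrace m (bgrad \<psi>) e x \<bullet> ?n e) * btrace m q e x) + 1 * (\<sigma> / face_size m e * face_int e (\<lambda>x. btrace m q e x * btrace m \<psi> e x))"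
      by simp
  qed
  show ?thesis
    unfolding alpha_def j0form_def bform_parts[OF \<gamma> rq] bform_parts[OF poly_broken_bgrad[OF \<psi>] rq]
      vol sum_recon_moment[OF \<psi> rq] int neu
    by simp
qed

end

section \<open>The projection\<close>

context mesh begin

lemma Qh_comb:
  assumes "u \<in> Qh m l" "v \<in> Qh m l" shows "(\<lambda>E x. s * u E x + t * v E x) \<in> Qh m l"
proof -
  have "case_prod u \<in> qspan l" "case_prod v \<in> qspan l" using assms by (simp_all add: qspan_iff)
  then have "(\<lambda>x. s * case_prod u x + t * case_prod v x) \<in> qspan l" unfolding qspan_def by (rule lspan_comb)
  then show ?thesis by (simp add: qspan_iff curry_def)
qed

lemma Xh_comb:
  assumes "u \<in> Xh m p" "v \<in> Xh m p" shows "(\<lambda>E x. s *\<^sub>R u E x + t *\<^sub>R v E x) \<in> Xh m p"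
  using assms Qh_comb unfolding Xh_def by simp

lemma Xh_poly: "w \<in> Xh m p \<Longrightarrow> poly_broken w"
  using Qh_rpf unfolding Xh_def poly_broken_def poly_field_def rpf_broken_def by blast

lemma Xh_outside: "w \<in> Xh m p \<Longrightarrow> E \<notin> elems m \<Longrightarrow> w E x = 0"
  unfolding Xh_def Qh_def by (auto simp: vec_eq_iff fun_eq_iff)

lemma RTh_Xh:
  assumes \<gamma>: "\<gamma> \<in> RTh m k" and k: "Suc k \<le> p" shows "\<gamma> \<in> Xh m p"
  unfolding Xh_def Qh_def
proof (intro CollectI allI conjI ballI impI)
  fix i E assume E: "E \<in> elems m"
  then have "\<gamma> E \<in> RT_elem m k E" using \<gamma> unfolding RTh_def by blast
  from element.RT_elem_components[OF elem[OF E] this, of i]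
  obtain q where q: "q \<in> polys (\<lambda>_. Suc k)" "(\<lambda>x. \<gamma> E x $ i) = q \<circ> inv (elem_map m E)" by (elim bexE)
  have "q \<in> polys (\<lambda>_. p)" using q(1) by (rule polys_mono) (rule k)
  then show "\<exists>q\<in>polys (\<lambda>_. p). (\<lambda>x. \<gamma> E x $ i) = q \<circ> inv (elem_map m E)" by (intro bexI[of _ q] q(2))
next
  fix i E assume "E \<notin> elems m"
  then have "\<gamma> E = (\<lambda>_. 0)" using \<gamma> unfolding RTh_def by blast
  then show "(\<lambda>x. \<gamma> E x $ i) = (\<lambda>_. 0)" by simp
qed

lemma l2_comb:
  assumes "poly_broken u" "poly_broken v" "poly_broken w"
  shows "l2 m (\<lambda>E x. s *\<^sub>R u E x + t *\<^sub>R v E x) w = s * l2 m u w + t * l2 m v w"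
  unfolding l2_def
  by (rule elem_sum_combination) (intro continuous_intros assms, intro continuous_intros assms, simp add: inner_add_left)

text \<open>
  The reconstructed field already belongs to the velocity space, so the \<open>L\<^sup>2\<close> projection in the last step
  only adds it.
\<close>

lemma RT_projection_deg_eq:
  assumes w: "w \<in> Xh m p" and \<gamma>: "reconstruction m \<sigma> k (pressure m g \<sigma> p w) \<in> Xh m p"
  shows "RT_projection_deg m g \<sigma> p k w = (\<lambda>E x. w E x + reconstruction m \<sigma> k (pressure m g \<sigma> p w) E x)"
proof -
  define \<rho> where "\<rho> = reconstruction m \<sigma> k (pressure m g \<sigma> p w)"
  have \<rho>: "\<rho> \<in> Xh m p" using \<gamma> by (simp add: \<rho>_def)
  let ?v = "\<lambda>E x. w E x + \<rho> E x"
  have vX: "?v \<in> Xh m p" using Xh_comb[OF w \<rho>, of 1 1] by simp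
  have lv: "l2 m ?v \<phi> = l2 m w \<phi> + l2 m \<rho> \<phi>" if "\<phi> \<in> Xh m p" for \<phi>
    using l2_comb[OF Xh_poly[OF w] Xh_poly[OF \<rho>] Xh_poly[OF that], of 1 1] by simp
  have "(THE v. v \<in> Xh m p \<and> (\<forall>\<phi>\<in>Xh m p. l2 m v \<phi> = l2 m w \<phi> + l2 m \<rho> \<phi>)) = ?v"
  proof (rule the_equality)
    show "?v \<in> Xh m p \<and> (\<forall>\<phi>\<in>Xh m p. l2 m ?v \<phi> = l2 m w \<phi> + l2 m \<rho> \<phi>)" using vX lv by blast
    fix v assume v: "v \<in> Xh m p \<and> (\<forall>\<phi>\<in>Xh m p. l2 m v \<phi> = l2 m w \<phi> + l2 m \<rho> \<phi>)"
    define d where "d = (\<lambda>E x. 1 *\<^sub>R v E x + (-1) *\<^sub>R ?v E x)"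
    have dX: "d \<in> Xh m p" unfolding d_def by (rule Xh_comb) (use v vX in blast)+
    have "l2 m d \<phi> = 1 * l2 m v \<phi> + (-1) * l2 m ?v \<phi>" if "poly_broken \<phi>" for \<phi>
      unfolding d_def by (rule l2_comb[OF _ Xh_poly[OF vX] that]) (use v Xh_poly in blast)
    from this[OF Xh_poly[OF dX]] have "l2 m d d = 1 * l2 m v d + (-1) * l2 m ?v d" .
    then have z: "l2 m d d = 0" using v lv[OF dX] dX by simp
    have nn: "0 \<le> (LINT x:E|lborel. d E x \<bullet> d E x)" for E
      unfolding set_lebesgue_integral_def by (intro integral_nonneg_AE AE_I2) (auto simp: indicator_def)
    have d0: "d E x = 0" for E x
    proof (cases "E \<in> elems m")
      case True
      then have "(LINT x:E|lborel. d E x \<bullet> d E x) = 0"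
        using sum_nonneg_eq_0_iff[OF finite_elems nn] z unfolding l2_def by simp
      then show ?thesis by (rule element.body_integral_square_zero[OF elem[OF True] poly_brokenD[OF Xh_poly[OF dX]]])
    next
      case False
      then show ?thesis by (rule Xh_outside[OF dX])
    qed
    have "v E x - ?v E x = 0" for E x using d0[of E x] by (simp add: d_def algebra_simps)
    then show "v = ?v" by (intro ext) (simp only: right_minus_eq)
  qed
  then show ?thesis unfolding RT_projection_deg_def \<rho>_def[symmetric] .
qed

subsection \<open>Piecewise constant test functions\<close>

lemma grad_const: "grad (\<lambda>x. c) = (\<lambda>x. 0)"
  by (auto simp: grad_def vec_eq_iff)

lemma pw_const_Qh: "(\<And>E. E \<notin> elems m \<Longrightarrow> c E = 0) \<Longrightarrow> (\<lambda>E x. c E) \<in> Qh m l"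
  unfolding Qh_def
proof (intro CollectI conjI ballI allI impI)
  fix E
  show "\<exists>q\<in>polys (\<lambda>_. l). (\<lambda>x. c E) = q \<circ> inv (elem_map m E)"
    by (rule bexI[of _ "\<lambda>x. c E"]) (simp_all add: o_def)
qed auto

lemma bgrad_pw_const: "bgrad (\<lambda>E x. c E) E = (\<lambda>x. 0)"
  by (simp add: bgrad_def grad_const)

lemma bform_pw_const:
  assumes v: "poly_broken v" and c: "\<And>E. E \<notin> elems m \<Longrightarrow> c E = 0"
  shows "bform m v (\<lambda>E x. c E) =
    - (\<Sum>e\<in>int_faces m. face_int e (\<lambda>x. (avg m v e x \<bullet> normal m e) * (c (elem1 m e) - c (elem2 m e))))
    - (\<Sum>e\<in>N_faces m. face_int e (\<lambda>x. (btrace m v e x \<bullet> normal m e) * c (bdry_elem m e)))"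
  using bform_parts[OF v Qh_rpf[OF pw_const_Qh[OF c, where l=0]]]
  by (simp add: bgrad_pw_const jump_def btrace_def)

lemma pressure_props:
  assumes g: "dirichlet_data m g" and co: "coercive_on m \<sigma> (Mh m (p - 1))" and w: "w \<in> Xh m p"
  shows "pressure m g \<sigma> p w \<in> Mh m (p - 1)"
    and "\<And>q. q \<in> Mh m (p - 1) \<Longrightarrow> alpha m \<sigma> (pressure m g \<sigma> p w) q = bform m w q - rform m g q"
    and "\<And>\<psi>. \<psi> \<in> Mh m (p - 1) \<Longrightarrow> (\<And>q. q \<in> Mh m (p - 1) \<Longrightarrow> alpha m \<sigma> \<psi> q = bform m w q - rform m g q) \<Longrightarrow> pressure m g \<sigma> p w = \<psi>"
proof -
  have ex: "\<exists>!\<psi>. \<psi> \<in> Mh m (p - 1) \<and> (\<forall>q\<in>Mh m (p - 1). alpha m \<sigma> \<psi> q = bform m w q - rform m g q)"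
  proof (rule pressure_exists[OF co])
    fix u v s t assume "u \<in> Mh m (p - 1)" "v \<in> Mh m (p - 1)"
    then have uv: "rpf_broken u" "rpf_broken v" by (auto intro: Qh_rpf[OF Mh_sub])
    show "bform m w (\<lambda>E x. s * u E x + t * v E x) - rform m g (\<lambda>E x. s * u E x + t * v E x) =
       s * (bform m w u - rform m g u) + t * (bform m w v - rform m g v)"
      unfolding bform_right[OF Xh_poly[OF w] uv] rform_comb[OF g uv] by (simp add: algebra_simps)
  qed
  from theI'[OF ex] show "pressure m g \<sigma> p w \<in> Mh m (p - 1)"
    and "\<And>q. q \<in> Mh m (p - 1) \<Longrightarrow> alpha m \<sigma> (pressure m g \<sigma> p w) q = bform m w q - rform m g q"
    unfolding pressure_def by blast+
  fix \<psi> assume \<psi>: "\<psi> \<in> Mh m (p - 1)" "\<And>q. q \<in> Mh m (p - 1) \<Longrightarrow> alpha m \<sigma> \<psi> q = bform m w q - rform m g q"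
  show "pressure m g \<sigma> p w = \<psi>"
    unfolding pressure_def by (rule the1_equality[OF ex]) (use \<psi> in blast)
qed

text \<open>
  In the Dirichlet case the pressure equation is only available for test functions of mean zero. It
  extends to all piecewise constants because both sides vanish on constants, the right-hand side by the
  compatibility of the data.
\<close>

lemma galerkin_pw_const:
  assumes g: "dirichlet_data m g" and co: "coercive_on m \<sigma> (Mh m (p - 1))" and w: "w \<in> Xh m p"
    and c: "\<And>E. E \<notin> elems m \<Longrightarrow> c E = 0"
  shows "alpha m \<sigma> (pressure m g \<sigma> p w) (\<lambda>E x. c E) = bform m w (\<lambda>E x. c E) - rform m g (\<lambda>E x. c E)"
proof -
  let ?\<psi> = "pressure m g \<sigma> p w"
  note pr = pressure_props[OF g co w]
  have r\<psi>: "rpf_broken ?\<psi>" by (rule Qh_rpf[OF Mh_sub[OF pr(1)]])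
  define vol where "vol E = (LINT x:E|lborel. (1::real))" for E :: "(real^'n) set"
  have int_const: "(LINT x:E|lborel. d) = d * vol E" for E d
  proof -
    have "(LINT x:E|lborel. d * 1) = d * (LINT x:E|lborel. 1)" by (rule set_integral_mult_right)
    then show ?thesis by (simp add: vol_def)
  qed
  have Mh_iff: "(\<lambda>E x. d E) \<in> Mh m (p - 1) \<longleftrightarrow> (dirichlet_case m \<longrightarrow> (\<Sum>E\<in>elems m. d E * vol E) = 0)"
    if "\<And>E. E \<notin> elems m \<Longrightarrow> d E = 0" for d
    using pw_const_Qh[OF that] by (simp add: Mh_def int_const)
  show ?thesis
  proof (cases "dirichlet_case m \<and> elems m \<noteq> {}")
    case False
    then have "(\<lambda>E x. c E) \<in> Mh m (p - 1)" using Mh_iff[of c] c by auto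
    then show ?thesis by (rule pr(2))
  next
    case True
    define one where "one E = (if E \<in> elems m then 1 else 0 :: real)" for E
    have one: "\<And>E. E \<notin> elems m \<Longrightarrow> one E = 0" by (simp add: one_def)
    have r1: "rpf_broken (\<lambda>E x. one E)" "rpf_broken (\<lambda>E x. c E)"
      using Qh_rpf[OF pw_const_Qh[of one, where l=0]] Qh_rpf[OF pw_const_Qh[of c, where l=0]] one c by auto
    have vol_nn: "0 \<le> vol E" for E
      unfolding vol_def set_lebesgue_integral_def by (intro integral_nonneg_AE AE_I2) (auto simp: indicator_def)
    have vol_nz: "vol E \<noteq> 0" if E: "E \<in> elems m" for E
    proof
      assume "vol E = 0"
      then have "(1::real) = 0"
        by (intro element.body_integral_square_zero_scalar[OF elem[OF E], of "\<lambda>x. 1"]) (auto simp: vol_def intro: real_polynomial_function.intros(2))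
      then show False by simp
    qed
    define V where "V = (\<Sum>E\<in>elems m. vol E)"
    have "V > 0" unfolding V_def using True vol_nn vol_nz by (intro sum_pos finite_elems) (auto simp: less_le)
    define a where "a = (\<Sum>E\<in>elems m. c E * vol E) / V"
    \<comment> \<open>Subtracting the mean value \<open>a\<close> makes the test function admissible.\<close>
    have "(\<Sum>E\<in>elems m. (1 * c E + (-a) * one E) * vol E) = (\<Sum>E\<in>elems m. c E * vol E) - a * V"
      by (simp add: V_def one_def sum_distrib_left algebra_simps sum_subtractf)
    also have "\<dots> = 0" using \<open>V > 0\<close> by (simp add: a_def)
    finally have q: "(\<lambda>E x. 1 * c E + (-a) * one E) \<in> Mh m (p - 1)"
      using Mh_iff[of "\<lambda>E. 1 * c E + (-a) * one E"] c one by simp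
    have noN: "N_faces m = {}"
    proof -
      have "GammaN m = {}" using True by (simp add: GammaN_def dirichlet_case_def)
      then show ?thesis using face_convex_ne faces_sub(3) unfolding N_faces_def by blast
    qed
    have jump_one: "jump m (\<lambda>E x. one E) e x = 0" if "e \<in> int_faces m" for e x
      using elem12[OF that] by (simp add: jump_def one_def)
    have b1: "bform m v (\<lambda>E x. one E) = 0" if v: "poly_broken v" for v
    proof -
      have "bform m v (\<lambda>E x. one E) = - (\<Sum>e\<in>int_faces m. face_int e (\<lambda>x. (avg m v e x \<bullet> normal m e) * (one (elem1 m e) - one (elem2 m e))))"
        using bform_pw_const[OF v one] noN by simp
      also have "\<dots> = 0" using elem12 by (simp add: one_def)
      finally show ?thesis .
    qed
    have bg1: "bgrad (\<lambda>E x. one E) = (\<lambda>E x. 0)" by (intro ext) (simp add: bgrad_pw_const)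
    have j1: "j0form m \<sigma> ?\<psi> (\<lambda>E x. one E) = 0"
      unfolding j0form_def bg1 noN using jump_one by (simp add: avg_def)
    have al1: "alpha m \<sigma> ?\<psi> (\<lambda>E x. one E) = 0"
      unfolding alpha_def using b1[OF poly_broken_bgrad[OF r\<psi>]] j1 by simp
    have rf1: "rform m g (\<lambda>E x. one E) = 0"
    proof -
      have "rform m g (\<lambda>E x. one E) = (\<Sum>e\<in>D_faces m. face_int e (\<lambda>x. g x \<bullet> normal m e))"
        unfolding rform_def using bdry_elem by (intro sum.cong refl) (simp add: btrace_def one_def)
      then show ?thesis using g True unfolding dirichlet_data_def by simp
    qed
    have "alpha m \<sigma> ?\<psi> (\<lambda>E x. 1 * c E + (-a) * one E) = bform m w (\<lambda>E x. 1 * c E + (-a) * one E) - rform m g (\<lambda>E x. 1 * c E + (-a) * one E)"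
      by (rule pr(2)[OF q])
    then show ?thesis
      unfolding alpha_right[OF r1(2,1) r\<psi>] bform_right[OF Xh_poly[OF w] r1(2,1)] rform_comb[OF g r1(2,1)]
      using al1 b1[OF Xh_poly[OF w]] rf1 by simp
  qed
qed

text \<open>
  The test function is the indicator of one element. Its jump on an interior face of that element is
  \<open>1\<close> or \<open>- 1\<close>, the sign that turns the normal of the face into the outer normal of the element.
\<close>

lemma conservative_of_galerkin:
  assumes v: "poly_broken v"
    and eq: "\<And>c. (\<And>E. E \<notin> elems m \<Longrightarrow> c E = 0) \<Longrightarrow> bform m v (\<lambda>E x. c E) = rform m g (\<lambda>E x. c E)"
  shows "locally_conservative m g v"
  unfolding locally_conservative_def
proof
  fix E0 assume E0: "E0 \<in> elems m"
  define c where "c E = (if E = E0 then 1 else 0 :: real)" for E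
  have c: "\<And>E. E \<notin> elems m \<Longrightarrow> c E = 0" using E0 by (auto simp: c_def)
  have int: "(\<Sum>e\<in>int_faces m. face_int e (\<lambda>x. (avg m v e x \<bullet> normal m e) * (c (elem1 m e) - c (elem2 m e)))) =
    (\<Sum>e\<in>{e \<in> int_faces m. e facet_of E0}. face_int e (\<lambda>x. avg m v e x \<bullet> outer_normal E0 e))"
  proof (rule sum.mono_neutral_cong_right)
    show "\<forall>e\<in>int_faces m - {e \<in> int_faces m. e facet_of E0}. face_int e (\<lambda>x. (avg m v e x \<bullet> normal m e) * (c (elem1 m e) - c (elem2 m e))) = 0"
    proof
      fix e assume e: "e \<in> int_faces m - {e \<in> int_faces m. e facet_of E0}"
      then have "elem1 m e \<noteq> E0" "elem2 m e \<noteq> E0" using elem12[of e] by auto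
      then show "face_int e (\<lambda>x. (avg m v e x \<bullet> normal m e) * (c (elem1 m e) - c (elem2 m e))) = 0" by (simp add: c_def)
    qed
    fix e assume "e \<in> {e \<in> int_faces m. e facet_of E0}"
    then have e: "e \<in> int_faces m" and f: "e facet_of E0" by auto
    then consider "E0 = elem1 m e" | "E0 = elem2 m e"
      using facet_adjacent[OF E0 f] adjacent_int(1)[OF e] by blast
    then show "face_int e (\<lambda>x. (avg m v e x \<bullet> normal m e) * (c (elem1 m e) - c (elem2 m e))) = face_int e (\<lambda>x. avg m v e x \<bullet> outer_normal E0 e)"
    proof cases
      case 1
      then have "c (elem1 m e) = 1" "c (elem2 m e) = 0" "outer_normal E0 e = normal m e"
        using adjacent_int(2)[OF e] normal_int[OF e] by (auto simp: c_def)
      then show ?thesis by simp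
    next
      case 2
      then have "c (elem1 m e) = 0" "c (elem2 m e) = 1" "outer_normal E0 e = - normal m e"
        using adjacent_int(2)[OF e] opposite_normals[OF e] by (auto simp: c_def)
      then show ?thesis by simp
    qed
  qed auto
  have bdry: "(\<Sum>e\<in>S. face_int e (\<lambda>x. (f e x \<bullet> normal m e) * c (bdry_elem m e))) =
    (\<Sum>e\<in>{e \<in> S. e facet_of E0}. face_int e (\<lambda>x. f e x \<bullet> outer_normal E0 e))"
    if S: "S \<subseteq> D_faces m \<union> N_faces m" for S and f :: "_ \<Rightarrow> _ \<Rightarrow> real^'n"
  proof (rule sum.mono_neutral_cong_right)
    show "finite S" using S by (rule finite_subset) simp
    show "\<forall>e\<in>S - {e \<in> S. e facet_of E0}. face_int e (\<lambda>x. (f e x \<bullet> normal m e) * c (bdry_elem m e)) = 0"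
    proof
      fix e assume e: "e \<in> S - {e \<in> S. e facet_of E0}"
      then have "bdry_elem m e \<noteq> E0" using bdry_elem[of e] S by auto
      then show "face_int e (\<lambda>x. (f e x \<bullet> normal m e) * c (bdry_elem m e)) = 0" by (simp add: c_def)
    qed
    fix e assume "e \<in> {e \<in> S. e facet_of E0}"
    then have e: "e \<in> D_faces m \<union> N_faces m" and f: "e facet_of E0" using S by auto
    have "bdry_elem m e = E0" using facet_adjacent[OF E0 f] adjacent_bdry[OF e] by simp
    then show "face_int e (\<lambda>x. (f e x \<bullet> normal m e) * c (bdry_elem m e)) = face_int e (\<lambda>x. f e x \<bullet> outer_normal E0 e)"
      using normal_bdry[OF e] by (simp add: c_def)
  qed auto
  have galerkin: "bform m v (\<lambda>E x. c E) = rform m g (\<lambda>E x. c E)" by (rule eq[OF c])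
  show "(\<Sum>e\<in>{e \<in> int_faces m. e facet_of E0}. face_int e (\<lambda>x. avg m v e x \<bullet> outer_normal E0 e))
   + (\<Sum>e\<in>{e \<in> N_faces m. e facet_of E0}. face_int e (\<lambda>x. btrace m v e x \<bullet> outer_normal E0 e))
   + (\<Sum>e\<in>{e \<in> D_faces m. e facet_of E0}. face_int e (\<lambda>x. g x \<bullet> outer_normal E0 e)) = 0"
    using galerkin bform_pw_const[OF v c] int bdry[of "N_faces m" "btrace m v"] bdry[of "D_faces m" "\<lambda>_. g"]
    by (simp add: rform_def btrace_def)
qed

end

theorem mainTheorem2:
  fixes m :: "('n::finite) dgmesh" and g :: "real^'n \<Rightarrow> real^'n" and \<sigma> :: real and p :: nat
  assumes dim: "CARD('n) = 2 \<or> CARD('n) = 3"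
    and mesh: "affine_mesh m"
    and data: "dirichlet_data m g"
    and degree: "p \<ge> 1"
    and penalty: "\<sigma> > 0" "coercive_on m \<sigma> (Mh m (p - 1))"
  shows "(\<forall>w\<in>Xh m p. locally_conservative m g (RT_projection m g \<sigma> p w)) \<and>
         (\<forall>k\<le>p - 1. \<forall>w\<in>Xh m p. locally_conservative m g (RT_projection_deg m g \<sigma> p k w)) \<and>
         (p = 1 \<or> rectangular_mesh m \<longrightarrow>
           (\<forall>w\<in>Xh m p.
              RT_projection m g \<sigma> p (RT_projection m g \<sigma> p w) = RT_projection m g \<sigma> p w \<and>
              (\<forall>q\<in>Mh m (p - 1). bform m (RT_projection m g \<sigma> p w) q - rform m g q = 0) \<and>
              reconstruction m \<sigma> (p - 1) (pressure m g \<sigma> p (RT_projection m g \<sigma> p w)) = (\<lambda>E x. 0)))"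
proof -
  interpret mesh m by unfold_locales (rule mesh)
  note pr = pressure_props[OF data penalty(2)]
  define \<gamma> where "\<gamma> k w = reconstruction m \<sigma> k (pressure m g \<sigma> p w)" for k w
  have r\<psi>: "rpf_broken (pressure m g \<sigma> p w)" if "w \<in> Xh m p" for w
    by (rule Qh_rpf[OF Mh_sub[OF pr(1)[OF that]]])
  have rec: "is_reconstruction m \<sigma> k (pressure m g \<sigma> p w) (\<gamma> k w)" if "w \<in> Xh m p" for k w
    unfolding \<gamma>_def by (rule reconstruction_is[OF r\<psi>[OF that]])
  have \<gamma>X: "\<gamma> k w \<in> Xh m p" if "w \<in> Xh m p" "k \<le> p - 1" for k w
    by (rule RTh_Xh[of _ k]) (use rec[OF that(1), of k] that degree in \<open>auto simp: is_reconstruction_def\<close>)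
  have proj: "RT_projection_deg m g \<sigma> p k w = (\<lambda>E x. w E x + \<gamma> k w E x)" if "w \<in> Xh m p" "k \<le> p - 1" for k w
    unfolding \<gamma>_def by (rule RT_projection_deg_eq[OF that(1)]) (use \<gamma>X[OF that] in \<open>simp add: \<gamma>_def\<close>)
  have vX: "RT_projection_deg m g \<sigma> p k w \<in> Xh m p" if "w \<in> Xh m p" "k \<le> p - 1" for k w
    unfolding proj[OF that] using Xh_comb[OF that(1) \<gamma>X[OF that], of 1 1] by simp
  have key: "bform m (RT_projection_deg m g \<sigma> p k w) q = bform m w q - alpha m \<sigma> (pressure m g \<sigma> p w) q"
    if w: "w \<in> Xh m p" "k \<le> p - 1" and q: "q \<in> Qh m k"
      and gr: "\<And>E. E \<in> elems m \<Longrightarrow> bgrad q E = (\<lambda>x. 0) \<or> k > 0 \<and> bgrad q E \<in> Psi_elem m k E" for k w q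
  proof -
    have "bform m (\<lambda>E x. 1 *\<^sub>R w E x + 1 *\<^sub>R \<gamma> k w E x) q = 1 * bform m w q + 1 * bform m (\<gamma> k w) q"
      by (rule bform_left[OF Xh_poly[OF w(1)] Xh_poly[OF \<gamma>X[OF w]] Qh_rpf[OF q]])
    moreover have "bform m (\<gamma> k w) q = - alpha m \<sigma> (pressure m g \<sigma> p w) q"
      by (rule bform_reconstruction[OF r\<psi>[OF w(1)] rec[OF w(1)] q gr])
    ultimately show ?thesis unfolding proj[OF w] by simp
  qed
  have cons: "locally_conservative m g (RT_projection_deg m g \<sigma> p k w)" if w: "w \<in> Xh m p" "k \<le> p - 1" for k w
  proof (rule conservative_of_galerkin[OF Xh_poly[OF vX[OF w]]])
    fix c :: "(real^'n) set \<Rightarrow> real" assume c: "\<And>E. E \<notin> elems m \<Longrightarrow> c E = 0"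
    have "bform m (RT_projection_deg m g \<sigma> p k w) (\<lambda>E x. c E) = bform m w (\<lambda>E x. c E) - alpha m \<sigma> (pressure m g \<sigma> p w) (\<lambda>E x. c E)"
      by (rule key[OF w pw_const_Qh[OF c]]) (simp_all add: bgrad_pw_const)
    then show "bform m (RT_projection_deg m g \<sigma> p k w) (\<lambda>E x. c E) = rform m g (\<lambda>E x. c E)"
      using galerkin_pw_const[OF data penalty(2) w(1) c] by simp
  qed
  have third: "RT_projection m g \<sigma> p (RT_projection m g \<sigma> p w) = RT_projection m g \<sigma> p w \<and>
      (\<forall>q\<in>Mh m (p - 1). bform m (RT_projection m g \<sigma> p w) q - rform m g q = 0) \<and>
      reconstruction m \<sigma> (p - 1) (pressure m g \<sigma> p (RT_projection m g \<sigma> p w)) = (\<lambda>E x. 0)"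
    if R: "p = 1 \<or> rectangular_mesh m" and w: "w \<in> Xh m p" for w
  proof -
    define v where "v = RT_projection m g \<sigma> p w"
    have v: "v = RT_projection_deg m g \<sigma> p (p - 1) w" by (simp add: v_def RT_projection_def)
    have vX': "v \<in> Xh m p" unfolding v by (rule vX[OF w]) simp
    have zero: "bform m v q - rform m g q = 0" if q: "q \<in> Mh m (p - 1)" for q
    proof -
      have "bgrad q E = (\<lambda>x. 0) \<or> p - 1 > 0 \<and> bgrad q E \<in> Psi_elem m (p - 1) E" if E: "E \<in> elems m" for E
      proof -
        from Qh_element[OF Mh_sub[OF q] E] obtain u where u: "u \<in> polys (\<lambda>_. p - 1)" "q E = u \<circ> inv (elem_map m E)" by (elim bexE)
        show ?thesis
        proof (cases "p = 1")
          case True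
          have "u x = u 0" for x
          proof -
            have e0: "exponents (\<lambda>_::'n. 0) = {\<lambda>_. 0}" by (auto simp: exponents_def)
            obtain b where "u = (\<lambda>x. \<Sum>a\<in>exponents (\<lambda>_. 0). b a * monomial a x)"
              using u(1) True unfolding polys_eq_lspan lspan_def by auto
            then show ?thesis unfolding e0 by (simp add: monomial_def)
          qed
          then have "q E = (\<lambda>x. u 0)" unfolding u(2) o_def by (intro ext)
          then show ?thesis by (simp add: bgrad_def grad_const)
        next
          case False
          then have "rectangular_mesh m" using R by simp
          then have "grad (u \<circ> inv (elem_map m E)) \<in> Psi_elem m (p - 1) E"
            using E unfolding rectangular_mesh_def by (intro element.grad_in_Psi[OF elem[OF E] u(1)]) blast
          then show ?thesis using False degree unfolding bgrad_def u(2) by simp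
        qed
      qed
      from key[OF w order_refl Mh_sub[OF q] this] pr(2)[OF w q] show ?thesis unfolding v by simp
    qed
    have zM: "(\<lambda>E x. 0) \<in> Mh m (p - 1)" using pw_const_Qh[of "\<lambda>_. 0"] by (simp add: Mh_def)
    have rz: "rpf_broken ((\<lambda>E x. 0) :: ('n, real) broken)" by (rule Qh_rpf[OF Mh_sub[OF zM]])
    have p0: "pressure m g \<sigma> p v = (\<lambda>E x. 0)"
    proof (rule pr(3)[OF vX' zM])
      fix q assume q: "q \<in> Mh m (p - 1)"
      have "alpha m \<sigma> (\<lambda>E x. 0 * 0 + 0 * 0) q = 0 * alpha m \<sigma> (\<lambda>E x. 0) q + 0 * alpha m \<sigma> (\<lambda>E x. 0) q"
        by (rule alpha_left[OF rz rz Qh_rpf[OF Mh_sub[OF q]]])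
      then show "alpha m \<sigma> (\<lambda>E x. 0) q = bform m v q - rform m g q" using zero[OF q] by simp
    qed
    have rec0: "reconstruction m \<sigma> (p - 1) (\<lambda>E x. 0) = (\<lambda>E x. 0)"
    proof (rule reconstruction_eqI)
      have bg: "bgrad (\<lambda>E x. 0) E x = 0" for E and x :: "real^'n" using bgrad_pw_const[of "\<lambda>_. 0" E] by (simp add: fun_eq_iff)
      have "glue m (\<lambda>E x. 0 :: real^'n) \<in> Hdiv (dom m)" by (rule glue_Hdiv) simp_all
      then have "(\<lambda>E x. 0) \<in> RTh m (p - 1)" unfolding RTh_def using element.RT_elem_zero[OF elem] by simp
      then show "is_reconstruction m \<sigma> (p - 1) (\<lambda>E x. 0) (\<lambda>E x. 0)"
        unfolding is_reconstruction_def by (simp add: bg avg_def jump_def btrace_def)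
    qed
    have "RT_projection m g \<sigma> p v = (\<lambda>E x. v E x + \<gamma> (p - 1) v E x)"
      unfolding RT_projection_def by (rule proj[OF vX']) simp
    then have "RT_projection m g \<sigma> p v = v" unfolding \<gamma>_def p0 rec0 by simp
    then show ?thesis using zero p0 rec0 unfolding v_def by simp
  qed
  show ?thesis
    using cons third unfolding RT_projection_def by blast
qed

end
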